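(* For every finite connected weighted graph $G=(V,(c_{xy})_{x,y\in V})$ and all positive site weights $\alpha=(\alpha_x)_{x\in V}$, $$\alpha_{\min}\left\{\frac{1}{21}\,\frac{\alpha_{\rm ratio}}{6^{\alpha_{\min}/\alpha_{\rm ratio}}}\,\frac{c_{\min}}{|V|^2\,{\rm diam}(G)}\right\}\le {\rm gap}_{\rm BEP}(G,\alpha)\le{\rm gap}_{\rm RW}(G,\alpha).$$ Moreover, in some cases, i.e., for some such $G$ and $\alpha$, one has ${\rm gap}_{\rm BEP}(G,\alpha)<{\rm gap}_{\rm RW}(G,\alpha)$.
   Context: $G=(V,(c_{xy})_{x,y\in V})$ is a finite graph with $|V|\ge 2$, symmetric conductances $c_{xy}=c_{yx}\ge 0$, $c_{xx}=0$, connected: any two sites are joined by a sequence of sites with positive conductance between consecutive ones. The graph distance of two distinct sites is the length (number of steps) of the shortest such sequence, and ${\rm diam}(G)$ is the largest graph distance. The site weights satisfy $\alpha_x>0$ for all $x\in V$; $\alpha_{\min}=\min_x\alpha_x$, $\alpha_{\rm ratio}=\alpha_{\min}/\max_x\alpha_x$, $c_{\min}=\min\{c_{xy}:c_{xy}>0\}$. The Brownian energy process ${\rm BEP}(G,\alpha)$ is the diffusion on the simplex $\varSigma=\{\zeta\in[0,1]^V:\sum_x\zeta_x=1\}$ with generator $$\mathcal L_{G,\alpha}=\frac12\sum_{x,y\in V}c_{xy}\Big\{-(\alpha_y\zeta_x-\alpha_x\zeta_y)(\partial_{\zeta_x}-\partial_{\zeta_y})+\zeta_x\zeta_y(\partial_{\zeta_x}-\partial_{\zeta_y})^2\Big\},$$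 reversible with respect to the Dirichlet distribution $\gamma_\alpha$ on $\varSigma$ with parameters $\alpha$, whose density with respect to the uniform measure on $\varSigma$ is proportional to $\prod_x\zeta_x^{\alpha_x-1}$. $\mathcal L_{G,\alpha}$ is regarded as a self-adjoint operator on $L^2(\gamma_\alpha)$ (its spectrum is pure point, with polynomial eigenfunctions), and ${\rm gap}_{\rm BEP}(G,\alpha)$ is its spectral gap: the smallest non-zero element of the spectrum of $-\mathcal L_{G,\alpha}$. ${\rm gap}_{\rm RW}(G,\alpha)$ is the smallest non-zero eigenvalue of minus the generator of the random walk on $V$ jumping from $x$ to $y$ at rate $c_{xy}\alpha_y$. *)

theory Defs
  imports "HOL-Probability.Probability"
begin

section \<open>Weighted graphs\<close>

text \<open>
  Vertices form a finite carrier set \<open>V\<close> rather than a finite type, so that the existence of a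
  graph can be asserted inside a formula. Functions on \<open>V\<close> (conductances, site weights) are only
  ever evaluated on \<open>V\<close>.
\<close>

definition wedges :: "'a set \<Rightarrow> ('a \<Rightarrow> 'a \<Rightarrow> real) \<Rightarrow> ('a \<times> 'a) set" where
  "wedges V c = {(x, y). x \<in> V \<and> y \<in> V \<and> 0 < c x y}"

definition connected_weighted_graph :: "'a set \<Rightarrow> ('a \<Rightarrow> 'a \<Rightarrow> real) \<Rightarrow> bool" where
  "connected_weighted_graph V c \<longleftrightarrow>
     finite V \<and> 2 \<le> card V \<and>
     (\<forall>x\<in>V. \<forall>y\<in>V. c x y = c y x) \<and>
     (\<forall>x\<in>V. \<forall>y\<in>V. 0 \<le> c x y) \<and>
     (\<forall>x\<in>V. c x x = 0) \<and>
     (\<forall>x\<in>V. \<forall>y\<in>V. (x, y) \<in> (wedges V c)\<^sup>*)"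

definition graph_dist :: "'a set \<Rightarrow> ('a \<Rightarrow> 'a \<Rightarrow> real) \<Rightarrow> 'a \<Rightarrow> 'a \<Rightarrow> nat" where
  "graph_dist V c x y = (LEAST n. (x, y) \<in> wedges V c ^^ n)"

definition graph_diam :: "'a set \<Rightarrow> ('a \<Rightarrow> 'a \<Rightarrow> real) \<Rightarrow> nat" where
  "graph_diam V c = Max {graph_dist V c x y | x y. x \<in> V \<and> y \<in> V \<and> x \<noteq> y}"

definition c_min :: "'a set \<Rightarrow> ('a \<Rightarrow> 'a \<Rightarrow> real) \<Rightarrow> real" where
  "c_min V c = Min {c x y | x y. x \<in> V \<and> y \<in> V \<and> 0 < c x y}"

definition alpha_min :: "'a set \<Rightarrow> ('a \<Rightarrow> real) \<Rightarrow> real" where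
  "alpha_min V \<alpha> = Min (\<alpha> ` V)"

definition alpha_ratio :: "'a set \<Rightarrow> ('a \<Rightarrow> real) \<Rightarrow> real" where
  "alpha_ratio V \<alpha> = alpha_min V \<alpha> / Max (\<alpha> ` V)"


section \<open>The random walk\<close>

definition rw_generator ::
    "'a set \<Rightarrow> ('a \<Rightarrow> 'a \<Rightarrow> real) \<Rightarrow> ('a \<Rightarrow> real) \<Rightarrow> ('a \<Rightarrow> real) \<Rightarrow> 'a \<Rightarrow> real" where
  "rw_generator V c \<alpha> f x = (\<Sum>y\<in>V. c x y * \<alpha> y * (f y - f x))"

text \<open>
  The generator is symmetric with respect to the weights \<open>\<alpha>\<close>, so its complex eigenvalues are real
  and have real eigenfunctions.
\<close>

definition rw_eigenvalues :: "'a set \<Rightarrow> ('a \<Rightarrow> 'a \<Rightarrow> real) \<Rightarrow> ('a \<Rightarrow> real) \<Rightarrow> real set" where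
  "rw_eigenvalues V c \<alpha> =
     {l. \<exists>f. (\<exists>x\<in>V. f x \<noteq> 0) \<and> (\<forall>x\<in>V. - rw_generator V c \<alpha> f x = l * f x)}"

definition gap_RW :: "'a set \<Rightarrow> ('a \<Rightarrow> 'a \<Rightarrow> real) \<Rightarrow> ('a \<Rightarrow> real) \<Rightarrow> real" where
  "gap_RW V c \<alpha> = (LEAST l. l \<in> rw_eigenvalues V c \<alpha> \<and> l \<noteq> 0)"


section \<open>The simplex and the Dirichlet distribution\<close>

definition prob_simplex :: "'a set \<Rightarrow> ('a \<Rightarrow> real) set" where
  "prob_simplex V = {\<zeta> \<in> V \<rightarrow>\<^sub>E {0..1}. (\<Sum>x\<in>V. \<zeta> x) = 1}"

text \<open>
  The uniform measure on the simplex: all coordinates except that of one site \<open>r\<close> are distributed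
  according to normalised Lebesgue measure on the solid simplex \<open>{\<eta> \<ge> 0, \<Sum>\<eta> \<le> 1}\<close>, and the
  coordinate of \<open>r\<close> is \<open>1 - \<Sum>\<eta>\<close>. The resulting measure does not depend on the choice of \<open>r\<close>,
  since exchanging the dropped coordinate is an affine map with determinant of modulus one.
\<close>

definition simplex_uniform :: "'a set \<Rightarrow> ('a \<Rightarrow> real) measure" where
  "simplex_uniform V =
     (let r = (SOME x. x \<in> V); W = V - {r};
          S = {\<eta> \<in> W \<rightarrow>\<^sub>E {0..}. (\<Sum>x\<in>W. \<eta> x) \<le> 1}
      in restrict_space
           (distr (uniform_measure (\<Pi>\<^sub>M x\<in>W. lborel) S) (\<Pi>\<^sub>M x\<in>V. borel)
             (\<lambda>\<eta>. \<eta>(r := 1 - (\<Sum>x\<in>W. \<eta> x))))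
           (prob_simplex V))"

definition dirichlet_weight :: "'a set \<Rightarrow> ('a \<Rightarrow> real) \<Rightarrow> ('a \<Rightarrow> real) \<Rightarrow> ennreal" where
  "dirichlet_weight V \<alpha> \<zeta> = ennreal (\<Prod>x\<in>V. \<zeta> x powr (\<alpha> x - 1))"

definition dirichlet :: "'a set \<Rightarrow> ('a \<Rightarrow> real) \<Rightarrow> ('a \<Rightarrow> real) measure" where
  "dirichlet V \<alpha> =
     density (simplex_uniform V)
       (\<lambda>\<zeta>. dirichlet_weight V \<alpha> \<zeta> /
              (\<integral>\<^sup>+ \<xi>. dirichlet_weight V \<alpha> \<xi> \<partial>simplex_uniform V))"


section \<open>Unbounded operators on \<open>L\<^sup>2\<close>\<close>

text \<open>
  Elements of the real Hilbert space \<open>L\<^sup>2(M)\<close> are given by representatives, and an operator is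
  given by its graph, a set of pairs of representatives.
\<close>

definition L2_space :: "'b measure \<Rightarrow> ('b \<Rightarrow> real) set" where
  "L2_space M = {f \<in> borel_measurable M. integrable M (\<lambda>x. (f x)\<^sup>2)}"

definition L2_norm :: "'b measure \<Rightarrow> ('b \<Rightarrow> real) \<Rightarrow> real" where
  "L2_norm M f = sqrt (\<integral>x. (f x)\<^sup>2 \<partial>M)"

definition L2_closure ::
    "'b measure \<Rightarrow> (('b \<Rightarrow> real) \<times> ('b \<Rightarrow> real)) set \<Rightarrow> (('b \<Rightarrow> real) \<times> ('b \<Rightarrow> real)) set" where
  "L2_closure M T =
     {(f, g). f \<in> L2_space M \<and> g \<in> L2_space M \<and>
        (\<exists>p q. (\<forall>n::nat. (p n, q n) \<in> T) \<and>
               (\<lambda>n. L2_norm M (\<lambda>x. p n x - f x)) \<longlonglongrightarrow> 0 \<and>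
               (\<lambda>n. L2_norm M (\<lambda>x. q n x - g x)) \<longlonglongrightarrow> 0)}"

text \<open>
  The resolvent set consists of those \<open>l\<close> for which \<open>T - l\<close> is onto and has a bounded inverse;
  the norm estimate contains injectivity. For a self-adjoint operator commuting with complex
  conjugation this real spectrum is the whole spectrum of its complexification.
\<close>

definition L2_resolvent_set ::
    "'b measure \<Rightarrow> (('b \<Rightarrow> real) \<times> ('b \<Rightarrow> real)) set \<Rightarrow> real set" where
  "L2_resolvent_set M T =
     {l. (\<forall>h\<in>L2_space M. \<exists>(f, g)\<in>T. AE x in M. g x - l * f x = h x) \<and>
         (\<exists>C. \<forall>(f, g)\<in>T. L2_norm M f \<le> C * L2_norm M (\<lambda>x. g x - l * f x))}"

definition L2_spectrum ::
    "'b measure \<Rightarrow> (('b \<Rightarrow> real) \<times> ('b \<Rightarrow> real)) set \<Rightarrow> real set" where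
  "L2_spectrum M T = - L2_resolvent_set M T"


section \<open>The Brownian energy process\<close>

definition partial_deriv :: "'a \<Rightarrow> (('a \<Rightarrow> real) \<Rightarrow> real) \<Rightarrow> ('a \<Rightarrow> real) \<Rightarrow> real" where
  "partial_deriv x f \<zeta> = deriv (\<lambda>t. f (\<zeta>(x := t))) (\<zeta> x)"

definition diff_deriv :: "'a \<Rightarrow> 'a \<Rightarrow> (('a \<Rightarrow> real) \<Rightarrow> real) \<Rightarrow> ('a \<Rightarrow> real) \<Rightarrow> real" where
  "diff_deriv x y f \<zeta> = partial_deriv x f \<zeta> - partial_deriv y f \<zeta>"

definition bep_generator ::
    "'a set \<Rightarrow> ('a \<Rightarrow> 'a \<Rightarrow> real) \<Rightarrow> ('a \<Rightarrow> real) \<Rightarrow>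
     (('a \<Rightarrow> real) \<Rightarrow> real) \<Rightarrow> ('a \<Rightarrow> real) \<Rightarrow> real" where
  "bep_generator V c \<alpha> f \<zeta> =
     1 / 2 * (\<Sum>x\<in>V. \<Sum>y\<in>V. c x y *
       (- (\<alpha> y * \<zeta> x - \<alpha> x * \<zeta> y) * diff_deriv x y f \<zeta>
        + \<zeta> x * \<zeta> y * diff_deriv x y (diff_deriv x y f) \<zeta>))"

text \<open>Polynomial functions in the coordinates \<open>\<zeta> x\<close>, \<open>x \<in> V\<close>.\<close>

inductive polynomial_on :: "'a set \<Rightarrow> (('a \<Rightarrow> real) \<Rightarrow> real) \<Rightarrow> bool" for V where
  const: "polynomial_on V (\<lambda>\<zeta>. a)"
| coord: "x \<in> V \<Longrightarrow> polynomial_on V (\<lambda>\<zeta>. \<zeta> x)"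
| add: "polynomial_on V f \<Longrightarrow> polynomial_on V g \<Longrightarrow> polynomial_on V (\<lambda>\<zeta>. f \<zeta> + g \<zeta>)"
| mult: "polynomial_on V f \<Longrightarrow> polynomial_on V g \<Longrightarrow> polynomial_on V (\<lambda>\<zeta>. f \<zeta> * g \<zeta>)"

text \<open>
  Minus the generator as an operator on \<open>L\<^sup>2\<close> of the Dirichlet distribution. On polynomials it is
  symmetric, and it maps the polynomials of degree at most \<open>n\<close> to themselves; hence it has a
  complete system of polynomial eigenfunctions and is essentially self-adjoint there. Its closure
  is the self-adjoint operator meant by the generator of the process. All derivatives involved are
  tangential to the simplex, so the values on the simplex depend only on the restriction of the
  polynomial to it.
\<close>

definition bep_operator ::
    "'a set \<Rightarrow> ('a \<Rightarrow> 'a \<Rightarrow> real) \<Rightarrow> ('a \<Rightarrow> real) \<Rightarrow>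
     ((('a \<Rightarrow> real) \<Rightarrow> real) \<times> (('a \<Rightarrow> real) \<Rightarrow> real)) set" where
  "bep_operator V c \<alpha> =
     L2_closure (dirichlet V \<alpha>)
       {(p, \<lambda>\<zeta>. - bep_generator V c \<alpha> p \<zeta>) | p. polynomial_on V p}"

definition gap_BEP :: "'a set \<Rightarrow> ('a \<Rightarrow> 'a \<Rightarrow> real) \<Rightarrow> ('a \<Rightarrow> real) \<Rightarrow> real" where
  "gap_BEP V c \<alpha> =
     (LEAST l. l \<in> L2_spectrum (dirichlet V \<alpha>) (bep_operator V c \<alpha>) \<and> l \<noteq> 0)"

end

theory Submission
  imports Defs
begin

text \<open>
  \<^bold>\<open>Lower bound.\<close> Integration by parts turns \<open>- L\<close> into the symmetric form with density
  \<open>c x y * \<zeta> x * \<zeta> y * (\<partial>\<^sub>x f - \<partial>\<^sub>y f)\<^sup>2\<close>, so what is needed is a Poincare inequality for polynomials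
  (\<open>bep_poincare\<close>). Every site is split into a part of weight \<open>\<beta>\<close>, half the minimal site weight, and a
  remainder. The parts of weight \<open>\<beta>\<close> at two sites can be exchanged without changing the law, whatever the
  site weights are. Let \<open>d x y\<close> be the \<open>L\<^sup>2\<close> distance between \<open>f\<close> and \<open>f\<close> after this exchange.
  Along an edge, \<open>(d x y)\<^sup>2\<close> is bounded by the energy of that edge, because the difference is odd under the
  exchange and the mass difference of the two parts is a ground state among odd functions
  (\<open>swap_energy\<close>, \<open>swap_dist_edge\<close>). Transpositions are conjugate to one another, so the distance for
  the ends of a path is at most twice the sum over its edges (\<open>swap_dist_path\<close>). Finally, the sum of
  \<open>(d x y)\<^sup>2\<close> over all pairs dominates the variance of \<open>f\<close> (\<open>complete_graph_poincare\<close>): replacing \<open>f\<close> by its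
  expectation after a random exchange is a symmetric operator that contracts Lipschitz constants on the
  simplex, and for a symmetric operator a geometric bound for the iterates, whatever its constant,
  forces the same rate in \<open>L\<^sup>2\<close>. Together these give the gap bound \<open>alpha_ratio * alpha_min * c_min / (4 * |V|\<^sup>2 * diam)\<close>, which
  implies the stated one because \<open>4 \<le> 21\<close> and \<open>6\<close> is raised to a positive power.

  \<^bold>\<open>Spectrum.\<close> The generator is symmetric and does not raise the degree of a polynomial, and polynomials are
  dense in \<open>L\<^sup>2\<close>. Hence a number lies in the resolvent set exactly if \<open>- L - l\<close> is bounded below on
  polynomials (\<open>resolvent_iff\<close>). The spectrum is therefore closed, the Poincare inequality keeps its
  non-zero part away from zero, and every polynomial eigenfunction contributes a point; so the gap
  is attained and lies between the Poincare constant and any non-zero eigenvalue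
  (\<open>gap_BEP_properties\<close>).

  \<^bold>\<open>Upper bound.\<close> On functions that are linear in the coordinates, the generator acts through the generator of
  the random walk (\<open>bep_generator_linear\<close>).

  \<^bold>\<open>Strictness.\<close> On the \<open>7 \<times> 7\<close> rook's graph with all site weights \<open>1 / 44\<close> there is a quadratic
  eigenfunction with eigenvalue \<open>6 / 44\<close>, whereas the random walk has gap \<open>7 / 44\<close>: two piles
  of mass on squares without a common line need a long time to meet.
\<close>

section \<open>Polynomial functions\<close>

lemma polynomial_on_cmult: "polynomial_on I p \<Longrightarrow> polynomial_on I (\<lambda>z. a * p z)"
  by (rule polynomial_on.mult[OF polynomial_on.const])

lemma polynomial_on_diff:
  assumes "polynomial_on I p" "polynomial_on I q"
  shows "polynomial_on I (\<lambda>z. p z - q z)"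
  using polynomial_on.add[OF assms(1) polynomial_on_cmult[OF assms(2), of "-1"]] by simp

lemma polynomial_on_uminus:
  assumes "polynomial_on I p"
  shows "polynomial_on I (\<lambda>z. - p z)"
  using polynomial_on_cmult[OF assms, of "-1"] by simp

lemma polynomial_on_sum:
  assumes "\<And>j. j \<in> J \<Longrightarrow> polynomial_on I (p j)"
  shows "polynomial_on I (\<lambda>z. \<Sum>j\<in>J. p j z)"
proof (cases "finite J")
  case True
  then show ?thesis using assms
    by (induction J) (auto intro: polynomial_on.intros)
qed (auto intro: polynomial_on.intros)

lemma polynomial_on_power:
  assumes "polynomial_on I p"
  shows "polynomial_on I (\<lambda>z. p z ^ n)"
  using assms by (induction n) (auto intro: polynomial_on.intros)

lemma polynomial_on_prod:
  assumes "\<And>j. j \<in> J \<Longrightarrow> polynomial_on I (p j)"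
  shows "polynomial_on I (\<lambda>z. \<Prod>j\<in>J. p j z)"
proof (cases "finite J")
  case True
  then show ?thesis using assms
    by (induction J) (auto intro: polynomial_on.intros)
qed (auto intro: polynomial_on.intros)

lemmas poly_intros = polynomial_on.const polynomial_on.coord polynomial_on.add polynomial_on.mult
  polynomial_on_diff polynomial_on_uminus polynomial_on_sum polynomial_on_power polynomial_on_prod

lemma polynomial_on_monomial: "polynomial_on I (\<lambda>z. a * (\<Prod>i\<in>I. z i ^ k i))"
  by (intro poly_intros)

inductive monomial_span :: "'a set \<Rightarrow> (('a \<Rightarrow> real) \<Rightarrow> real) \<Rightarrow> bool" for I where
  monomial: "monomial_span I (\<lambda>z. a * (\<Prod>i\<in>I. z i ^ k i))"
| add: "monomial_span I p \<Longrightarrow> monomial_span I q \<Longrightarrow> monomial_span I (\<lambda>z. p z + q z)"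

lemma monomial_span_mult:
  assumes "monomial_span I p" "monomial_span I q"
  shows "monomial_span I (\<lambda>z. p z * q z)"
  using assms(1)
proof induction
  case (monomial a k)
  show ?case
    using assms(2)
  proof induction
    case (monomial b l)
    have "(\<lambda>z. a * (\<Prod>i\<in>I. z i ^ k i) * (b * (\<Prod>i\<in>I. z i ^ l i))) =
        (\<lambda>z. (a * b) * (\<Prod>i\<in>I. (z i :: real) ^ (k i + l i)))"
      by (simp add: power_add prod.distrib fun_eq_iff)
    then show ?case
      by (simp only: monomial_span.monomial)
  next
    case (add p q)
    then show ?case
      by (simp add: distrib_left monomial_span.add)
  qed
next
  case (add p' q')
  then show ?case
    by (simp add: distrib_right monomial_span.add)
qed

lemma polynomial_on_monomial_span:
  assumes "finite I" "polynomial_on I p"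
  shows "monomial_span I p"
  using assms(2)
proof induction
  case (const a)
  show ?case
    using monomial_span.monomial[of I a "\<lambda>_. 0"] by simp
next
  case (coord x)
  have "(\<Prod>i\<in>I. z i ^ (if i = x then 1 else 0)) = z x" for z :: "'a \<Rightarrow> real"
    using assms(1) coord by (simp add: if_distrib prod.delta cong: if_cong)
  then show ?case
    using monomial_span.monomial[of I 1 "\<lambda>i. if i = x then 1 else 0"] by simp
qed (auto intro: monomial_span.add monomial_span_mult)

text \<open>
  Linear identities between polynomials need only be checked on monomials.
\<close>

lemma polynomial_monomial_induct [consumes 2, case_names monomial add]:
  assumes "finite I" "polynomial_on I p"
    and monomial: "\<And>a k. P (\<lambda>z. a * (\<Prod>i\<in>I. z i ^ k i))"
    and add: "\<And>p q. polynomial_on I p \<Longrightarrow> polynomial_on I q \<Longrightarrow> P p \<Longrightarrow> P q \<Longrightarrow> P (\<lambda>z. p z + q z)"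
  shows "P p"
proof -
  have "monomial_span I p \<Longrightarrow> polynomial_on I p \<and> P p"
    by (induction rule: monomial_span.induct)
      (auto intro: monomial add polynomial_on_monomial polynomial_on.add)
  then show ?thesis
    using polynomial_on_monomial_span[OF assms(1,2)] by simp
qed

lemma polynomial_on_subst:
  assumes "polynomial_on I p" "\<And>i. i \<in> I \<Longrightarrow> polynomial_on J (\<lambda>z. s z i)"
  shows "polynomial_on J (\<lambda>z. p (s z))"
  using assms(1) by induction (auto intro: poly_intros assms(2))

lemma polynomial_on_cong:
  assumes "polynomial_on I p" "\<And>i. i \<in> I \<Longrightarrow> z i = w i"
  shows "p z = p w"
  using assms by induction auto

lemma polynomial_on_measurable:
  assumes "polynomial_on I p"
  shows "p \<in> borel_measurable (\<Pi>\<^sub>M i\<in>I. borel)"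
  using assms by induction auto

lemma polynomial_on_bounded:
  assumes "polynomial_on I p"
  shows "\<exists>B\<ge>0. \<forall>z. (\<forall>i\<in>I. 0 \<le> z i \<and> z i \<le> 1) \<longrightarrow> \<bar>p z\<bar> \<le> B"
  using assms
proof induction
  case (const a)
  show ?case by (rule exI[of _ "\<bar>a\<bar>"]) auto
next
  case (coord x)
  then show ?case by (intro exI[of _ 1]) auto
next
  case (add f g)
  then obtain B C where "B \<ge> 0" "C \<ge> 0"
    "\<forall>z. (\<forall>i\<in>I. 0 \<le> z i \<and> z i \<le> 1) \<longrightarrow> \<bar>f z\<bar> \<le> B"
    "\<forall>z. (\<forall>i\<in>I. 0 \<le> z i \<and> z i \<le> 1) \<longrightarrow> \<bar>g z\<bar> \<le> C" by blast
  then show ?case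
    by (intro exI[of _ "B + C"]) (auto intro!: order_trans[OF abs_triangle_ineq] add_mono)
next
  case (mult f g)
  then obtain B C where "B \<ge> 0" "C \<ge> 0"
    "\<forall>z. (\<forall>i\<in>I. 0 \<le> z i \<and> z i \<le> 1) \<longrightarrow> \<bar>f z\<bar> \<le> B"
    "\<forall>z. (\<forall>i\<in>I. 0 \<le> z i \<and> z i \<le> 1) \<longrightarrow> \<bar>g z\<bar> \<le> C" by blast
  then show ?case
    by (intro exI[of _ "B * C"]) (auto simp: abs_mult intro!: mult_mono)
qed

section \<open>Partial derivatives of polynomials\<close>

lemma polynomial_has_partial_deriv_aux:
  assumes "polynomial_on I p"
  shows "\<exists>p'. polynomial_on I p' \<and>
    (\<forall>z t. ((\<lambda>t. p (z(x := t))) has_real_derivative p' (z(x := t))) (at t))"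
  using assms
proof induction
  case (const a)
  show ?case
    by (rule exI[of _ "\<lambda>_. 0"]) (auto intro: poly_intros)
next
  case (coord y)
  show ?case
    by (rule exI[of _ "\<lambda>_. if x = y then 1 else 0"]) (auto intro: poly_intros)
next
  case (add f g)
  then obtain f' g' where
    "polynomial_on I f'" "\<And>z t. ((\<lambda>t. f (z(x := t))) has_real_derivative f' (z(x := t))) (at t)"
    "polynomial_on I g'" "\<And>z t. ((\<lambda>t. g (z(x := t))) has_real_derivative g' (z(x := t))) (at t)"
    by blast
  then show ?case
    by (intro exI[of _ "\<lambda>z. f' z + g' z"] conjI allI poly_intros DERIV_add) blast+
next
  case (mult f g)
  then obtain f' g' where
    "polynomial_on I f'" "\<And>z t. ((\<lambda>t. f (z(x := t))) has_real_derivative f' (z(x := t))) (at t)"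
    "polynomial_on I g'" "\<And>z t. ((\<lambda>t. g (z(x := t))) has_real_derivative g' (z(x := t))) (at t)"
    by blast
  with mult.hyps show ?case
    by (intro exI[of _ "\<lambda>z. f z * g' z + f' z * g z"] conjI allI poly_intros DERIV_mult') blast+
qed

lemma partial_deriv_eqI:
  assumes "\<And>z t. ((\<lambda>t. p (z(x := t))) has_real_derivative p' (z(x := t))) (at t)"
  shows "partial_deriv x p = p'"
  using assms[of _ "_ x"] by (auto simp: partial_deriv_def fun_eq_iff intro!: DERIV_imp_deriv)
    (metis assms fun_upd_triv)

lemma polynomial_on_partial_deriv:
  assumes "polynomial_on I p"
  shows "polynomial_on I (partial_deriv x p)"
  using polynomial_has_partial_deriv_aux[OF assms, of x] partial_deriv_eqI by metis

lemma polynomial_has_partial_deriv: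
  assumes "polynomial_on I p"
  shows "((\<lambda>t. p (z(x := t))) has_real_derivative partial_deriv x p (z(x := t))) (at t)"
  using polynomial_has_partial_deriv_aux[OF assms, of x] partial_deriv_eqI by metis

lemma partial_deriv_const [simp]: "partial_deriv x (\<lambda>z. a) = (\<lambda>z. 0)"
  by (rule partial_deriv_eqI) auto

lemma partial_deriv_coord: "partial_deriv x (\<lambda>z. z y) = (\<lambda>z. if x = y then 1 else 0)"
  by (rule partial_deriv_eqI) auto

lemma partial_deriv_add:
  assumes "polynomial_on I p" "polynomial_on I q"
  shows "partial_deriv x (\<lambda>z. p z + q z) = (\<lambda>z. partial_deriv x p z + partial_deriv x q z)"
  by (intro partial_deriv_eqI DERIV_add polynomial_has_partial_deriv[OF assms(1)]
      polynomial_has_partial_deriv[OF assms(2)])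

lemma partial_deriv_mult:
  assumes "polynomial_on I p" "polynomial_on I q"
  shows "partial_deriv x (\<lambda>z. p z * q z) = (\<lambda>z. partial_deriv x p z * q z + p z * partial_deriv x q z)"
proof (rule partial_deriv_eqI)
  fix z t
  show "((\<lambda>t. p (z(x := t)) * q (z(x := t))) has_real_derivative
      partial_deriv x p (z(x := t)) * q (z(x := t)) + p (z(x := t)) * partial_deriv x q (z(x := t))) (at t)"
    by (rule DERIV_cong[OF DERIV_mult'[OF assms[THEN polynomial_has_partial_deriv]]]) simp
qed

lemma polynomial_on_diff_deriv:
  "polynomial_on I p \<Longrightarrow> polynomial_on I (diff_deriv x y p)"
  unfolding diff_deriv_def[abs_def] by (intro poly_intros polynomial_on_partial_deriv)

lemma diff_deriv_const [simp]: "diff_deriv x y (\<lambda>z. a) = (\<lambda>z. 0)"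
  by (simp add: diff_deriv_def fun_eq_iff)

lemma diff_deriv_coord:
  "diff_deriv x y (\<lambda>z. z i) = (\<lambda>z. (if x = i then 1 else 0) - (if y = i then 1 else 0))"
  by (simp add: diff_deriv_def fun_eq_iff partial_deriv_coord)

lemma diff_deriv_add:
  assumes "polynomial_on I p" "polynomial_on I q"
  shows "diff_deriv x y (\<lambda>z. p z + q z) = (\<lambda>z. diff_deriv x y p z + diff_deriv x y q z)"
  by (simp add: diff_deriv_def fun_eq_iff partial_deriv_add[OF assms])

lemma diff_deriv_mult:
  assumes "polynomial_on I p" "polynomial_on I q"
  shows "diff_deriv x y (\<lambda>z. p z * q z) = (\<lambda>z. diff_deriv x y p z * q z + p z * diff_deriv x y q z)"
  by (simp add: diff_deriv_def fun_eq_iff partial_deriv_mult[OF assms] algebra_simps)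

lemma diff_deriv_cmult:
  assumes "polynomial_on I p"
  shows "diff_deriv x y (\<lambda>z. a * p z) = (\<lambda>z. a * diff_deriv x y p z)"
  using diff_deriv_mult[OF polynomial_on.const assms, of x y a] by simp

lemma diff_deriv_diff:
  assumes "polynomial_on I p" "polynomial_on I q"
  shows "diff_deriv x y (\<lambda>z. p z - q z) = (\<lambda>z. diff_deriv x y p z - diff_deriv x y q z)"
  using diff_deriv_add[OF assms(1) polynomial_on_cmult[OF assms(2), of "-1"], of x y]
    diff_deriv_cmult[OF assms(2), of x y "-1"] by simp

lemma diff_deriv_sum:
  assumes "\<And>j. j \<in> J \<Longrightarrow> polynomial_on I (p j)"
  shows "diff_deriv x y (\<lambda>z. \<Sum>j\<in>J. p j z) = (\<lambda>z. \<Sum>j\<in>J. diff_deriv x y (p j) z)"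
proof (cases "finite J")
  case True
  then show ?thesis using assms
  proof (induction J)
    case (insert j J)
    then show ?case
      using diff_deriv_add[of I "p j" "\<lambda>z. \<Sum>j\<in>J. p j z" x y]
      by (simp add: polynomial_on_sum)
  qed auto
qed auto

lemma partial_deriv_monomial:
  assumes "finite I" "x \<in> I"
  shows "z x * partial_deriv x (\<lambda>z. a * (\<Prod>i\<in>I. z i ^ k i)) z = real (k x) * (a * (\<Prod>i\<in>I. z i ^ k i))"
proof -
  have *: "(\<Prod>i\<in>I. (z(x := t)) i ^ k i) = t ^ k x * (\<Prod>i\<in>I - {x}. z i ^ k i)" for z :: "'a \<Rightarrow> real" and t
    using assms by (subst prod.remove[of I x]) (auto intro!: prod.cong)
  have "partial_deriv x (\<lambda>z. a * (\<Prod>i\<in>I. z i ^ k i)) =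
      (\<lambda>z. a * ((real (k x) * z x ^ (k x - 1)) * (\<Prod>i\<in>I - {x}. z i ^ k i)))"
  proof (rule partial_deriv_eqI)
    fix z :: "'a \<Rightarrow> real" and t
    have 1: "(\<Prod>i\<in>I - {x}. (z(x := t)) i ^ k i) = (\<Prod>i\<in>I - {x}. z i ^ k i)"
      by (auto intro!: prod.cong)
    show "((\<lambda>t. a * (\<Prod>i\<in>I. (z(x := t)) i ^ k i)) has_real_derivative
        a * ((real (k x) * (z(x := t)) x ^ (k x - 1)) * (\<Prod>i\<in>I - {x}. (z(x := t)) i ^ k i))) (at t)"
      unfolding * 1 by (auto intro!: derivative_eq_intros)
  qed
  moreover have "(\<Prod>i\<in>I. z i ^ k i) = z x ^ k x * (\<Prod>i\<in>I - {x}. z i ^ k i)"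
    using *[of z "z x"] by simp
  moreover have "z x * (real (k x) * z x ^ (k x - 1)) = real (k x) * z x ^ k x"
    by (cases "k x") auto
  ultimately show ?thesis
    by (auto simp: algebra_simps)
qed

section \<open>The Dirichlet integral\<close>

lemma Beta_integral_scaled:
  assumes "a > 0" "c > 0" "s > (0 :: real)"
  shows "(\<integral>\<^sup>+ t. ennreal (indicator {0..s} t * (t powr (a - 1) * (s - t) powr (c - 1))) \<partial>lborel) =
    ennreal (s powr (a + c - 1) * Beta a c)"
proof -
  have "(\<integral>\<^sup>+ t. ennreal (indicator {0..s} t * (t powr (a - 1) * (s - t) powr (c - 1))) \<partial>lborel) =
    ennreal \<bar>s\<bar> * (\<integral>\<^sup>+ t. ennreal (indicator {0..s} (0 + s * t) *
      ((0 + s * t) powr (a - 1) * (s - (0 + s * t)) powr (c - 1))) \<partial>lborel)"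
    using assms by (subst nn_integral_real_affine[where c = s and t = 0]) auto
  also have "\<dots> = ennreal s * (\<integral>\<^sup>+ t. ennreal (s powr (a + c - 2)) *
      ennreal (indicator {0..1} t * (t powr (a - 1) * (1 - t) powr (c - 1))) \<partial>lborel)"
  proof -
    have "indicator {0..s} (0 + s * t) * ((0 + s * t) powr (a - 1) * (s - (0 + s * t)) powr (c - 1)) =
        s powr (a + c - 2) * (indicator {0..1} t * (t powr (a - 1) * (1 - t) powr (c - 1)))" for t :: real
    proof (cases "0 \<le> t \<and> t \<le> 1")
      case True
      have 1: "s - (0 + s * t) = s * (1 - t)" by (simp add: algebra_simps)
      have 2: "s powr (a - 1) * s powr (c - 1) = s powr (a + c - 2)"
        by (simp add: powr_add[symmetric])
      have "(0 + s * t) powr (a - 1) * (s - (0 + s * t)) powr (c - 1) =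
          s powr (a + c - 2) * (t powr (a - 1) * (1 - t) powr (c - 1))"
        unfolding 1 2[symmetric] using True assms by (simp add: powr_mult)
      moreover have "s * t \<le> s" using True assms by (simp add: mult_left_le)
      ultimately show ?thesis
        using True assms by (simp add: indicator_def)
    next
      case False
      then have "\<not> (0 \<le> s * t \<and> s * t \<le> s)"
        using assms by (auto simp: zero_le_mult_iff mult_le_cancel_left1)
      then show ?thesis using False by (auto simp: indicator_def)
    qed
    then show ?thesis using assms
      by (simp add: ennreal_mult)
  qed
  also have "\<dots> = ennreal s * (ennreal (s powr (a + c - 2)) * ennreal (Beta a c))"
  proof -
    have "(\<integral>\<^sup>+ t. ennreal (indicator {0..1} t * (t powr (a - 1) * (1 - t) powr (c - 1))) \<partial>lborel) = ennreal (Beta a c)"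
      using nn_integral_has_integral_lebesgue[OF _ has_integral_Beta_real[OF assms(1,2)]] by simp
    then show ?thesis by (subst nn_integral_cmult) auto
  qed
  also have "\<dots> = ennreal (s powr (a + c - 1) * Beta a c)"
  proof -
    have "s * s powr (a + c - 2) = s powr (a + c - 1)"
      using assms powr_add[of s 1 "a + c - 2"] by simp
    moreover have "Beta a c \<ge> 0"
      using assms by (simp add: Beta_def Gamma_real_nonneg)
    ultimately show ?thesis
      using assms by (simp add: ennreal_mult[symmetric] mult.assoc[symmetric])
  qed
  finally show ?thesis .
qed

text \<open>
  The unnormalised Dirichlet density on configurations of mass \<open>s\<close>; what the sites in \<open>W\<close> do not
  carry belongs to one further site, of weight \<open>b\<close>.
\<close>

definition dirichlet_density :: "'a set \<Rightarrow> ('a \<Rightarrow> real) \<Rightarrow> real \<Rightarrow> real \<Rightarrow> ('a \<Rightarrow> real) \<Rightarrow> real" where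
  "dirichlet_density W a b s \<eta> = (if (\<forall>x\<in>W. 0 \<le> \<eta> x) \<and> sum \<eta> W \<le> s
     then (\<Prod>x\<in>W. \<eta> x powr (a x - 1)) * (s - sum \<eta> W) powr (b - 1) else 0)"

lemma dirichlet_density_measurable [measurable]:
  assumes "finite W"
  shows "dirichlet_density W a b s \<in> borel_measurable (\<Pi>\<^sub>M x\<in>W. lborel)"
  unfolding dirichlet_density_def[abs_def] using assms by measurable

text \<open>
  Integrating out the sites one after the other reduces Dirichlet's integral to Euler's Beta
  integral: the last coordinate \<open>t\<close> leaves mass \<open>s - t\<close> for the others.
\<close>

lemma dirichlet_integral:
  assumes "finite W" "\<And>x. x \<in> W \<Longrightarrow> a x > 0" "b > 0" "s > 0"
  shows "(\<integral>\<^sup>+ \<eta>. ennreal (dirichlet_density W a b s \<eta>) \<partial>(\<Pi>\<^sub>M x\<in>W. lborel)) =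
    ennreal (s powr (sum a W + b - 1) * ((\<Prod>x\<in>W. Gamma (a x)) * Gamma b / Gamma (sum a W + b)))"
  using assms
proof (induction W arbitrary: s rule: finite_induct)
  case empty
  have "Gamma b \<noteq> 0" using empty by (simp add: Gamma_real_pos less_imp_neq[symmetric])
  with empty show ?case
    by (simp add: PiM_empty nn_integral_count_space_finite dirichlet_density_def)
next
  case (insert x W)
  interpret product_sigma_finite "\<lambda>_::'a. lborel :: real measure" by standard
  define c where "c = sum a W + b"
  define C where "C = (\<Prod>x\<in>W. Gamma (a x)) * Gamma b / Gamma c"
  have c: "c > 0" unfolding c_def using insert by (intro add_nonneg_pos sum_nonneg) (auto intro: less_imp_le)
  have Cpos: "C \<ge> 0" unfolding C_def using insert c
    by (intro divide_nonneg_nonneg mult_nonneg_nonneg prod_nonneg) (auto intro!: Gamma_real_nonneg less_imp_le)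
  have ax: "a x > 0" using insert by auto
  have "(\<integral>\<^sup>+ \<eta>. ennreal (dirichlet_density (insert x W) a b s \<eta>) \<partial>(\<Pi>\<^sub>M x\<in>insert x W. lborel)) =
    (\<integral>\<^sup>+ t. (\<integral>\<^sup>+ \<eta>. ennreal (dirichlet_density (insert x W) a b s (\<eta>(x := t))) \<partial>(\<Pi>\<^sub>M x\<in>W. lborel)) \<partial>lborel)"
    using insert.hyps by (intro product_nn_integral_insert_rev) auto
  also have "\<dots> = (\<integral>\<^sup>+ t. ennreal (indicator {0..s} t * (t powr (a x - 1) * (s - t) powr (c - 1))) * ennreal C \<partial>lborel)"
  proof (rule nn_integral_cong_AE)
    have dd: "dirichlet_density (insert x W) a b s (\<eta>(x := t)) =
        (if 0 \<le> t then t powr (a x - 1) else 0) * dirichlet_density W a b (s - t) \<eta>" for \<eta> t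
    proof -
      have "sum (\<eta>(x := t)) W = sum \<eta> W" "(\<Prod>y\<in>W. (\<eta>(x := t)) y powr (a y - 1)) = (\<Prod>y\<in>W. \<eta> y powr (a y - 1))"
        "(\<forall>y\<in>W. 0 \<le> (\<eta>(x := t)) y) \<longleftrightarrow> (\<forall>y\<in>W. 0 \<le> \<eta> y)"
        using insert.hyps by (auto intro!: sum.cong prod.cong)
      then show ?thesis using insert.hyps
        by (auto simp: dirichlet_density_def algebra_simps)
    qed
    show "AE t in lborel. (\<integral>\<^sup>+ \<eta>. ennreal (dirichlet_density (insert x W) a b s (\<eta>(x := t))) \<partial>(\<Pi>\<^sub>M x\<in>W. lborel)) =
      ennreal (indicator {0..s} t * (t powr (a x - 1) * (s - t) powr (c - 1))) * ennreal C"
      using AE_lborel_singleton[of s]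
    proof eventually_elim
      case (elim t)
      consider "t < 0" | "t > s" | "0 \<le> t" "t < s" using elim by linarith
      then show ?case
      proof cases
        case 1 then show ?thesis by (simp add: dd)
      next
        case 2
        then have "dirichlet_density W a b (s - t) \<eta> = 0" for \<eta>
          using sum_nonneg[of W \<eta>] by (auto simp: dirichlet_density_def)
        then show ?thesis using 2 by (simp add: dd)
      next
        case 3
        have nn: "dirichlet_density W a b (s - t) \<eta> \<ge> 0" for \<eta>
          by (auto simp: dirichlet_density_def intro!: mult_nonneg_nonneg prod_nonneg)
        have "(\<integral>\<^sup>+ \<eta>. ennreal (dirichlet_density (insert x W) a b s (\<eta>(x := t))) \<partial>(\<Pi>\<^sub>M x\<in>W. lborel)) =
          ennreal (t powr (a x - 1)) * (\<integral>\<^sup>+ \<eta>. ennreal (dirichlet_density W a b (s - t) \<eta>) \<partial>(\<Pi>\<^sub>M x\<in>W. lborel))"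
          using 3 insert.hyps by (simp add: dd ennreal_mult nn nn_integral_cmult)
        also have "\<dots> = ennreal (t powr (a x - 1)) * ennreal ((s - t) powr (c - 1) * C)"
          using insert.IH[of "s - t"] insert.prems 3 by (simp add: c_def C_def)
        finally show ?thesis
          using 3 Cpos by (simp add: ennreal_mult[symmetric] mult_ac)
      qed
    qed
  qed
  also have "\<dots> = ennreal (s powr (a x + c - 1) * Beta (a x) c) * ennreal C"
    using Beta_integral_scaled[OF ax c insert.prems(3)] by (subst nn_integral_multc) auto
  also have "\<dots> = ennreal (s powr (a x + c - 1) * (Beta (a x) c * C))"
  proof -
    have "Beta (a x) c \<ge> 0" using ax c by (simp add: Beta_def Gamma_real_nonneg)
    then show ?thesis using Cpos by (simp add: ennreal_mult[symmetric] mult_ac)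
  qed
  also have "Beta (a x) c * C = (\<Prod>x\<in>insert x W. Gamma (a x)) * Gamma b / Gamma (sum a (insert x W) + b)"
  proof -
    have "Gamma c \<noteq> 0" using Gamma_real_pos[OF c] by simp
    then show ?thesis using insert.hyps by (simp add: Beta_def C_def c_def add_ac)
  qed
  also have "a x + c = sum a (insert x W) + b"
    using insert.hyps by (simp add: c_def add_ac)
  finally show ?case .
qed

lemma prob_simplex_sets [measurable]:
  assumes "finite V"
  shows "prob_simplex V \<in> sets (\<Pi>\<^sub>M x\<in>V. borel)"
proof -
  have "prob_simplex V = {\<zeta> \<in> space (\<Pi>\<^sub>M x\<in>V. borel). (\<forall>x\<in>V. \<zeta> x \<in> {0..1}) \<and> sum \<zeta> V = 1}"
    by (auto simp: prob_simplex_def space_PiM)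
  also have "\<dots> \<in> sets (\<Pi>\<^sub>M x\<in>V. borel)"
    using assms by measurable
  finally show ?thesis .
qed

lemma nn_integral_simplex_uniform:
  assumes V: "finite V" "V \<noteq> {}" and h: "h \<in> borel_measurable (\<Pi>\<^sub>M x\<in>V. borel)"
  defines "r \<equiv> SOME x. x \<in> V" and "S \<equiv> {\<eta> \<in> (V - {SOME x. x \<in> V}) \<rightarrow>\<^sub>E {0..}. (\<Sum>x\<in>V - {SOME x. x \<in> V}. \<eta> x) \<le> (1 :: real)}"
  shows "(\<integral>\<^sup>+ \<zeta>. h \<zeta> \<partial>simplex_uniform V) =
    (\<integral>\<^sup>+ \<eta>. h (\<eta>(r := 1 - sum \<eta> (V - {r}))) * indicator S \<eta> \<partial>(\<Pi>\<^sub>M x\<in>V - {r}. lborel)) /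
      emeasure (\<Pi>\<^sub>M x\<in>V - {r}. lborel) S"
proof -
  define W where "W = V - {r}"
  let ?P = "\<Pi>\<^sub>M x\<in>W. lborel :: real measure"
  let ?f = "\<lambda>\<eta>. \<eta>(r := 1 - sum \<eta> W)"
  have r: "r \<in> V" unfolding r_def using V by (simp add: some_in_eq)
  have W: "finite W" "r \<notin> W" "insert r W = V" using V r by (auto simp: W_def)
  have S_eq: "S = {\<eta> \<in> space ?P. (\<forall>x\<in>W. 0 \<le> \<eta> x) \<and> sum \<eta> W \<le> 1}"
    by (auto simp: S_def space_PiM W_def r_def PiE_def Pi_def)
  have S: "S \<in> sets ?P"
    unfolding S_eq using W(1) by measurable
  have f: "?f \<in> measurable ?P (\<Pi>\<^sub>M x\<in>V. borel)"
  proof -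
    have "(\<lambda>\<eta>. (\<eta>(r := 1 - sum \<eta> W))) \<in> measurable ?P (\<Pi>\<^sub>M x\<in>insert r W. borel)"
    proof (rule measurable_PiM_single')
      fix i assume "i \<in> insert r W"
      then show "(\<lambda>\<eta>. (\<eta>(r := 1 - sum \<eta> W)) i) \<in> measurable ?P borel"
        using W(1) by (cases "i = r") auto
    qed (auto simp: space_PiM PiE_def extensional_def)
    then show ?thesis using W by simp
  qed
  have sets_f: "sets (distr (uniform_measure ?P S) (\<Pi>\<^sub>M x\<in>V. borel) ?f) = sets (\<Pi>\<^sub>M x\<in>V. borel)"
    by simp
  have Sf: "indicator S \<eta> * (h (?f \<eta>) * indicator (prob_simplex V) (?f \<eta>)) = h (?f \<eta>) * indicator S \<eta>"
    if "\<eta> \<in> space ?P" for \<eta>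
  proof (cases "\<eta> \<in> S")
    case True
    then have *: "\<forall>x\<in>W. 0 \<le> \<eta> x" "sum \<eta> W \<le> 1" by (auto simp: S_eq)
    have le1: "\<eta> x \<le> 1" if "x \<in> W" for x
      using *(1) *(2) member_le_sum[OF that, of \<eta>] W(1) by force
    have "sum (?f \<eta>) V = 1"
    proof -
      have "sum (?f \<eta>) V = (1 - sum \<eta> W) + sum (?f \<eta>) W"
        using W(1,2) unfolding W(3)[symmetric] by (subst sum.insert) simp_all
      also have "sum (?f \<eta>) W = sum \<eta> W"
        using W by (intro sum.cong) auto
      finally show ?thesis by simp
    qed
    moreover have "?f \<eta> \<in> V \<rightarrow>\<^sub>E {0..1}"
      using that * le1 W sum_nonneg[of W \<eta>] by (auto simp: space_PiM PiE_def extensional_def Pi_def)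
    ultimately have "?f \<eta> \<in> prob_simplex V" by (simp add: prob_simplex_def)
    then show ?thesis by (simp add: indicator_def)
  qed simp
  have "(\<integral>\<^sup>+ \<zeta>. h \<zeta> \<partial>simplex_uniform V) =
      (\<integral>\<^sup>+ \<zeta>. h \<zeta> \<partial>restrict_space (distr (uniform_measure ?P S) (\<Pi>\<^sub>M x\<in>V. borel) ?f) (prob_simplex V))"
    by (simp add: simplex_uniform_def Let_def W_def r_def S_def)
  also have "\<dots> = (\<integral>\<^sup>+ \<zeta>. h \<zeta> * indicator (prob_simplex V) \<zeta> \<partial>distr (uniform_measure ?P S) (\<Pi>\<^sub>M x\<in>V. borel) ?f)"
    using prob_simplex_sets[OF V(1)] by (subst nn_integral_restrict_space) (auto simp: sets.Int_space_eq2)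
  also have "\<dots> = (\<integral>\<^sup>+ \<eta>. h (?f \<eta>) * indicator (prob_simplex V) (?f \<eta>) \<partial>uniform_measure ?P S)"
    using f h prob_simplex_sets[OF V(1)]
    by (subst nn_integral_distr) (auto simp: uniform_measure_def)
  also have "\<dots> = (\<integral>\<^sup>+ \<eta>. (indicator S \<eta> / emeasure ?P S) * (h (?f \<eta>) * indicator (prob_simplex V) (?f \<eta>)) \<partial>?P)"
    unfolding uniform_measure_def using f h S prob_simplex_sets[OF V(1)]
    by (subst nn_integral_density) (auto intro!: borel_measurable_divide_ennreal)
  also have "\<dots> = (\<integral>\<^sup>+ \<eta>. (h (?f \<eta>) * indicator S \<eta>) / emeasure ?P S \<partial>?P)"
  proof (intro nn_integral_cong)
    fix \<eta> assume "\<eta> \<in> space ?P"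
    have assoc: "(a / b) * x = (a * x) / b" for a b x :: ennreal
      by (simp only: divide_ennreal_def mult_ac)
    show "(indicator S \<eta> / emeasure ?P S) * (h (?f \<eta>) * indicator (prob_simplex V) (?f \<eta>)) =
        (h (?f \<eta>) * indicator S \<eta>) / emeasure ?P S"
      unfolding assoc Sf[OF \<open>\<eta> \<in> space ?P\<close>] ..
  qed
  also have "\<dots> = (\<integral>\<^sup>+ \<eta>. h (?f \<eta>) * indicator S \<eta> \<partial>?P) / emeasure ?P S"
    using f h S by (intro nn_integral_divide) auto
  finally show ?thesis unfolding W_def .
qed

text \<open>
  Dirichlet's integral, divided by the volume of the solid simplex; the latter is the same integral
  with all weights equal to one, which accounts for the factor \<open>Gamma (card V)\<close>.
\<close>

lemma simplex_uniform_integral_powr: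
  assumes V: "finite V" "V \<noteq> {}" and a: "\<And>x. x \<in> V \<Longrightarrow> a x > 0"
  shows "(\<integral>\<^sup>+ \<zeta>. ennreal (\<Prod>x\<in>V. \<zeta> x powr (a x - 1)) \<partial>simplex_uniform V) =
    ennreal (Gamma (real (card V)) * ((\<Prod>x\<in>V. Gamma (a x)) / Gamma (sum a V)))"
proof -
  define r where "r = (SOME x. x \<in> V)"
  define W where "W = V - {r}"
  let ?P = "\<Pi>\<^sub>M x\<in>W. lborel :: real measure"
  define S where "S = {\<eta> \<in> W \<rightarrow>\<^sub>E {0..}. (\<Sum>x\<in>W. \<eta> x) \<le> (1 :: real)}"
  have r: "r \<in> V" unfolding r_def using V by (simp add: some_in_eq)
  have W: "finite W" "r \<notin> W" "insert r W = V" using V r by (auto simp: W_def)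
  have dens: "ennreal (\<Prod>x\<in>V. (\<eta>(r := 1 - sum \<eta> W)) x powr (a x - 1)) * indicator S \<eta> =
      ennreal (dirichlet_density W a (a r) 1 \<eta>)" if "\<eta> \<in> space ?P" for \<eta> a
  proof -
    have "(\<Prod>x\<in>V. (\<eta>(r := 1 - sum \<eta> W)) x powr (a x - 1)) =
        (1 - sum \<eta> W) powr (a r - 1) * (\<Prod>x\<in>W. (\<eta>(r := 1 - sum \<eta> W)) x powr (a x - 1))"
      using W(1,2) unfolding W(3)[symmetric] by (subst prod.insert) simp_all
    also have "(\<Prod>x\<in>W. (\<eta>(r := 1 - sum \<eta> W)) x powr (a x - 1)) = (\<Prod>x\<in>W. \<eta> x powr (a x - 1))"
      using W by (intro prod.cong) auto
    finally have 1: "(\<Prod>x\<in>V. (\<eta>(r := 1 - sum \<eta> W)) x powr (a x - 1)) = (\<Prod>x\<in>W. \<eta> x powr (a x - 1)) * (1 - sum \<eta> W) powr (a r - 1)"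
      by simp
    have 2: "\<eta> \<in> S \<longleftrightarrow> (\<forall>x\<in>W. 0 \<le> \<eta> x) \<and> sum \<eta> W \<le> 1"
      using that by (auto simp: S_def space_PiM PiE_def Pi_def)
    show ?thesis unfolding 1 dirichlet_density_def using 2 by (auto simp: indicator_def)
  qed
  have main: "(\<integral>\<^sup>+ \<eta>. ennreal (\<Prod>x\<in>V. (\<eta>(r := 1 - sum \<eta> W)) x powr (a x - 1)) * indicator S \<eta> \<partial>?P) =
      ennreal ((\<Prod>x\<in>V. Gamma (a x)) / Gamma (sum a V))" if "\<And>x. x \<in> V \<Longrightarrow> a x > 0" for a
  proof -
    have "(\<integral>\<^sup>+ \<eta>. ennreal (\<Prod>x\<in>V. (\<eta>(r := 1 - sum \<eta> W)) x powr (a x - 1)) * indicator S \<eta> \<partial>?P) =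
        (\<integral>\<^sup>+ \<eta>. ennreal (dirichlet_density W a (a r) 1 \<eta>) \<partial>?P)"
      by (intro nn_integral_cong dens)
    also have "\<dots> = ennreal (1 powr (sum a W + a r - 1) * ((\<Prod>x\<in>W. Gamma (a x)) * Gamma (a r) / Gamma (sum a W + a r)))"
      using that W r by (intro dirichlet_integral) auto
    also have "(\<Prod>x\<in>W. Gamma (a x)) * Gamma (a r) = (\<Prod>x\<in>V. Gamma (a x))"
      using W(1,2) by (subst W(3)[symmetric]) simp
    also have "sum a W + a r = sum a V"
      using W(1,2) by (subst W(3)[symmetric]) simp
    finally show ?thesis by simp
  qed
  have vol: "emeasure ?P S = ennreal (1 / Gamma (real (card V)))"
  proof -
    have S: "S \<in> sets ?P"
    proof -
      have S_eq: "S = {\<eta> \<in> space ?P. (\<forall>x\<in>W. 0 \<le> \<eta> x) \<and> sum \<eta> W \<le> 1}"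
        by (auto simp: S_def space_PiM PiE_def Pi_def)
      show ?thesis unfolding S_eq using W(1) by measurable
    qed
    have "emeasure ?P S = (\<integral>\<^sup>+ \<eta>. indicator S \<eta> \<partial>?P)"
      using S by simp
    also have "\<dots> = (\<integral>\<^sup>+ \<eta>. ennreal (dirichlet_density W (\<lambda>_. 1) 1 1 \<eta>) \<partial>?P)"
    proof (rule nn_integral_cong_AE)
      interpret product_sigma_finite "\<lambda>_::'a. lborel :: real measure" by standard
      interpret finite_product_sigma_finite "\<lambda>_::'a. lborel :: real measure" W by standard (rule W(1))
      \<comment> \<open>The boundary of the solid simplex, where \<open>0 powr 0 = 0\<close>, is a null set.\<close>
      have 0: "emeasure ?P {\<eta> \<in> space ?P. \<eta> x = 0} = 0" if "x \<in> W" for x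
      proof -
        have "{\<eta> \<in> space ?P. \<eta> x = 0} = (\<Pi>\<^sub>E y\<in>W. if y = x then {0} else UNIV)"
          using that by (auto simp: space_PiM PiE_def Pi_def split: if_splits)
        moreover have "emeasure ?P (\<Pi>\<^sub>E y\<in>W. if y = x then {0} else UNIV) =
            (\<Prod>y\<in>W. emeasure lborel (if y = x then {0 :: real} else UNIV))"
          using W(1) by (intro emeasure_PiM) auto
        moreover have "\<dots> = 0"
          using that W(1) by (intro prod_zero) (auto intro!: bexI[of _ x])
        ultimately show ?thesis by simp
      qed
      have AE1: "AE \<eta> in ?P. \<forall>x\<in>W. \<eta> x \<noteq> 0"
        using W(1)
      proof (intro AE_finite_allI)
        fix x assume x: "x \<in> W"
        have "{\<eta> \<in> space ?P. \<eta> x = 0} \<in> sets ?P" using x by measurable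
        then show "AE \<eta> in ?P. \<eta> x \<noteq> 0"
          using 0[OF x] by (intro AE_I[of _ _ "{\<eta> \<in> space ?P. \<eta> x = 0}"]) auto
      qed
      have AE2: "AE \<eta> in ?P. sum \<eta> W \<noteq> 1"
      proof (cases "W = {}")
        case False
        then obtain x where x: "x \<in> W" by auto
        define W' where "W' = W - {x}"
        have W': "finite W'" "x \<notin> W'" "W = insert x W'" using W x by (auto simp: W'_def)
        have meas: "{\<eta> \<in> space ?P. sum \<eta> W = 1} \<in> sets ?P" using W(1) by measurable
        have "emeasure ?P {\<eta> \<in> space ?P. sum \<eta> W = 1} = (\<integral>\<^sup>+ \<eta>. indicator {\<eta> \<in> space ?P. sum \<eta> W = 1} \<eta> \<partial>?P)"
          using meas by simp
        also have "\<dots> = (\<integral>\<^sup>+ \<eta>. \<integral>\<^sup>+ t. indicator {\<eta> \<in> space ?P. sum \<eta> W = 1} (\<eta>(x := t)) \<partial>lborel \<partial>(\<Pi>\<^sub>M x\<in>W'. lborel))"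
          using meas W' by (simp only: W'(3)) (intro product_nn_integral_insert, auto)
        also have "\<dots> = (\<integral>\<^sup>+ \<eta>. \<integral>\<^sup>+ t. indicator {1 - sum \<eta> W' :: real} t \<partial>lborel \<partial>(\<Pi>\<^sub>M x\<in>W'. lborel))"
        proof (rule nn_integral_cong, rule nn_integral_cong)
          fix \<eta> :: "'a \<Rightarrow> real" and t :: real
          assume "\<eta> \<in> space (\<Pi>\<^sub>M x\<in>W'. lborel)"
          then have "\<eta>(x := t) \<in> space ?P" using W' by (auto simp: space_PiM PiE_def extensional_def)
          moreover have "sum (\<eta>(x := t)) W = t + sum \<eta> W'"
            using W' by (simp cong: sum.cong) (auto intro!: sum.cong)
          ultimately show "indicator {\<eta> \<in> space ?P. sum \<eta> W = 1} (\<eta>(x := t)) = (indicator {1 - sum \<eta> W'} t :: ennreal)"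
            by (auto simp: indicator_def)
        qed
        also have "\<dots> = 0" by simp
        finally have "emeasure ?P {\<eta> \<in> space ?P. sum \<eta> W = 1} = 0" .
        then show ?thesis using meas by (intro AE_I[of _ _ "{\<eta> \<in> space ?P. sum \<eta> W = 1}"]) auto
      qed simp
      show "AE \<eta> in ?P. indicator S \<eta> = ennreal (dirichlet_density W (\<lambda>_. 1) 1 1 \<eta>)"
        using AE1 AE2 AE_space
      proof eventually_elim
        case (elim \<eta>)
        have 2: "\<eta> \<in> S \<longleftrightarrow> (\<forall>x\<in>W. 0 \<le> \<eta> x) \<and> sum \<eta> W \<le> 1"
          using elim by (auto simp: S_def space_PiM PiE_def Pi_def)
        show ?case using elim by (auto simp: dirichlet_density_def 2 indicator_def)
      qed
    qed
    also have "\<dots> = ennreal (1 powr (sum (\<lambda>_. 1) W + 1 - 1) * ((\<Prod>x\<in>W. Gamma 1) * Gamma 1 / Gamma (sum (\<lambda>_. 1) W + 1)))"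
      by (rule dirichlet_integral) (use W in auto)
    also have "\<dots> = ennreal (1 / Gamma (real (card V)))"
    proof -
      have "card V = Suc (card W)" using W(1,2) unfolding W(3)[symmetric] by simp
      then show ?thesis by (simp add: add.commute)
    qed
    finally show ?thesis .
  qed
  have card: "card V > 0" using V by (simp add: card_gt_0_iff)
  have Gpos: "Gamma (real (card V)) > 0" using card by (intro Gamma_real_pos) simp
  have pos: "(\<Prod>x\<in>V. Gamma (a x)) / Gamma (sum a V) \<ge> 0"
  proof -
    have "(\<Prod>x\<in>V. Gamma (a x)) > 0" using a by (intro prod_pos Gamma_real_pos)
    moreover have "Gamma (sum a V) > 0" using a V by (intro Gamma_real_pos sum_pos) auto
    ultimately show ?thesis by simp
  qed
  have "(\<integral>\<^sup>+ \<zeta>. ennreal (\<Prod>x\<in>V. \<zeta> x powr (a x - 1)) \<partial>simplex_uniform V) =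
      ennreal ((\<Prod>x\<in>V. Gamma (a x)) / Gamma (sum a V)) / ennreal (1 / Gamma (real (card V)))"
    using V main[OF a] vol by (subst nn_integral_simplex_uniform) (auto simp: r_def W_def S_def)
  also have "\<dots> = ennreal ((\<Prod>x\<in>V. Gamma (a x)) / Gamma (sum a V) / (1 / Gamma (real (card V))))"
    using pos Gpos by (intro divide_ennreal) auto
  finally show ?thesis by (simp add: mult.commute)
qed

lemma sets_simplex_uniform:
  "sets (simplex_uniform V) = sets (restrict_space (\<Pi>\<^sub>M x\<in>V. borel) (prob_simplex V))"
  unfolding simplex_uniform_def Let_def by (intro sets_restrict_space_cong) simp

lemma sets_dirichlet:
  "sets (dirichlet V \<alpha>) = sets (restrict_space (\<Pi>\<^sub>M x\<in>V. borel) (prob_simplex V))"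
  by (simp add: dirichlet_def sets_simplex_uniform)

lemma space_dirichlet [simp]: "space (dirichlet V \<alpha>) = prob_simplex V"
proof -
  have "space (dirichlet V \<alpha>) = space (restrict_space (\<Pi>\<^sub>M x\<in>V. borel) (prob_simplex V))"
    by (rule sets_eq_imp_space_eq[OF sets_dirichlet])
  also have "\<dots> = prob_simplex V"
    by (auto simp: space_restrict_space space_PiM prob_simplex_def)
  finally show ?thesis .
qed

lemma measurable_dirichletI:
  "f \<in> measurable (\<Pi>\<^sub>M x\<in>V. borel) N \<Longrightarrow> f \<in> measurable (dirichlet V \<alpha>) N"
  unfolding measurable_cong_sets[OF sets_dirichlet refl] by (rule measurable_restrict_space1)

text \<open>
  Multiplying the Dirichlet weight by a monomial only shifts the parameters.
\<close>

lemma dirichlet_nn_moment: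
  assumes V: "finite V" "V \<noteq> {}" and a: "\<And>x. x \<in> V \<Longrightarrow> \<alpha> x > 0"
  shows "(\<integral>\<^sup>+ \<zeta>. ennreal (\<Prod>x\<in>V. \<zeta> x ^ k x) \<partial>dirichlet V \<alpha>) =
    ennreal ((\<Prod>x\<in>V. pochhammer (\<alpha> x) (k x)) / pochhammer (sum \<alpha> V) (sum k V))"
proof -
  define Z where "Z a = Gamma (real (card V)) * ((\<Prod>x\<in>V. Gamma (a x)) / Gamma (sum a V))" for a :: "'a \<Rightarrow> real"
  have Zpos: "Z a > 0" if "\<And>x. x \<in> V \<Longrightarrow> a x > 0" for a
    unfolding Z_def using that V
    by (intro mult_pos_pos divide_pos_pos prod_pos Gamma_real_pos sum_pos) (auto simp: card_gt_0_iff intro!: Gamma_real_pos)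
  have norm: "(\<integral>\<^sup>+ \<xi>. dirichlet_weight V \<alpha> \<xi> \<partial>simplex_uniform V) = ennreal (Z \<alpha>)"
    unfolding dirichlet_weight_def Z_def by (rule simplex_uniform_integral_powr[OF V a])
  have meas: "g \<in> borel_measurable (simplex_uniform V)" if "g \<in> borel_measurable (\<Pi>\<^sub>M x\<in>V. borel)" for g :: "_ \<Rightarrow> ennreal"
    using measurable_restrict_space1[OF that] by (simp add: measurable_cong_sets[OF sets_simplex_uniform refl])
  have m1: "dirichlet_weight V \<alpha> \<in> borel_measurable (\<Pi>\<^sub>M x\<in>V. borel)"
    unfolding dirichlet_weight_def[abs_def] by measurable
  have sp: "space (simplex_uniform V) = prob_simplex V"
    by (simp add: space_dirichlet[of V \<alpha>, symmetric] dirichlet_def)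
  have "(\<integral>\<^sup>+ \<zeta>. ennreal (\<Prod>x\<in>V. \<zeta> x ^ k x) \<partial>dirichlet V \<alpha>) =
      (\<integral>\<^sup>+ \<zeta>. dirichlet_weight V \<alpha> \<zeta> / ennreal (Z \<alpha>) * ennreal (\<Prod>x\<in>V. \<zeta> x ^ k x) \<partial>simplex_uniform V)"
    unfolding dirichlet_def norm using m1
    by (intro nn_integral_density meas borel_measurable_divide_ennreal) auto
  also have "\<dots> = (\<integral>\<^sup>+ \<zeta>. ennreal (\<Prod>x\<in>V. \<zeta> x powr (\<alpha> x + real (k x) - 1)) / ennreal (Z \<alpha>) \<partial>simplex_uniform V)"
  proof (intro nn_integral_cong)
    fix \<zeta> assume "\<zeta> \<in> space (simplex_uniform V)"
    then have nn: "\<And>x. x \<in> V \<Longrightarrow> \<zeta> x \<ge> 0" by (auto simp: sp prob_simplex_def)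
    have "(\<Prod>x\<in>V. \<zeta> x powr (\<alpha> x - 1)) * (\<Prod>x\<in>V. \<zeta> x ^ k x) = (\<Prod>x\<in>V. \<zeta> x powr (\<alpha> x + real (k x) - 1))"
      unfolding prod.distrib[symmetric]
    proof (intro prod.cong refl)
      fix x assume "x \<in> V"
      with nn consider "\<zeta> x = 0" | "\<zeta> x > 0" by fastforce
      then show "\<zeta> x powr (\<alpha> x - 1) * \<zeta> x ^ k x = \<zeta> x powr (\<alpha> x + real (k x) - 1)"
        by cases (auto simp: powr_realpow[symmetric] powr_add[symmetric] algebra_simps)
    qed
    moreover have "(\<Prod>x\<in>V. \<zeta> x ^ k x) \<ge> 0" "(\<Prod>x\<in>V. \<zeta> x powr (\<alpha> x - 1)) \<ge> 0"
      using nn by (auto intro!: prod_nonneg)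
    ultimately show "dirichlet_weight V \<alpha> \<zeta> / ennreal (Z \<alpha>) * ennreal (\<Prod>x\<in>V. \<zeta> x ^ k x) =
        ennreal (\<Prod>x\<in>V. \<zeta> x powr (\<alpha> x + real (k x) - 1)) / ennreal (Z \<alpha>)"
    proof -
      have assoc: "(a / b) * x = (a * x) / b" for a b x :: ennreal
        by (simp only: divide_ennreal_def mult_ac)
      assume eq: "(\<Prod>x\<in>V. \<zeta> x powr (\<alpha> x - 1)) * (\<Prod>x\<in>V. \<zeta> x ^ k x) = (\<Prod>x\<in>V. \<zeta> x powr (\<alpha> x + real (k x) - 1))"
        and nn: "(\<Prod>x\<in>V. \<zeta> x ^ k x) \<ge> 0" "(\<Prod>x\<in>V. \<zeta> x powr (\<alpha> x - 1)) \<ge> 0"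
      show ?thesis
        unfolding assoc dirichlet_weight_def ennreal_mult[OF nn(2,1), symmetric] eq by (rule refl)
    qed
  qed
  also have "\<dots> = (\<integral>\<^sup>+ \<zeta>. ennreal (\<Prod>x\<in>V. \<zeta> x powr (\<alpha> x + real (k x) - 1)) \<partial>simplex_uniform V) / ennreal (Z \<alpha>)"
    by (intro nn_integral_divide meas) auto
  also have "\<dots> = ennreal (Z (\<lambda>x. \<alpha> x + real (k x))) / ennreal (Z \<alpha>)"
    unfolding Z_def using a by (subst simplex_uniform_integral_powr[OF V]) (auto intro: add_pos_nonneg)
  also have "\<dots> = ennreal (Z (\<lambda>x. \<alpha> x + real (k x)) / Z \<alpha>)"
    by (intro divide_ennreal less_imp_le[OF Zpos] Zpos a add_pos_nonneg) auto
  also have "Z (\<lambda>x. \<alpha> x + real (k x)) / Z \<alpha> = (\<Prod>x\<in>V. pochhammer (\<alpha> x) (k x)) / pochhammer (sum \<alpha> V) (sum k V)"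
  proof -
    have nz: "z \<notin> \<int>\<^sub>\<le>\<^sub>0" if "z > 0" for z :: real using that by (auto dest: nonpos_Ints_nonpos)
    have "sum \<alpha> V > 0" using a V by (intro sum_pos) auto
    then have "pochhammer (sum \<alpha> V) (sum k V) = Gamma (sum \<alpha> V + real (sum k V)) / Gamma (sum \<alpha> V)"
      by (intro pochhammer_Gamma nz)
    moreover have "(\<Prod>x\<in>V. pochhammer (\<alpha> x) (k x)) = (\<Prod>x\<in>V. Gamma (\<alpha> x + real (k x))) / (\<Prod>x\<in>V. Gamma (\<alpha> x))"
      unfolding prod_dividef[symmetric] by (intro prod.cong refl pochhammer_Gamma nz a)
    moreover have "Gamma (real (card V)) > 0"
      using V by (intro Gamma_real_pos) (simp add: card_gt_0_iff)
    ultimately show ?thesis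
      by (simp add: Z_def sum.distrib)
  qed
  finally show ?thesis .
qed

lemma prob_space_dirichlet:
  assumes V: "finite V" "V \<noteq> {}" and a: "\<And>x. x \<in> V \<Longrightarrow> \<alpha> x > 0"
  shows "prob_space (dirichlet V \<alpha>)"
  using dirichlet_nn_moment[OF V a, where k = "\<lambda>_. 0"] by (intro prob_spaceI) simp

lemma dirichlet_moment:
  assumes V: "finite V" "V \<noteq> {}" and a: "\<And>x. x \<in> V \<Longrightarrow> \<alpha> x > 0"
  shows "(\<integral> \<zeta>. (\<Prod>x\<in>V. \<zeta> x ^ k x) \<partial>dirichlet V \<alpha>) =
    (\<Prod>x\<in>V. pochhammer (\<alpha> x) (k x)) / pochhammer (sum \<alpha> V) (sum k V)"
proof -
  have "0 \<le> (\<Prod>x\<in>V. pochhammer (\<alpha> x) (k x)) / pochhammer (sum \<alpha> V) (sum k V)"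
    using a V by (intro divide_nonneg_nonneg prod_nonneg pochhammer_nonneg)
      (auto intro!: pochhammer_nonneg sum_pos)
  moreover have "AE \<zeta> in dirichlet V \<alpha>. 0 \<le> (\<Prod>x\<in>V. \<zeta> x ^ k x)"
    by (intro AE_I2 prod_nonneg zero_le_power) (auto simp: prob_simplex_def)
  moreover have "(\<lambda>\<zeta>. \<Prod>x\<in>V. \<zeta> x ^ k x) \<in> borel_measurable (dirichlet V \<alpha>)"
    by (rule measurable_dirichletI) simp
  ultimately show ?thesis
    using dirichlet_nn_moment[OF V a, where k = k] by (subst integral_eq_nn_integral) auto
qed

section \<open>Functionals with Dirichlet moments\<close>

definition exchange :: "'i \<Rightarrow> 'i \<Rightarrow> ('i \<Rightarrow> real) \<Rightarrow> 'i \<Rightarrow> real" where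
  "exchange x y z = (\<lambda>i. z (Transposition.transpose x y i))"

lemma exchange_simps [simp]:
  "exchange x y z x = z y" "exchange x y z y = z x"
  "i \<noteq> x \<Longrightarrow> i \<noteq> y \<Longrightarrow> exchange x y z i = z i"
  by (auto simp: exchange_def)

text \<open>
  The form is homogeneous in \<open>s\<close> and \<open>t\<close>, so that the Cauchy--Schwarz inequality is obtained also for
  polynomials of norm zero.
\<close>

lemma nonneg_quadratic_discriminant:
  fixes P Q R :: real
  assumes quad: "\<And>s t. 0 \<le> s\<^sup>2 * P + 2 * s * t * R + t\<^sup>2 * Q"
  shows "R\<^sup>2 \<le> P * Q"
proof -
  have PQ: "P \<ge> 0" "Q \<ge> 0" using quad[of 1 0] quad[of 0 1] by simp_all
  show ?thesis
  proof (cases "Q = 0")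
    case True
    have "R = 0"
    proof (rule ccontr)
      assume "R \<noteq> 0"
      then have "2 * 1 * (- (P + 1) / R) * R = - (2 * (P + 1))" by simp
      with quad[of 1 "- (P + 1) / R"] True have "0 \<le> P - 2 * (P + 1)" by simp
      then show False using PQ by simp
    qed
    then show ?thesis using True by simp
  next
    case False
    then have "Q > 0" using PQ by simp
    have "0 \<le> Q\<^sup>2 * P - 2 * Q * R * R + R\<^sup>2 * Q"
      using quad[of Q "- R"] by simp
    also have "\<dots> = Q * (P * Q - R\<^sup>2)"
      by (simp add: power2_eq_square algebra_simps)
    finally show ?thesis using \<open>Q > 0\<close> by (simp add: zero_le_mult_iff)
  qed
qed

text \<open>
  Everything about a Dirichlet distribution that enters algebraically is contained in its moments.
  Working with a positive functional on polynomials, rather than with a measure, lets the same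
  lemmas serve the Dirichlet distribution itself and the splitting of its sites constructed below.
\<close>

locale dirichlet_moments =
  fixes I :: "'i set" and a :: "'i \<Rightarrow> real" and E :: "(('i \<Rightarrow> real) \<Rightarrow> real) \<Rightarrow> real"
  assumes finite_I: "finite I"
    and a_pos: "i \<in> I \<Longrightarrow> 0 < a i"
    and E_add: "polynomial_on I p \<Longrightarrow> polynomial_on I q \<Longrightarrow> E (\<lambda>z. p z + q z) = E p + E q"
    and E_cmult: "polynomial_on I p \<Longrightarrow> E (\<lambda>z. b * p z) = b * E p"
    and E_monomial: "E (\<lambda>z. \<Prod>i\<in>I. z i ^ k i) = (\<Prod>i\<in>I. pochhammer (a i) (k i)) / pochhammer (sum a I) (sum k I)"
    and E_nonneg: "polynomial_on I p \<Longrightarrow>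
      (\<And>z. (\<And>i. i \<in> I \<Longrightarrow> 0 \<le> z i) \<Longrightarrow> sum z I = 1 \<Longrightarrow> 0 \<le> p z) \<Longrightarrow> 0 \<le> E p"
begin

lemma E_const [simp]: "E (\<lambda>z. b) = b"
proof -
  have "E (\<lambda>z. 1) = 1" using E_monomial[of "\<lambda>_. 0"] by simp
  then show ?thesis using E_cmult[OF polynomial_on.const[of _ 1], of b] by simp
qed

lemma E_diff:
  assumes "polynomial_on I p" "polynomial_on I q"
  shows "E (\<lambda>z. p z - q z) = E p - E q"
  using E_add[OF assms(1) polynomial_on_cmult[OF assms(2), of "-1"]] E_cmult[OF assms(2), of "-1"] by simp

lemma E_sum:
  assumes "\<And>j. j \<in> J \<Longrightarrow> polynomial_on I (p j)"
  shows "E (\<lambda>z. \<Sum>j\<in>J. p j z) = (\<Sum>j\<in>J. E (p j))"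
proof (cases "finite J")
  case True
  then show ?thesis using assms
    by (induction J) (auto simp: E_add polynomial_on_sum)
qed auto

lemma E_mono:
  assumes "polynomial_on I p" "polynomial_on I q"
    and "\<And>z. (\<And>i. i \<in> I \<Longrightarrow> 0 \<le> z i) \<Longrightarrow> sum z I = 1 \<Longrightarrow> p z \<le> q z"
  shows "E p \<le> E q"
  using E_nonneg[OF polynomial_on_diff[OF assms(2,1)]] assms E_diff[OF assms(2,1)] by force

lemma E_sq_nonneg: "polynomial_on I p \<Longrightarrow> 0 \<le> E (\<lambda>z. (p z)\<^sup>2)"
  by (rule E_nonneg) (auto intro: poly_intros)

lemma E_shift:
  assumes "x \<in> I"
  shows "(sum a I + real (sum k I)) * E (\<lambda>z. z x * (\<Prod>i\<in>I. z i ^ k i)) =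
    (a x + real (k x)) * E (\<lambda>z. \<Prod>i\<in>I. z i ^ k i)"
proof -
  define l where "l = k(x := Suc (k x))"
  have rest: "(\<Prod>i\<in>I - {x}. f i (l i)) = (\<Prod>i\<in>I - {x}. f i (k i))" for f :: "'i \<Rightarrow> nat \<Rightarrow> real"
    by (rule prod.cong) (auto simp: l_def)
  have "(\<Prod>i\<in>I. z i ^ l i) = z x * (\<Prod>i\<in>I. z i ^ k i)" for z :: "'i \<Rightarrow> real"
    using finite_I assms rest[of "\<lambda>i n. z i ^ n"] by (simp add: prod.remove l_def)
  moreover have "(\<Prod>i\<in>I. pochhammer (a i) (l i)) = (a x + real (k x)) * (\<Prod>i\<in>I. pochhammer (a i) (k i))"
    using finite_I assms rest[of "\<lambda>i n. pochhammer (a i) n"]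
    by (simp add: prod.remove l_def pochhammer_Suc)
  moreover have "sum l I = Suc (sum k I)"
  proof -
    have "sum l (I - {x}) = sum k (I - {x})" by (rule sum.cong) (auto simp: l_def)
    then show ?thesis using finite_I assms by (simp add: sum.remove l_def)
  qed
  moreover have "sum a I > 0"
    using finite_I assms a_pos by (intro sum_pos) auto
  then have "sum a I + real (sum k I) > 0" "pochhammer (sum a I) (sum k I) > 0"
    using of_nat_0_le_iff[of "sum k I"] by (linarith, intro pochhammer_pos)
  ultimately have "E (\<lambda>z. z x * (\<Prod>i\<in>I. z i ^ k i)) =
      ((a x + real (k x)) * (\<Prod>i\<in>I. pochhammer (a i) (k i))) /
      (pochhammer (sum a I) (sum k I) * (sum a I + real (sum k I)))"
    using E_monomial[of l] by (simp add: pochhammer_Suc)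
  then show ?thesis
    using \<open>sum a I + real (sum k I) > 0\<close> E_monomial[of k] by simp
qed

text \<open>
  Integration by parts for the Dirichlet distribution. Both sides are linear, and on a monomial
  both are combinations of its two shifts by \<open>x\<close> and \<open>y\<close>.
\<close>

lemma stein:
  assumes xy: "x \<in> I" "y \<in> I" and p: "polynomial_on I p"
  shows "E (\<lambda>z. (a y * z x - a x * z y) * p z) = E (\<lambda>z. z x * z y * diff_deriv x y p z)"
  using finite_I p
proof (induction rule: polynomial_monomial_induct)
  case (monomial b k)
  let ?m = "\<lambda>z. \<Prod>i\<in>I. z i ^ k i"
  have P: "polynomial_on I (\<lambda>z. z x * ?m z)" "polynomial_on I (\<lambda>z. z y * ?m z)"
    using xy by (auto intro!: poly_intros)
  have A: "sum a I + real (sum k I) > 0"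
    using finite_I a_pos xy by (intro add_pos_nonneg sum_pos of_nat_0_le_iff) auto
  have lin: "E (\<lambda>z. c * (z x * ?m z) - d * (z y * ?m z)) = c * E (\<lambda>z. z x * ?m z) - d * E (\<lambda>z. z y * ?m z)" for c d
    using P by (simp add: E_diff E_cmult polynomial_on_cmult)
  have "E (\<lambda>z. (a y * z x - a x * z y) * (b * ?m z)) =
      E (\<lambda>z. (b * a y) * (z x * ?m z) - (b * a x) * (z y * ?m z))"
    by (simp add: algebra_simps)
  also have "\<dots> = (b * a y) * E (\<lambda>z. z x * ?m z) - (b * a x) * E (\<lambda>z. z y * ?m z)"
    by (rule lin)
  also have "\<dots> = - (b * real (k y)) * E (\<lambda>z. z x * ?m z) - - (b * real (k x)) * E (\<lambda>z. z y * ?m z)"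
  proof -
    define s where "s = sum a I + real (sum k I)"
    define e where "e = E ?m"
    have 1: "s * E (\<lambda>z. z x * ?m z) = (a x + real (k x)) * e"
      and 2: "s * E (\<lambda>z. z y * ?m z) = (a y + real (k y)) * e"
      unfolding s_def e_def by (rule E_shift[OF xy(1)], rule E_shift[OF xy(2)])
    have "s * ((a y + real (k y)) * E (\<lambda>z. z x * ?m z)) = s * ((a x + real (k x)) * E (\<lambda>z. z y * ?m z))"
      unfolding mult.left_commute[of s] 1 2 by (simp only: mult_ac)
    then have "(a y + real (k y)) * E (\<lambda>z. z x * ?m z) = (a x + real (k x)) * E (\<lambda>z. z y * ?m z)"
      using A unfolding s_def[symmetric] by (simp only: mult_cancel_left) auto
    then have "b * ((a y + real (k y)) * E (\<lambda>z. z x * ?m z)) = b * ((a x + real (k x)) * E (\<lambda>z. z y * ?m z))"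
      by simp
    then show ?thesis by (simp add: algebra_simps)
  qed
  also have "\<dots> = E (\<lambda>z. - (b * real (k y)) * (z x * ?m z) - - (b * real (k x)) * (z y * ?m z))"
    by (rule lin[symmetric])
  also have "\<dots> = E (\<lambda>z. z x * z y * diff_deriv x y (\<lambda>z. b * ?m z) z)"
  proof (rule arg_cong[where f = E], rule ext)
    fix z
    have "z x * z y * diff_deriv x y (\<lambda>z. b * ?m z) z =
        z y * (z x * partial_deriv x (\<lambda>z. b * ?m z) z) - z x * (z y * partial_deriv y (\<lambda>z. b * ?m z) z)"
      by (simp add: diff_deriv_def algebra_simps)
    then show "- (b * real (k y)) * (z x * ?m z) - - (b * real (k x)) * (z y * ?m z) =
        z x * z y * diff_deriv x y (\<lambda>z. b * ?m z) z"
      using xy by (simp add: partial_deriv_monomial[OF finite_I] algebra_simps)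
  qed
  finally show ?case .
next
  case (add p q)
  have "polynomial_on I (\<lambda>z. (a y * z x - a x * z y) * r z)" "polynomial_on I (\<lambda>z. z x * z y * diff_deriv x y r z)"
    if "polynomial_on I r" for r
    using xy that by (auto intro!: poly_intros polynomial_on_diff_deriv)
  then show ?case
    using add by (simp add: diff_deriv_add[OF add(1,2)] distrib_left E_add)
qed

lemma polynomial_on_swap:
  assumes "x \<in> I" "y \<in> I" "polynomial_on I p"
  shows "polynomial_on I (\<lambda>z. p (exchange x y z))"
  by (rule polynomial_on_subst[OF assms(3)])
    (use assms in \<open>auto simp: exchange_def Transposition.transpose_def intro: poly_intros\<close>)

text \<open>
  The exchange of two sites of equal weight permutes the monomials, and corresponding monomials have
  equal moments.
\<close>

lemma E_swap:
  assumes xy: "x \<in> I" "y \<in> I" and eq: "a x = a y" and p: "polynomial_on I p"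
  shows "E (\<lambda>z. p (exchange x y z)) = E p"
  using finite_I p
proof (induction rule: polynomial_monomial_induct)
  case (monomial b k)
  have bij: "bij_betw (Transposition.transpose x y) I I"
    using xy by (intro bij_betwI[where g = "Transposition.transpose x y"]) (auto simp: exchange_def Transposition.transpose_def)
  have aeq: "a (Transposition.transpose x y i) = a i" for i
    using eq by (simp add: exchange_def Transposition.transpose_def)
  have r: "(\<Prod>i\<in>I. f (Transposition.transpose x y i)) = prod f I" for f :: "_ \<Rightarrow> real"
    using bij by (rule prod.reindex_bij_betw)
  have r': "(\<Sum>i\<in>I. f (Transposition.transpose x y i)) = sum f I" for f :: "_ \<Rightarrow> nat"
    using bij by (rule sum.reindex_bij_betw)
  have "(\<Prod>i\<in>I. (exchange x y z) i ^ k i) = (\<Prod>i\<in>I. z i ^ k (Transposition.transpose x y i))" for z :: "'i \<Rightarrow> real"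
    using r[of "\<lambda>i. z i ^ k (Transposition.transpose x y i)"] by (simp add: exchange_def)
  then have "E (\<lambda>z. \<Prod>i\<in>I. (exchange x y z) i ^ k i) =
      (\<Prod>i\<in>I. pochhammer (a i) (k (Transposition.transpose x y i))) / pochhammer (sum a I) (sum k I)"
    using r'[of k] by (simp only: E_monomial)
  also have "\<dots> = E (\<lambda>z. \<Prod>i\<in>I. z i ^ k i)"
    using r[of "\<lambda>i. pochhammer (a i) (k i)"] by (simp add: E_monomial aeq)
  finally have *: "E (\<lambda>z. \<Prod>i\<in>I. (exchange x y z) i ^ k i) = E (\<lambda>z. \<Prod>i\<in>I. z i ^ k i)" .
  have m: "polynomial_on I (\<lambda>z. \<Prod>i\<in>I. z i ^ k i)"
    by (intro poly_intros)
  show ?case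
    using * E_cmult[OF polynomial_on_swap[OF xy m], of b] E_cmult[OF m, of b] by simp
next
  case (add p q)
  then show ?case
    using xy by (simp add: E_add polynomial_on_swap)
qed

lemma Cauchy_Schwarz:
  assumes "polynomial_on I p" "polynomial_on I q"
  shows "(E (\<lambda>z. p z * q z))\<^sup>2 \<le> E (\<lambda>z. (p z)\<^sup>2) * E (\<lambda>z. (q z)\<^sup>2)"
proof (rule nonneg_quadratic_discriminant)
  fix s t
  let ?P = "E (\<lambda>z. (p z)\<^sup>2)" and ?Q = "E (\<lambda>z. (q z)\<^sup>2)" and ?R = "E (\<lambda>z. p z * q z)"
  have pol: "polynomial_on I (\<lambda>z. (p z)\<^sup>2)" "polynomial_on I (\<lambda>z. (q z)\<^sup>2)" "polynomial_on I (\<lambda>z. p z * q z)"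
    using assms by (auto intro!: poly_intros)
  have "0 \<le> E (\<lambda>z. (s * p z + t * q z)\<^sup>2)"
    by (rule E_sq_nonneg) (use assms in \<open>auto intro!: poly_intros\<close>)
  also have "E (\<lambda>z. (s * p z + t * q z)\<^sup>2) = E (\<lambda>z. s\<^sup>2 * (p z)\<^sup>2 + ((2 * s * t) * (p z * q z) + t\<^sup>2 * (q z)\<^sup>2))"
    by (simp add: power2_eq_square algebra_simps)
  also have "\<dots> = s\<^sup>2 * ?P + ((2 * s * t) * ?R + t\<^sup>2 * ?Q)"
    using pol by (simp add: E_add E_cmult polynomial_on_cmult polynomial_on.add)
  finally show "0 \<le> s\<^sup>2 * ?P + 2 * s * t * ?R + t\<^sup>2 * ?Q" by simp
qed

definition nrm :: "(('i \<Rightarrow> real) \<Rightarrow> real) \<Rightarrow> real" where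
  "nrm p = sqrt (E (\<lambda>z. (p z)\<^sup>2))"

lemma nrm_nonneg: "polynomial_on I p \<Longrightarrow> 0 \<le> nrm p"
  unfolding nrm_def by (simp add: E_sq_nonneg)

lemma nrm_square: "polynomial_on I p \<Longrightarrow> (nrm p)\<^sup>2 = E (\<lambda>z. (p z)\<^sup>2)"
  unfolding nrm_def by (simp add: E_sq_nonneg)

lemma nrm_triangle:
  assumes "polynomial_on I p" "polynomial_on I q"
  shows "nrm (\<lambda>z. p z + q z) \<le> nrm p + nrm q"
proof (rule power2_le_imp_le)
  have pol: "polynomial_on I (\<lambda>z. (p z)\<^sup>2)" "polynomial_on I (\<lambda>z. (q z)\<^sup>2)" "polynomial_on I (\<lambda>z. p z * q z)"
    using assms by (auto intro!: poly_intros)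
  have "E (\<lambda>z. (p z + q z)\<^sup>2) = E (\<lambda>z. (p z)\<^sup>2 + (2 * (p z * q z) + (q z)\<^sup>2))"
    by (simp add: power2_eq_square algebra_simps)
  also have "\<dots> = (nrm p)\<^sup>2 + (2 * E (\<lambda>z. p z * q z) + (nrm q)\<^sup>2)"
    using pol assms by (simp add: E_add E_cmult polynomial_on_cmult polynomial_on.add nrm_square)
  also have "E (\<lambda>z. p z * q z) \<le> nrm p * nrm q"
    using Cauchy_Schwarz[OF assms] real_le_rsqrt by (simp add: nrm_def real_sqrt_mult[symmetric])
  finally have "E (\<lambda>z. (p z + q z)\<^sup>2) \<le> (nrm p + nrm q)\<^sup>2"
    by (simp add: power2_sum)
  then show "(nrm (\<lambda>z. p z + q z))\<^sup>2 \<le> (nrm p + nrm q)\<^sup>2"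
    using nrm_square[OF polynomial_on.add[OF assms]] by simp
qed (use assms in \<open>auto intro: nrm_nonneg add_nonneg_nonneg\<close>)

lemma nrm_swap:
  assumes "x \<in> I" "y \<in> I" "a x = a y" "polynomial_on I p"
  shows "nrm (\<lambda>z. p (exchange x y z)) = nrm p"
  unfolding nrm_def using E_swap[OF assms(1-3), of "\<lambda>z. (p z)\<^sup>2"] assms(4) by (simp add: polynomial_on_power)

text \<open>
  The difference vanishes where \<open>z x = z y\<close>. The quotient is built along the structure of the
  polynomial, with a product rule for differences.
\<close>

lemma swap_difference_factor:
  assumes "x \<in> I" "y \<in> I" "polynomial_on I p"
  shows "\<exists>q. polynomial_on I q \<and> (\<forall>z. p z - p (exchange x y z) = (z x - z y) * q z)"
  using assms(3)
proof induction
  case (const b)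
  show ?case by (rule exI[of _ "\<lambda>_. 0"]) (auto intro: poly_intros)
next
  case (coord i)
  show ?case
    by (rule exI[of _ "\<lambda>_. (if i = x then 1 else 0) - (if i = y then 1 else 0)"])
      (auto intro: poly_intros simp: exchange_def Transposition.transpose_def)
next
  case (add f g)
  then obtain q r where "polynomial_on I q" "\<forall>z. f z - f (exchange x y z) = (z x - z y) * q z"
    "polynomial_on I r" "\<forall>z. g z - g (exchange x y z) = (z x - z y) * r z" by blast
  then show ?case
    by (intro exI[of _ "\<lambda>z. q z + r z"] conjI allI polynomial_on.add) (simp_all only: add_diff_add distrib_left)
next
  case (mult f g)
  then obtain q r where q: "polynomial_on I q" "\<And>z. f z - f (exchange x y z) = (z x - z y) * q z"
    and r: "polynomial_on I r" "\<And>z. g z - g (exchange x y z) = (z x - z y) * r z" by blast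
  show ?case
  proof (intro exI conjI allI)
    show "polynomial_on I (\<lambda>z. f z * r z + q z * g (exchange x y z))"
      using q r mult.hyps assms by (auto intro!: poly_intros polynomial_on_swap)
    fix z
    have "f z * g z - f (exchange x y z) * g (exchange x y z) =
        f z * (g z - g (exchange x y z)) +
        (f z - f (exchange x y z)) * g (exchange x y z)"
      by (simp add: algebra_simps)
    also have "\<dots> = (z x - z y) * (f z * r z + q z * g (exchange x y z))"
      unfolding q r by (simp add: algebra_simps)
    finally show "f z * g z - f (exchange x y z) * g (exchange x y z) =
        (z x - z y) * (f z * r z + q z * g (exchange x y z))" .
  qed
qed

lemma diff_deriv_swap:
  assumes "x \<in> I" "y \<in> I" "polynomial_on I p"
  shows "diff_deriv x y (\<lambda>z. p (exchange x y z)) =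
    (\<lambda>z. - diff_deriv x y p (exchange x y z))"
  using assms(3)
proof induction
  case (coord i)
  show ?case by (auto simp: diff_deriv_coord fun_eq_iff exchange_def Transposition.transpose_def)
next
  case (add f g)
  then show ?case
    using diff_deriv_add[OF polynomial_on_swap[OF assms(1,2) add.hyps(1)] polynomial_on_swap[OF assms(1,2) add.hyps(2)], of x y]
    by (simp add: diff_deriv_add fun_eq_iff)
next
  case (mult f g)
  then show ?case
    using diff_deriv_mult[OF polynomial_on_swap[OF assms(1,2) mult.hyps(1)] polynomial_on_swap[OF assms(1,2) mult.hyps(2)], of x y]
    by (simp add: diff_deriv_mult fun_eq_iff)
qed simp

text \<open>
  For two sites of equal weight \<open>b\<close> the function \<open>\<phi> = z x - z y\<close> is an eigenfunction of the energy
  exchange between them with eigenvalue \<open>2 * b\<close>, and every function that is odd under the exchange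
  of the two sites is a multiple \<open>\<phi> * q\<close>. Factoring out \<open>\<phi>\<close> turns the energy of \<open>\<phi> * q\<close> into
  \<open>2 * b\<close> times its square norm plus the nonnegative energy of \<open>q\<close> weighted by \<open>\<phi>\<^sup>2\<close>.
\<close>

lemma odd_poincare:
  assumes xy: "x \<in> I" "y \<in> I" "x \<noteq> y" and ab: "a x = b" "a y = b" and q: "polynomial_on I q"
  shows "2 * b * E (\<lambda>z. ((z x - z y) * q z)\<^sup>2) \<le>
    E (\<lambda>z. z x * z y * (diff_deriv x y (\<lambda>z. (z x - z y) * q z) z)\<^sup>2)"
proof -
  let ?D = "diff_deriv x y"
  have phi: "polynomial_on I (\<lambda>z. z x - z y)" using xy by (intro poly_intros)
  have Dphi: "?D (\<lambda>z. z x - z y) = (\<lambda>z. 2)"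
    using xy by (subst diff_deriv_diff[of I]) (auto intro: poly_intros simp: diff_deriv_coord)
  have Dg: "?D (\<lambda>z. (z x - z y) * q z) = (\<lambda>z. 2 * q z + (z x - z y) * ?D q z)"
    by (simp add: diff_deriv_mult[OF phi q] Dphi)
  have D2: "?D (\<lambda>z. (z x - z y) * q z * q z) =
      (\<lambda>z. (2 * q z + (z x - z y) * ?D q z) * q z + (z x - z y) * q z * ?D q z)"
    by (simp add: diff_deriv_mult[OF polynomial_on.mult[OF phi q] q] Dg)
  have "2 * b * E (\<lambda>z. ((z x - z y) * q z)\<^sup>2) =
      2 * E (\<lambda>z. (a y * z x - a x * z y) * ((z x - z y) * q z * q z))"
    using xy q ab by (subst E_cmult[symmetric], (intro poly_intros, auto)[1], subst E_cmult[symmetric])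
      (auto intro!: poly_intros simp: power2_eq_square algebra_simps)
  also have "\<dots> = 2 * E (\<lambda>z. z x * z y * ?D (\<lambda>z. (z x - z y) * q z * q z) z)"
    using xy q by (subst stein) (auto intro!: poly_intros)
  also have "\<dots> = E (\<lambda>z. 2 * (z x * z y * ?D (\<lambda>z. (z x - z y) * q z * q z) z))"
    using xy q by (intro E_cmult[symmetric]) (auto intro!: poly_intros polynomial_on_diff_deriv)
  also have "\<dots> \<le> E (\<lambda>z. z x * z y * (?D (\<lambda>z. (z x - z y) * q z) z)\<^sup>2)"
  proof (rule E_mono)
    fix z :: "'i \<Rightarrow> real" assume z: "\<And>i. i \<in> I \<Longrightarrow> 0 \<le> z i"
    have "z x * z y * (2 * q z + (z x - z y) * ?D q z)\<^sup>2 -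
        2 * (z x * z y * ((2 * q z + (z x - z y) * ?D q z) * q z + (z x - z y) * q z * ?D q z)) =
        (z x * z y) * ((z x - z y) * ?D q z)\<^sup>2"
      by (simp add: power2_eq_square algebra_simps)
    moreover have "0 \<le> (z x * z y) * ((z x - z y) * ?D q z)\<^sup>2"
      using z xy by (intro mult_nonneg_nonneg) auto
    ultimately show "2 * (z x * z y * ?D (\<lambda>z. (z x - z y) * q z * q z) z) \<le>
        z x * z y * (?D (\<lambda>z. (z x - z y) * q z) z)\<^sup>2"
      unfolding D2 Dg by linarith
  qed (use xy q in \<open>auto intro!: poly_intros polynomial_on_diff_deriv\<close>)
  finally show ?thesis .
qed

text \<open>
  The difference is odd, and since the exchange preserves \<open>E\<close>, its energy is at most four times
  that of \<open>p\<close>.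
\<close>

lemma swap_energy:
  assumes xy: "x \<in> I" "y \<in> I" "x \<noteq> y" and ab: "a x = b" "a y = b" and p: "polynomial_on I p"
  shows "b * E (\<lambda>z. (p z - p (exchange x y z))\<^sup>2) \<le>
    2 * E (\<lambda>z. z x * z y * (diff_deriv x y p z)\<^sup>2)"
proof -
  let ?D = "diff_deriv x y" and ?s = "exchange x y"
  let ?g = "\<lambda>z. p z - p (?s z)" and ?e = "\<lambda>z. z x * z y * (?D p z)\<^sup>2"
  obtain q where q: "polynomial_on I q" "\<And>z. ?g z = (z x - z y) * q z"
    using swap_difference_factor[OF xy(1,2) p] by blast
  have ps: "polynomial_on I (\<lambda>z. p (?s z))" by (rule polynomial_on_swap[OF xy(1,2) p])
  have e: "polynomial_on I ?e"
    using xy p by (auto intro!: poly_intros polynomial_on_diff_deriv)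
  have es: "polynomial_on I (\<lambda>z. ?e (?s z))"
    by (rule polynomial_on_swap[OF xy(1,2) e])
  have "2 * b * E (\<lambda>z. (?g z)\<^sup>2) \<le> E (\<lambda>z. z x * z y * (?D ?g z)\<^sup>2)"
    using odd_poincare[OF xy ab q(1)] by (simp only: q(2))
  also have "\<dots> \<le> E (\<lambda>z. 2 * (?e z + ?e (?s z)))"
  proof (rule E_mono)
    fix z :: "'i \<Rightarrow> real" assume z: "\<And>i. i \<in> I \<Longrightarrow> 0 \<le> z i"
    have 1: "?D ?g z = ?D p z + ?D p (?s z)"
      by (simp add: diff_deriv_diff[OF p ps] diff_deriv_swap[OF xy(1,2) p])
    have "(?D ?g z)\<^sup>2 \<le> 2 * ((?D p z)\<^sup>2 + (?D p (?s z))\<^sup>2)"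
      unfolding 1 using sum_squares_ge_zero[of "?D p z - ?D p (?s z)" 0]
      by (simp add: power2_eq_square algebra_simps)
    then have "z x * z y * (?D ?g z)\<^sup>2 \<le> z x * z y * (2 * ((?D p z)\<^sup>2 + (?D p (?s z))\<^sup>2))"
      using z xy by (intro mult_left_mono) auto
    then show "z x * z y * (?D ?g z)\<^sup>2 \<le> 2 * (?e z + ?e (?s z))"
      by (simp add: algebra_simps)
  qed (use xy p ps e es in \<open>auto intro!: polynomial_on_cmult polynomial_on.add poly_intros polynomial_on_diff_deriv\<close>)
  also have "\<dots> = 2 * (E ?e + E ?e)"
    using E_cmult[OF polynomial_on.add[OF e es], of 2] E_add[OF e es] E_swap[OF xy(1,2) _ e] ab by simp
  finally show ?thesis by simp
qed

lemma nrm_minus_commute: "nrm (\<lambda>z. p z - q z) = nrm (\<lambda>z. q z - p z)"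
  unfolding nrm_def by (simp add: power2_commute)

end

section \<open>The Dirichlet distribution and the splitting of sites\<close>

lemma dirichlet_coordinate_measurable:
  "x \<in> V \<Longrightarrow> (\<lambda>\<zeta>. \<zeta> x) \<in> borel_measurable (dirichlet V \<alpha>)"
  by (rule measurable_dirichletI) simp

lemma polynomial_dirichlet_integrable:
  assumes V: "finite V" "V \<noteq> {}" and a: "\<And>x. x \<in> V \<Longrightarrow> \<alpha> x > 0" and p: "polynomial_on V p"
  shows "integrable (dirichlet V \<alpha>) p"
proof -
  interpret prob_space "dirichlet V \<alpha>" by (rule prob_space_dirichlet[OF V a])
  obtain B where B: "\<forall>z. (\<forall>i\<in>V. 0 \<le> z i \<and> z i \<le> 1) \<longrightarrow> \<bar>p z\<bar> \<le> B"
    using polynomial_on_bounded[OF p] by blast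
  show ?thesis
  proof (rule integrable_const_bound)
    show "AE z in dirichlet V \<alpha>. norm (p z) \<le> B"
      by (rule AE_I2) (auto simp: prob_simplex_def PiE_iff intro!: B[rule_format])
    show "p \<in> borel_measurable (dirichlet V \<alpha>)"
      by (rule measurable_dirichletI[OF polynomial_on_measurable[OF p]])
  qed
qed

lemma dirichlet_moments_dirichlet:
  assumes V: "finite V" "V \<noteq> {}" and a: "\<And>x. x \<in> V \<Longrightarrow> \<alpha> x > 0"
  shows "dirichlet_moments V \<alpha> (\<lambda>p. \<integral>z. p z \<partial>dirichlet V \<alpha>)"
proof
  show "(\<integral>z. (\<Prod>i\<in>V. z i ^ k i) \<partial>dirichlet V \<alpha>) =
      (\<Prod>i\<in>V. pochhammer (\<alpha> i) (k i)) / pochhammer (sum \<alpha> V) (sum k V)" for k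
    by (rule dirichlet_moment[OF V a])
  show "0 \<le> (\<integral>z. p z \<partial>dirichlet V \<alpha>)"
    if "\<And>z. (\<And>i. i \<in> V \<Longrightarrow> 0 \<le> z i) \<Longrightarrow> sum z V = 1 \<Longrightarrow> 0 \<le> p z" for p :: "('a \<Rightarrow> real) \<Rightarrow> real"
    by (rule Bochner_Integration.integral_nonneg) (auto simp: prob_simplex_def PiE_iff intro!: that)
qed (use V a in \<open>auto intro!: Bochner_Integration.integral_add polynomial_dirichlet_integrable\<close>)

text \<open>
  Each site \<open>x\<close> is split into \<open>(x, True)\<close> of weight \<open>\<beta>\<close>, the same for all sites, and \<open>(x, False)\<close>
  carrying the remaining weight. By the aggregation property of the Dirichlet distribution the
  mass \<open>\<zeta> x\<close> is divided between the two by an independent Beta variable. Since the parts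
  \<open>(x, True)\<close> have equal weights, exchanging two of them preserves the law, although the original
  weights are arbitrary.
\<close>

locale split_sites =
  fixes V :: "'a set" and \<alpha> :: "'a \<Rightarrow> real" and \<beta> :: real
  assumes finite_V: "finite V" and V_nonempty: "V \<noteq> {}"
    and \<alpha>_pos: "x \<in> V \<Longrightarrow> 0 < \<alpha> x"
    and \<beta>_pos: "0 < \<beta>" and \<beta>_less: "x \<in> V \<Longrightarrow> \<beta> < \<alpha> x"
begin

text \<open>
  The value one outside \<open>V\<close> makes every factor of the product below a probability measure.
\<close>

definition part_weight :: "'a \<Rightarrow> bool \<Rightarrow> real" where
  "part_weight x i = (if x \<in> V then (if i then \<beta> else \<alpha> x - \<beta>) else 1)"

definition fractions :: "('a \<Rightarrow> bool \<Rightarrow> real) measure" where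
  "fractions = (\<Pi>\<^sub>M x\<in>V. dirichlet UNIV (part_weight x))"

definition split :: "('a \<Rightarrow> real) \<Rightarrow> ('a \<Rightarrow> bool \<Rightarrow> real) \<Rightarrow> 'a \<times> bool \<Rightarrow> real" where
  "split \<zeta> b = (\<lambda>(x, i). \<zeta> x * b x i)"

definition merge_parts :: "('a \<times> bool \<Rightarrow> real) \<Rightarrow> 'a \<Rightarrow> real" where
  "merge_parts z x = z (x, True) + z (x, False)"

text \<open>
  The conditional expectation given the masses of the original sites.
\<close>

definition avg :: "(('a \<times> bool \<Rightarrow> real) \<Rightarrow> real) \<Rightarrow> ('a \<Rightarrow> real) \<Rightarrow> real" where
  "avg Q \<zeta> = (\<integral>b. Q (split \<zeta> b) \<partial>fractions)"

definition mean :: "(('a \<Rightarrow> real) \<Rightarrow> real) \<Rightarrow> real" where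
  "mean p = (\<integral>\<zeta>. p \<zeta> \<partial>dirichlet V \<alpha>)"

definition split_mean :: "(('a \<times> bool \<Rightarrow> real) \<Rightarrow> real) \<Rightarrow> real" where
  "split_mean Q = mean (avg Q)"

abbreviation parts :: "('a \<times> bool) set" where "parts \<equiv> V \<times> UNIV"

lemma part_weight_pos: "0 < part_weight x i"
  using \<beta>_pos \<beta>_less[of x] by (simp add: part_weight_def)

lemma part_prob_space: "prob_space (dirichlet (UNIV :: bool set) (part_weight x))"
  by (rule prob_space_dirichlet) (auto simp: part_weight_pos)

lemma fractions_prob_space: "prob_space fractions"
  unfolding fractions_def by (intro prob_space_PiM part_prob_space)

sublocale fractions: prob_space fractions by (rule fractions_prob_space)

sublocale G: dirichlet_moments V \<alpha> mean
  unfolding mean_def[abs_def] by (rule dirichlet_moments_dirichlet[OF finite_V V_nonempty \<alpha>_pos])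

lemma space_fractions: "space fractions = (\<Pi>\<^sub>E x\<in>V. prob_simplex UNIV)"
  by (simp add: fractions_def space_PiM)

lemma fractions_bounds:
  assumes "b \<in> space fractions" "x \<in> V"
  shows "0 \<le> b x i" "b x i \<le> 1" "b x True + b x False = 1"
proof -
  have "b x \<in> prob_simplex UNIV" using assms unfolding space_fractions by (rule PiE_mem)
  then have "\<forall>i. b x i \<in> {0..1}" "sum (b x) UNIV = 1" by (auto simp: prob_simplex_def PiE_UNIV_domain)
  then show "0 \<le> b x i" "b x i \<le> 1" "b x True + b x False = 1"
    by (simp_all add: UNIV_bool add.commute)
qed

lemma fractions_measurable:
  "x \<in> V \<Longrightarrow> (\<lambda>b. b x i) \<in> borel_measurable fractions"
  unfolding fractions_def
  by (rule measurable_compose[of "\<lambda>b. b x" _ "dirichlet UNIV (part_weight x)" "\<lambda>d. d i"])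
    (simp_all add: measurable_component_singleton dirichlet_coordinate_measurable)

lemma split_measurable:
  assumes "polynomial_on parts Q"
  shows "(\<lambda>b. Q (split \<zeta> b)) \<in> borel_measurable fractions"
  using assms
proof induction
  case (coord p)
  then obtain x i where "p = (x, i)" "x \<in> V" by auto
  then show ?case
    using borel_measurable_times[OF borel_measurable_const fractions_measurable, of x "\<zeta> x" i]
    by (simp add: split_def)
qed (rule borel_measurable_const borel_measurable_add borel_measurable_times; assumption?)+

lemma split_bounded:
  assumes "polynomial_on parts Q"
  shows "\<exists>C\<ge>0. \<forall>b\<in>space fractions. \<bar>Q (split \<zeta> b)\<bar> \<le> C"
  using assms
proof induction
  case (const a)
  show ?case by (rule exI[of _ "\<bar>a\<bar>"]) auto
next
  case (coord p)
  then obtain x i where "p = (x, i)" "x \<in> V" by auto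
  then show ?case
    by (intro exI[of _ "\<bar>\<zeta> x\<bar>"]) (auto simp: split_def abs_mult fractions_bounds mult_left_le)
next
  case (add f g)
  then obtain B C where "B \<ge> 0" "C \<ge> 0" "\<forall>b\<in>space fractions. \<bar>f (split \<zeta> b)\<bar> \<le> B"
    "\<forall>b\<in>space fractions. \<bar>g (split \<zeta> b)\<bar> \<le> C" by blast
  then show ?case
    by (intro exI[of _ "B + C"]) (auto intro!: order_trans[OF abs_triangle_ineq] add_mono)
next
  case (mult f g)
  then obtain B C where "B \<ge> 0" "C \<ge> 0" "\<forall>b\<in>space fractions. \<bar>f (split \<zeta> b)\<bar> \<le> B"
    "\<forall>b\<in>space fractions. \<bar>g (split \<zeta> b)\<bar> \<le> C" by blast
  then show ?case
    by (intro exI[of _ "B * C"]) (auto simp: abs_mult intro!: mult_mono)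
qed

lemma split_integrable:
  assumes "polynomial_on parts Q"
  shows "integrable fractions (\<lambda>b. Q (split \<zeta> b))"
proof -
  obtain C where "\<forall>b\<in>space fractions. \<bar>Q (split \<zeta> b)\<bar> \<le> C" using split_bounded[OF assms] by blast
  then show ?thesis
    by (intro fractions.integrable_const_bound[of _ C] split_measurable assms) auto
qed

lemma avg_add:
  "polynomial_on parts Q \<Longrightarrow> polynomial_on parts R \<Longrightarrow> avg (\<lambda>z. Q z + R z) = (\<lambda>\<zeta>. avg Q \<zeta> + avg R \<zeta>)"
  by (simp add: avg_def fun_eq_iff split_integrable)

lemma avg_cmult: "avg (\<lambda>z. c * Q z) = (\<lambda>\<zeta>. c * avg Q \<zeta>)"
  by (simp add: avg_def fun_eq_iff)

lemma sum_part_weight: "x \<in> V \<Longrightarrow> sum (part_weight x) UNIV = \<alpha> x"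
  by (simp add: part_weight_def UNIV_bool)

lemma part_moment:
  assumes "x \<in> V"
  shows "(\<integral>d. (\<Prod>i\<in>UNIV. d i ^ k i) \<partial>dirichlet (UNIV :: bool set) (part_weight x)) =
    (\<Prod>i\<in>UNIV. pochhammer (part_weight x i) (k i)) / pochhammer (\<alpha> x) (sum k UNIV)"
  using dirichlet_moment[of UNIV "part_weight x" k] assms by (simp add: part_weight_pos sum_part_weight)

lemma integral_fractions_prod:
  assumes "\<And>x. x \<in> V \<Longrightarrow> polynomial_on UNIV (f x)"
  shows "(\<integral>b. (\<Prod>x\<in>V. f x (b x)) \<partial>fractions) = (\<Prod>x\<in>V. \<integral>d. f x d \<partial>dirichlet UNIV (part_weight x))"
proof -
  interpret P: product_prob_space "\<lambda>x. dirichlet (UNIV :: bool set) (part_weight x)" V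
    unfolding product_prob_space_def product_sigma_finite_def product_prob_space_axioms_def
    using part_prob_space prob_space_imp_sigma_finite by blast
  show ?thesis
    unfolding fractions_def using finite_V assms
    by (intro P.product_integral_prod polynomial_dirichlet_integrable) (auto simp: part_weight_pos)
qed

lemma avg_monomial:
  "avg (\<lambda>z. \<Prod>p\<in>parts. z p ^ k p) \<zeta> =
    (\<Prod>x\<in>V. (\<Prod>i\<in>UNIV. pochhammer (part_weight x i) (k (x, i))) / pochhammer (\<alpha> x) (\<Sum>i\<in>UNIV. k (x, i))) *
    (\<Prod>x\<in>V. \<zeta> x ^ (\<Sum>i\<in>UNIV. k (x, i)))"
proof -
  have "(\<Prod>p\<in>parts. split \<zeta> b p ^ k p) =
      (\<Prod>x\<in>V. \<zeta> x ^ (\<Sum>i\<in>UNIV. k (x, i))) * (\<Prod>x\<in>V. \<Prod>i\<in>UNIV. b x i ^ k (x, i))" for b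
  proof -
    have "(\<Prod>p\<in>parts. split \<zeta> b p ^ k p) = (\<Prod>x\<in>V. \<Prod>i\<in>UNIV. (\<zeta> x * b x i) ^ k (x, i))"
      by (simp add: prod.cartesian_product split_def case_prod_unfold)
    then show ?thesis
      by (simp add: power_mult_distrib prod.distrib power_sum)
  qed
  then have "avg (\<lambda>z. \<Prod>p\<in>parts. z p ^ k p) \<zeta> = (\<Prod>x\<in>V. \<zeta> x ^ (\<Sum>i\<in>UNIV. k (x, i))) *
      (\<integral>b. (\<Prod>x\<in>V. \<Prod>i\<in>UNIV. b x i ^ k (x, i)) \<partial>fractions)"
    by (simp add: avg_def)
  also have "(\<integral>b. (\<Prod>x\<in>V. \<Prod>i\<in>UNIV. b x i ^ k (x, i)) \<partial>fractions) =
      (\<Prod>x\<in>V. \<integral>d. (\<Prod>i\<in>UNIV. d i ^ k (x, i)) \<partial>dirichlet UNIV (part_weight x))"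
    by (rule integral_fractions_prod[of "\<lambda>x d. \<Prod>i\<in>UNIV. d i ^ k (x, i)"]) (intro poly_intros)
  also have "\<dots> = (\<Prod>x\<in>V. (\<Prod>i\<in>UNIV. pochhammer (part_weight x i) (k (x, i))) / pochhammer (\<alpha> x) (\<Sum>i\<in>UNIV. k (x, i)))"
    by (intro prod.cong refl part_moment)
  finally show ?thesis by (simp only: mult.commute)
qed

lemma finite_parts: "finite parts" using finite_V by simp

lemma polynomial_on_avg:
  assumes "polynomial_on parts Q"
  shows "polynomial_on V (avg Q)"
  using finite_parts assms
proof (induction rule: polynomial_monomial_induct)
  case (monomial a k)
  have "polynomial_on V (avg (\<lambda>z. \<Prod>p\<in>parts. z p ^ k p))"
    unfolding avg_monomial[abs_def] by (intro poly_intros)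
  then show ?case by (simp add: avg_cmult polynomial_on_cmult)
next
  case (add p q)
  then show ?case by (simp add: avg_add polynomial_on.add)
qed

text \<open>
  The parts again have Dirichlet moments: the Pochhammer symbols of the site weights, which are the
  denominators for the fractions, cancel against the numerators for the sites.
\<close>

sublocale S: dirichlet_moments parts "\<lambda>(x, i). part_weight x i" split_mean
proof
  fix k :: "'a \<times> bool \<Rightarrow> nat"
  have 1: "sum (\<lambda>(x, i). part_weight x i) parts = sum \<alpha> V"
    by (simp add: sum.cartesian_product[symmetric] sum_part_weight)
  have 2: "sum k parts = (\<Sum>x\<in>V. \<Sum>i\<in>UNIV. k (x, i))"
    by (simp add: sum.cartesian_product)
  have 3: "(\<Prod>p\<in>parts. pochhammer ((\<lambda>(x, i). part_weight x i) p) (k p)) =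
      (\<Prod>x\<in>V. \<Prod>i\<in>UNIV. pochhammer (part_weight x i) (k (x, i)))"
    by (simp add: prod.cartesian_product case_prod_unfold)
  have 4: "(\<Prod>x\<in>V. pochhammer (\<alpha> x) (\<Sum>i\<in>UNIV. k (x, i))) \<noteq> 0"
  proof -
    have "(\<Prod>x\<in>V. pochhammer (\<alpha> x) (\<Sum>i\<in>UNIV. k (x, i))) > 0"
      by (intro prod_pos pochhammer_pos \<alpha>_pos)
    then show ?thesis by simp
  qed
  have "split_mean (\<lambda>z. \<Prod>p\<in>parts. z p ^ k p) =
      (\<Prod>x\<in>V. (\<Prod>i\<in>UNIV. pochhammer (part_weight x i) (k (x, i))) / pochhammer (\<alpha> x) (\<Sum>i\<in>UNIV. k (x, i))) *
      mean (\<lambda>\<zeta>. \<Prod>x\<in>V. \<zeta> x ^ (\<Sum>i\<in>UNIV. k (x, i)))"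
    unfolding split_mean_def avg_monomial[abs_def] by (rule G.E_cmult) (intro poly_intros)
  also have "\<dots> = (\<Prod>x\<in>V. \<Prod>i\<in>UNIV. pochhammer (part_weight x i) (k (x, i))) /
      pochhammer (sum \<alpha> V) (\<Sum>x\<in>V. \<Sum>i\<in>UNIV. k (x, i))"
    using 4 by (simp add: G.E_monomial prod_dividef)
  finally show "split_mean (\<lambda>z. \<Prod>p\<in>parts. z p ^ k p) =
      (\<Prod>p\<in>parts. pochhammer ((\<lambda>(x, i). part_weight x i) p) (k p)) /
      pochhammer (sum (\<lambda>(x, i). part_weight x i) parts) (sum k parts)"
    unfolding 1 2 3 .
next
  fix Q assume Q: "polynomial_on parts Q"
    and nn: "\<And>z. (\<And>i. i \<in> parts \<Longrightarrow> 0 \<le> z i) \<Longrightarrow> sum z parts = 1 \<Longrightarrow> 0 \<le> Q z"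
  show "0 \<le> split_mean Q"
    unfolding split_mean_def
  proof (rule G.E_nonneg[OF polynomial_on_avg[OF Q]])
    fix \<zeta> :: "'a \<Rightarrow> real" assume \<zeta>: "\<And>i. i \<in> V \<Longrightarrow> 0 \<le> \<zeta> i" "sum \<zeta> V = 1"
    show "0 \<le> avg Q \<zeta>"
      unfolding avg_def
    proof (intro Bochner_Integration.integral_nonneg_AE AE_I2 nn)
      fix b assume b: "b \<in> space fractions"
      show "0 \<le> split \<zeta> b p" if "p \<in> parts" for p
        using that \<zeta> fractions_bounds[OF b] by (auto simp: split_def)
      have "sum (split \<zeta> b) parts = (\<Sum>x\<in>V. \<Sum>i\<in>UNIV. \<zeta> x * b x i)"
        by (simp add: sum.cartesian_product split_def)
      also have "\<dots> = sum \<zeta> V"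
        using fractions_bounds(3)[OF b] by (intro sum.cong) (auto simp: UNIV_bool distrib_left[symmetric] add.commute)
      finally show "sum (split \<zeta> b) parts = 1" using \<zeta> by simp
    qed
  qed
qed (auto simp: finite_V part_weight_pos split_mean_def avg_add avg_cmult G.E_add G.E_cmult polynomial_on_avg)

lemma polynomial_on_merge:
  assumes "polynomial_on V f"
  shows "polynomial_on parts (\<lambda>z. f (merge_parts z))"
  by (rule polynomial_on_subst[OF assms]) (auto simp: merge_parts_def intro!: poly_intros)

lemma merge_split:
  assumes "polynomial_on V f" "b \<in> space fractions"
  shows "f (merge_parts (split \<zeta> b)) = f \<zeta>"
  using assms(2) by (intro polynomial_on_cong[OF assms(1)])
    (simp add: merge_parts_def split_def distrib_left[symmetric] fractions_bounds)

lemma avg_merge_mult: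
  assumes "polynomial_on V f"
  shows "avg (\<lambda>z. f (merge_parts z) * Q z) \<zeta> = f \<zeta> * avg Q \<zeta>"
proof -
  have "avg (\<lambda>z. f (merge_parts z) * Q z) \<zeta> = (\<integral>b. f \<zeta> * Q (split \<zeta> b) \<partial>fractions)"
    unfolding avg_def by (intro Bochner_Integration.integral_cong) (simp_all add: merge_split[OF assms])
  then show ?thesis by (simp add: avg_def)
qed

lemma split_mean_merge_mult:
  "polynomial_on V f \<Longrightarrow> split_mean (\<lambda>z. f (merge_parts z) * Q z) = mean (\<lambda>\<zeta>. f \<zeta> * avg Q \<zeta>)"
  unfolding split_mean_def by (rule arg_cong[where f = mean], rule ext, rule avg_merge_mult)

lemma split_mean_merge:
  assumes "polynomial_on V f"
  shows "split_mean (\<lambda>z. f (merge_parts z)) = mean f"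
  using split_mean_merge_mult[OF assms, of "\<lambda>_. 1"] by (simp add: avg_def fractions.prob_space)

lemma diff_deriv_merge:
  assumes "polynomial_on V f"
  shows "diff_deriv (x, i) (y, j) (\<lambda>z. f (merge_parts z)) = (\<lambda>z. diff_deriv x y f (merge_parts z))"
  using assms
proof induction
  case (coord w)
  have 1: "polynomial_on {(w, True), (w, False)} (\<lambda>z. z (w, True))"
    "polynomial_on {(w, True), (w, False)} (\<lambda>z. z (w, False))"
    by (auto intro: poly_intros)
  show ?case
    unfolding merge_parts_def diff_deriv_add[OF 1] diff_deriv_coord by (cases i; cases j) auto
next
  case (add f g)
  then show ?case
    by (simp add: diff_deriv_add[OF polynomial_on_merge polynomial_on_merge] diff_deriv_add)
next
  case (mult f g)
  then show ?case
    by (simp add: diff_deriv_mult[OF polynomial_on_merge polynomial_on_merge] diff_deriv_mult)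
qed simp

lemma integral_fractions_True:
  assumes "x \<in> V"
  shows "(\<integral>b. b x True \<partial>fractions) = \<beta> / \<alpha> x"
    and "y \<in> V \<Longrightarrow> x \<noteq> y \<Longrightarrow> (\<integral>b. b x True * b y True \<partial>fractions) = \<beta> / \<alpha> x * (\<beta> / \<alpha> y)"
proof -
  have 1: "(\<integral>d. d True \<partial>dirichlet (UNIV :: bool set) (part_weight x)) = \<beta> / \<alpha> x" if "x \<in> V" for x
    using part_moment[OF that, of "\<lambda>i. if i then 1 else 0"] that by (simp add: UNIV_bool part_weight_def)
  have D: "measure (dirichlet (UNIV :: bool set) (part_weight w)) (prob_simplex UNIV) = 1" for w
    using prob_space.prob_space[OF part_prob_space[of w]] by simp
  define f where "f A w = (\<lambda>d :: bool \<Rightarrow> real. if w \<in> A then d True else 1)" for A and w :: 'a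
  have prod: "(\<Prod>w\<in>V. f A w (b w)) = (\<Prod>w\<in>A. b w True)" if "A \<subseteq> V" for A and b :: "'a \<Rightarrow> bool \<Rightarrow> real"
    using finite_V that unfolding f_def by (simp add: prod.If_cases Int_absorb1)
  have "(\<integral>b. (\<Prod>w\<in>A. b w True) \<partial>fractions) = (\<Prod>w\<in>A. \<beta> / \<alpha> w)" if A: "A \<subseteq> V" for A
  proof -
    have "(\<integral>b. (\<Prod>w\<in>A. b w True) \<partial>fractions) = (\<Prod>w\<in>V. \<integral>d. f A w d \<partial>dirichlet UNIV (part_weight w))"
      unfolding prod[OF A, symmetric]
    proof (rule integral_fractions_prod)
      show "polynomial_on UNIV (f A w)" for w
        by (cases "w \<in> A") (simp_all add: f_def poly_intros)
    qed
    also have "\<dots> = (\<Prod>w\<in>V. if w \<in> A then \<beta> / \<alpha> w else 1)"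
      by (intro prod.cong) (auto simp: f_def 1 D)
    also have "\<dots> = (\<Prod>w\<in>A. \<beta> / \<alpha> w)"
      using finite_V A by (simp add: prod.If_cases Int_absorb1)
    finally show ?thesis .
  qed
  note * = this
  show "(\<integral>b. b x True \<partial>fractions) = \<beta> / \<alpha> x"
    and "y \<in> V \<Longrightarrow> x \<noteq> y \<Longrightarrow> (\<integral>b. b x True * b y True \<partial>fractions) = \<beta> / \<alpha> x * (\<beta> / \<alpha> y)"
  proof -
    have "{x} \<subseteq> V" using assms by simp
    from *[OF this] show "(\<integral>b. b x True \<partial>fractions) = \<beta> / \<alpha> x" by simp
    assume "y \<in> V" "x \<noteq> y"
    then have "{x, y} \<subseteq> V" using assms by simp
    from *[OF this] \<open>x \<noteq> y\<close> show "(\<integral>b. b x True * b y True \<partial>fractions) = \<beta> / \<alpha> x * (\<beta> / \<alpha> y)" by simp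
  qed
qed

text \<open>
  Measures how far \<open>f\<close> is from being invariant under the exchange of the equally weighted parts of
  \<open>x\<close> and \<open>y\<close>.
\<close>

definition swap_dist :: "(('a \<Rightarrow> real) \<Rightarrow> real) \<Rightarrow> 'a \<Rightarrow> 'a \<Rightarrow> real" where
  "swap_dist f x y = S.nrm (\<lambda>z. f (merge_parts z) - f (merge_parts (exchange (x, True) (y, True) z)))"

lemma polynomial_on_merge_exchange:
  assumes "x \<in> V" "y \<in> V" "polynomial_on V f"
  shows "polynomial_on parts (\<lambda>z. f (merge_parts (exchange (x, True) (y, True) z)))"
  using S.polynomial_on_swap[OF _ _ polynomial_on_merge[OF assms(3)], of "(x, True)" "(y, True)"] assms
  by simp

text \<open>
  The estimate for sites of equal weight is applied to the two parts. Given the site masses \<open>\<zeta>\<close>, the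
  product of the masses of the parts has expectation \<open>\<beta> / \<alpha> x * (\<beta> / \<alpha> y) * (\<zeta> x * \<zeta> y)\<close>.
\<close>

lemma swap_dist_edge:
  assumes xy: "x \<in> V" "y \<in> V" "x \<noteq> y" and f: "polynomial_on V f"
  shows "(swap_dist f x y)\<^sup>2 \<le> 2 * \<beta> / (\<alpha> x * \<alpha> y) * mean (\<lambda>\<zeta>. \<zeta> x * \<zeta> y * (diff_deriv x y f \<zeta>)\<^sup>2)"
proof -
  let ?D = "diff_deriv x y f"
  have D: "polynomial_on V (\<lambda>\<zeta>. (?D \<zeta>)\<^sup>2)" using f by (intro poly_intros polynomial_on_diff_deriv)
  have "\<beta> * split_mean (\<lambda>z. (f (merge_parts z) - f (merge_parts (exchange (x, True) (y, True) z)))\<^sup>2) \<le>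
      2 * split_mean (\<lambda>z. z (x, True) * z (y, True) * (?D (merge_parts z))\<^sup>2)"
    using S.swap_energy[OF _ _ _ _ _ polynomial_on_merge[OF f], of "(x, True)" "(y, True)" \<beta>] xy
    by (simp add: part_weight_def diff_deriv_merge[OF f])
  also have "split_mean (\<lambda>z. z (x, True) * z (y, True) * (?D (merge_parts z))\<^sup>2) =
      mean (\<lambda>\<zeta>. (?D \<zeta>)\<^sup>2 * avg (\<lambda>z. z (x, True) * z (y, True)) \<zeta>)"
    using split_mean_merge_mult[OF D, of "\<lambda>z. z (x, True) * z (y, True)"] by (simp add: mult.commute)
  also have "avg (\<lambda>z. z (x, True) * z (y, True)) = (\<lambda>\<zeta>. (\<beta> / \<alpha> x * (\<beta> / \<alpha> y)) * (\<zeta> x * \<zeta> y))"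
  proof
    fix \<zeta>
    have "avg (\<lambda>z. z (x, True) * z (y, True)) \<zeta> = (\<integral>b. (\<zeta> x * \<zeta> y) * (b x True * b y True) \<partial>fractions)"
      by (simp add: avg_def split_def mult_ac)
    also have "\<dots> = (\<zeta> x * \<zeta> y) * (\<integral>b. b x True * b y True \<partial>fractions)"
      by (rule integral_mult_right_zero)
    finally show "avg (\<lambda>z. z (x, True) * z (y, True)) \<zeta> = (\<beta> / \<alpha> x * (\<beta> / \<alpha> y)) * (\<zeta> x * \<zeta> y)"
      using integral_fractions_True(2)[OF xy] by simp
  qed
  also have "mean (\<lambda>\<zeta>. (?D \<zeta>)\<^sup>2 * ((\<beta> / \<alpha> x * (\<beta> / \<alpha> y)) * (\<zeta> x * \<zeta> y))) =
      mean (\<lambda>\<zeta>. (\<beta> / \<alpha> x * (\<beta> / \<alpha> y)) * (\<zeta> x * \<zeta> y * (?D \<zeta>)\<^sup>2))"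
    by (simp add: mult_ac)
  also have "\<dots> = (\<beta> / \<alpha> x * (\<beta> / \<alpha> y)) * mean (\<lambda>\<zeta>. \<zeta> x * \<zeta> y * (?D \<zeta>)\<^sup>2)"
    using xy D by (intro G.E_cmult polynomial_on.mult polynomial_on.coord)
  finally have "\<beta> * split_mean (\<lambda>z. (f (merge_parts z) - f (merge_parts (exchange (x, True) (y, True) z)))\<^sup>2) \<le>
      \<beta> * (2 * \<beta> / (\<alpha> x * \<alpha> y) * mean (\<lambda>\<zeta>. \<zeta> x * \<zeta> y * (?D \<zeta>)\<^sup>2))"
    by (simp add: mult_ac)
  then have "split_mean (\<lambda>z. (f (merge_parts z) - f (merge_parts (exchange (x, True) (y, True) z)))\<^sup>2) \<le>
      2 * \<beta> / (\<alpha> x * \<alpha> y) * mean (\<lambda>\<zeta>. \<zeta> x * \<zeta> y * (?D \<zeta>)\<^sup>2)"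
    using \<beta>_pos by (simp only: mult_le_cancel_left_pos)
  then show ?thesis
    using S.nrm_square[OF polynomial_on_diff[OF polynomial_on_merge[OF f] polynomial_on_merge_exchange[OF xy(1,2) f]]]
    by (simp add: swap_dist_def)
qed

lemma exchange_commute: "exchange x y = exchange y x"
  by (simp add: exchange_def Transposition.transpose_commute fun_eq_iff)

lemma swap_dist_commute: "swap_dist f x y = swap_dist f y x"
  by (simp add: swap_dist_def exchange_commute)

lemma swap_dist_same [simp]: "polynomial_on V f \<Longrightarrow> swap_dist f x x = 0"
  by (simp add: swap_dist_def exchange_def S.nrm_def)

lemma swap_dist_nonneg:
  "x \<in> V \<Longrightarrow> y \<in> V \<Longrightarrow> polynomial_on V f \<Longrightarrow> 0 \<le> swap_dist f x y"
  unfolding swap_dist_def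
  by (intro S.nrm_nonneg polynomial_on_diff polynomial_on_merge polynomial_on_merge_exchange)

text \<open>
  The transposition of \<open>x\<close> and \<open>z\<close> is conjugate to that of \<open>y\<close> and \<open>z\<close> by that of \<open>x\<close> and \<open>y\<close>, and
  composing with a transposition is an isometry.
\<close>

lemma swap_dist_triangle:
  assumes xyz: "x \<in> V" "y \<in> V" "z \<in> V" and f: "polynomial_on V f"
  shows "swap_dist f x z \<le> 2 * swap_dist f x y + swap_dist f y z"
proof (cases "x = z \<or> y = z \<or> x = y")
  case True
  then show ?thesis
    using swap_dist_nonneg[OF xyz(1,2) f] swap_dist_nonneg[OF xyz(2,3) f] f by auto
next
  case False
  let ?F = "\<lambda>w. f (merge_parts w)"
  let ?xy = "exchange (x, True) (y, True) :: ('a \<times> bool \<Rightarrow> real) \<Rightarrow> _"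
  let ?yz = "exchange (y, True) (z, True) :: ('a \<times> bool \<Rightarrow> real) \<Rightarrow> _"
  let ?xz = "exchange (x, True) (z, True) :: ('a \<times> bool \<Rightarrow> real) \<Rightarrow> _"
  have conj: "?xz w = ?xy (?yz (?xy w))" for w
    using False by (auto simp: exchange_def Transposition.transpose_def fun_eq_iff)
  have F: "polynomial_on parts ?F" by (rule polynomial_on_merge[OF f])
  have xy: "polynomial_on parts (\<lambda>w. p (?xy w))" if "polynomial_on parts p" for p
    using xyz that by (intro S.polynomial_on_swap) auto
  have yz: "polynomial_on parts (\<lambda>w. p (?yz w))" if "polynomial_on parts p" for p
    using xyz that by (intro S.polynomial_on_swap) auto
  have nxy: "S.nrm (\<lambda>w. p (?xy w)) = S.nrm p" if "polynomial_on parts p" for p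
    using xyz that by (intro S.nrm_swap) (auto simp: part_weight_def)
  have nyz: "S.nrm (\<lambda>w. p (?yz w)) = S.nrm p" if "polynomial_on parts p" for p
    using xyz that by (intro S.nrm_swap) (auto simp: part_weight_def)
  have "swap_dist f x z = S.nrm (\<lambda>w. (?F w - ?F (?xy w)) +
      ((?F (?xy w) - ?F (?yz (?xy w))) + (?F (?yz (?xy w)) - ?F (?xy (?yz (?xy w))))))"
    unfolding swap_dist_def conj by simp
  also have "\<dots> \<le> S.nrm (\<lambda>w. ?F w - ?F (?xy w)) +
      S.nrm (\<lambda>w. (?F (?xy w) - ?F (?yz (?xy w))) + (?F (?yz (?xy w)) - ?F (?xy (?yz (?xy w)))))"
    by (intro S.nrm_triangle polynomial_on_diff polynomial_on.add F xy[OF F] xy[OF yz[OF F]] xy[OF yz[OF xy[OF F]]])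
  also have "S.nrm (\<lambda>w. (?F (?xy w) - ?F (?yz (?xy w))) + (?F (?yz (?xy w)) - ?F (?xy (?yz (?xy w))))) \<le>
      S.nrm (\<lambda>w. ?F (?xy w) - ?F (?yz (?xy w))) + S.nrm (\<lambda>w. ?F (?yz (?xy w)) - ?F (?xy (?yz (?xy w))))"
    by (intro S.nrm_triangle polynomial_on_diff polynomial_on.add F xy[OF F] xy[OF yz[OF F]] xy[OF yz[OF xy[OF F]]])
  also have "S.nrm (\<lambda>w. ?F (?xy w) - ?F (?yz (?xy w))) = S.nrm (\<lambda>w. ?F w - ?F (?yz w))"
    by (rule nxy[OF polynomial_on_diff[OF F yz[OF F]]])
  also have "S.nrm (\<lambda>w. ?F (?yz (?xy w)) - ?F (?xy (?yz (?xy w)))) = S.nrm (\<lambda>w. ?F w - ?F (?xy w))"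
    using nxy[OF yz[OF polynomial_on_diff[OF F xy[OF F]]]] nyz[OF polynomial_on_diff[OF F xy[OF F]]] by simp
  finally show ?thesis
    by (simp add: swap_dist_def)
qed

end

section \<open>Contraction on the complete graph\<close>

text \<open>
  A positive sequence whose ratios increase grows at least like its first ratio; so a geometric
  upper bound, whatever its constant, already controls the first ratio.
\<close>

lemma log_convex_first_ratio:
  fixes s :: "nat \<Rightarrow> real"
  assumes nn: "\<And>n. 0 \<le> s n" and conv: "\<And>n. (s (Suc n))\<^sup>2 \<le> s n * s (Suc (Suc n))"
    and bound: "\<And>n. s n \<le> M * q ^ n" and q: "0 < q"
  shows "s 1 \<le> q * s 0"
proof (rule ccontr)
  assume "\<not> s 1 \<le> q * s 0"
  then have gt: "s 1 > q * s 0" by simp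
  have "s 0 > 0"
  proof (rule ccontr)
    assume "\<not> s 0 > 0"
    then have "s 0 = 0" using nn[of 0] by simp
    then have "s 1 = 0" using conv[of 0] by simp
    then show False using gt \<open>s 0 = 0\<close> by simp
  qed
  define r where "r = s 1 / s 0"
  have r: "r > q" using gt \<open>s 0 > 0\<close> by (simp add: r_def field_simps)
  have step: "s n > 0 \<and> s (Suc n) \<ge> r * s n" for n
  proof (induction n)
    case 0
    then show ?case using \<open>s 0 > 0\<close> by (simp add: r_def)
  next
    case (Suc n)
    have pos: "s (Suc n) > 0"
      using Suc r q by (smt (verit) mult_pos_pos)
    have "r * s n * s (Suc n) \<le> s (Suc n) * s (Suc n)"
      using Suc pos by (intro mult_right_mono) auto
    also have "\<dots> \<le> s n * s (Suc (Suc n))"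
      using conv[of n] by (simp add: power2_eq_square)
    finally have "s n * (r * s (Suc n)) \<le> s n * s (Suc (Suc n))" by (simp add: mult_ac)
    then show ?case using Suc pos by simp
  qed
  have lower: "s 0 * r ^ n \<le> s n" for n
  proof (induction n)
    case (Suc n)
    have "s 0 * r ^ Suc n = r * (s 0 * r ^ n)" by simp
    also have "\<dots> \<le> r * s n" using Suc r q by (intro mult_left_mono) auto
    also have "\<dots> \<le> s (Suc n)" using step by simp
    finally show ?case .
  qed simp
  obtain n where n: "M / s 0 < (r / q) ^ n"
    using real_arch_pow[of "r / q" "M / s 0"] r q by auto
  have "M * q ^ n < s 0 * r ^ n"
    using n \<open>s 0 > 0\<close> q by (simp add: field_simps power_divide)
  then show False using lower[of n] bound[of n] by linarith
qed

definition put :: "'a \<Rightarrow> real \<Rightarrow> ('a \<Rightarrow> real) \<Rightarrow> 'a \<Rightarrow> real" where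
  "put u t \<theta> = \<theta>(u := \<theta> u + t)"

lemma put_add: "put u s (put u t \<theta>) = put u (s + t) \<theta>"
  by (auto simp: put_def fun_eq_iff)

lemma put_commute: "put u s (put v t \<theta>) = put v t (put u s \<theta>)"
  by (auto simp: put_def fun_eq_iff)

lemma sum_put: "finite V \<Longrightarrow> u \<in> V \<Longrightarrow> sum (put u t \<theta>) V = sum \<theta> V + t"
proof -
  assume V: "finite V" "u \<in> V"
  have "sum (put u t \<theta>) (V - {u}) = sum \<theta> (V - {u})"
    by (intro sum.cong) (auto simp: put_def)
  then show ?thesis using V by (simp add: put_def sum.remove)
qed

lemma put_nonneg: "(\<And>x. x \<in> V \<Longrightarrow> 0 \<le> \<theta> x) \<Longrightarrow> 0 \<le> t \<Longrightarrow> x \<in> V \<Longrightarrow> 0 \<le> put u t \<theta> x"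
  by (auto simp: put_def intro: add_nonneg_nonneg)

text \<open>
  The Lipschitz property for the metric on the simplex in which moving mass \<open>t\<close> from one site to
  another costs \<open>t\<close>. The part of the mass that does not move is called \<open>\<theta>\<close>.
\<close>

definition move_lipschitz :: "'a set \<Rightarrow> real \<Rightarrow> (('a \<Rightarrow> real) \<Rightarrow> real) \<Rightarrow> bool" where
  "move_lipschitz V C f \<longleftrightarrow> (\<forall>\<theta> t. \<forall>u\<in>V. \<forall>v\<in>V.
     (\<forall>x\<in>V. 0 \<le> \<theta> x) \<longrightarrow> 0 \<le> t \<longrightarrow> sum \<theta> V + t = 1 \<longrightarrow> \<bar>f (put u t \<theta>) - f (put v t \<theta>)\<bar> \<le> C * t)"

lemma move_lipschitzD:
  assumes "move_lipschitz V C f" "u \<in> V" "v \<in> V" "\<And>x. x \<in> V \<Longrightarrow> 0 \<le> \<theta> x" "0 \<le> t" "sum \<theta> V + t = 1"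
  shows "\<bar>f (put u t \<theta>) - f (put v t \<theta>)\<bar> \<le> C * t"
  using assms unfolding move_lipschitz_def by blast

lemma polynomial_move_lipschitz:
  assumes V: "finite V" and f: "polynomial_on V f"
  shows "\<exists>C\<ge>0. move_lipschitz V C f"
  using f
proof induction
  case (const a)
  show ?case by (rule exI[of _ 0]) (simp add: move_lipschitz_def)
next
  case (coord x)
  show ?case by (rule exI[of _ 1]) (auto simp: move_lipschitz_def put_def)
next
  case (add f g)
  then obtain C D where "C \<ge> 0" "move_lipschitz V C f" "D \<ge> 0" "move_lipschitz V D g" by blast
  show ?case
  proof (intro exI conjI)
    show "move_lipschitz V (C + D) (\<lambda>\<zeta>. f \<zeta> + g \<zeta>)"
      unfolding move_lipschitz_def
    proof (intro allI ballI impI)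
      fix \<theta> :: "'a \<Rightarrow> real" and t :: real and u v assume "u \<in> V" "v \<in> V" "\<forall>x\<in>V. 0 \<le> \<theta> x" "0 \<le> t" "sum \<theta> V + t = 1"
      then have "\<bar>f (put u t \<theta>) - f (put v t \<theta>)\<bar> \<le> C * t" "\<bar>g (put u t \<theta>) - g (put v t \<theta>)\<bar> \<le> D * t"
        using \<open>move_lipschitz V C f\<close> \<open>move_lipschitz V D g\<close> by (auto intro!: move_lipschitzD)
      then show "\<bar>f (put u t \<theta>) + g (put u t \<theta>) - (f (put v t \<theta>) + g (put v t \<theta>))\<bar> \<le> (C + D) * t"
        by (simp add: distrib_right)
    qed
  qed (use \<open>C \<ge> 0\<close> \<open>D \<ge> 0\<close> in auto)
next
  case (mult f g)
  then obtain C D where CD: "C \<ge> 0" "move_lipschitz V C f" "D \<ge> 0" "move_lipschitz V D g" by blast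
  obtain A where A: "A \<ge> 0" "\<And>z. (\<forall>i\<in>V. 0 \<le> z i \<and> z i \<le> 1) \<Longrightarrow> \<bar>f z\<bar> \<le> A"
    using polynomial_on_bounded[OF mult.hyps(1)] by blast
  obtain B where B: "B \<ge> 0" "\<And>z. (\<forall>i\<in>V. 0 \<le> z i \<and> z i \<le> 1) \<Longrightarrow> \<bar>g z\<bar> \<le> B"
    using polynomial_on_bounded[OF mult.hyps(2)] by blast
  show ?case
  proof (intro exI conjI)
    show "move_lipschitz V (A * D + C * B) (\<lambda>\<zeta>. f \<zeta> * g \<zeta>)"
      unfolding move_lipschitz_def
    proof (intro allI ballI impI)
      fix \<theta> :: "'a \<Rightarrow> real" and t :: real and u v assume h: "u \<in> V" "v \<in> V" "\<forall>x\<in>V. 0 \<le> \<theta> x" "0 \<le> t" "sum \<theta> V + t = 1"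
      then have fg: "\<bar>f (put u t \<theta>) - f (put v t \<theta>)\<bar> \<le> C * t" "\<bar>g (put u t \<theta>) - g (put v t \<theta>)\<bar> \<le> D * t"
        using CD by (auto intro!: move_lipschitzD)
      have cube: "\<forall>i\<in>V. 0 \<le> put w t \<theta> i \<and> put w t \<theta> i \<le> 1" if "w \<in> V" for w
      proof (intro ballI conjI)
        fix i assume i: "i \<in> V"
        show "0 \<le> put w t \<theta> i" using h i by (intro put_nonneg[of V]) auto
        have "put w t \<theta> i \<le> sum (put w t \<theta>) V"
          using h i V by (intro member_le_sum put_nonneg[of V]) auto
        also have "\<dots> = 1" using V that h by (simp add: sum_put)
        finally show "put w t \<theta> i \<le> 1" .
      qed
      have eq: "f (put u t \<theta>) * g (put u t \<theta>) - f (put v t \<theta>) * g (put v t \<theta>) =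
          f (put u t \<theta>) * (g (put u t \<theta>) - g (put v t \<theta>)) + (f (put u t \<theta>) - f (put v t \<theta>)) * g (put v t \<theta>)"
        by (simp add: algebra_simps)
      have "\<bar>f (put u t \<theta>) * g (put u t \<theta>) - f (put v t \<theta>) * g (put v t \<theta>)\<bar> \<le> \<bar>f (put u t \<theta>)\<bar> * \<bar>g (put u t \<theta>) - g (put v t \<theta>)\<bar> + \<bar>f (put u t \<theta>) - f (put v t \<theta>)\<bar> * \<bar>g (put v t \<theta>)\<bar>"
        unfolding eq by (intro order_trans[OF abs_triangle_ineq]) (simp add: abs_mult)
      also have "\<dots> \<le> A * (D * t) + (C * t) * B"
        using A(2)[OF cube[OF h(1)]] B(2)[OF cube[OF h(2)]] fg A(1) B(1) CD h
        by (intro add_mono mult_mono) auto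
      finally show "\<bar>f (put u t \<theta>) * g (put u t \<theta>) - f (put v t \<theta>) * g (put v t \<theta>)\<bar> \<le> (A * D + C * B) * t"
        by (simp add: algebra_simps)
    qed
  qed (use CD A(1) B(1) in auto)
qed

text \<open>
  The mass in \<open>W\<close> is moved to \<open>r\<close> one site after the other. A Lipschitz function is thus close to
  its value at a vertex of the simplex, which bounds its oscillation.
\<close>

lemma move_lipschitz_gather:
  assumes "finite V" "r \<in> V" "polynomial_on V f" "move_lipschitz V C f" "finite W"
    and "W \<subseteq> V - {r}" "\<And>x. x \<in> V \<Longrightarrow> 0 \<le> \<zeta> x" "sum \<zeta> V = 1" "\<And>x. x \<in> V - {r} - W \<Longrightarrow> \<zeta> x = 0"
  shows "\<bar>f \<zeta> - f (\<lambda>x. if x = r then 1 else 0)\<bar> \<le> C * sum \<zeta> W"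
  using assms(5-)
proof (induction W arbitrary: \<zeta> rule: finite_induct)
  case empty
  have "\<zeta> r = 1" using empty assms(1,2) by (simp add: sum.remove[of V r])
  then have "f \<zeta> = f (\<lambda>x. if x = r then 1 else 0)"
    using empty by (intro polynomial_on_cong[OF assms(3)]) auto
  then show ?case by simp
next
  case (insert w W)
  define \<theta> where "\<theta> = \<zeta>(w := 0)"
  have w: "w \<in> V" "w \<noteq> r" "w \<notin> W" using insert by auto
  have \<zeta>: "\<zeta> = put w (\<zeta> w) \<theta>" by (auto simp: \<theta>_def put_def fun_eq_iff)
  have \<theta>: "\<And>x. x \<in> V \<Longrightarrow> 0 \<le> \<theta> x" using insert.prems by (auto simp: \<theta>_def)
  have sum: "sum \<theta> V + \<zeta> w = 1"
    using sum_put[OF assms(1) w(1), of "\<zeta> w" \<theta>] insert.prems(3) \<zeta> by simp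
  have nn: "\<zeta> w \<ge> 0" using insert.prems w by auto
  define \<xi> where "\<xi> = put r (\<zeta> w) \<theta>"
  have 1: "\<bar>f \<zeta> - f \<xi>\<bar> \<le> C * \<zeta> w"
    using move_lipschitzD[OF assms(4) w(1) assms(2) \<theta> nn sum] \<zeta> by (simp add: \<xi>_def)
  have "\<bar>f \<xi> - f (\<lambda>x. if x = r then 1 else 0)\<bar> \<le> C * sum \<xi> W"
  proof (rule insert.IH)
    show "W \<subseteq> V - {r}" using insert.prems by auto
    show "0 \<le> \<xi> x" if "x \<in> V" for x unfolding \<xi>_def using \<theta> nn that by (rule put_nonneg)
    show "sum \<xi> V = 1" unfolding \<xi>_def using sum_put[OF assms(1,2)] sum by simp
    show "\<xi> x = 0" if "x \<in> V - {r} - W" for x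
      using that insert.prems by (auto simp: \<xi>_def put_def \<theta>_def)
  qed
  also have "sum \<xi> W = sum \<zeta> W"
    using w insert.prems by (intro sum.cong) (auto simp: \<xi>_def put_def \<theta>_def)
  finally show ?case using 1 insert.hyps by (simp add: distrib_left)
qed

lemma move_lipschitz_split:
  assumes "finite V" and lip: "move_lipschitz V C f" and v: "a \<in> V" "b \<in> V" "v \<in> V"
    and \<theta>: "\<And>x. x \<in> V \<Longrightarrow> 0 \<le> \<theta> x" and st: "0 \<le> s" "0 \<le> t" "sum \<theta> V + (s + t) = 1"
  shows "\<bar>f (put a s (put b t \<theta>)) - f (put v (s + t) \<theta>)\<bar> \<le> C * (s + t)"
proof -
  have "\<bar>f (put a s (put b t \<theta>)) - f (put v s (put b t \<theta>))\<bar> \<le> C * s"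
    using assms by (intro move_lipschitzD[OF lip] put_nonneg[of V]) (auto simp: sum_put)
  moreover have "\<bar>f (put b t (put v s \<theta>)) - f (put v t (put v s \<theta>))\<bar> \<le> C * t"
    using assms by (intro move_lipschitzD[OF lip] put_nonneg[of V]) (auto simp: sum_put)
  ultimately show ?thesis
    unfolding put_commute[of b] put_add by (simp add: add.commute distrib_left)
qed

context split_sites
begin

text \<open>
  The expected value of \<open>f\<close> after the exchange, as a function of the site masses before it.
\<close>

definition exchange_mean :: "'a \<Rightarrow> 'a \<Rightarrow> (('a \<Rightarrow> real) \<Rightarrow> real) \<Rightarrow> ('a \<Rightarrow> real) \<Rightarrow> real" where
  "exchange_mean x y f = avg (\<lambda>z. f (merge_parts (exchange (x, True) (y, True) z)))"

lemma polynomial_on_exchange_mean: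
  "x \<in> V \<Longrightarrow> y \<in> V \<Longrightarrow> polynomial_on V f \<Longrightarrow> polynomial_on V (exchange_mean x y f)"
  unfolding exchange_mean_def by (intro polynomial_on_avg polynomial_on_merge_exchange)

lemma exchange_mean_symmetric:
  assumes xy: "x \<in> V" "y \<in> V" and f: "polynomial_on V f" and g: "polynomial_on V g"
  shows "mean (\<lambda>\<zeta>. g \<zeta> * exchange_mean x y f \<zeta>) = mean (\<lambda>\<zeta>. f \<zeta> * exchange_mean x y g \<zeta>)"
proof -
  let ?s = "exchange (x, True) (y, True) :: ('a \<times> bool \<Rightarrow> real) \<Rightarrow> _"
  have ss: "?s (?s z) = z" for z by (simp add: exchange_def)
  have "mean (\<lambda>\<zeta>. g \<zeta> * exchange_mean x y f \<zeta>) = split_mean (\<lambda>z. g (merge_parts z) * f (merge_parts (?s z)))"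
    by (simp add: split_mean_merge_mult[OF g] exchange_mean_def)
  also have "\<dots> = split_mean (\<lambda>z. g (merge_parts (?s z)) * f (merge_parts (?s (?s z))))"
    using xy by (intro S.E_swap[symmetric] polynomial_on.mult polynomial_on_merge_exchange polynomial_on_merge f g)
      (auto simp: part_weight_def)
  also have "\<dots> = split_mean (\<lambda>z. f (merge_parts z) * g (merge_parts (?s z)))"
    by (simp add: ss mult.commute)
  also have "\<dots> = mean (\<lambda>\<zeta>. f \<zeta> * exchange_mean x y g \<zeta>)"
    by (simp add: split_mean_merge_mult[OF f] exchange_mean_def)
  finally show ?thesis .
qed

lemma exchange_mean_const [simp]: "exchange_mean x y (\<lambda>_. c) = (\<lambda>_. c)"
  using fractions.prob_space by (simp add: exchange_mean_def avg_def[abs_def])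

lemma swap_dist_square:
  assumes xy: "x \<in> V" "y \<in> V" and f: "polynomial_on V f"
  shows "(swap_dist f x y)\<^sup>2 = 2 * mean (\<lambda>\<zeta>. (f \<zeta>)\<^sup>2) - 2 * mean (\<lambda>\<zeta>. f \<zeta> * exchange_mean x y f \<zeta>)"
proof -
  let ?F = "\<lambda>z. f (merge_parts z)" and ?G = "\<lambda>z. f (merge_parts (exchange (x, True) (y, True) z))"
  have F: "polynomial_on parts ?F" and G: "polynomial_on parts ?G"
    using polynomial_on_merge[OF f] polynomial_on_merge_exchange[OF xy f] by auto
  have f2: "polynomial_on V (\<lambda>\<zeta>. (f \<zeta>)\<^sup>2)" using f by (intro poly_intros)
  have "(swap_dist f x y)\<^sup>2 = split_mean (\<lambda>z. (?F z - ?G z)\<^sup>2)"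
    unfolding swap_dist_def by (intro S.nrm_square polynomial_on_diff F G)
  also have "\<dots> = split_mean (\<lambda>z. ((?F z)\<^sup>2 + (?G z)\<^sup>2) - 2 * (?F z * ?G z))"
    by (simp add: power2_eq_square algebra_simps)
  also have "\<dots> = split_mean (\<lambda>z. (?F z)\<^sup>2) + split_mean (\<lambda>z. (?G z)\<^sup>2) - 2 * split_mean (\<lambda>z. ?F z * ?G z)"
  proof -
    have p: "polynomial_on parts (\<lambda>z. (?F z)\<^sup>2)" "polynomial_on parts (\<lambda>z. (?G z)\<^sup>2)" "polynomial_on parts (\<lambda>z. ?F z * ?G z)"
      using F G by (auto intro!: poly_intros)
    show ?thesis
      unfolding S.E_diff[OF polynomial_on.add[OF p(1,2)] polynomial_on_cmult[OF p(3)]] S.E_add[OF p(1,2)] S.E_cmult[OF p(3)] ..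
  qed
  also have "split_mean (\<lambda>z. (?G z)\<^sup>2) = split_mean (\<lambda>z. (?F z)\<^sup>2)"
    using xy by (intro S.E_swap[of _ _ "\<lambda>z. (?F z)\<^sup>2"] polynomial_on_power F) (auto simp: part_weight_def)
  also have "split_mean (\<lambda>z. (?F z)\<^sup>2) = mean (\<lambda>\<zeta>. (f \<zeta>)\<^sup>2)"
    by (rule split_mean_merge[OF f2])
  also have "split_mean (\<lambda>z. ?F z * ?G z) = mean (\<lambda>\<zeta>. f \<zeta> * exchange_mean x y f \<zeta>)"
    by (simp add: split_mean_merge_mult[OF f] exchange_mean_def)
  finally show ?thesis by simp
qed

text \<open>
  The site masses after the exchange, if \<open>b x True\<close> and \<open>b y True\<close> are the fractions exchanged.
\<close>

definition exchanged :: "'a \<Rightarrow> 'a \<Rightarrow> ('a \<Rightarrow> bool \<Rightarrow> real) \<Rightarrow> ('a \<Rightarrow> real) \<Rightarrow> 'a \<Rightarrow> real" where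
  "exchanged x y b \<zeta> = \<zeta>(x := \<zeta> x * (1 - b x True) + \<zeta> y * b y True, y := \<zeta> y * (1 - b y True) + \<zeta> x * b x True)"

lemma exchange_mean_eq:
  assumes xy: "x \<in> V" "y \<in> V" "x \<noteq> y" and f: "polynomial_on V f"
  shows "exchange_mean x y f \<zeta> = (\<integral>b. f (exchanged x y b \<zeta>) \<partial>fractions)"
    and "integrable fractions (\<lambda>b. f (exchanged x y b \<zeta>))"
proof -
  have eq: "f (merge_parts (exchange (x, True) (y, True) (split \<zeta> b))) = f (exchanged x y b \<zeta>)"
    if b: "b \<in> space fractions" for b
  proof (rule polynomial_on_cong[OF f])
    fix w assume w: "w \<in> V"
    have F: "b w False = 1 - b w True" if "w \<in> V" for w using fractions_bounds(3)[OF b that] by simp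
    show "merge_parts (exchange (x, True) (y, True) (split \<zeta> b)) w = exchanged x y b \<zeta> w"
      using w xy by (auto simp: merge_parts_def exchanged_def exchange_def Transposition.transpose_def split_def F algebra_simps)
  qed
  have int: "integrable fractions (\<lambda>b. f (merge_parts (exchange (x, True) (y, True) (split \<zeta> b))))"
    using split_integrable[OF polynomial_on_merge_exchange[OF xy(1,2) f]] .
  show "exchange_mean x y f \<zeta> = (\<integral>b. f (exchanged x y b \<zeta>) \<partial>fractions)"
    unfolding exchange_mean_def avg_def by (intro Bochner_Integration.integral_cong eq) auto
  show "integrable fractions (\<lambda>b. f (exchanged x y b \<zeta>))"
    using int by (subst Bochner_Integration.integrable_cong[OF refl eq[symmetric]]) auto
qed

lemma exchanged_put:
  assumes "x \<noteq> y"
  shows "exchanged x y b (put x t \<theta>) = put x (t * (1 - b x True)) (put y (t * b x True) (exchanged x y b \<theta>))"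
    and "exchanged x y b (put y t \<theta>) = put y (t * (1 - b y True)) (put x (t * b y True) (exchanged x y b \<theta>))"
    and "u \<noteq> x \<Longrightarrow> u \<noteq> y \<Longrightarrow> exchanged x y b (put u t \<theta>) = put u t (exchanged x y b \<theta>)"
  using assms by (auto simp: exchanged_def put_def fun_eq_iff algebra_simps)

lemma sum_exchanged:
  assumes "x \<in> V" "y \<in> V" "x \<noteq> y"
  shows "sum (exchanged x y b \<theta>) V = sum \<theta> V"
proof -
  have "sum h V = h x + h y + sum h (V - {x} - {y})" for h :: "'a \<Rightarrow> real"
    using assms finite_V by (simp add: sum.remove[of V x] sum.remove[of "V - {x}" y])
  moreover have "sum (exchanged x y b \<theta>) (V - {x} - {y}) = sum \<theta> (V - {x} - {y})"
    by (intro sum.cong) (auto simp: exchanged_def)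
  ultimately show ?thesis
    using assms by (simp add: exchanged_def algebra_simps)
qed

lemma exchanged_nonneg:
  assumes "x \<in> V" "y \<in> V" "x \<noteq> y" "b \<in> space fractions" "\<And>w. w \<in> V \<Longrightarrow> 0 \<le> \<theta> w" "w \<in> V"
  shows "0 \<le> exchanged x y b \<theta> w"
  using assms fractions_bounds[OF assms(4,1)] fractions_bounds[OF assms(4,2)]
  by (auto simp: exchanged_def intro!: add_nonneg_nonneg mult_nonneg_nonneg)

text \<open>
  Two configurations that differ in the place of mass \<open>t\<close> are exchanged with the same fractions.
  Mass sitting at \<open>x\<close> in one and at \<open>y\<close> in the other then meets, except for the proportion
  \<open>\<bar>1 - b x True - b y True\<bar>\<close>; every other discrepancy is transported without growing.
\<close>

lemma exchanged_lipschitz: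
  assumes xy: "x \<in> V" "y \<in> V" "x \<noteq> y" and lip: "move_lipschitz V C f"
    and b: "b \<in> space fractions" and uv: "u \<in> V" "v \<in> V" "u \<noteq> v"
    and \<theta>: "\<And>w. w \<in> V \<Longrightarrow> 0 \<le> \<theta> w" and t: "0 \<le> t" "sum \<theta> V + t = 1"
  shows "\<bar>f (exchanged x y b (put u t \<theta>)) - f (exchanged x y b (put v t \<theta>))\<bar> \<le>
    C * t * (if {u, v} = {x, y} then \<bar>1 - b x True - b y True\<bar> else 1)"
proof -
  define \<eta> where "\<eta> = exchanged x y b \<theta>"
  define p q where "p = b x True" and "q = b y True"
  have pq: "0 \<le> p" "p \<le> 1" "0 \<le> q" "q \<le> 1"
    using fractions_bounds[OF b] xy by (auto simp: p_def q_def)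
  have \<eta>: "\<And>w. w \<in> V \<Longrightarrow> 0 \<le> \<eta> w" unfolding \<eta>_def by (rule exchanged_nonneg[OF xy b \<theta>])
  have \<eta>t: "sum \<eta> V + t = 1" unfolding \<eta>_def using sum_exchanged[OF xy] t by simp
  note ex = exchanged_put[OF xy(3), where b = b and t = t and \<theta> = \<theta>, folded \<eta>_def p_def q_def]
  have split: "\<bar>f (put a (t * (1 - r)) (put c (t * r) \<eta>)) - f (put w t \<eta>)\<bar> \<le> C * t"
    if "0 \<le> r" "r \<le> 1" "a \<in> V" "c \<in> V" "w \<in> V" for r a c w
  proof -
    have "t * (1 - r) + t * r = t" by (simp add: algebra_simps)
    then show ?thesis
      using move_lipschitz_split[OF finite_V lip that(3-5) \<eta>, where s = "t * (1 - r)" and t = "t * r"] that t \<eta>t by simp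
  qed
  have meet: "\<bar>f (put x (t * (1 - p)) (put y (t * p) \<eta>)) - f (put y (t * (1 - q)) (put x (t * q) \<eta>))\<bar> \<le>
      C * t * \<bar>1 - p - q\<bar>"
  proof (cases "p + q \<le> 1")
    case True
    define \<xi> where "\<xi> = put x (t * q) (put y (t * p) \<eta>)"
    have \<xi>: "\<And>w. w \<in> V \<Longrightarrow> 0 \<le> \<xi> w" unfolding \<xi>_def using \<eta> pq t by (intro put_nonneg[of V]) auto
    have s: "sum \<xi> V + t * (1 - p - q) = 1"
      unfolding \<xi>_def using xy finite_V \<eta>t by (simp add: sum_put algebra_simps)
    have 1: "put x (t * (1 - p)) (put y (t * p) \<eta>) = put x (t * (1 - p - q)) \<xi>"
      unfolding \<xi>_def put_add by (simp add: algebra_simps)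
    have 2: "put y (t * (1 - q)) (put x (t * q) \<eta>) = put y (t * (1 - p - q)) \<xi>"
      unfolding \<xi>_def put_commute[of x] put_add by (simp add: algebra_simps)
    show ?thesis
      unfolding 1 2 using move_lipschitzD[OF lip xy(1,2) \<xi> _ s] True t by (simp add: mult.assoc)
  next
    case False
    define \<xi> where "\<xi> = put x (t * (1 - p)) (put y (t * (1 - q)) \<eta>)"
    have \<xi>: "\<And>w. w \<in> V \<Longrightarrow> 0 \<le> \<xi> w" unfolding \<xi>_def using \<eta> pq t by (intro put_nonneg[of V]) auto
    have s: "sum \<xi> V + t * (p + q - 1) = 1"
      unfolding \<xi>_def using xy finite_V \<eta>t by (simp add: sum_put algebra_simps)
    have 1: "put x (t * (1 - p)) (put y (t * p) \<eta>) = put y (t * (p + q - 1)) \<xi>"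
      unfolding \<xi>_def put_commute[of x] put_add by (simp add: algebra_simps)
    have 2: "put y (t * (1 - q)) (put x (t * q) \<eta>) = put x (t * (p + q - 1)) \<xi>"
      unfolding \<xi>_def put_commute[of y] put_add by (simp add: algebra_simps)
    show ?thesis
    proof -
      have "\<bar>1 - p - q\<bar> = p + q - 1" using False by simp
      then show ?thesis
        unfolding 1 2 \<open>\<bar>1 - p - q\<bar> = p + q - 1\<close> mult.assoc
        using False t by (intro move_lipschitzD[OF lip xy(2,1) \<xi> _ s]) auto
    qed
  qed
  consider "u = x" "v = y" | "u = y" "v = x" | "u = x" "v \<noteq> x" "v \<noteq> y" | "u = y" "v \<noteq> x" "v \<noteq> y"
    | "v = x" "u \<noteq> x" "u \<noteq> y" | "v = y" "u \<noteq> x" "u \<noteq> y" | "u \<noteq> x" "u \<noteq> y" "v \<noteq> x" "v \<noteq> y"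
    using uv by blast
  then show ?thesis
  proof cases
    case 1
    then show ?thesis using meet ex by (simp add: p_def q_def)
  next
    case 2
    then show ?thesis using meet ex by (simp add: p_def q_def insert_commute abs_minus_commute)
  next
    case 3
    then have "{u, v} \<noteq> {x, y}" by auto
    then show ?thesis using split[OF pq(1,2) xy(1,2) uv(2)] ex 3 by simp
  next
    case 4
    then have "{u, v} \<noteq> {x, y}" by auto
    then show ?thesis using split[OF pq(3,4) xy(2,1) uv(2)] ex 4 by simp
  next
    case 5
    then have "{u, v} \<noteq> {x, y}" by auto
    then show ?thesis using split[OF pq(1,2) xy(1,2) uv(1)] ex 5 by (simp add: abs_minus_commute)
  next
    case 6
    then have "{u, v} \<noteq> {x, y}" by auto
    then show ?thesis using split[OF pq(3,4) xy(2,1) uv(1)] ex 6 by (simp add: abs_minus_commute)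
  next
    case 7
    then have "{u, v} \<noteq> {x, y}" by auto
    then show ?thesis using move_lipschitzD[OF lip uv(1,2) \<eta> t(1) \<eta>t] ex 7 by simp
  qed
qed

text \<open>
  The proportion that does not meet satisfies \<open>\<bar>1 - p - q\<bar> \<le> (1 - p) * (1 - q) + p * q\<close>. The two fractions
  are independent, with means between \<open>\<rho>\<close> and \<open>1 / 2\<close>, so the right hand side has expectation at most
  \<open>1 - \<rho>\<close>.
\<close>

lemma exchange_mean_lipschitz:
  assumes xy: "x \<in> V" "y \<in> V" "x \<noteq> y" and lip: "move_lipschitz V C f" and C: "0 \<le> C"
    and f: "polynomial_on V f" and uv: "u \<in> V" "v \<in> V" "u \<noteq> v"
    and \<theta>: "\<And>w. w \<in> V \<Longrightarrow> 0 \<le> \<theta> w" and t: "0 \<le> t" "sum \<theta> V + t = 1"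
    and \<rho>: "\<And>w. w \<in> V \<Longrightarrow> \<rho> \<le> \<beta> / \<alpha> w" "\<And>w. w \<in> V \<Longrightarrow> \<beta> / \<alpha> w \<le> 1 / 2"
  shows "\<bar>exchange_mean x y f (put u t \<theta>) - exchange_mean x y f (put v t \<theta>)\<bar> \<le>
    C * t * (if {u, v} = {x, y} then 1 - \<rho> else 1)"
proof -
  note eq = exchange_mean_eq[OF xy f]
  define k where "k b = (if {u, v} = {x, y} then (1 - b x True - b y True) + 2 * (b x True * b y True) else 1)"
    for b :: "'a \<Rightarrow> bool \<Rightarrow> real"
  have meas [measurable]: "(\<lambda>b. b x True) \<in> borel_measurable fractions" "(\<lambda>b. b y True) \<in> borel_measurable fractions"
    by (intro fractions_measurable xy)+
  have int: "integrable fractions (\<lambda>b. b x True)" "integrable fractions (\<lambda>b. b y True)"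
    "integrable fractions (\<lambda>b. b x True * b y True)"
    using fractions_bounds(1,2) xy
    by (auto intro!: fractions.integrable_const_bound[where B = 1] AE_I2 mult_le_one)
  have kint: "integrable fractions k"
  proof (cases "{u, v} = {x, y}")
    case True
    then have "k = (\<lambda>b. (1 - b x True - b y True) + 2 * (b x True * b y True))"
      by (simp add: k_def fun_eq_iff)
    then show ?thesis
      by (simp only:) (intro Bochner_Integration.integrable_add Bochner_Integration.integrable_diff
          integrable_mult_right int fractions.integrable_const)
  next
    case False
    then have "k = (\<lambda>b. 1)" by (simp add: k_def fun_eq_iff)
    then show ?thesis by (simp only: fractions.integrable_const)
  qed
  have "\<bar>exchange_mean x y f (put u t \<theta>) - exchange_mean x y f (put v t \<theta>)\<bar> =
      \<bar>\<integral>b. f (exchanged x y b (put u t \<theta>)) - f (exchanged x y b (put v t \<theta>)) \<partial>fractions\<bar>"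
    by (simp add: eq)
  also have "\<dots> \<le> (\<integral>b. \<bar>f (exchanged x y b (put u t \<theta>)) - f (exchanged x y b (put v t \<theta>))\<bar> \<partial>fractions)"
    by (rule integral_abs_bound)
  also have "\<dots> \<le> (\<integral>b. C * t * k b \<partial>fractions)"
  proof (intro integral_mono)
    show "integrable fractions (\<lambda>b. \<bar>f (exchanged x y b (put u t \<theta>)) - f (exchanged x y b (put v t \<theta>))\<bar>)"
      by (intro integrable_abs Bochner_Integration.integrable_diff eq)
    show "integrable fractions (\<lambda>b. C * t * k b)" using kint by simp
    fix b assume b: "b \<in> space fractions"
    have pq: "0 \<le> b x True" "b x True \<le> 1" "0 \<le> b y True" "b y True \<le> 1"
      using fractions_bounds[OF b] xy by auto
    then have "0 \<le> (1 - b x True) * (1 - b y True)" by simp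
    moreover have "0 \<le> b x True * b y True" using pq by simp
    ultimately have "\<bar>1 - b x True - b y True\<bar> \<le> (1 - b x True - b y True) + 2 * (b x True * b y True)"
      by (simp add: abs_if algebra_simps)
    then have "(if {u, v} = {x, y} then \<bar>1 - b x True - b y True\<bar> else 1) \<le> k b"
      by (simp add: k_def)
    then show "\<bar>f (exchanged x y b (put u t \<theta>)) - f (exchanged x y b (put v t \<theta>))\<bar> \<le> C * t * k b"
      using C t by (intro order_trans[OF exchanged_lipschitz[OF xy lip b uv \<theta> t]] mult_left_mono) auto
  qed
  also have "\<dots> = C * t * (\<integral>b. k b \<partial>fractions)" by simp
  also have "(\<integral>b. k b \<partial>fractions) \<le> (if {u, v} = {x, y} then 1 - \<rho> else 1)"
  proof (cases "{u, v} = {x, y}")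
    case True
    define p q where "p = \<beta> / \<alpha> x" and "q = \<beta> / \<alpha> y"
    have pq: "0 \<le> p" "p \<le> 1 / 2" "\<rho> \<le> p" "0 \<le> q" "q \<le> 1 / 2" "\<rho> \<le> q"
      unfolding p_def q_def
      by (intro \<rho> xy divide_nonneg_pos \<alpha>_pos less_imp_le[OF \<beta>_pos])+
    have "(\<integral>b. k b \<partial>fractions) = 1 - p - q + 2 * (p * q)"
      using True int integral_fractions_True(1)[OF xy(1)] integral_fractions_True(1)[OF xy(2)]
        integral_fractions_True(2)[OF xy(1,2,3)]
      by (simp add: k_def p_def q_def fractions.prob_space)
    moreover have "p * q \<le> p * (1 / 2)" using pq by (intro mult_left_mono)
    moreover have "p * q \<le> 1 / 2 * q" using pq by (intro mult_right_mono)
    ultimately show ?thesis using True pq by simp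
  next
    case False
    then show ?thesis by (simp add: k_def fractions.prob_space)
  qed
  finally show ?thesis using C t by (auto simp: mult_left_mono)
qed

abbreviation site_pairs :: "('a \<times> 'a) set" where
  "site_pairs \<equiv> {(x, y). x \<in> V \<and> y \<in> V \<and> x \<noteq> y}"

lemma finite_site_pairs: "finite site_pairs"
  by (rule finite_subset[of _ "V \<times> V"]) (use finite_V in auto)

definition exchange_all :: "(('a \<Rightarrow> real) \<Rightarrow> real) \<Rightarrow> ('a \<Rightarrow> real) \<Rightarrow> real" where
  "exchange_all f \<zeta> = 1 / real (card site_pairs) * (\<Sum>(x, y)\<in>site_pairs. exchange_mean x y f \<zeta>)"

lemma polynomial_on_exchange_all:
  assumes "polynomial_on V f"
  shows "polynomial_on V (exchange_all f)"
  unfolding exchange_all_def[abs_def]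
proof (intro polynomial_on_cmult polynomial_on_sum)
  fix p assume "p \<in> site_pairs"
  then show "polynomial_on V (\<lambda>\<zeta>. case p of (x, y) \<Rightarrow> exchange_mean x y f \<zeta>)"
    using polynomial_on_exchange_mean[OF _ _ assms] by (cases p) auto
qed

lemma mean_mult_exchange_all:
  assumes f: "polynomial_on V f" and g: "polynomial_on V g"
  shows "mean (\<lambda>\<zeta>. g \<zeta> * exchange_all f \<zeta>) =
    1 / real (card site_pairs) * (\<Sum>(x, y)\<in>site_pairs. mean (\<lambda>\<zeta>. g \<zeta> * exchange_mean x y f \<zeta>))"
proof -
  have p: "polynomial_on V (\<lambda>\<zeta>. case p of (x, y) \<Rightarrow> g \<zeta> * exchange_mean x y f \<zeta>)" if "p \<in> site_pairs" for p
    using that polynomial_on_exchange_mean[OF _ _ f] g by (cases p) (auto intro!: poly_intros)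
  have "mean (\<lambda>\<zeta>. g \<zeta> * exchange_all f \<zeta>) =
      mean (\<lambda>\<zeta>. 1 / real (card site_pairs) * (\<Sum>p\<in>site_pairs. case p of (x, y) \<Rightarrow> g \<zeta> * exchange_mean x y f \<zeta>))"
    by (simp add: exchange_all_def sum_distrib_left case_prod_unfold mult_ac)
  also have "\<dots> = 1 / real (card site_pairs) * (\<Sum>p\<in>site_pairs. mean (\<lambda>\<zeta>. case p of (x, y) \<Rightarrow> g \<zeta> * exchange_mean x y f \<zeta>))"
    by (simp only: G.E_cmult[OF polynomial_on_sum[OF p]] G.E_sum[OF p])
  finally show ?thesis by (simp add: case_prod_unfold)
qed

lemma exchange_all_symmetric:
  assumes f: "polynomial_on V f" and g: "polynomial_on V g"
  shows "mean (\<lambda>\<zeta>. g \<zeta> * exchange_all f \<zeta>) = mean (\<lambda>\<zeta>. f \<zeta> * exchange_all g \<zeta>)"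
  unfolding mean_mult_exchange_all[OF f g] mean_mult_exchange_all[OF g f]
  using exchange_mean_symmetric[OF _ _ f g] by (intro arg_cong2[where f = "(*)"] sum.cong) auto

text \<open>
  Among the ordered pairs, \<open>(u, v)\<close> and \<open>(v, u)\<close> reduce a discrepancy between \<open>u\<close> and \<open>v\<close> by the
  factor \<open>1 - \<rho>\<close>, and the others do not increase it.
\<close>

lemma exchange_all_lipschitz:
  assumes lip: "move_lipschitz V C f" and C: "0 \<le> C" and f: "polynomial_on V f"
    and \<rho>: "\<And>w. w \<in> V \<Longrightarrow> \<rho> \<le> \<beta> / \<alpha> w" "\<And>w. w \<in> V \<Longrightarrow> \<beta> / \<alpha> w \<le> 1 / 2"
    and pos: "0 \<le> 1 - 2 * \<rho> / real (card site_pairs)"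
  shows "move_lipschitz V (C * (1 - 2 * \<rho> / real (card site_pairs))) (exchange_all f)"
  unfolding move_lipschitz_def
proof (intro allI ballI impI)
  fix \<theta> :: "'a \<Rightarrow> real" and t :: real and u v assume h: "u \<in> V" "v \<in> V" "\<forall>x\<in>V. 0 \<le> \<theta> x" "0 \<le> t" "sum \<theta> V + t = 1"
  let ?m = "real (card site_pairs)"
  show "\<bar>exchange_all f (put u t \<theta>) - exchange_all f (put v t \<theta>)\<bar> \<le> C * (1 - 2 * \<rho> / ?m) * t"
  proof (cases "u = v")
    case True
    then show ?thesis using C pos h by simp
  next
    case False
    have m: "?m > 0" using False h finite_site_pairs by (auto simp: card_gt_0_iff)
    have uv: "{(u, v), (v, u)} \<subseteq> site_pairs" using False h by auto
    have "\<bar>exchange_all f (put u t \<theta>) - exchange_all f (put v t \<theta>)\<bar> =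
        1 / ?m * \<bar>\<Sum>(x, y)\<in>site_pairs. exchange_mean x y f (put u t \<theta>) - exchange_mean x y f (put v t \<theta>)\<bar>"
      using m by (simp add: exchange_all_def sum_subtractf case_prod_unfold right_diff_distrib[symmetric] abs_mult diff_divide_distrib[symmetric])
    also have "\<dots> \<le> 1 / ?m * (\<Sum>(x, y)\<in>site_pairs. C * t * (if {u, v} = {x, y} then 1 - \<rho> else 1))"
      using m exchange_mean_lipschitz[OF _ _ _ lip C f h(1,2) False _ h(4,5) \<rho>] h(3)
      by (intro mult_left_mono order_trans[OF sum_abs] sum_mono) (auto simp: case_prod_unfold)
    also have "(\<Sum>(x, y)\<in>site_pairs. C * t * (if {u, v} = {x, y} then 1 - \<rho> else 1)) =
        C * t * (\<Sum>p\<in>site_pairs. 1 - (if p \<in> {(u, v), (v, u)} then \<rho> else 0))"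
      unfolding sum_distrib_left by (intro sum.cong) (auto simp: doubleton_eq_iff split: if_splits)
    also have "(\<Sum>p\<in>site_pairs. 1 - (if p \<in> {(u, v), (v, u)} then \<rho> else 0)) = ?m - (\<Sum>p\<in>{(u, v), (v, u)}. \<rho>)"
      unfolding sum_subtractf using finite_site_pairs uv
      by (subst sum.inter_restrict[OF finite_site_pairs, symmetric]) (simp add: Int_absorb1)
    also have "\<dots> = ?m - 2 * \<rho>" using False by simp
    also have "1 / ?m * (C * t * (?m - 2 * \<rho>)) = C * (1 - 2 * \<rho> / ?m) * t"
      using m by (simp add: field_simps)
    finally show ?thesis .
  qed
qed

text \<open>
  The averaged exchange is symmetric and contracts Lipschitz constants by \<open>1 - 2 * \<rho> / m\<close>, where \<open>m\<close>
  is the number of ordered pairs. By symmetry the square norms of its iterates are log-convex,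
  so on mean zero functions it contracts the norm at the same rate.
\<close>

lemma complete_graph_poincare:
  assumes f: "polynomial_on V f" and mean0: "mean f = 0" and card: "2 \<le> card V"
    and \<rho>: "\<And>w. w \<in> V \<Longrightarrow> \<rho> \<le> \<beta> / \<alpha> w" "\<And>w. w \<in> V \<Longrightarrow> \<beta> / \<alpha> w \<le> 1 / 2"
  shows "4 * \<rho> * mean (\<lambda>\<zeta>. (f \<zeta>)\<^sup>2) \<le> (\<Sum>(x, y)\<in>site_pairs. (swap_dist f x y)\<^sup>2)"
proof -
  let ?m = "real (card site_pairs)"
  define q where "q = 1 - 2 * \<rho> / ?m"
  obtain u where u: "u \<in> V" using V_nonempty by auto
  obtain v where v: "v \<in> V" "v \<noteq> u"
  proof -
    have "V \<noteq> {u}" using card by auto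
    then show ?thesis using that u by blast
  qed
  have "{(u, v), (v, u)} \<subseteq> site_pairs" using u v by auto
  then have "card {(u, v), (v, u)} \<le> card site_pairs" by (rule card_mono[OF finite_site_pairs])
  then have m: "?m \<ge> 2" using v by simp
  have "\<rho> \<le> 1 / 2" using \<rho>[OF u] by linarith
  then have "2 * \<rho> / ?m \<le> 1 / 2" using m by (simp add: field_simps)
  then have q: "0 < q" unfolding q_def by linarith
  define F where "F n = (exchange_all ^^ n) f" for n
  have FS: "F (Suc n) = exchange_all (F n)" for n by (simp add: F_def)
  have Fp: "polynomial_on V (F n)" for n
    by (induction n) (auto simp: F_def f polynomial_on_exchange_all)
  have Fm: "mean (F n) = 0" for n
  proof (induction n)
    case (Suc n)
    have "mean (F (Suc n)) = mean (\<lambda>\<zeta>. F n \<zeta> * exchange_all (\<lambda>_. 1) \<zeta>)"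
      using exchange_all_symmetric[OF Fp[of n] polynomial_on.const[of V 1]] by (simp add: FS)
    also have "exchange_all (\<lambda>_. 1) = (\<lambda>_. 1)"
      using m by (simp add: exchange_all_def fun_eq_iff case_prod_unfold)
    finally show ?case using Suc by simp
  qed (simp add: F_def mean0)
  obtain C where C: "0 \<le> C" "move_lipschitz V C f"
    using polynomial_move_lipschitz[OF finite_V f] by blast
  have Fl: "move_lipschitz V (C * q ^ n) (F n)" for n
  proof (induction n)
    case (Suc n)
    then show ?case
      using exchange_all_lipschitz[OF Suc _ Fp \<rho>] C q by (simp add: FS q_def mult_ac)
  qed (simp add: F_def C)
  define s where "s n = mean (\<lambda>\<zeta>. (F n \<zeta>)\<^sup>2)" for n
  have bound: "s n \<le> (2 * C)\<^sup>2 * (q\<^sup>2) ^ n" for n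
  proof -
    define c where "c = F n (\<lambda>x. if x = u then 1 else 0)"
    define D where "D = C * q ^ n"
    have D: "D \<ge> 0" using C q by (simp add: D_def)
    have osc: "\<bar>F n \<zeta> - c\<bar> \<le> D" if \<zeta>: "\<And>x. x \<in> V \<Longrightarrow> 0 \<le> \<zeta> x" "sum \<zeta> V = 1" for \<zeta>
    proof -
      have "\<bar>F n \<zeta> - c\<bar> \<le> D * sum \<zeta> (V - {u})"
        unfolding c_def D_def
        by (rule move_lipschitz_gather[OF finite_V u Fp Fl]) (use finite_V \<zeta> in auto)
      also have "\<dots> \<le> D * 1"
      proof (rule mult_left_mono)
        have "sum \<zeta> (V - {u}) \<le> sum \<zeta> V" using \<zeta> finite_V by (intro sum_mono2) auto
        then show "sum \<zeta> (V - {u}) \<le> 1" using \<zeta> by simp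
      qed (rule D)
      finally show ?thesis by simp
    qed
    have "c \<le> D"
    proof -
      have "mean (\<lambda>\<zeta>. c - D) \<le> mean (F n)"
      proof (intro G.E_mono Fp polynomial_on.const)
        fix \<zeta> :: "'a \<Rightarrow> real" assume z: "\<And>x. x \<in> V \<Longrightarrow> 0 \<le> \<zeta> x" "sum \<zeta> V = 1"
        show "c - D \<le> F n \<zeta>" using osc[OF z] by linarith
      qed
      then show ?thesis using Fm by simp
    qed
    moreover have "- D \<le> c"
    proof -
      have "mean (F n) \<le> mean (\<lambda>\<zeta>. c + D)"
      proof (intro G.E_mono Fp polynomial_on.const)
        fix \<zeta> :: "'a \<Rightarrow> real" assume z: "\<And>x. x \<in> V \<Longrightarrow> 0 \<le> \<zeta> x" "sum \<zeta> V = 1"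
        show "F n \<zeta> \<le> c + D" using osc[OF z] by linarith
      qed
      then show ?thesis using Fm by simp
    qed
    ultimately have le: "\<bar>F n \<zeta>\<bar> \<le> 2 * D" if "\<And>x. x \<in> V \<Longrightarrow> 0 \<le> \<zeta> x" "sum \<zeta> V = 1" for \<zeta>
      using osc[OF that] by linarith
    have "s n \<le> mean (\<lambda>\<zeta>. (2 * D)\<^sup>2)"
      unfolding s_def
    proof (intro G.E_mono polynomial_on_power Fp polynomial_on.const)
      fix \<zeta> :: "'a \<Rightarrow> real" assume z: "\<And>x. x \<in> V \<Longrightarrow> 0 \<le> \<zeta> x" "sum \<zeta> V = 1"
      show "(F n \<zeta>)\<^sup>2 \<le> (2 * D)\<^sup>2"
        using le[OF z] by (intro power2_le_iff_abs_le[THEN iffD2]) (use D in auto)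
    qed
    then show ?thesis by (simp add: D_def power_mult_distrib power_mult[symmetric] mult_ac)
  qed
  have sym: "mean (\<lambda>\<zeta>. F (Suc n) \<zeta> * F (Suc n) \<zeta>) = mean (\<lambda>\<zeta>. F n \<zeta> * F (Suc (Suc n)) \<zeta>)" for n
    using exchange_all_symmetric[OF Fp[of n] Fp[of "Suc n"]] by (simp add: FS)
  have "s 1 \<le> q\<^sup>2 * s 0"
  proof (rule log_convex_first_ratio)
    show "0 \<le> s n" for n unfolding s_def by (rule G.E_sq_nonneg[OF Fp])
    show "(s (Suc n))\<^sup>2 \<le> s n * s (Suc (Suc n))" for n
      using G.Cauchy_Schwarz[OF Fp Fp, of n "Suc (Suc n)"] sym[of n] by (simp add: s_def power2_eq_square)
    show "s n \<le> (2 * C)\<^sup>2 * (q\<^sup>2) ^ n" for n by (rule bound)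
  qed (use q in simp)
  have s0: "0 \<le> s 0" unfolding s_def by (rule G.E_sq_nonneg[OF Fp])
  have "mean (\<lambda>\<zeta>. f \<zeta> * exchange_all f \<zeta>) \<le> q * s 0"
  proof (rule power2_le_imp_le)
    have "(mean (\<lambda>\<zeta>. f \<zeta> * exchange_all f \<zeta>))\<^sup>2 \<le> s 0 * s 1"
      using G.Cauchy_Schwarz[OF Fp Fp, of 0 1] by (simp add: s_def F_def)
    also have "\<dots> \<le> s 0 * (q\<^sup>2 * s 0)" using \<open>s 1 \<le> q\<^sup>2 * s 0\<close> s0 by (intro mult_left_mono)
    finally show "(mean (\<lambda>\<zeta>. f \<zeta> * exchange_all f \<zeta>))\<^sup>2 \<le> (q * s 0)\<^sup>2"
      by (simp add: power2_eq_square mult_ac)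
  qed (use q s0 in simp)
  then have le: "(\<Sum>(x, y)\<in>site_pairs. mean (\<lambda>\<zeta>. f \<zeta> * exchange_mean x y f \<zeta>)) \<le> ?m * (q * s 0)"
    unfolding mean_mult_exchange_all[OF f f] using m by (simp add: field_simps)
  have "(\<Sum>(x, y)\<in>site_pairs. (swap_dist f x y)\<^sup>2) =
      (\<Sum>(x, y)\<in>site_pairs. 2 * s 0 - 2 * mean (\<lambda>\<zeta>. f \<zeta> * exchange_mean x y f \<zeta>))"
    by (intro sum.cong) (auto simp: swap_dist_square[OF _ _ f] s_def F_def)
  also have "\<dots> = ?m * (2 * s 0) - 2 * (\<Sum>(x, y)\<in>site_pairs. mean (\<lambda>\<zeta>. f \<zeta> * exchange_mean x y f \<zeta>))"
    by (simp add: case_prod_unfold sum_subtractf sum_distrib_left)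
  also have "\<dots> \<ge> ?m * (2 * s 0) - 2 * (?m * (q * s 0))" using le by simp
  also have "?m * (2 * s 0) - 2 * (?m * (q * s 0)) = 4 * \<rho> * s 0"
    using m by (simp add: q_def field_simps)
  finally show ?thesis by (simp add: s_def F_def)
qed

end

section \<open>The generator on polynomials\<close>

lemma polynomial_on_bep_generator:
  "polynomial_on V p \<Longrightarrow> polynomial_on V (bep_generator V c \<alpha> p)"
  unfolding bep_generator_def[abs_def]
  by (intro polynomial_on_cmult polynomial_on_sum polynomial_on.add polynomial_on.mult polynomial_on_uminus
      polynomial_on_diff polynomial_on_diff_deriv polynomial_on.coord)

lemma bep_generator_add:
  assumes "polynomial_on V p" "polynomial_on V q"
  shows "bep_generator V c \<alpha> (\<lambda>\<zeta>. p \<zeta> + q \<zeta>) = (\<lambda>\<zeta>. bep_generator V c \<alpha> p \<zeta> + bep_generator V c \<alpha> q \<zeta>)"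
  by (rule ext) (simp add: bep_generator_def diff_deriv_add[OF assms]
      diff_deriv_add[OF polynomial_on_diff_deriv[OF assms(1)] polynomial_on_diff_deriv[OF assms(2)]]
      distrib_left sum.distrib[symmetric] add_ac)

lemma bep_generator_cmult:
  assumes "polynomial_on V p"
  shows "bep_generator V c \<alpha> (\<lambda>\<zeta>. a * p \<zeta>) = (\<lambda>\<zeta>. a * bep_generator V c \<alpha> p \<zeta>)"
proof
  fix \<zeta>
  have "(\<Sum>x\<in>V. \<Sum>y\<in>V. c x y * (- (\<alpha> y * \<zeta> x - \<alpha> x * \<zeta> y) * (a * diff_deriv x y p \<zeta>)
        + \<zeta> x * \<zeta> y * (a * diff_deriv x y (diff_deriv x y p) \<zeta>))) =
      a * (\<Sum>x\<in>V. \<Sum>y\<in>V. c x y * (- (\<alpha> y * \<zeta> x - \<alpha> x * \<zeta> y) * diff_deriv x y p \<zeta>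
        + \<zeta> x * \<zeta> y * diff_deriv x y (diff_deriv x y p) \<zeta>))"
    unfolding sum_distrib_left by (intro sum.cong refl) (simp add: algebra_simps)
  then show "bep_generator V c \<alpha> (\<lambda>\<zeta>. a * p \<zeta>) \<zeta> = a * bep_generator V c \<alpha> p \<zeta>"
    by (simp add: bep_generator_def diff_deriv_cmult[OF assms] diff_deriv_cmult[OF polynomial_on_diff_deriv[OF assms]])
qed

context dirichlet_moments
begin

text \<open>
  Integration by parts turns the drift and the diffusion of each pair of sites together into a
  symmetric bilinear form of first derivatives.
\<close>

lemma bep_generator_form:
  assumes p: "polynomial_on I p" and q: "polynomial_on I q"
  shows "E (\<lambda>\<zeta>. q \<zeta> * - bep_generator I c a p \<zeta>) =
    1 / 2 * (\<Sum>x\<in>I. \<Sum>y\<in>I. c x y * E (\<lambda>\<zeta>. \<zeta> x * \<zeta> y * (diff_deriv x y p \<zeta> * diff_deriv x y q \<zeta>)))"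
proof -
  let ?D = "\<lambda>x y. diff_deriv x y"
  define T where "T x y = (\<lambda>\<zeta>. (a y * \<zeta> x - a x * \<zeta> y) * (?D x y p \<zeta> * q \<zeta>) - \<zeta> x * \<zeta> y * (?D x y (?D x y p) \<zeta> * q \<zeta>))" for x y
  have Dp: "polynomial_on I (?D x y p)" "polynomial_on I (?D x y (?D x y p))" "polynomial_on I (?D x y q)" for x y
    using p q by (auto intro: polynomial_on_diff_deriv)
  have T: "polynomial_on I (T x y)" if "x \<in> I" "y \<in> I" for x y
    unfolding T_def using that Dp[of x y] q by (intro poly_intros)
  have ET: "E (T x y) = E (\<lambda>\<zeta>. \<zeta> x * \<zeta> y * (?D x y p \<zeta> * ?D x y q \<zeta>))" if xy: "x \<in> I" "y \<in> I" for x y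
  proof -
    have "E (T x y) = E (\<lambda>\<zeta>. (a y * \<zeta> x - a x * \<zeta> y) * (?D x y p \<zeta> * q \<zeta>)) - E (\<lambda>\<zeta>. \<zeta> x * \<zeta> y * (?D x y (?D x y p) \<zeta> * q \<zeta>))"
      unfolding T_def using xy Dp[of x y] q by (intro E_diff poly_intros)
    also have "E (\<lambda>\<zeta>. (a y * \<zeta> x - a x * \<zeta> y) * (?D x y p \<zeta> * q \<zeta>)) = E (\<lambda>\<zeta>. \<zeta> x * \<zeta> y * ?D x y (\<lambda>\<zeta>. ?D x y p \<zeta> * q \<zeta>) \<zeta>)"
      using xy Dp q by (intro stein polynomial_on.mult)
    also have "\<dots> = E (\<lambda>\<zeta>. \<zeta> x * \<zeta> y * (?D x y (?D x y p) \<zeta> * q \<zeta>) + \<zeta> x * \<zeta> y * (?D x y p \<zeta> * ?D x y q \<zeta>))"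
      by (simp add: diff_deriv_mult[OF Dp(1) q] distrib_left)
    also have "\<dots> = E (\<lambda>\<zeta>. \<zeta> x * \<zeta> y * (?D x y (?D x y p) \<zeta> * q \<zeta>)) + E (\<lambda>\<zeta>. \<zeta> x * \<zeta> y * (?D x y p \<zeta> * ?D x y q \<zeta>))"
      using xy Dp[of x y] q by (intro E_add poly_intros)
    finally show ?thesis by simp
  qed
  have "E (\<lambda>\<zeta>. q \<zeta> * - bep_generator I c a p \<zeta>) = E (\<lambda>\<zeta>. 1 / 2 * (\<Sum>x\<in>I. \<Sum>y\<in>I. c x y * T x y \<zeta>))"
  proof (rule arg_cong[where f = E], rule ext)
    fix \<zeta>
    have "q \<zeta> * - bep_generator I c a p \<zeta> = 1 / 2 * (- q \<zeta> * (\<Sum>x\<in>I. \<Sum>y\<in>I. c x y *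
       (- (a y * \<zeta> x - a x * \<zeta> y) * ?D x y p \<zeta> + \<zeta> x * \<zeta> y * ?D x y (?D x y p) \<zeta>)))"
      by (simp add: bep_generator_def)
    also have "- q \<zeta> * (\<Sum>x\<in>I. \<Sum>y\<in>I. c x y *
       (- (a y * \<zeta> x - a x * \<zeta> y) * ?D x y p \<zeta> + \<zeta> x * \<zeta> y * ?D x y (?D x y p) \<zeta>)) = (\<Sum>x\<in>I. \<Sum>y\<in>I. c x y * T x y \<zeta>)"
      unfolding sum_distrib_left by (intro sum.cong refl) (simp add: T_def algebra_simps)
    finally show "q \<zeta> * - bep_generator I c a p \<zeta> = 1 / 2 * (\<Sum>x\<in>I. \<Sum>y\<in>I. c x y * T x y \<zeta>)" .
  qed
  also have "\<dots> = 1 / 2 * E (\<lambda>\<zeta>. \<Sum>x\<in>I. \<Sum>y\<in>I. c x y * T x y \<zeta>)"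
    by (intro E_cmult polynomial_on_sum polynomial_on_cmult T)
  also have "E (\<lambda>\<zeta>. \<Sum>x\<in>I. \<Sum>y\<in>I. c x y * T x y \<zeta>) = (\<Sum>x\<in>I. E (\<lambda>\<zeta>. \<Sum>y\<in>I. c x y * T x y \<zeta>))"
    by (intro E_sum polynomial_on_sum polynomial_on_cmult T)
  also have "\<dots> = (\<Sum>x\<in>I. \<Sum>y\<in>I. E (\<lambda>\<zeta>. c x y * T x y \<zeta>))"
    by (intro sum.cong refl E_sum polynomial_on_cmult T)
  also have "\<dots> = (\<Sum>x\<in>I. \<Sum>y\<in>I. c x y * E (\<lambda>\<zeta>. \<zeta> x * \<zeta> y * (?D x y p \<zeta> * ?D x y q \<zeta>)))"
    by (intro sum.cong refl) (simp add: E_cmult[OF T] ET)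
  finally show ?thesis .
qed

lemma bep_generator_symmetric:
  assumes "polynomial_on I p" "polynomial_on I q"
  shows "E (\<lambda>\<zeta>. q \<zeta> * - bep_generator I c a p \<zeta>) = E (\<lambda>\<zeta>. p \<zeta> * - bep_generator I c a q \<zeta>)"
  unfolding bep_generator_form[OF assms] bep_generator_form[OF assms(2,1)] by (simp add: mult.commute)

end

section \<open>Paths in the graph\<close>

text \<open>
  A walk of minimal length visits no point twice, since the loop could be removed.
\<close>

lemma wedges_relpow_shortest_path:
  assumes "(x, y) \<in> R\<^sup>*"
  defines "n \<equiv> LEAST n. (x, y) \<in> R ^^ n"
  obtains p where "p 0 = x" "p n = y" "\<And>i. i < n \<Longrightarrow> (p i, p (Suc i)) \<in> R" "inj_on p {..n}"
proof -
  obtain m where "(x, y) \<in> R ^^ m" using assms(1) by (auto dest: rtrancl_imp_relpow)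
  then have "(x, y) \<in> R ^^ n" unfolding n_def by (rule LeastI)
  then obtain p where p: "p 0 = x" "p n = y" "\<And>i. i < n \<Longrightarrow> (p i, p (Suc i)) \<in> R"
    by (auto simp: relpow_fun_conv)
  have sub: "(p i, p j) \<in> R ^^ (j - i)" if "i \<le> j" "j \<le> n" for i j
    unfolding relpow_fun_conv using that by (intro exI[of _ "\<lambda>k. p (i + k)"]) (auto simp: p(3))
  have "p i \<noteq> p j" if "i < j" "j \<le> n" for i j
  proof
    assume "p i = p j"
    then have "(x, y) \<in> R ^^ i O R ^^ (n - j)"
      using sub[of 0 i] sub[of j n] that p(1,2) by auto
    then have "(x, y) \<in> R ^^ (i + (n - j))" by (simp add: relpow_add)
    then have "n \<le> i + (n - j)" unfolding n_def by (rule Least_le)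
    then show False using that by linarith
  qed
  then have "inj_on p {..n}" by (auto simp: inj_on_def) (metis linorder_neqE_nat)
  with p that show ?thesis by blast
qed

lemma graph_dist_le_diam:
  assumes "finite V" "x \<in> V" "y \<in> V" "x \<noteq> y"
  shows "graph_dist V c x y \<le> graph_diam V c"
proof -
  have "finite {graph_dist V c x y | x y. x \<in> V \<and> y \<in> V \<and> x \<noteq> y}"
    by (rule finite_subset[of _ "(\<lambda>(x, y). graph_dist V c x y) ` (V \<times> V)"]) (use assms in auto)
  then show ?thesis unfolding graph_diam_def using assms by (intro Max_ge) auto
qed

lemma finite_wedges: "finite V \<Longrightarrow> finite (wedges V c)"
  by (rule finite_subset[of _ "V \<times> V"]) (auto simp: wedges_def)

lemma c_min_properties:
  assumes "connected_weighted_graph V c"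
  shows "0 < c_min V c" "(x, y) \<in> wedges V c \<Longrightarrow> c_min V c \<le> c x y"
proof -
  let ?S = "{c x y | x y. x \<in> V \<and> y \<in> V \<and> 0 < c x y}"
  have fin: "finite V" using assms by (simp add: connected_weighted_graph_def)
  have finS: "finite ?S"
    by (rule finite_subset[of _ "(\<lambda>(x, y). c x y) ` (V \<times> V)"]) (use fin in auto)
  have ne: "?S \<noteq> {}"
  proof -
    have "\<not> card V \<le> Suc 0" using assms by (simp add: connected_weighted_graph_def)
    then obtain x y where xy: "x \<in> V" "y \<in> V" "x \<noteq> y"
      using fin by (auto simp: card_le_Suc0_iff_eq)
    then have "(x, y) \<in> (wedges V c)\<^sup>*" using assms by (auto simp: connected_weighted_graph_def)
    then obtain z where "(x, z) \<in> wedges V c" using xy(3) by (meson converse_rtranclE)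
    then show ?thesis by (auto simp: wedges_def)
  qed
  show "0 < c_min V c" unfolding c_min_def using Min_in[OF finS ne] by auto
  show "(x, y) \<in> wedges V c \<Longrightarrow> c_min V c \<le> c x y"
    unfolding c_min_def using finS by (intro Min_le) (auto simp: wedges_def)
qed

context split_sites
begin

text \<open>
  The triangle inequality doubles only one of its two terms. Letting this be the single last step keeps
  the factor two from accumulating along the walk.
\<close>

lemma swap_dist_walk:
  assumes f: "polynomial_on V f" and p: "\<And>i. i \<le> n \<Longrightarrow> p i \<in> V"
  shows "swap_dist f (p 0) (p n) \<le> 2 * (\<Sum>i<n. swap_dist f (p i) (p (Suc i)))"
  using p
proof (induction n)
  case (Suc n)
  have "swap_dist f (p (Suc n)) (p 0) \<le> 2 * swap_dist f (p (Suc n)) (p n) + swap_dist f (p n) (p 0)"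
    using Suc.prems by (intro swap_dist_triangle f) auto
  then show ?case
    using Suc by (simp add: swap_dist_commute[of f "p (Suc n)"] swap_dist_commute[of f "p n" "p 0"])
qed (simp add: f)

text \<open>
  Cauchy--Schwarz along a shortest path, which uses every edge at most once.
\<close>

lemma swap_dist_path:
  assumes graph: "connected_weighted_graph V c" and f: "polynomial_on V f"
    and xy: "x \<in> V" "y \<in> V" "x \<noteq> y"
  shows "(swap_dist f x y)\<^sup>2 \<le> 4 * real (graph_diam V c) * (\<Sum>(u, v)\<in>wedges V c. (swap_dist f u v)\<^sup>2)"
proof -
  let ?d = "swap_dist f" and ?n = "graph_dist V c x y"
  have "(x, y) \<in> (wedges V c)\<^sup>*" using graph xy by (simp add: connected_weighted_graph_def)
  then obtain p where p: "p 0 = x" "p ?n = y" "\<And>i. i < ?n \<Longrightarrow> (p i, p (Suc i)) \<in> wedges V c" "inj_on p {..?n}"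
    unfolding graph_dist_def by (rule wedges_relpow_shortest_path) blast
  have pV: "p i \<in> V" if "i \<le> ?n" for i
    using p(3)[of "i - 1"] p(1) xy that by (cases i) (auto simp: wedges_def)
  have "?d x y \<le> 2 * (\<Sum>i<?n. ?d (p i) (p (Suc i)))"
    using swap_dist_walk[OF f, where n = ?n and p = p] pV p(1,2) by simp
  then have "(?d x y)\<^sup>2 \<le> (2 * (\<Sum>i<?n. ?d (p i) (p (Suc i))))\<^sup>2"
    using swap_dist_nonneg[OF xy(1,2) f] by (rule power_mono)
  also have "\<dots> = 4 * (\<Sum>i<?n. 1 * ?d (p i) (p (Suc i)))\<^sup>2" by (simp add: power_mult_distrib)
  also have "\<dots> \<le> 4 * ((\<Sum>i<?n. 1\<^sup>2) * (\<Sum>i<?n. (?d (p i) (p (Suc i)))\<^sup>2))"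
    by (intro mult_left_mono Cauchy_Schwarz_ineq_sum) simp
  also have "\<dots> = 4 * (real ?n * (\<Sum>i<?n. (?d (p i) (p (Suc i)))\<^sup>2))" by simp
  also have "\<dots> \<le> 4 * (real (graph_diam V c) * (\<Sum>(u, v)\<in>wedges V c. (?d u v)\<^sup>2))"
  proof (intro mult_left_mono mult_mono)
    show "real ?n \<le> real (graph_diam V c)" using graph_dist_le_diam[OF finite_V xy] by simp
    have inj: "inj_on (\<lambda>i. (p i, p (Suc i))) {..<?n}"
      using p(4) by (auto simp: inj_on_def)
    have "(\<Sum>i<?n. (?d (p i) (p (Suc i)))\<^sup>2) = (\<Sum>(u, v)\<in>(\<lambda>i. (p i, p (Suc i))) ` {..<?n}. (?d u v)\<^sup>2)"
      using inj by (simp add: sum.reindex)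
    also have "\<dots> \<le> (\<Sum>(u, v)\<in>wedges V c. (?d u v)\<^sup>2)"
      using finite_wedges[OF finite_V] p(3) by (intro sum_mono2) auto
    finally show "(\<Sum>i<?n. (?d (p i) (p (Suc i)))\<^sup>2) \<le> (\<Sum>(u, v)\<in>wedges V c. (?d u v)\<^sup>2)" .
  qed (auto intro: sum_nonneg)
  finally show ?thesis by simp
qed

end

section \<open>The Poincare inequality\<close>

definition bep_energy :: "'a set \<Rightarrow> ('a \<Rightarrow> 'a \<Rightarrow> real) \<Rightarrow> ('a \<Rightarrow> real) \<Rightarrow> (('a \<Rightarrow> real) \<Rightarrow> real) \<Rightarrow> real" where
  "bep_energy V c \<alpha> f =
     1 / 2 * (\<Sum>x\<in>V. \<Sum>y\<in>V. c x y * (\<integral>\<zeta>. \<zeta> x * \<zeta> y * (diff_deriv x y f \<zeta>)\<^sup>2 \<partial>dirichlet V \<alpha>))"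

lemma alpha_min_properties:
  assumes "finite V" "V \<noteq> {}" "\<forall>x\<in>V. 0 < \<alpha> x"
  shows "0 < alpha_min V \<alpha>" "x \<in> V \<Longrightarrow> alpha_min V \<alpha> \<le> \<alpha> x"
    "0 < alpha_ratio V \<alpha>" "x \<in> V \<Longrightarrow> alpha_ratio V \<alpha> \<le> alpha_min V \<alpha> / \<alpha> x"
proof -
  have "alpha_min V \<alpha> \<in> \<alpha> ` V" "Max (\<alpha> ` V) \<in> \<alpha> ` V"
    unfolding alpha_min_def using assms by auto
  then have "\<forall>m\<in>{alpha_min V \<alpha>, Max (\<alpha> ` V)}. 0 < m"
    using assms(3) by auto
  then have 1: "0 < alpha_min V \<alpha>" and 2: "0 < Max (\<alpha> ` V)" by simp_all
  then show "0 < alpha_min V \<alpha>" "0 < alpha_ratio V \<alpha>"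
    unfolding alpha_ratio_def by simp_all
  show "x \<in> V \<Longrightarrow> alpha_min V \<alpha> \<le> \<alpha> x" using assms by (simp add: alpha_min_def)
  show "alpha_ratio V \<alpha> \<le> alpha_min V \<alpha> / \<alpha> x" if "x \<in> V"
  proof -
    have "\<alpha> x \<le> Max (\<alpha> ` V)" using assms that by simp
    then show ?thesis unfolding alpha_ratio_def
      using 1 2 assms(3) that by (intro divide_left_mono mult_pos_pos) auto
  qed
qed

text \<open>
  With \<open>\<beta> = alpha_min / 2\<close> the exchanged part of a site has at least the proportion \<open>alpha_ratio / 2\<close> and at
  most one half of its weight. The variance is bounded by exchanges between all pairs of sites, these
  by exchanges along the edges of paths, and these by the energy.
\<close>

theorem bep_poincare:
  assumes graph: "connected_weighted_graph V c" and \<alpha>: "\<forall>x\<in>V. 0 < \<alpha> x"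
    and f: "polynomial_on V f" and mean0: "(\<integral>\<zeta>. f \<zeta> \<partial>dirichlet V \<alpha>) = 0"
  shows "alpha_ratio V \<alpha> * alpha_min V \<alpha> * c_min V c * (\<integral>\<zeta>. (f \<zeta>)\<^sup>2 \<partial>dirichlet V \<alpha>) \<le>
    4 * (real (card V))\<^sup>2 * real (graph_diam V c) * bep_energy V c \<alpha> f"
proof -
  have V: "finite V" "V \<noteq> {}" "2 \<le> card V" using graph by (auto simp: connected_weighted_graph_def)
  note am = alpha_min_properties[OF V(1,2) \<alpha>]
  note cm = c_min_properties[OF graph]
  define \<beta> where "\<beta> = alpha_min V \<alpha> / 2"
  interpret split_sites V \<alpha> \<beta>
    using V \<alpha> am(1,2) by unfold_locales (force simp: \<beta>_def)+
  let ?d = "swap_dist f" and ?e = "\<lambda>x y. mean (\<lambda>\<zeta>. \<zeta> x * \<zeta> y * (diff_deriv x y f \<zeta>)\<^sup>2)"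
  let ?N = "real (card V)" and ?D = "real (graph_diam V c)"
  have e0: "0 \<le> ?e x y" if "x \<in> V" "y \<in> V" for x y
    using that f by (intro G.E_nonneg) (auto intro!: poly_intros polynomial_on_diff_deriv)
  have c0: "0 \<le> c x y" if "x \<in> V" "y \<in> V" for x y
    using that graph by (auto simp: connected_weighted_graph_def)
  define S where "S = (\<Sum>(u, v)\<in>wedges V c. (?d u v)\<^sup>2)"
  have S0: "0 \<le> S" unfolding S_def by (auto intro: sum_nonneg)
  have edge: "alpha_min V \<alpha> * c_min V c * (?d u v)\<^sup>2 \<le> c u v * ?e u v" if uv: "(u, v) \<in> wedges V c" for u v
  proof -
    have in_V: "u \<in> V" "v \<in> V" "u \<noteq> v" using uv graph by (auto simp: wedges_def connected_weighted_graph_def)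
    have pos: "0 < \<alpha> u" "0 < \<alpha> v" using \<alpha> in_V by auto
    have "alpha_min V \<alpha> * (alpha_min V \<alpha> / (\<alpha> u * \<alpha> v)) \<le> 1"
      using am(1) am(2)[OF in_V(1)] am(2)[OF in_V(2)] pos by (simp add: mult_mono)
    then have "alpha_min V \<alpha> * (2 * \<beta> / (\<alpha> u * \<alpha> v)) * ?e u v \<le> 1 * ?e u v"
      using e0[OF in_V(1,2)] by (intro mult_right_mono) (auto simp: \<beta>_def)
    moreover have "alpha_min V \<alpha> * (?d u v)\<^sup>2 \<le> alpha_min V \<alpha> * (2 * \<beta> / (\<alpha> u * \<alpha> v) * ?e u v)"
      using swap_dist_edge[OF in_V f] am(1) by (intro mult_left_mono) auto
    ultimately have "alpha_min V \<alpha> * (?d u v)\<^sup>2 \<le> ?e u v" by (simp add: mult.assoc)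
    then have "c_min V c * (alpha_min V \<alpha> * (?d u v)\<^sup>2) \<le> c u v * ?e u v"
      using cm(1) cm(2)[OF uv] am(1) by (intro mult_mono) auto
    then show ?thesis by (simp add: mult_ac)
  qed
  have "alpha_min V \<alpha> * c_min V c * S \<le> (\<Sum>(u, v)\<in>wedges V c. c u v * ?e u v)"
    unfolding S_def sum_distrib_left using edge by (intro sum_mono) auto
  also have "\<dots> \<le> (\<Sum>(u, v)\<in>V \<times> V. c u v * ?e u v)"
    using V(1) e0 c0 by (intro sum_mono2) (auto simp: wedges_def)
  also have "\<dots> = 2 * bep_energy V c \<alpha> f"
    by (simp add: bep_energy_def sum.cartesian_product mean_def)
  finally have S: "alpha_min V \<alpha> * c_min V c * S \<le> 2 * bep_energy V c \<alpha> f" .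
  have "4 * (alpha_ratio V \<alpha> / 2) * mean (\<lambda>\<zeta>. (f \<zeta>)\<^sup>2) \<le> (\<Sum>(x, y)\<in>site_pairs. (?d x y)\<^sup>2)"
  proof (rule complete_graph_poincare[OF f _ V(3)])
    show "mean f = 0" using mean0 by (simp add: mean_def)
    show "alpha_ratio V \<alpha> / 2 \<le> \<beta> / \<alpha> w" "\<beta> / \<alpha> w \<le> 1 / 2" if "w \<in> V" for w
      using am(2,4)[OF that] \<alpha> that by (auto simp: \<beta>_def)
  qed
  also have "\<dots> \<le> (\<Sum>(x, y)\<in>site_pairs. 4 * ?D * S)"
    using swap_dist_path[OF graph f] by (intro sum_mono) (auto simp: S_def)
  also have "\<dots> = real (card site_pairs) * (4 * ?D * S)" by (simp add: case_prod_unfold)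
  also have "\<dots> \<le> ?N\<^sup>2 * (4 * ?D * S)"
  proof (rule mult_right_mono)
    have "card site_pairs \<le> card (V \<times> V)" using V(1) by (intro card_mono) auto
    then show "real (card site_pairs) \<le> ?N\<^sup>2"
      by (simp add: card_cartesian_product power2_eq_square flip: of_nat_mult)
  qed (use S0 in simp)
  finally have "alpha_ratio V \<alpha> * mean (\<lambda>\<zeta>. (f \<zeta>)\<^sup>2) \<le> ?N\<^sup>2 * (2 * ?D * S)"
    by (simp add: mult_ac)
  then have "alpha_min V \<alpha> * c_min V c * (alpha_ratio V \<alpha> * mean (\<lambda>\<zeta>. (f \<zeta>)\<^sup>2)) \<le>
      alpha_min V \<alpha> * c_min V c * (?N\<^sup>2 * (2 * ?D * S))"
    using am(1) cm(1) by (intro mult_left_mono) auto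
  also have "\<dots> = ?N\<^sup>2 * (2 * ?D) * (alpha_min V \<alpha> * c_min V c * S)" by simp
  also have "\<dots> \<le> ?N\<^sup>2 * (2 * ?D) * (2 * bep_energy V c \<alpha> f)"
    using S by (intro mult_left_mono) auto
  finally show ?thesis by (simp add: mean_def mult_ac)
qed

section \<open>The filtration by degree\<close>

text \<open>
  Polynomials of degree at most \<open>n\<close>. Building them up by one coordinate at a time makes
  both their finite dimension and their invariance under the generator simple inductions.
\<close>

inductive poly_deg :: "'a set \<Rightarrow> nat \<Rightarrow> (('a \<Rightarrow> real) \<Rightarrow> real) \<Rightarrow> bool" for V where
  const: "poly_deg V n (\<lambda>z. a)"
| add: "poly_deg V n p \<Longrightarrow> poly_deg V n q \<Longrightarrow> poly_deg V n (\<lambda>z. p z + q z)"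
| coord_mult: "x \<in> V \<Longrightarrow> poly_deg V n p \<Longrightarrow> poly_deg V (Suc n) (\<lambda>z. z x * p z)"

lemma poly_deg_polynomial_on: "poly_deg V n p \<Longrightarrow> polynomial_on V p"
  by (induction rule: poly_deg.induct) (auto intro: poly_intros)

lemma poly_deg_Suc: "poly_deg V n p \<Longrightarrow> poly_deg V (Suc n) p"
  by (induction rule: poly_deg.induct) (auto intro: poly_deg.intros)

lemma poly_deg_mono: "poly_deg V m p \<Longrightarrow> m \<le> n \<Longrightarrow> poly_deg V n p"
  by (induction n) (auto intro: poly_deg_Suc elim: le_SucE)

lemma poly_deg_cmult: "poly_deg V n p \<Longrightarrow> poly_deg V n (\<lambda>z. b * p z)"
proof (induction rule: poly_deg.induct)
  case (coord_mult x n p)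
  then show ?case using poly_deg.coord_mult[OF coord_mult(1,3)] by (simp add: mult.left_commute)
qed (auto intro: poly_deg.intros simp: distrib_left)

lemma poly_deg_sum:
  assumes "\<And>j. j \<in> J \<Longrightarrow> poly_deg V n (p j)"
  shows "poly_deg V n (\<lambda>z. \<Sum>j\<in>J. p j z)"
proof (cases "finite J")
  case True
  then show ?thesis using assms by (induction J) (auto intro: poly_deg.intros)
qed (auto intro: poly_deg.intros)

lemma poly_deg_diff: "poly_deg V n p \<Longrightarrow> poly_deg V n q \<Longrightarrow> poly_deg V n (\<lambda>z. p z - q z)"
  using poly_deg.add[OF _ poly_deg_cmult[of V n q "-1"]] by simp

lemma poly_deg_mult:
  assumes "poly_deg V m p" "poly_deg V n q"
  shows "poly_deg V (m + n) (\<lambda>z. p z * q z)"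
  using assms(1)
proof induction
  case (const m a)
  show ?case by (rule poly_deg_mono[OF poly_deg_cmult[OF assms(2)]]) simp
next
  case (add m p q)
  then show ?case by (simp add: distrib_right poly_deg.add)
next
  case (coord_mult x m p)
  then show ?case using poly_deg.coord_mult[OF coord_mult(1,3)] by (simp add: mult.assoc)
qed

lemma polynomial_on_poly_deg: "polynomial_on V p \<Longrightarrow> \<exists>n. poly_deg V n p"
proof (induction rule: polynomial_on.induct)
  case (coord x)
  show ?case using poly_deg.coord_mult[OF coord poly_deg.const[of V 0 1]] by auto
next
  case (add f g)
  then obtain m n where "poly_deg V m f" "poly_deg V n g" by blast
  then have "poly_deg V (max m n) f" "poly_deg V (max m n) g" by (auto intro: poly_deg_mono)
  then show ?case by (blast intro: poly_deg.add)
next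
  case (mult f g)
  then show ?case by (blast intro: poly_deg_mult)
qed (auto intro: poly_deg.intros)

text \<open>
  The coordinate restores the degree that the derivative takes away.
\<close>

lemma poly_deg_coord_deriv:
  assumes "poly_deg V n p" "i \<in> V"
  shows "poly_deg V n (\<lambda>z. z i * diff_deriv x y p z)"
  using assms(1)
proof induction
  case (const n a)
  show ?case by (simp add: poly_deg.const)
next
  case (add n p q)
  then show ?case
    using diff_deriv_add[OF add(1,2)[THEN poly_deg_polynomial_on], of x y]
    by (simp add: distrib_left poly_deg.add)
next
  case (coord_mult w n p)
  let ?k = "(if x = w then 1 else 0) - (if y = w then 1 else 0) :: real"
  have eq: "(\<lambda>z. z i * diff_deriv x y (\<lambda>z. z w * p z) z) =
      (\<lambda>z. ?k * (z i * p z) + z w * (z i * diff_deriv x y p z))"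
    unfolding diff_deriv_mult[OF polynomial_on.coord[OF coord_mult(1)] poly_deg_polynomial_on[OF coord_mult(2)]]
      diff_deriv_coord
    by (simp only: algebra_simps)
  show ?case
    unfolding eq by (intro poly_deg.add poly_deg_cmult poly_deg.coord_mult coord_mult assms(2))
qed

lemma poly_deg_coord_deriv2:
  assumes "poly_deg V n p" "i \<in> V" "j \<in> V"
  shows "poly_deg V n (\<lambda>z. z i * z j * diff_deriv x y (diff_deriv x y p) z)"
  using assms(1)
proof induction
  case (const n a)
  show ?case by (simp add: poly_deg.const)
next
  case (add n p q)
  have P: "polynomial_on V p" "polynomial_on V q" using add by (auto dest: poly_deg_polynomial_on)
  show ?case
    using add diff_deriv_add[OF P, of x y]
      diff_deriv_add[OF polynomial_on_diff_deriv[OF P(1)] polynomial_on_diff_deriv[OF P(2)], of x y]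
    by (simp add: distrib_left poly_deg.add)
next
  case (coord_mult w n p)
  let ?k = "(if x = w then 1 else 0) - (if y = w then 1 else 0) :: real"
  have p: "polynomial_on V p" and w: "polynomial_on V (\<lambda>z. z w)"
    using coord_mult by (auto dest: poly_deg_polynomial_on intro: poly_intros)
  have D1: "diff_deriv x y (\<lambda>z. z w * p z) = (\<lambda>z. ?k * p z + z w * diff_deriv x y p z)"
    using diff_deriv_mult[OF w p, of x y] by (simp add: diff_deriv_coord)
  have "diff_deriv x y (diff_deriv x y (\<lambda>z. z w * p z)) =
      (\<lambda>z. ?k * diff_deriv x y p z + (?k * diff_deriv x y p z + z w * diff_deriv x y (diff_deriv x y p) z))"
    unfolding D1 diff_deriv_add[OF polynomial_on_cmult[OF p] polynomial_on.mult[OF w polynomial_on_diff_deriv[OF p]]]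
      diff_deriv_cmult[OF p] diff_deriv_mult[OF w polynomial_on_diff_deriv[OF p]]
    by (simp add: diff_deriv_coord)
  then have D2: "diff_deriv x y (diff_deriv x y (\<lambda>z. z w * p z)) z =
      ?k * diff_deriv x y p z + (?k * diff_deriv x y p z + z w * diff_deriv x y (diff_deriv x y p) z)" for z
    by (rule fun_cong)
  have eq: "(\<lambda>z. z i * z j * diff_deriv x y (diff_deriv x y (\<lambda>z. z w * p z)) z) =
      (\<lambda>z. (2 * ?k) * (z i * (z j * diff_deriv x y p z)) + z w * (z i * z j * diff_deriv x y (diff_deriv x y p) z))"
  proof
    fix z :: "'a \<Rightarrow> real"
    have "a * b * (k * d + (k * d + e)) = (2 * k) * (a * (b * d)) + a * b * e" for a b k d e :: real
      by (simp add: algebra_simps)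
    then show "z i * z j * diff_deriv x y (diff_deriv x y (\<lambda>z. z w * p z)) z =
        (2 * ?k) * (z i * (z j * diff_deriv x y p z)) + z w * (z i * z j * diff_deriv x y (diff_deriv x y p) z)"
      unfolding D2 by (simp only: mult_ac)
  qed
  show ?case
    unfolding eq by (intro poly_deg.add poly_deg_cmult poly_deg.coord_mult coord_mult assms(2)
        poly_deg_coord_deriv[OF coord_mult(2) assms(3)])
qed

lemma poly_deg_bep_generator:
  assumes "poly_deg V n p"
  shows "poly_deg V n (bep_generator V c \<alpha> p)"
proof -
  have eq: "bep_generator V c \<alpha> p = (\<lambda>\<zeta>. 1 / 2 * (\<Sum>x\<in>V. \<Sum>y\<in>V. c x y *
      ((- \<alpha> y) * (\<zeta> x * diff_deriv x y p \<zeta>) + (\<alpha> x * (\<zeta> y * diff_deriv x y p \<zeta>) +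
       \<zeta> x * \<zeta> y * diff_deriv x y (diff_deriv x y p) \<zeta>))))"
    unfolding bep_generator_def[abs_def]
    by (intro ext arg_cong2[where f = "(*)"] refl sum.cong) (simp add: algebra_simps)
  show ?thesis
    unfolding eq
    by (intro poly_deg_cmult poly_deg_sum poly_deg.add poly_deg_coord_deriv poly_deg_coord_deriv2 assms)
qed

text \<open>
  \<open>S\<close> is contained in the linear span of \<open>G\<close>, in the form of an induction principle.
\<close>

definition linearly_generates :: "(('a \<Rightarrow> real) \<Rightarrow> real) set \<Rightarrow> ((('a \<Rightarrow> real) \<Rightarrow> real) \<Rightarrow> bool) \<Rightarrow> bool" where
  "linearly_generates G S \<longleftrightarrow>
    (\<forall>Q. (\<forall>g\<in>G. Q g) \<longrightarrow> (\<forall>p q. Q p \<longrightarrow> Q q \<longrightarrow> Q (\<lambda>z. p z + q z)) \<longrightarrow>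
      (\<forall>p b. Q p \<longrightarrow> Q (\<lambda>z. b * p z)) \<longrightarrow> (\<forall>p. S p \<longrightarrow> Q p))"

lemma linearly_generates_induct [consumes 2, case_names generator add cmult]:
  assumes "linearly_generates G S" "S p"
    and "\<And>g. g \<in> G \<Longrightarrow> Q g"
    and "\<And>p q. Q p \<Longrightarrow> Q q \<Longrightarrow> Q (\<lambda>z. p z + q z)"
    and "\<And>p b. Q p \<Longrightarrow> Q (\<lambda>z. b * p z)"
  shows "Q p"
  using assms(1)[unfolded linearly_generates_def, THEN spec, of Q] assms(2-) by blast

lemma poly_deg_finitely_generated:
  assumes "finite V"
  shows "\<exists>G. finite G \<and> (\<forall>g\<in>G. poly_deg V n g) \<and> linearly_generates G (poly_deg V n)"
proof (induction n)
  case 0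
  have "Q p" if Q: "Q (\<lambda>z. 1)" "\<And>p q. Q p \<Longrightarrow> Q q \<Longrightarrow> Q (\<lambda>z. p z + q z)"
    "\<And>p b. Q p \<Longrightarrow> Q (\<lambda>z. b * p z)" and p: "poly_deg V n p" "n = 0" for Q n and p :: "('a \<Rightarrow> real) \<Rightarrow> real"
    using p
  proof induction
    case (const n a)
    then show ?case using Q(3)[OF Q(1), of a] by simp
  qed (auto intro: Q)
  then have "linearly_generates {\<lambda>z. 1} (poly_deg V 0)"
    unfolding linearly_generates_def by blast
  then show ?case
    by (intro exI[of _ "{\<lambda>z. 1}"] conjI ballI) (simp_all add: poly_deg.const)
next
  case (Suc n)
  then obtain G where G: "finite G" "\<forall>g\<in>G. poly_deg V n g"
    and gen: "linearly_generates G (poly_deg V n)"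
    by blast
  define H where "H = insert (\<lambda>z. 1) ((\<lambda>(x, g) z. z x * g z) ` (V \<times> G))"
  have H: "finite H" "\<And>h. h \<in> H \<Longrightarrow> poly_deg V (Suc n) h"
    using G assms by (auto simp: H_def intro: poly_deg.intros)
  have "linearly_generates H (poly_deg V (Suc n))"
    unfolding linearly_generates_def
  proof (rule allI, rule impI, rule impI, rule impI)
    fix Q :: "(('a \<Rightarrow> real) \<Rightarrow> real) \<Rightarrow> bool"
    assume Q_H: "\<forall>g\<in>H. Q g" and Q_add: "\<forall>p q. Q p \<longrightarrow> Q q \<longrightarrow> Q (\<lambda>z. p z + q z)"
      and Q_cmult: "\<forall>p b. Q p \<longrightarrow> Q (\<lambda>z. b * p z)"
    have "m = Suc n \<longrightarrow> Q p" if "poly_deg V m p" for m p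
      using that
    proof induction
      case (const m a)
      have "Q (\<lambda>z. a * 1)" by (rule Q_cmult[rule_format]) (use Q_H in \<open>simp add: H_def\<close>)
      then show ?case by simp
    next
      case (add m p q)
      then show ?case using Q_add by blast
    next
      case (coord_mult x k p)
      show ?case
      proof
        assume "Suc k = Suc n"
        then have p: "poly_deg V n p" using coord_mult by simp
        show "Q (\<lambda>z. z x * p z)"
        proof (rule linearly_generates_induct[where G = G and S = "poly_deg V n" and p = p and
            Q = "\<lambda>p. Q (\<lambda>z. z x * p z)"], rule gen, rule p)
          show "Q (\<lambda>z. z x * g z)" if "g \<in> G" for g
            using that coord_mult(1) by (intro Q_H[rule_format]) (auto simp: H_def)
          show "Q (\<lambda>z. z x * (p z + q z))" if "Q (\<lambda>z. z x * p z)" "Q (\<lambda>z. z x * q z)" for p q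
            using Q_add[rule_format, OF that] by (simp add: distrib_left)
          show "Q (\<lambda>z. z x * (b * p z))" if "Q (\<lambda>z. z x * p z)" for b p
            using Q_cmult[rule_format, OF that, of b] by (simp add: mult.left_commute)
        qed
      qed
    qed
    then show "\<forall>p. poly_deg V (Suc n) p \<longrightarrow> Q p" by simp
  qed
  then show ?case using H by (intro exI[of _ H] conjI ballI)
qed

context dirichlet_moments
begin

lemma E_null_mult:
  assumes "polynomial_on I p" "polynomial_on I q" "E (\<lambda>z. (p z)\<^sup>2) = 0"
  shows "E (\<lambda>z. p z * q z) = 0"
  using Cauchy_Schwarz[OF assms(1,2)] assms(3) by simp

lemma nrm_cmult: "polynomial_on I p \<Longrightarrow> nrm (\<lambda>z. b * p z) = \<bar>b\<bar> * nrm p"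
  by (simp add: nrm_def power_mult_distrib E_cmult polynomial_on_power real_sqrt_mult)

lemma nrm_sum_le:
  assumes "finite J" "\<And>j. j \<in> J \<Longrightarrow> polynomial_on I (p j)"
  shows "nrm (\<lambda>z. \<Sum>j\<in>J. p j z) \<le> (\<Sum>j\<in>J. nrm (p j))"
  using assms
proof (induction J)
  case empty
  show ?case by (simp add: nrm_def)
next
  case (insert j J)
  then show ?case
    using nrm_triangle[of "p j" "\<lambda>z. \<Sum>j\<in>J. p j z"] by (simp add: polynomial_on_sum)
qed

text \<open>Gram--Schmidt; vectors of norm zero are discarded.\<close>

lemma finite_orthonormal_basis:
  assumes "finite G" "\<And>g. g \<in> G \<Longrightarrow> poly_deg I n g"
  shows "\<exists>U. finite U \<and> (\<forall>u\<in>U. poly_deg I n u) \<and> (\<forall>u\<in>U. \<forall>v\<in>U. E (\<lambda>z. u z * v z) = (if u = v then 1 else 0)) \<and>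
    (\<forall>g\<in>G. E (\<lambda>z. (g z - (\<Sum>u\<in>U. E (\<lambda>z. g z * u z) * u z))\<^sup>2) = 0)"
  using assms
proof (induction G)
  case empty
  show ?case by (intro exI[of _ "{}"]) simp
next
  case (insert e G)
  have "\<exists>U. finite U \<and> (\<forall>u\<in>U. poly_deg I n u) \<and> (\<forall>u\<in>U. \<forall>v\<in>U. E (\<lambda>z. u z * v z) = (if u = v then 1 else 0)) \<and>
    (\<forall>g\<in>G. E (\<lambda>z. (g z - (\<Sum>u\<in>U. E (\<lambda>z. g z * u z) * u z))\<^sup>2) = 0)"
    by (rule insert.IH) (use insert.prems in simp)
  then obtain U where U': "finite U" "\<forall>u\<in>U. poly_deg I n u"
    "\<forall>u\<in>U. \<forall>v\<in>U. E (\<lambda>z. u z * v z) = (if u = v then 1 else 0)"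
    "\<forall>g\<in>G. E (\<lambda>z. (g z - (\<Sum>u\<in>U. E (\<lambda>z. g z * u z) * u z))\<^sup>2) = 0"
    by (elim exE conjE) (rule that; assumption)
  note U = U'(1) U'(2)[rule_format] and on = U'(3)[rule_format] and null = U'(4)[rule_format]
  have Up: "u \<in> U \<Longrightarrow> polynomial_on I u" for u using U(2) by (rule poly_deg_polynomial_on)
  define proj where "proj g = (\<lambda>z. \<Sum>u\<in>U. E (\<lambda>z. g z * u z) * u z)" for g
  have projp: "poly_deg I n (proj g)" for g
    unfolding proj_def by (intro poly_deg_sum poly_deg_cmult U)
  have proj_E: "E (\<lambda>z. proj g z * w z) = (\<Sum>u\<in>U. E (\<lambda>z. g z * u z) * E (\<lambda>z. u z * w z))" if w: "polynomial_on I w" for g w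
  proof -
    have "E (\<lambda>z. proj g z * w z) = E (\<lambda>z. \<Sum>u\<in>U. E (\<lambda>z. g z * u z) * (u z * w z))"
      by (simp add: proj_def sum_distrib_right mult.assoc)
    also have "\<dots> = (\<Sum>u\<in>U. E (\<lambda>z. E (\<lambda>z. g z * u z) * (u z * w z)))"
      by (intro E_sum polynomial_on_cmult polynomial_on.mult Up w)
    also have "\<dots> = (\<Sum>u\<in>U. E (\<lambda>z. g z * u z) * E (\<lambda>z. u z * w z))"
      by (intro sum.cong refl E_cmult polynomial_on.mult Up w)
    finally show ?thesis .
  qed
  have ep: "poly_deg I n e" using insert.prems by simp
  define r where "r = (\<lambda>z. e z - proj e z)"
  have rp: "poly_deg I n r" unfolding r_def by (intro poly_deg_diff ep projp)
  have r_orth: "E (\<lambda>z. r z * u z) = 0" if "u \<in> U" for u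
  proof -
    have "E (\<lambda>z. r z * u z) = E (\<lambda>z. e z * u z - proj e z * u z)" by (simp add: r_def left_diff_distrib)
    also have "\<dots> = E (\<lambda>z. e z * u z) - E (\<lambda>z. proj e z * u z)"
      by (intro E_diff polynomial_on.mult Up that poly_deg_polynomial_on[OF ep] poly_deg_polynomial_on[OF projp])
    also have "E (\<lambda>z. proj e z * u z) = (\<Sum>v\<in>U. E (\<lambda>z. e z * v z) * (if v = u then 1 else 0))"
      unfolding proj_E[OF Up[OF that]] using on that by (intro sum.cong) auto
    also have "\<dots> = E (\<lambda>z. e z * u z)" using U(1) that by (simp add: if_distrib cong: if_cong)
    finally show ?thesis by simp
  qed
  show ?case
  proof (cases "E (\<lambda>z. (r z)\<^sup>2) = 0")
    case True
    then show ?thesis using U on null by (intro exI[of _ U]) (auto simp: r_def proj_def)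
  next
    case False
    then have pos: "0 < E (\<lambda>z. (r z)\<^sup>2)"
      using E_sq_nonneg[OF poly_deg_polynomial_on[OF rp]] by simp
    define s where "s = nrm r"
    have s: "s > 0" "s\<^sup>2 = E (\<lambda>z. (r z)\<^sup>2)" using pos by (auto simp: s_def nrm_def)
    define w where "w = (\<lambda>z. 1 / s * r z)"
    have wp: "poly_deg I n w" unfolding w_def by (rule poly_deg_cmult[OF rp])
    note rpol = poly_deg_polynomial_on[OF rp] and wpol = poly_deg_polynomial_on[OF wp]
    have ww: "E (\<lambda>z. w z * w z) = 1"
    proof -
      have "E (\<lambda>z. w z * w z) = E (\<lambda>z. (1 / s)\<^sup>2 * (r z)\<^sup>2)" by (simp add: w_def power2_eq_square)
      also have "\<dots> = (1 / s)\<^sup>2 * s\<^sup>2" using rpol by (simp only: E_cmult polynomial_on_power s(2))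
      finally show ?thesis using s(1) by (simp add: power_divide)
    qed
    have wu: "E (\<lambda>z. w z * u z) = 0" if "u \<in> U" for u
      using r_orth[OF that] E_cmult[OF polynomial_on.mult[OF rpol Up[OF that]], of "1 / s"]
      by (simp add: w_def mult.assoc)
    have uw: "E (\<lambda>z. u z * w z) = 0" if "u \<in> U" for u
      using wu[OF that] by (simp only: mult.commute)
    have wU: "w \<notin> U" using wu ww by auto
    have gw: "E (\<lambda>z. g z * w z) = 0" if "g \<in> G" for g
    proof -
      have gp: "polynomial_on I g" using insert.prems that by (auto dest: poly_deg_polynomial_on)
      have "0 = E (\<lambda>z. (g z - proj g z) * w z)"
        by (rule E_null_mult[symmetric]) (use null[OF that] gp wpol poly_deg_polynomial_on[OF projp] in \<open>auto simp: proj_def intro: polynomial_on_diff\<close>)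
      also have "\<dots> = E (\<lambda>z. g z * w z - proj g z * w z)" by (simp add: left_diff_distrib)
      also have "\<dots> = E (\<lambda>z. g z * w z) - E (\<lambda>z. proj g z * w z)"
        by (intro E_diff polynomial_on.mult gp wpol poly_deg_polynomial_on[OF projp])
      also have "E (\<lambda>z. proj g z * w z) = 0"
        unfolding proj_E[OF wpol] using uw by simp
      finally show ?thesis by simp
    qed
    have ew: "E (\<lambda>z. e z * w z) = s"
    proof -
      have "E (\<lambda>z. e z * w z) = E (\<lambda>z. r z * w z + proj e z * w z)" by (simp add: r_def algebra_simps)
      also have "\<dots> = E (\<lambda>z. r z * w z) + E (\<lambda>z. proj e z * w z)"
        by (intro E_add polynomial_on.mult rpol wpol poly_deg_polynomial_on[OF projp])
      also have "E (\<lambda>z. proj e z * w z) = 0"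
        unfolding proj_E[OF wpol] using uw by simp
      also have "E (\<lambda>z. r z * w z) = E (\<lambda>z. 1 / s * (r z)\<^sup>2)"
        by (simp add: w_def power2_eq_square mult_ac)
      also have "\<dots> = s"
        unfolding E_cmult[OF polynomial_on_power[OF rpol]] s(2)[symmetric] using s(1) by (simp add: power2_eq_square)
      finally show ?thesis by simp
    qed
    show ?thesis
    proof (intro exI[of _ "insert w U"] conjI ballI)
      fix g assume g: "g \<in> insert e G"
      have sum: "(\<Sum>u\<in>insert w U. E (\<lambda>z. g z * u z) * u z) = E (\<lambda>z. g z * w z) * w z + proj g z" for z
        using U(1) wU by (simp add: proj_def)
      show "E (\<lambda>z. (g z - (\<Sum>u\<in>insert w U. E (\<lambda>z. g z * u z) * u z))\<^sup>2) = 0"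
      proof (cases "g = e")
        case True
        have "s * w z = r z" for z using s(1) by (simp add: w_def)
        then have null_e: "e z - (s * w z + proj e z) = 0" for z by (simp add: r_def)
        show ?thesis unfolding sum unfolding True ew null_e by simp
      next
        case False
        then have "g \<in> G" using g by simp
        show ?thesis unfolding sum gw[OF \<open>g \<in> G\<close>] using null[OF \<open>g \<in> G\<close>] by (simp add: proj_def)
      qed
    next
      fix u v assume "u \<in> insert w U" "v \<in> insert w U"
      then show "E (\<lambda>z. u z * v z) = (if u = v then 1 else 0)"
        using on wu uw ww wU by (elim insertE) auto
    qed (use U wp in auto)
  qed
qed

text \<open>
  A symmetric operator that preserves the degree is bounded on each degree: it annihilates vectors
  of norm zero, and it is determined by its values on an orthonormal basis.
\<close>

lemma degree_preserving_bounded: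
  assumes A_deg: "\<And>p. poly_deg I n p \<Longrightarrow> poly_deg I n (A p)"
    and A_add: "\<And>p q. polynomial_on I p \<Longrightarrow> polynomial_on I q \<Longrightarrow> A (\<lambda>z. p z + q z) = (\<lambda>z. A p z + A q z)"
    and A_cmult: "\<And>p b. polynomial_on I p \<Longrightarrow> A (\<lambda>z. b * p z) = (\<lambda>z. b * A p z)"
    and A_sym: "\<And>p q. polynomial_on I p \<Longrightarrow> polynomial_on I q \<Longrightarrow> E (\<lambda>z. q z * A p z) = E (\<lambda>z. p z * A q z)"
  shows "\<exists>M>0. \<forall>p. poly_deg I n p \<longrightarrow> nrm (A p) \<le> M * nrm p"
proof -
  obtain G where G: "finite G" "\<And>g. g \<in> G \<Longrightarrow> poly_deg I n g"
    and gen: "linearly_generates G (poly_deg I n)"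
    using poly_deg_finitely_generated[OF finite_I, of n] by blast
  have "\<exists>U. finite U \<and> (\<forall>u\<in>U. poly_deg I n u) \<and> (\<forall>u\<in>U. \<forall>v\<in>U. E (\<lambda>z. u z * v z) = (if u = v then 1 else 0)) \<and>
    (\<forall>g\<in>G. E (\<lambda>z. (g z - (\<Sum>u\<in>U. E (\<lambda>z. g z * u z) * u z))\<^sup>2) = 0)"
    using G by (rule finite_orthonormal_basis)
  then obtain U where U': "finite U" "\<forall>u\<in>U. poly_deg I n u"
    "\<forall>u\<in>U. \<forall>v\<in>U. E (\<lambda>z. u z * v z) = (if u = v then 1 else 0)"
    "\<forall>g\<in>G. E (\<lambda>z. (g z - (\<Sum>u\<in>U. E (\<lambda>z. g z * u z) * u z))\<^sup>2) = 0"
    by (elim exE conjE) (rule that; assumption)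
  note U = U'(1) U'(2)[rule_format] and on = U'(3)[rule_format] and null = U'(4)[rule_format]
  have Up: "u \<in> U \<Longrightarrow> polynomial_on I u" for u using U(2) by (rule poly_deg_polynomial_on)
  define res where "res p = (\<lambda>z. p z - (\<Sum>u\<in>U. E (\<lambda>z. p z * u z) * u z))" for p
  have resp: "poly_deg I n (res p)" if "poly_deg I n p" for p
    unfolding res_def by (intro poly_deg_diff that poly_deg_sum poly_deg_cmult U)
  have res_null: "nrm (res p) = 0" if "poly_deg I n p" for p
  proof -
    have "poly_deg I n p \<and> nrm (res p) = 0"
    proof (rule linearly_generates_induct[where G = G and S = "poly_deg I n" and p = p and
          Q = "\<lambda>p. poly_deg I n p \<and> nrm (res p) = 0"], rule gen, rule that)
      show "poly_deg I n g \<and> nrm (res g) = 0" if "g \<in> G" for g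
        using G(2)[OF that] null[OF that] by (simp add: res_def nrm_def)
    next
      fix p q assume pq: "poly_deg I n p \<and> nrm (res p) = 0" "poly_deg I n q \<and> nrm (res q) = 0"
      then have pol: "polynomial_on I p" "polynomial_on I q" by (auto dest: poly_deg_polynomial_on)
      have "res (\<lambda>z. p z + q z) = (\<lambda>z. res p z + res q z)"
      proof
        fix z
        have "(\<Sum>u\<in>U. E (\<lambda>z. (p z + q z) * u z) * u z) =
            (\<Sum>u\<in>U. E (\<lambda>z. p z * u z) * u z + E (\<lambda>z. q z * u z) * u z)"
        proof (intro sum.cong refl)
          fix u assume "u \<in> U"
          then have "E (\<lambda>z. (p z + q z) * u z) = E (\<lambda>z. p z * u z) + E (\<lambda>z. q z * u z)"
            unfolding distrib_right using pol Up by (intro E_add polynomial_on.mult)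
          then show "E (\<lambda>z. (p z + q z) * u z) * u z = E (\<lambda>z. p z * u z) * u z + E (\<lambda>z. q z * u z) * u z"
            by (simp add: distrib_right)
        qed
        then show "res (\<lambda>z. p z + q z) z = res p z + res q z"
          by (simp add: res_def sum.distrib)
      qed
      then have "nrm (res (\<lambda>z. p z + q z)) \<le> 0"
        using nrm_triangle[OF poly_deg_polynomial_on[OF resp] poly_deg_polynomial_on[OF resp], of p q] pq by simp
      moreover have "0 \<le> nrm (res (\<lambda>z. p z + q z))"
        using pq by (intro nrm_nonneg poly_deg_polynomial_on[OF resp] poly_deg.add) auto
      ultimately show "poly_deg I n (\<lambda>z. p z + q z) \<and> nrm (res (\<lambda>z. p z + q z)) = 0"
        using pq by (auto intro: poly_deg.add)
    next
      fix p b assume p: "poly_deg I n p \<and> nrm (res p) = 0"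
      then have pol: "polynomial_on I p" by (auto dest: poly_deg_polynomial_on)
      have "res (\<lambda>z. b * p z) = (\<lambda>z. b * res p z)"
      proof
        fix z
        have "(\<Sum>u\<in>U. E (\<lambda>z. (b * p z) * u z) * u z) = (\<Sum>u\<in>U. b * (E (\<lambda>z. p z * u z) * u z))"
        proof (intro sum.cong refl)
          fix u assume "u \<in> U"
          then have "E (\<lambda>z. (b * p z) * u z) = b * E (\<lambda>z. p z * u z)"
            unfolding mult.assoc using pol Up by (intro E_cmult polynomial_on.mult)
          then show "E (\<lambda>z. (b * p z) * u z) * u z = b * (E (\<lambda>z. p z * u z) * u z)" by simp
        qed
        then show "res (\<lambda>z. b * p z) z = b * res p z"
          by (simp add: res_def sum_distrib_left right_diff_distrib)
      qed
      then show "poly_deg I n (\<lambda>z. b * p z) \<and> nrm (res (\<lambda>z. b * p z)) = 0"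
        using p nrm_cmult[OF poly_deg_polynomial_on[OF resp]] by (auto intro: poly_deg_cmult)
    qed
    then show ?thesis by simp
  qed
  have A_pol: "polynomial_on I (A p)" if "poly_deg I n p" for p
    using A_deg[OF that] by (rule poly_deg_polynomial_on)
  have A_null: "nrm (A p) = 0" if p: "poly_deg I n p" "nrm p = 0" for p
  proof -
    have "E (\<lambda>z. (p z)\<^sup>2) = 0" using p nrm_square[OF poly_deg_polynomial_on[OF p(1)]] by simp
    then have "E (\<lambda>z. p z * A (A p) z) = 0"
      using p by (intro E_null_mult A_pol A_deg poly_deg_polynomial_on[OF p(1)])
    then have "E (\<lambda>z. A p z * A p z) = 0"
      using A_sym[OF poly_deg_polynomial_on[OF p(1)] A_pol[OF p(1)]] by simp
    then show ?thesis by (simp add: nrm_def power2_eq_square)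
  qed
  have A_sum: "A (\<lambda>z. \<Sum>u\<in>J. b u * u z) = (\<lambda>z. \<Sum>u\<in>J. b u * A u z)" if "finite J" "J \<subseteq> U" for J b
    using that
  proof (induction J)
    case empty
    show ?case using A_cmult[OF polynomial_on.const[of I 0], of 0] by simp
  next
    case (insert u J)
    then show ?case
      using A_add[of "\<lambda>z. b u * u z" "\<lambda>z. \<Sum>u\<in>J. b u * u z"] Up
      by (simp add: A_cmult polynomial_on_cmult polynomial_on_sum subset_iff)
  qed
  have "nrm (A p) \<le> (\<Sum>u\<in>U. nrm (A u)) * nrm p" if p: "poly_deg I n p" for p
  proof -
    define b where "b u = E (\<lambda>z. p z * u z)" for u
    have b: "\<bar>b u\<bar> \<le> nrm p" if "u \<in> U" for u
    proof (rule power2_le_imp_le)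
      have "(b u)\<^sup>2 \<le> E (\<lambda>z. (p z)\<^sup>2) * E (\<lambda>z. (u z)\<^sup>2)"
        unfolding b_def using p that by (intro Cauchy_Schwarz poly_deg_polynomial_on[OF p] Up)
      also have "E (\<lambda>z. (u z)\<^sup>2) = 1" using on[OF that that] by (simp add: power2_eq_square)
      finally show "\<bar>b u\<bar>\<^sup>2 \<le> (nrm p)\<^sup>2" using nrm_square[OF poly_deg_polynomial_on[OF p]] by simp
    qed (rule nrm_nonneg[OF poly_deg_polynomial_on[OF p]])
    have sp: "poly_deg I n (\<lambda>z. \<Sum>u\<in>U. b u * u z)"
      by (intro poly_deg_sum poly_deg_cmult U)
    have "A p = A (\<lambda>z. res p z + (\<Sum>u\<in>U. b u * u z))" by (simp add: res_def b_def)
    also have "\<dots> = (\<lambda>z. A (res p) z + (\<Sum>u\<in>U. b u * A u z))"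
      using A_add[OF poly_deg_polynomial_on[OF resp[OF p]] poly_deg_polynomial_on[OF sp]]
        A_sum[OF U(1) subset_refl] by simp
    finally have "nrm (A p) \<le> nrm (A (res p)) + nrm (\<lambda>z. \<Sum>u\<in>U. b u * A u z)"
      using nrm_triangle[OF A_pol[OF resp[OF p]] polynomial_on_sum[of U I "\<lambda>u z. b u * A u z"]] A_pol U(2)
      by (simp add: polynomial_on_cmult)
    also have "nrm (A (res p)) = 0" using p by (intro A_null resp res_null)
    also have "nrm (\<lambda>z. \<Sum>u\<in>U. b u * A u z) \<le> (\<Sum>u\<in>U. nrm (\<lambda>z. b u * A u z))"
      using U A_pol by (intro nrm_sum_le polynomial_on_cmult) auto
    also have "\<dots> \<le> (\<Sum>u\<in>U. nrm (A u) * nrm p)"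
    proof (intro sum_mono)
      fix u assume u: "u \<in> U"
      have "nrm (\<lambda>z. b u * A u z) = \<bar>b u\<bar> * nrm (A u)" using u U A_pol by (intro nrm_cmult) auto
      also have "\<dots> \<le> nrm p * nrm (A u)"
        using b[OF u] u U A_pol by (intro mult_right_mono nrm_nonneg) auto
      finally show "nrm (\<lambda>z. b u * A u z) \<le> nrm (A u) * nrm p" by (simp add: mult.commute)
    qed
    finally show ?thesis by (simp add: sum_distrib_right)
  qed
  moreover have "0 \<le> (\<Sum>u\<in>U. nrm (A u))"
    using U A_pol by (intro sum_nonneg nrm_nonneg) auto
  ultimately show ?thesis
    by (intro exI[of _ "(\<Sum>u\<in>U. nrm (A u)) + 1"])
      (auto simp: distrib_right intro!: add_increasing2 nrm_nonneg poly_deg_polynomial_on)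
qed

text \<open>
  Richardson iteration: the residual of the equation \<open>A p = q\<close> is multiplied by \<open>1 - A\<^sup>2 / M\<^sup>2\<close>, which
  is a strict contraction because \<open>A\<close> is symmetric and bounded from both sides.
\<close>

lemma degree_preserving_dense_range:
  assumes A_deg: "\<And>n p. poly_deg I n p \<Longrightarrow> poly_deg I n (A p)"
    and A_add: "\<And>p q. polynomial_on I p \<Longrightarrow> polynomial_on I q \<Longrightarrow> A (\<lambda>z. p z + q z) = (\<lambda>z. A p z + A q z)"
    and A_cmult: "\<And>p b. polynomial_on I p \<Longrightarrow> A (\<lambda>z. b * p z) = (\<lambda>z. b * A p z)"
    and A_sym: "\<And>p q. polynomial_on I p \<Longrightarrow> polynomial_on I q \<Longrightarrow> E (\<lambda>z. q z * A p z) = E (\<lambda>z. p z * A q z)"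
    and below: "0 < e" "\<And>p. polynomial_on I p \<Longrightarrow> e * nrm p \<le> nrm (A p)"
    and q: "polynomial_on I q" and d: "0 < d"
  shows "\<exists>p. polynomial_on I p \<and> nrm (\<lambda>z. A p z - q z) < d"
proof -
  obtain n where qn: "poly_deg I n q" using polynomial_on_poly_deg[OF q] by blast
  obtain M where M: "M > 0" "\<And>p. poly_deg I n p \<Longrightarrow> nrm (A p) \<le> M * nrm p"
    using degree_preserving_bounded[of n A, OF A_deg A_add A_cmult A_sym] by blast
  define t where "t = 1 / M\<^sup>2"
  have t: "t > 0" using M by (simp add: t_def)
  have A_pol: "polynomial_on I (A p)" if "poly_deg I n p" for p
    using A_deg[OF that] by (rule poly_deg_polynomial_on)
  have contract: "(nrm (\<lambda>z. r z - t * A (A r) z))\<^sup>2 \<le> (1 - t * e\<^sup>2) * (nrm r)\<^sup>2" if r: "poly_deg I n r" for r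
  proof -
    have pol: "polynomial_on I r" "polynomial_on I (A r)" "polynomial_on I (A (A r))"
      using r A_deg A_pol poly_deg_polynomial_on by blast+
    have pol2: "polynomial_on I (\<lambda>z. (r z)\<^sup>2)" "polynomial_on I (\<lambda>z. r z * A (A r) z)" "polynomial_on I (\<lambda>z. (A (A r) z)\<^sup>2)"
      using pol by (auto intro!: poly_intros)
    have "(nrm (\<lambda>z. r z - t * A (A r) z))\<^sup>2 = E (\<lambda>z. (r z - t * A (A r) z)\<^sup>2)"
      using pol by (intro nrm_square) (auto intro!: poly_intros)
    also have "\<dots> = E (\<lambda>z. ((r z)\<^sup>2 + t\<^sup>2 * (A (A r) z)\<^sup>2) - (2 * t) * (r z * A (A r) z))"
      by (simp add: power2_eq_square algebra_simps)
    also have "\<dots> = (E (\<lambda>z. (r z)\<^sup>2) + t\<^sup>2 * E (\<lambda>z. (A (A r) z)\<^sup>2)) - (2 * t) * E (\<lambda>z. r z * A (A r) z)"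
      using pol2 by (simp add: E_diff E_add E_cmult polynomial_on_cmult polynomial_on.add)
    also have "E (\<lambda>z. r z * A (A r) z) = (nrm (A r))\<^sup>2"
      using A_sym[OF pol(2,1)] nrm_square[OF pol(2)] by (simp add: power2_eq_square)
    also have "E (\<lambda>z. (A (A r) z)\<^sup>2) = (nrm (A (A r)))\<^sup>2" using nrm_square[OF pol(3)] by simp
    also have "E (\<lambda>z. (r z)\<^sup>2) = (nrm r)\<^sup>2" using nrm_square[OF pol(1)] by simp
    also have "(nrm r)\<^sup>2 + t\<^sup>2 * (nrm (A (A r)))\<^sup>2 - 2 * t * (nrm (A r))\<^sup>2 \<le> (nrm r)\<^sup>2 - t * (nrm (A r))\<^sup>2"
    proof -
      have "(nrm (A (A r)))\<^sup>2 \<le> (M * nrm (A r))\<^sup>2"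
        using M(2)[OF A_deg[OF r]] nrm_nonneg[OF pol(3)] by (rule power_mono)
      then have "t\<^sup>2 * (nrm (A (A r)))\<^sup>2 \<le> t\<^sup>2 * (M * nrm (A r))\<^sup>2" by (rule mult_left_mono) simp
      also have "\<dots> = t * (nrm (A r))\<^sup>2" using M by (simp add: t_def power2_eq_square field_simps)
      finally show ?thesis by simp
    qed
    also have "\<dots> \<le> (nrm r)\<^sup>2 - t * (e * nrm r)\<^sup>2"
    proof -
      have "(e * nrm r)\<^sup>2 \<le> (nrm (A r))\<^sup>2"
        using below(1) below(2)[OF pol(1)] nrm_nonneg[OF pol(1)] by (intro power_mono) auto
      then show ?thesis using t by simp
    qed
    finally show ?thesis by (simp add: algebra_simps power_mult_distrib)
  qed
  define k where "k = max (1 - t * e\<^sup>2) 0"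
  have k: "0 \<le> k" "k < 1" using t below(1) by (auto simp: k_def)
  have "\<exists>p. poly_deg I n p \<and> (nrm (\<lambda>z. q z - A p z))\<^sup>2 \<le> k ^ j * (nrm q)\<^sup>2" for j
  proof (induction j)
    case 0
    have "A (\<lambda>z. 0) = (\<lambda>z. 0)" using A_cmult[OF polynomial_on.const[of I 0], of 0] by simp
    then show ?case by (intro exI[of _ "\<lambda>z. 0"]) (auto intro: poly_deg.const)
  next
    case (Suc j)
    then obtain p where p: "poly_deg I n p" "(nrm (\<lambda>z. q z - A p z))\<^sup>2 \<le> k ^ j * (nrm q)\<^sup>2" by blast
    define r where "r = (\<lambda>z. q z - A p z)"
    have r: "poly_deg I n r" unfolding r_def by (intro poly_deg_diff qn A_deg p)
    define p' where "p' = (\<lambda>z. p z + t * A r z)"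
    have p': "poly_deg I n p'" unfolding p'_def by (intro poly_deg.add poly_deg_cmult p A_deg r)
    have "A p' = (\<lambda>z. A p z + t * A (A r) z)"
      unfolding p'_def using p r A_pol
      by (simp add: A_add A_cmult poly_deg_polynomial_on polynomial_on_cmult)
    then have "(\<lambda>z. q z - A p' z) = (\<lambda>z. r z - t * A (A r) z)" by (simp add: r_def fun_eq_iff)
    then have "(nrm (\<lambda>z. q z - A p' z))\<^sup>2 \<le> (1 - t * e\<^sup>2) * (nrm r)\<^sup>2" using contract[OF r] by simp
    also have "\<dots> \<le> k * (nrm r)\<^sup>2" by (intro mult_right_mono) (auto simp: k_def)
    also have "\<dots> \<le> k * (k ^ j * (nrm q)\<^sup>2)" using p(2) k by (intro mult_left_mono) (auto simp: r_def)
    finally show ?case using p' by (auto simp: mult.assoc)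
  qed
  moreover obtain j where "k ^ j * (nrm q)\<^sup>2 < d\<^sup>2"
  proof -
    have "(\<lambda>j. k ^ j * (nrm q)\<^sup>2) \<longlonglongrightarrow> 0 * (nrm q)\<^sup>2"
      using k by (intro tendsto_mult LIMSEQ_power_zero tendsto_const) auto
    then have "eventually (\<lambda>j. k ^ j * (nrm q)\<^sup>2 < d\<^sup>2) sequentially"
      using d by (intro order_tendstoD(2)) auto
    then show ?thesis using that by (auto simp: eventually_sequentially)
  qed
  ultimately obtain p where p: "poly_deg I n p" "(nrm (\<lambda>z. q z - A p z))\<^sup>2 < d\<^sup>2" by (meson le_less_trans)
  then have "nrm (\<lambda>z. q z - A p z) < d" using d by (simp add: power_less_imp_less_base)
  then show ?thesis
    using poly_deg_polynomial_on[OF p(1)] nrm_minus_commute[of "A p" q] by (intro exI[of _ p]) simp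
qed

end

section \<open>Square integrable functions\<close>

lemma L2_spaceD:
  assumes "f \<in> L2_space M"
  shows "f \<in> borel_measurable M" "integrable M (\<lambda>x. (f x)\<^sup>2)"
  using assms unfolding L2_space_def by simp_all

lemma L2_space_mult_integrable:
  assumes "f \<in> L2_space M" "g \<in> L2_space M"
  shows "integrable M (\<lambda>x. f x * g x)"
proof (rule Bochner_Integration.integrable_bound)
  show "integrable M (\<lambda>x. (f x)\<^sup>2 + (g x)\<^sup>2)"
    by (intro Bochner_Integration.integrable_add L2_spaceD assms)
  show "(\<lambda>x. f x * g x) \<in> borel_measurable M"
    by (intro borel_measurable_times L2_spaceD assms)
  have "\<bar>a * b\<bar> \<le> a\<^sup>2 + b\<^sup>2" for a b :: real
  proof -
    have "0 \<le> (\<bar>a\<bar> - \<bar>b\<bar>)\<^sup>2" by simp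
    then have "2 * \<bar>a * b\<bar> \<le> a\<^sup>2 + b\<^sup>2" by (simp add: power2_diff abs_mult)
    then show ?thesis using abs_ge_zero[of "a * b"] by linarith
  qed
  then show "AE x in M. norm (f x * g x) \<le> norm ((f x)\<^sup>2 + (g x)\<^sup>2)" by simp
qed

lemma L2_space_add:
  assumes "f \<in> L2_space M" "g \<in> L2_space M"
  shows "(\<lambda>x. f x + g x) \<in> L2_space M"
proof -
  have "integrable M (\<lambda>x. (f x)\<^sup>2 + (g x)\<^sup>2 + 2 * (f x * g x))"
    by (intro Bochner_Integration.integrable_add integrable_mult_right L2_space_mult_integrable L2_spaceD assms)
  then have "integrable M (\<lambda>x. (f x + g x)\<^sup>2)" by (simp add: power2_sum mult.assoc)
  moreover have "(\<lambda>x. f x + g x) \<in> borel_measurable M"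
    by (intro borel_measurable_add L2_spaceD assms)
  ultimately show ?thesis by (simp add: L2_space_def)
qed

lemma L2_space_cmult:
  assumes "f \<in> L2_space M"
  shows "(\<lambda>x. b * f x) \<in> L2_space M"
proof -
  have "integrable M (\<lambda>x. b\<^sup>2 * (f x)\<^sup>2)" by (intro integrable_mult_right L2_spaceD assms)
  then have "integrable M (\<lambda>x. (b * f x)\<^sup>2)" by (simp only: power_mult_distrib)
  moreover have "(\<lambda>x. b * f x) \<in> borel_measurable M"
    by (intro borel_measurable_times borel_measurable_const L2_spaceD assms)
  ultimately show ?thesis by (simp add: L2_space_def)
qed

lemma L2_space_diff: "f \<in> L2_space M \<Longrightarrow> g \<in> L2_space M \<Longrightarrow> (\<lambda>x. f x - g x) \<in> L2_space M"
  using L2_space_add[OF _ L2_space_cmult[of g M "-1"]] by simp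

lemma L2_norm_nonneg: "0 \<le> L2_norm M f"
  by (simp add: L2_norm_def)

lemma L2_norm_square: "(L2_norm M f)\<^sup>2 = (\<integral>x. (f x)\<^sup>2 \<partial>M)"
  by (simp add: L2_norm_def)

lemma L2_Cauchy_Schwarz:
  assumes "f \<in> L2_space M" "g \<in> L2_space M"
  shows "(\<integral>x. f x * g x \<partial>M)\<^sup>2 \<le> (\<integral>x. (f x)\<^sup>2 \<partial>M) * (\<integral>x. (g x)\<^sup>2 \<partial>M)"
proof (rule nonneg_quadratic_discriminant)
  fix s t
  have int: "integrable M (\<lambda>x. s\<^sup>2 * (f x)\<^sup>2)" "integrable M (\<lambda>x. (2 * s * t) * (f x * g x))" "integrable M (\<lambda>x. t\<^sup>2 * (g x)\<^sup>2)"
    by (intro integrable_mult_right L2_spaceD L2_space_mult_integrable assms)+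
  have "0 \<le> (\<integral>x. (s * f x + t * g x)\<^sup>2 \<partial>M)" by simp
  also have "\<dots> = (\<integral>x. s\<^sup>2 * (f x)\<^sup>2 + (2 * s * t) * (f x * g x) + t\<^sup>2 * (g x)\<^sup>2 \<partial>M)"
    by (intro Bochner_Integration.integral_cong) (simp_all add: power2_eq_square algebra_simps)
  also have "\<dots> = s\<^sup>2 * (\<integral>x. (f x)\<^sup>2 \<partial>M) + 2 * s * t * (\<integral>x. f x * g x \<partial>M) + t\<^sup>2 * (\<integral>x. (g x)\<^sup>2 \<partial>M)"
    using int by (simp only: Bochner_Integration.integral_add Bochner_Integration.integrable_add integral_mult_right_zero)
  finally show "0 \<le> s\<^sup>2 * (\<integral>x. (f x)\<^sup>2 \<partial>M) + 2 * s * t * (\<integral>x. f x * g x \<partial>M) + t\<^sup>2 * (\<integral>x. (g x)\<^sup>2 \<partial>M)" .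
qed

lemma L2_norm_triangle:
  assumes "f \<in> L2_space M" "g \<in> L2_space M"
  shows "L2_norm M (\<lambda>x. f x + g x) \<le> L2_norm M f + L2_norm M g"
proof (rule power2_le_imp_le)
  have int: "integrable M (\<lambda>x. (f x)\<^sup>2)" "integrable M (\<lambda>x. 2 * (f x * g x))" "integrable M (\<lambda>x. (g x)\<^sup>2)"
    by (intro integrable_mult_right L2_spaceD L2_space_mult_integrable assms)+
  have "(L2_norm M (\<lambda>x. f x + g x))\<^sup>2 = (\<integral>x. (f x)\<^sup>2 + 2 * (f x * g x) + (g x)\<^sup>2 \<partial>M)"
    unfolding L2_norm_square
    by (intro Bochner_Integration.integral_cong) (simp_all add: power2_eq_square algebra_simps)
  also have "\<dots> = (L2_norm M f)\<^sup>2 + 2 * (\<integral>x. f x * g x \<partial>M) + (L2_norm M g)\<^sup>2"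
    using int by (simp only: L2_norm_square Bochner_Integration.integral_add Bochner_Integration.integrable_add integral_mult_right_zero)
  also have "(\<integral>x. f x * g x \<partial>M) \<le> L2_norm M f * L2_norm M g"
    unfolding L2_norm_def real_sqrt_mult[symmetric] by (rule real_le_rsqrt[OF L2_Cauchy_Schwarz[OF assms]])
  finally show "(L2_norm M (\<lambda>x. f x + g x))\<^sup>2 \<le> (L2_norm M f + L2_norm M g)\<^sup>2"
    by (simp add: power2_sum)
qed (simp add: L2_norm_nonneg)

lemma L2_norm_cmult: "L2_norm M (\<lambda>x. b * f x) = \<bar>b\<bar> * L2_norm M f"
  by (simp add: L2_norm_def power_mult_distrib real_sqrt_mult)

lemma L2_norm_minus_commute: "L2_norm M (\<lambda>x. f x - g x) = L2_norm M (\<lambda>x. g x - f x)"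
  by (simp add: L2_norm_def power2_commute)

lemma L2_norm_diff_triangle:
  assumes "f \<in> L2_space M" "g \<in> L2_space M" "h \<in> L2_space M"
  shows "L2_norm M (\<lambda>x. f x - h x) \<le> L2_norm M (\<lambda>x. f x - g x) + L2_norm M (\<lambda>x. g x - h x)"
  using L2_norm_triangle[OF L2_space_diff[OF assms(1,2)] L2_space_diff[OF assms(2,3)]] by simp

lemma L2_norm_reverse_triangle:
  assumes "f \<in> L2_space M" "g \<in> L2_space M"
  shows "\<bar>L2_norm M f - L2_norm M g\<bar> \<le> L2_norm M (\<lambda>x. f x - g x)"
proof -
  have "L2_norm M f \<le> L2_norm M (\<lambda>x. f x - g x) + L2_norm M g"
    using L2_norm_triangle[OF L2_space_diff[OF assms] assms(2)] by simp
  moreover have "L2_norm M g \<le> L2_norm M (\<lambda>x. g x - f x) + L2_norm M f"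
    using L2_norm_triangle[OF L2_space_diff[OF assms(2,1)] assms(1)] by simp
  ultimately show ?thesis using L2_norm_minus_commute[of M f g] by linarith
qed

lemma L2_norm_tendsto:
  assumes "\<And>n. p n \<in> L2_space M" "f \<in> L2_space M" "(\<lambda>n. L2_norm M (\<lambda>x. p n x - f x)) \<longlonglongrightarrow> 0"
  shows "(\<lambda>n. L2_norm M (p n)) \<longlonglongrightarrow> L2_norm M f"
proof -
  have "(\<lambda>n. L2_norm M (p n) - L2_norm M f) \<longlonglongrightarrow> 0"
    by (rule Lim_null_comparison[OF _ assms(3)])
      (use L2_norm_reverse_triangle[OF assms(1,2)] in auto)
  then show ?thesis by (simp add: LIM_zero_iff)
qed

lemma (in prob_space) L1_le_L2_norm:
  assumes "f \<in> L2_space M"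
  shows "(\<integral>\<^sup>+x. ennreal \<bar>f x\<bar> \<partial>M) \<le> ennreal (L2_norm M f)"
proof -
  have one: "(\<lambda>x. 1) \<in> L2_space M" by (simp add: L2_space_def)
  have abs: "(\<lambda>x. \<bar>f x\<bar>) \<in> L2_space M" using L2_spaceD[OF assms] by (simp add: L2_space_def)
  have int: "integrable M (\<lambda>x. \<bar>f x\<bar>)" using L2_space_mult_integrable[OF abs one] by simp
  have "(\<integral>x. \<bar>f x\<bar> \<partial>M) \<le> L2_norm M f"
    unfolding L2_norm_def using L2_Cauchy_Schwarz[OF abs one] by (intro real_le_rsqrt) (simp add: prob_space)
  then show ?thesis using int by (subst nn_integral_eq_integral) (auto intro: ennreal_leI)
qed

text \<open>
  Completeness (Riesz--Fischer): a subsequence with summable increments converges almost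
  everywhere, and Fatou's lemma identifies its limit as the limit in norm.
\<close>

lemma (in prob_space) L2_complete:
  assumes p: "\<And>n. p n \<in> L2_space M"
    and Cauchy: "\<And>e. 0 < e \<Longrightarrow> \<exists>N. \<forall>m\<ge>N. \<forall>n\<ge>N. L2_norm M (\<lambda>x. p m x - p n x) < e"
  shows "\<exists>f\<in>L2_space M. (\<lambda>n. L2_norm M (\<lambda>x. p n x - f x)) \<longlonglongrightarrow> 0"
proof -
  have "\<exists>N. \<forall>m\<ge>N. \<forall>n\<ge>N. L2_norm M (\<lambda>x. p m x - p n x) < (1 / 2) ^ k" for k
    by (rule Cauchy) simp
  then obtain N where N: "\<And>k m n. N k \<le> m \<Longrightarrow> N k \<le> n \<Longrightarrow> L2_norm M (\<lambda>x. p m x - p n x) < (1 / 2) ^ k"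
    by metis
  define r where "r k = (\<Sum>i\<le>k. N i) + k" for k
  have r_Suc: "r k < r (Suc k)" for k by (simp add: r_def)
  have r_ge: "N k \<le> r k" for k
    using member_le_sum[of k "{..k}" N] by (simp add: r_def)
  have r_mono: "strict_mono r" using r_Suc by (rule strict_monoI_Suc)
  define u where "u k x = p (r (Suc k)) x - p (r k) x" for k x
  have u: "u k \<in> L2_space M" for k unfolding u_def[abs_def] by (intro L2_space_diff p)
  note p_meas [measurable] = L2_spaceD(1)[OF p]
  have u_meas [measurable]: "u k \<in> borel_measurable M" for k using L2_spaceD(1)[OF u] .
  have u_norm: "L2_norm M (u k) \<le> (1 / 2) ^ k" for k
    using N[of k "r (Suc k)" "r k"] r_ge[of k] r_Suc[of k] by (simp add: u_def[abs_def])
  have "(\<integral>\<^sup>+x. (\<Sum>k. ennreal \<bar>u k x\<bar>) \<partial>M) = (\<Sum>k. \<integral>\<^sup>+x. ennreal \<bar>u k x\<bar> \<partial>M)"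
    by (rule nn_integral_suminf) simp
  also have "\<dots> \<le> (\<Sum>k. ennreal ((1 / 2) ^ k))"
    by (intro suminf_le order_trans[OF L1_le_L2_norm[OF u]] ennreal_leI u_norm) auto
  also have "\<dots> = ennreal (\<Sum>k. (1 / 2) ^ k)"
    by (intro suminf_ennreal2) (auto intro: summable_geometric)
  finally have "(\<integral>\<^sup>+x. (\<Sum>k. ennreal \<bar>u k x\<bar>) \<partial>M) \<noteq> \<infinity>" by (auto simp: top_unique)
  then have "AE x in M. (\<Sum>k. ennreal \<bar>u k x\<bar>) \<noteq> \<infinity>"
    by (intro nn_integral_PInf_AE) simp
  then have conv: "AE x in M. convergent (\<lambda>k. p (r k) x)"
  proof eventually_elim
    case (elim x)
    then have "summable (\<lambda>k. \<bar>u k x\<bar>)"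
      by (intro summable_suminf_not_top) auto
    then have "summable (\<lambda>k. u k x)" by (rule summable_rabs_cancel)
    then have "convergent (\<lambda>n. p (r 0) x + (\<Sum>k<n. u k x))"
      by (auto simp: summable_iff_convergent intro: convergent_add convergent_const)
    moreover have "p (r 0) x + (\<Sum>k<n. u k x) = p (r n) x" for n
      by (induction n) (auto simp: u_def)
    ultimately show ?case by simp
  qed
  define f where "f x = lim (\<lambda>k. p (r k) x)" for x
  have f_meas [measurable]: "f \<in> borel_measurable M"
    unfolding f_def[abs_def] by (rule borel_measurable_lim_metric) simp
  have limit: "AE x in M. (\<lambda>k. p (r k) x) \<longlonglongrightarrow> f x"
    using conv by eventually_elim (simp add: f_def convergent_LIMSEQ_iff)
  have fatou: "(\<integral>\<^sup>+x. ennreal ((p n x - f x)\<^sup>2) \<partial>M) \<le> ennreal (e\<^sup>2)"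
    if e: "0 \<le> e" and n: "\<And>k. K \<le> k \<Longrightarrow> L2_norm M (\<lambda>x. p n x - p (r k) x) \<le> e" for n e K
  proof -
    have "(\<integral>\<^sup>+x. ennreal ((p n x - f x)\<^sup>2) \<partial>M) = (\<integral>\<^sup>+x. liminf (\<lambda>k. ennreal ((p n x - p (r k) x)\<^sup>2)) \<partial>M)"
    proof (rule nn_integral_cong_AE)
      show "AE x in M. ennreal ((p n x - f x)\<^sup>2) = liminf (\<lambda>k. ennreal ((p n x - p (r k) x)\<^sup>2))"
        using limit
      proof eventually_elim
        case (elim x)
        then have "(\<lambda>k. ennreal ((p n x - p (r k) x)\<^sup>2)) \<longlonglongrightarrow> ennreal ((p n x - f x)\<^sup>2)"
          by (intro tendsto_intros) auto
        from lim_imp_Liminf[OF trivial_limit_sequentially this] show ?case by (rule sym)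
      qed
    qed
    also have "\<dots> \<le> liminf (\<lambda>k. \<integral>\<^sup>+x. ennreal ((p n x - p (r k) x)\<^sup>2) \<partial>M)"
      by (rule nn_integral_liminf) simp
    also have "\<dots> \<le> liminf (\<lambda>k. ennreal (e\<^sup>2))"
    proof (rule Liminf_mono, unfold eventually_sequentially, intro exI allI impI)
      fix k assume "K \<le> k"
      have "(\<integral>\<^sup>+x. ennreal ((p n x - p (r k) x)\<^sup>2) \<partial>M) = ennreal ((L2_norm M (\<lambda>x. p n x - p (r k) x))\<^sup>2)"
        unfolding L2_norm_square by (intro nn_integral_eq_integral L2_spaceD L2_space_diff p) auto
      also have "\<dots> \<le> ennreal (e\<^sup>2)"
        using n[OF \<open>K \<le> k\<close>] by (intro ennreal_leI power_mono L2_norm_nonneg)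
      finally show "(\<integral>\<^sup>+x. ennreal ((p n x - p (r k) x)\<^sup>2) \<partial>M) \<le> ennreal (e\<^sup>2)" .
    qed
    finally show ?thesis by (simp add: Liminf_const)
  qed
  have close: "(\<lambda>x. p n x - f x) \<in> L2_space M \<and> L2_norm M (\<lambda>x. p n x - f x) \<le> e"
    if e: "0 \<le> e" and n: "\<And>k. K \<le> k \<Longrightarrow> L2_norm M (\<lambda>x. p n x - p (r k) x) \<le> e" for n e K
  proof -
    have le: "(\<integral>\<^sup>+x. ennreal ((p n x - f x)\<^sup>2) \<partial>M) \<le> ennreal (e\<^sup>2)"
      by (rule fatou[OF e n])
    then have int: "integrable M (\<lambda>x. (p n x - f x)\<^sup>2)"
      by (intro integrableI_nonneg) (auto intro: le_less_trans)
    then have "ennreal ((L2_norm M (\<lambda>x. p n x - f x))\<^sup>2) \<le> ennreal (e\<^sup>2)"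
      using le by (simp add: L2_norm_square nn_integral_eq_integral)
    then have "(L2_norm M (\<lambda>x. p n x - f x))\<^sup>2 \<le> e\<^sup>2" by (simp add: ennreal_le_iff)
    then show ?thesis using int e by (auto simp: L2_space_def intro: power2_le_imp_le)
  qed
  have "(\<lambda>x. p (r 0) x - f x) \<in> L2_space M \<and> L2_norm M (\<lambda>x. p (r 0) x - f x) \<le> 1"
  proof (rule close)
    fix k :: nat assume "0 \<le> k"
    have "r 0 \<le> r k" using r_mono by (simp add: strict_mono_less_eq)
    then have "N 0 \<le> r k" using r_ge[of 0] by linarith
    from N[OF r_ge[of 0] this] show "L2_norm M (\<lambda>x. p (r 0) x - p (r k) x) \<le> 1" by simp
  qed simp
  then have "(\<lambda>x. p (r 0) x - f x) \<in> L2_space M" ..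
  from L2_space_diff[OF p[of "r 0"] this] have f: "f \<in> L2_space M" by simp
  have "(\<lambda>n. L2_norm M (\<lambda>x. p n x - f x)) \<longlonglongrightarrow> 0"
  proof (rule LIMSEQ_I)
    fix e :: real assume e: "0 < e"
    then obtain K where K: "\<And>m n. K \<le> m \<Longrightarrow> K \<le> n \<Longrightarrow> L2_norm M (\<lambda>x. p m x - p n x) < e / 2"
      using Cauchy[of "e / 2"] by auto
    have le: "L2_norm M (\<lambda>x. p n x - f x) \<le> e / 2" if "K \<le> n" for n
    proof (rule close[THEN conjunct2])
      fix k assume "K \<le> k"
      then have "K \<le> r k" using seq_suble[OF r_mono, of k] by linarith
      then show "L2_norm M (\<lambda>x. p n x - p (r k) x) \<le> e / 2" using K[OF that] by force
    qed (use e in simp)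
    show "\<exists>K. \<forall>n\<ge>K. norm (L2_norm M (\<lambda>x. p n x - f x) - 0) < e"
    proof (intro exI allI impI)
      fix n assume "K \<le> n"
      from le[OF this] show "norm (L2_norm M (\<lambda>x. p n x - f x) - 0) < e"
        using e L2_norm_nonneg[of M "\<lambda>x. p n x - f x"] by simp
    qed
  qed
  with f show ?thesis by blast
qed

section \<open>The resolvent set of an operator with a core\<close>

text \<open>
  For the closure of an operator \<open>A\<close> on a dense space \<open>P\<close> of functions, membership of \<open>l\<close> in the
  resolvent set is decided on \<open>P\<close>, provided that a lower bound for \<open>A - l\<close> on \<open>P\<close> forces the
  range of \<open>A - l\<close> to be dense.
\<close>

lemma (in prob_space) L2_resolvent_set_core:
  fixes P :: "('a \<Rightarrow> real) \<Rightarrow> bool" and A :: "('a \<Rightarrow> real) \<Rightarrow> 'a \<Rightarrow> real"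
  assumes P_L2: "\<And>p. P p \<Longrightarrow> p \<in> L2_space M"
    and P_diff: "\<And>p q. P p \<Longrightarrow> P q \<Longrightarrow> P (\<lambda>x. p x - q x)"
    and A_P: "\<And>p. P p \<Longrightarrow> P (A p)"
    and A_diff: "\<And>p q. P p \<Longrightarrow> P q \<Longrightarrow> A (\<lambda>x. p x - q x) = (\<lambda>x. A p x - A q x)"
    and dense: "\<And>h e. h \<in> L2_space M \<Longrightarrow> 0 < e \<Longrightarrow> \<exists>p. P p \<and> L2_norm M (\<lambda>x. p x - h x) < e"
    and dense_range: "\<And>e q d. 0 < e \<Longrightarrow> (\<And>p. P p \<Longrightarrow> e * L2_norm M p \<le> L2_norm M (\<lambda>x. A p x - l * p x)) \<Longrightarrow>
      P q \<Longrightarrow> 0 < d \<Longrightarrow> \<exists>p. P p \<and> L2_norm M (\<lambda>x. (A p x - l * p x) - q x) < d"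
  shows "l \<in> L2_resolvent_set M (L2_closure M {(p, A p) | p. P p}) \<longleftrightarrow>
    (\<exists>e>0. \<forall>p. P p \<longrightarrow> e * L2_norm M p \<le> L2_norm M (\<lambda>x. A p x - l * p x))"
proof
  let ?T = "L2_closure M {(p, A p) | p. P p}"
  assume "l \<in> L2_resolvent_set M ?T"
  then obtain C where C: "\<And>f g. (f, g) \<in> ?T \<Longrightarrow> L2_norm M f \<le> C * L2_norm M (\<lambda>x. g x - l * f x)"
    unfolding L2_resolvent_set_def by blast
  define D where "D = max C 1"
  have "1 / D * L2_norm M p \<le> L2_norm M (\<lambda>x. A p x - l * p x)" if p: "P p" for p
  proof -
    have "(p, A p) \<in> ?T"
      unfolding L2_closure_def
    proof (intro CollectI case_prodI conjI exI allI)
      show "(\<lambda>n. L2_norm M (\<lambda>x. p x - p x)) \<longlonglongrightarrow> 0" "(\<lambda>n. L2_norm M (\<lambda>x. A p x - A p x)) \<longlonglongrightarrow> 0"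
        by (simp_all add: L2_norm_def)
    qed (use p P_L2[OF p] P_L2[OF A_P[OF p]] in blast)+
    from C[OF this] have "L2_norm M p \<le> D * L2_norm M (\<lambda>x. A p x - l * p x)"
      by (rule order_trans) (auto simp: D_def intro: mult_right_mono L2_norm_nonneg)
    then show ?thesis by (simp add: D_def field_simps)
  qed
  then show "\<exists>e>0. \<forall>p. P p \<longrightarrow> e * L2_norm M p \<le> L2_norm M (\<lambda>x. A p x - l * p x)"
    by (intro exI[of _ "1 / D"]) (auto simp: D_def)
next
  let ?T = "L2_closure M {(p, A p) | p. P p}"
  assume "\<exists>e>0. \<forall>p. P p \<longrightarrow> e * L2_norm M p \<le> L2_norm M (\<lambda>x. A p x - l * p x)"
  then obtain e where e: "e > 0" "\<And>p. P p \<Longrightarrow> e * L2_norm M p \<le> L2_norm M (\<lambda>x. A p x - l * p x)" by blast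
  note A_L2 = P_L2[OF A_P]
  have Al: "(\<lambda>x. A p x - l * p x) \<in> L2_space M" if "P p" for p
    using that by (intro L2_space_diff L2_space_cmult A_L2 P_L2)
  have bound: "L2_norm M f \<le> 1 / e * L2_norm M (\<lambda>x. g x - l * f x)" if fg: "(f, g) \<in> ?T" for f g
  proof -
    obtain p q where f: "f \<in> L2_space M" and g: "g \<in> L2_space M"
      and pq: "\<And>n :: nat. (p n, q n) \<in> {(p, A p) | p. P p}"
      and lim: "(\<lambda>n. L2_norm M (\<lambda>x. p n x - f x)) \<longlonglongrightarrow> 0" "(\<lambda>n. L2_norm M (\<lambda>x. q n x - g x)) \<longlonglongrightarrow> 0"
      using fg unfolding L2_closure_def by blast
    have p: "P (p n)" and q: "q n = A (p n)" for n using pq[of n] by auto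
    have gl: "(\<lambda>x. g x - l * f x) \<in> L2_space M" by (intro L2_space_diff L2_space_cmult f g)
    have "(\<lambda>n. L2_norm M (\<lambda>x. (A (p n) x - l * p n x) - (g x - l * f x))) \<longlonglongrightarrow> 0"
    proof (rule Lim_null_comparison)
      show "(\<lambda>n. L2_norm M (\<lambda>x. q n x - g x) + \<bar>- l\<bar> * L2_norm M (\<lambda>x. p n x - f x)) \<longlonglongrightarrow> 0"
        using tendsto_add[OF lim(2) tendsto_mult[OF tendsto_const lim(1), of "\<bar>- l\<bar>"]] by simp
      have "L2_norm M (\<lambda>x. (A (p n) x - l * p n x) - (g x - l * f x)) \<le>
          L2_norm M (\<lambda>x. q n x - g x) + \<bar>- l\<bar> * L2_norm M (\<lambda>x. p n x - f x)" for n
      proof -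
        have "L2_norm M (\<lambda>x. (q n x - g x) + - l * (p n x - f x)) \<le>
            L2_norm M (\<lambda>x. q n x - g x) + L2_norm M (\<lambda>x. - l * (p n x - f x))"
          unfolding q by (intro L2_norm_triangle L2_space_diff L2_space_cmult A_L2 P_L2 p f g)
        then show ?thesis unfolding L2_norm_cmult q by (simp add: algebra_simps)
      qed
      then show "\<forall>\<^sub>F n in sequentially. norm (L2_norm M (\<lambda>x. (A (p n) x - l * p n x) - (g x - l * f x))) \<le>
          L2_norm M (\<lambda>x. q n x - g x) + \<bar>- l\<bar> * L2_norm M (\<lambda>x. p n x - f x)"
        by (simp add: L2_norm_nonneg)
    qed
    then have "(\<lambda>n. L2_norm M (\<lambda>x. A (p n) x - l * p n x)) \<longlonglongrightarrow> L2_norm M (\<lambda>x. g x - l * f x)"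
      by (intro L2_norm_tendsto Al p gl)
    moreover have "(\<lambda>n. e * L2_norm M (p n)) \<longlonglongrightarrow> e * L2_norm M f"
      by (intro tendsto_mult tendsto_const L2_norm_tendsto P_L2 p f lim)
    ultimately have "e * L2_norm M f \<le> L2_norm M (\<lambda>x. g x - l * f x)"
      using e(2)[OF p] by (intro LIMSEQ_le[of "\<lambda>n. e * L2_norm M (p n)"]) auto
    then show ?thesis using e(1) by (simp add: field_simps)
  qed
  have onto: "\<exists>(f, g)\<in>?T. AE x in M. g x - l * f x = h x" if h: "h \<in> L2_space M" for h
  proof -
    have "\<exists>p. P p \<and> L2_norm M (\<lambda>x. (A p x - l * p x) - h x) < 1 / real (Suc n)" for n
    proof -
      obtain q where q: "P q" "L2_norm M (\<lambda>x. q x - h x) < 1 / real (Suc n) / 2"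
        using dense[OF h, of "1 / real (Suc n) / 2"] by auto
      obtain p where p: "P p" "L2_norm M (\<lambda>x. (A p x - l * p x) - q x) < 1 / real (Suc n) / 2"
        using dense_range[OF e q(1), of "1 / real (Suc n) / 2"] by auto
      have "L2_norm M (\<lambda>x. (A p x - l * p x) - h x) < 1 / real (Suc n)"
        using L2_norm_diff_triangle[OF Al[OF p(1)] P_L2[OF q(1)] h] p(2) q(2) by linarith
      with p(1) show ?thesis by blast
    qed
    then obtain p where p: "\<And>n. P (p n)"
      and close: "\<And>n. L2_norm M (\<lambda>x. (A (p n) x - l * p n x) - h x) < 1 / real (Suc n)" by metis
    have lim_h: "(\<lambda>n. L2_norm M (\<lambda>x. (A (p n) x - l * p n x) - h x)) \<longlonglongrightarrow> 0"
      by (rule Lim_null_comparison[OF _ LIMSEQ_inverse_real_of_nat])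
        (use close in \<open>auto simp: L2_norm_nonneg inverse_eq_divide intro!: always_eventually less_imp_le\<close>)
    have "\<exists>f\<in>L2_space M. (\<lambda>n. L2_norm M (\<lambda>x. p n x - f x)) \<longlonglongrightarrow> 0"
    proof (rule L2_complete[OF P_L2[OF p]])
      fix d :: real assume d: "0 < d"
      then have "eventually (\<lambda>n. L2_norm M (\<lambda>x. (A (p n) x - l * p n x) - h x) < e * d / 2) sequentially"
        using e(1) by (intro order_tendstoD(2)[OF lim_h]) simp
      then obtain N where N: "\<And>n. N \<le> n \<Longrightarrow> L2_norm M (\<lambda>x. (A (p n) x - l * p n x) - h x) < e * d / 2"
        by (auto simp: eventually_sequentially)
      have "L2_norm M (\<lambda>x. p m x - p n x) < d" if mn: "N \<le> m" "N \<le> n" for m n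
      proof -
        have "e * L2_norm M (\<lambda>x. p m x - p n x) \<le> L2_norm M (\<lambda>x. A (\<lambda>x. p m x - p n x) x - l * (p m x - p n x))"
          by (rule e(2)[OF P_diff[OF p p]])
        also have "\<dots> = L2_norm M (\<lambda>x. (A (p m) x - l * p m x) - (A (p n) x - l * p n x))"
          by (simp add: A_diff[OF p p] algebra_simps)
        also have "\<dots> \<le> L2_norm M (\<lambda>x. (A (p m) x - l * p m x) - h x) + L2_norm M (\<lambda>x. h x - (A (p n) x - l * p n x))"
          by (intro L2_norm_diff_triangle Al p h)
        also have "\<dots> < e * d"
          using N[OF mn(1)] N[OF mn(2)] L2_norm_minus_commute[of M h "\<lambda>x. A (p n) x - l * p n x"] by linarith
        finally show ?thesis using e(1) by simp
      qed
      then show "\<exists>N. \<forall>m\<ge>N. \<forall>n\<ge>N. L2_norm M (\<lambda>x. p m x - p n x) < d" by blast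
    qed
    then obtain f where f: "f \<in> L2_space M" and lim_f: "(\<lambda>n. L2_norm M (\<lambda>x. p n x - f x)) \<longlonglongrightarrow> 0" by blast
    define g where "g = (\<lambda>x. h x + l * f x)"
    have g: "g \<in> L2_space M" unfolding g_def by (intro L2_space_add L2_space_cmult h f)
    have lim_g: "(\<lambda>n. L2_norm M (\<lambda>x. A (p n) x - g x)) \<longlonglongrightarrow> 0"
    proof (rule Lim_null_comparison)
      show "(\<lambda>n. L2_norm M (\<lambda>x. (A (p n) x - l * p n x) - h x) + \<bar>l\<bar> * L2_norm M (\<lambda>x. p n x - f x)) \<longlonglongrightarrow> 0"
        using tendsto_add[OF lim_h tendsto_mult[OF tendsto_const lim_f, of "\<bar>l\<bar>"]] by simp
      have "L2_norm M (\<lambda>x. A (p n) x - g x) \<le>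
          L2_norm M (\<lambda>x. (A (p n) x - l * p n x) - h x) + \<bar>l\<bar> * L2_norm M (\<lambda>x. p n x - f x)" for n
      proof -
        have "L2_norm M (\<lambda>x. ((A (p n) x - l * p n x) - h x) + l * (p n x - f x)) \<le>
            L2_norm M (\<lambda>x. (A (p n) x - l * p n x) - h x) + L2_norm M (\<lambda>x. l * (p n x - f x))"
          by (intro L2_norm_triangle L2_space_diff L2_space_cmult Al P_L2 p f h A_L2)
        then show ?thesis unfolding L2_norm_cmult by (simp add: g_def algebra_simps)
      qed
      then show "\<forall>\<^sub>F n in sequentially. norm (L2_norm M (\<lambda>x. A (p n) x - g x)) \<le>
          L2_norm M (\<lambda>x. (A (p n) x - l * p n x) - h x) + \<bar>l\<bar> * L2_norm M (\<lambda>x. p n x - f x)"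
        by (simp add: L2_norm_nonneg)
    qed
    have "(f, g) \<in> ?T"
      unfolding L2_closure_def
    proof (intro CollectI case_prodI conjI exI allI)
      show "(\<lambda>n. L2_norm M (\<lambda>x. p n x - f x)) \<longlonglongrightarrow> 0" by (rule lim_f)
      show "(\<lambda>n. L2_norm M (\<lambda>x. A (p n) x - g x)) \<longlonglongrightarrow> 0" by (rule lim_g)
    qed (use f g p in blast)+
    then show ?thesis by (intro bexI[of _ "(f, g)"]) (auto simp: g_def)
  qed
  show "l \<in> L2_resolvent_set M ?T"
    unfolding L2_resolvent_set_def using onto bound by blast
qed

section \<open>Density of polynomials\<close>

text \<open>
  Uniform limits of polynomials on the simplex with values in the unit interval. By the theorem of
  Weierstrass they include the continuous functions of one coordinate, and they are closed under
  products and complements, which correspond to intersections and complements of sets.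
\<close>

definition uniform_poly_limit :: "'a set \<Rightarrow> (('a \<Rightarrow> real) \<Rightarrow> real) \<Rightarrow> bool" where
  "uniform_poly_limit V g \<longleftrightarrow> g \<in> borel_measurable (\<Pi>\<^sub>M x\<in>V. borel) \<and>
    (\<forall>z\<in>prob_simplex V. 0 \<le> g z \<and> g z \<le> 1) \<and>
    (\<forall>e>0. \<exists>p. polynomial_on V p \<and> (\<forall>z\<in>prob_simplex V. \<bar>g z - p z\<bar> \<le> e))"

lemma uniform_poly_limit_const: "0 \<le> a \<Longrightarrow> a \<le> 1 \<Longrightarrow> uniform_poly_limit V (\<lambda>z. a)"
  unfolding uniform_poly_limit_def
  by (intro conjI allI impI exI[of _ "\<lambda>z. a"] polynomial_on.const) auto

lemma uniform_poly_limit_compl: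
  assumes "uniform_poly_limit V g"
  shows "uniform_poly_limit V (\<lambda>z. 1 - g z)"
proof -
  have "\<exists>p. polynomial_on V p \<and> (\<forall>z\<in>prob_simplex V. \<bar>(1 - g z) - p z\<bar> \<le> e)" if "e > 0" for e
  proof -
    obtain p where "polynomial_on V p" "\<forall>z\<in>prob_simplex V. \<bar>g z - p z\<bar> \<le> e"
      using assms \<open>e > 0\<close> unfolding uniform_poly_limit_def by blast
    then show ?thesis
      by (intro exI[of _ "\<lambda>z. 1 - p z"]) (auto intro: poly_intros simp: abs_minus_commute)
  qed
  then show ?thesis
    using assms unfolding uniform_poly_limit_def by (auto intro: borel_measurable_diff borel_measurable_const)
qed

lemma uniform_poly_limit_mult:
  assumes f: "uniform_poly_limit V f" and g: "uniform_poly_limit V g"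
  shows "uniform_poly_limit V (\<lambda>z. f z * g z)"
proof -
  have "\<exists>p. polynomial_on V p \<and> (\<forall>z\<in>prob_simplex V. \<bar>f z * g z - p z\<bar> \<le> e)" if e: "e > 0" for e
  proof -
    define d where "d = min 1 (e / 3)"
    have d: "d > 0" "d \<le> 1" "d \<le> e / 3" using e by (auto simp: d_def)
    obtain p where p: "polynomial_on V p" "\<forall>z\<in>prob_simplex V. \<bar>f z - p z\<bar> \<le> d"
      using f d(1) unfolding uniform_poly_limit_def by blast
    obtain q where q: "polynomial_on V q" "\<forall>z\<in>prob_simplex V. \<bar>g z - q z\<bar> \<le> d"
      using g d(1) unfolding uniform_poly_limit_def by blast
    have "\<bar>f z * g z - p z * q z\<bar> \<le> e" if z: "z \<in> prob_simplex V" for z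
    proof -
      have fg: "0 \<le> f z" "f z \<le> 1" "0 \<le> g z" "g z \<le> 1"
        using f g z unfolding uniform_poly_limit_def by blast+
      have pz: "\<bar>f z - p z\<bar> \<le> d" and qz: "\<bar>g z - q z\<bar> \<le> d" using p q z by auto
      have p2: "\<bar>p z\<bar> \<le> 2" using pz fg d by linarith
      have "f z * g z - p z * q z = (f z - p z) * g z + p z * (g z - q z)" by (simp add: algebra_simps)
      then have "\<bar>f z * g z - p z * q z\<bar> \<le> \<bar>f z - p z\<bar> * \<bar>g z\<bar> + \<bar>p z\<bar> * \<bar>g z - q z\<bar>"
        by (metis abs_mult abs_triangle_ineq)
      also have "\<dots> \<le> d * 1 + 2 * d"
        using pz qz p2 fg d by (intro add_mono mult_mono) auto
      finally show ?thesis using d by simp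
    qed
    then show ?thesis using p q by (intro exI[of _ "\<lambda>z. p z * q z"]) (auto intro: poly_intros)
  qed
  moreover have "\<forall>z\<in>prob_simplex V. 0 \<le> f z * g z \<and> f z * g z \<le> 1"
    using f g unfolding uniform_poly_limit_def by (auto intro: mult_le_one)
  ultimately show ?thesis
    using f g unfolding uniform_poly_limit_def by (auto intro: borel_measurable_times)
qed

lemma uniform_poly_limit_coord:
  assumes x: "x \<in> V" and h: "continuous_on UNIV h" "\<And>t. 0 \<le> h t" "\<And>t. h t \<le> (1 :: real)"
  shows "uniform_poly_limit V (\<lambda>z. h (z x))"
proof -
  have "\<exists>p. polynomial_on V p \<and> (\<forall>z\<in>prob_simplex V. \<bar>h (z x) - p z\<bar> \<le> e)" if e: "e > 0" for e
  proof -
    obtain n where n: "\<And>t. t \<in> {0..1} \<Longrightarrow> \<bar>h t - (\<Sum>k\<le>n. h (k / n) * Bernstein n k t)\<bar> < e"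
      using Bernstein_Weierstrass[OF continuous_on_subset[OF h(1)], of e] e by blast
    have "polynomial_on V (\<lambda>z. \<Sum>k\<le>n. h (k / n) * Bernstein n k (z x))"
      unfolding Bernstein_def using x by (intro poly_intros)
    moreover have "\<bar>h (z x) - (\<Sum>k\<le>n. h (k / n) * Bernstein n k (z x))\<bar> \<le> e" if "z \<in> prob_simplex V" for z
    proof -
      have "z x \<in> {0..1}" using that x by (auto simp: prob_simplex_def PiE_iff)
      from n[OF this] show ?thesis by simp
    qed
    ultimately show ?thesis by blast
  qed
  moreover have "(\<lambda>z. h (z x)) \<in> borel_measurable (\<Pi>\<^sub>M x\<in>V. borel)"
    using measurable_compose[OF measurable_component_singleton[OF x] borel_measurable_continuous_onI[OF h(1)]] .
  ultimately show ?thesis using h unfolding uniform_poly_limit_def by blast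
qed

lemma borel_measurable_dirichletI:
  "uniform_poly_limit V g \<Longrightarrow> g \<in> borel_measurable (dirichlet V \<alpha>)"
  unfolding uniform_poly_limit_def by (auto intro: measurable_dirichletI)

locale dirichlet_prob =
  fixes V :: "'a set" and \<alpha> :: "'a \<Rightarrow> real"
  assumes finite_V: "finite V" and V_nonempty: "V \<noteq> {}" and \<alpha>_pos: "x \<in> V \<Longrightarrow> 0 < \<alpha> x"
begin

abbreviation \<gamma> :: "('a \<Rightarrow> real) measure" where "\<gamma> \<equiv> dirichlet V \<alpha>"

sublocale prob_space \<gamma>
  by (rule prob_space_dirichlet[OF finite_V V_nonempty \<alpha>_pos])

sublocale D: dirichlet_moments V \<alpha> "\<lambda>p. \<integral>z. p z \<partial>\<gamma>"
  by (rule dirichlet_moments_dirichlet[OF finite_V V_nonempty \<alpha>_pos])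

lemma polynomial_integrable: "polynomial_on V p \<Longrightarrow> integrable \<gamma> p"
  by (rule polynomial_dirichlet_integrable[OF finite_V V_nonempty \<alpha>_pos])

lemma polynomial_L2: "polynomial_on V p \<Longrightarrow> p \<in> L2_space \<gamma>"
  unfolding L2_space_def
  by (intro CollectI conjI measurable_dirichletI polynomial_on_measurable polynomial_integrable polynomial_on_power)

lemma L2_norm_eq_nrm: "L2_norm \<gamma> p = D.nrm p"
  by (simp add: L2_norm_def D.nrm_def)

lemma unit_integrable:
  fixes g :: "('a \<Rightarrow> real) \<Rightarrow> real"
  assumes "g \<in> borel_measurable \<gamma>" "\<And>z. z \<in> prob_simplex V \<Longrightarrow> \<bar>g z\<bar> \<le> 1"
  shows "integrable \<gamma> g"
  by (rule integrable_const_bound[of g 1]) (use assms in auto)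

text \<open>
  The sets whose indicator functions are limits in mean of uniform limits of polynomials with
  values in the unit interval form a \<open>\<sigma>\<close>-algebra.
\<close>

definition approximable :: "('a \<Rightarrow> real) set \<Rightarrow> bool" where
  "approximable A \<longleftrightarrow> A \<in> sets \<gamma> \<and>
    (\<forall>e>0. \<exists>g. uniform_poly_limit V g \<and> (\<integral>z. \<bar>indicator A z - g z\<bar> \<partial>\<gamma>) \<le> e)"

lemma approximableD:
  "approximable A \<Longrightarrow> 0 < e \<Longrightarrow> \<exists>g. uniform_poly_limit V g \<and> (\<integral>z. \<bar>indicator A z - g z\<bar> \<partial>\<gamma>) \<le> e"
  unfolding approximable_def by blast

lemma approximable_diff_integrable:
  assumes "A \<in> sets \<gamma>" "uniform_poly_limit V g"
  shows "integrable \<gamma> (\<lambda>z. \<bar>indicator A z - g z\<bar>)"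
proof (rule unit_integrable)
  show "(\<lambda>z. \<bar>indicator A z - g z\<bar>) \<in> borel_measurable \<gamma>"
    by (intro borel_measurable_abs borel_measurable_diff borel_measurable_indicator assms borel_measurable_dirichletI)
  fix z assume "z \<in> prob_simplex V"
  then have "0 \<le> g z" "g z \<le> 1" using assms(2) unfolding uniform_poly_limit_def by auto
  then show "\<bar>\<bar>indicator A z - g z\<bar>\<bar> \<le> 1" by (auto simp: indicator_def)
qed

lemma approximable_empty: "approximable {}"
  unfolding approximable_def
  by (intro conjI allI impI exI[of _ "\<lambda>z. 0"] uniform_poly_limit_const) auto

lemma approximable_compl:
  assumes "approximable A"
  shows "approximable (prob_simplex V - A)"
  unfolding approximable_def
proof (intro conjI allI impI)
  have A: "A \<in> sets \<gamma>" using assms by (simp add: approximable_def)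
  show "prob_simplex V - A \<in> sets \<gamma>" using sets.compl_sets[OF A] by simp
  fix e :: real assume "e > 0"
  then obtain g where g: "uniform_poly_limit V g" "(\<integral>z. \<bar>indicator A z - g z\<bar> \<partial>\<gamma>) \<le> e"
    using approximableD[OF assms] by blast
  have "(\<integral>z. \<bar>indicator (prob_simplex V - A) z - (1 - g z)\<bar> \<partial>\<gamma>) = (\<integral>z. \<bar>indicator A z - g z\<bar> \<partial>\<gamma>)"
    by (intro Bochner_Integration.integral_cong) (auto simp: indicator_def)
  then show "\<exists>g. uniform_poly_limit V g \<and> (\<integral>z. \<bar>indicator (prob_simplex V - A) z - g z\<bar> \<partial>\<gamma>) \<le> e"
    using g uniform_poly_limit_compl by (intro exI[of _ "\<lambda>z. 1 - g z"]) auto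
qed

lemma approximable_Int:
  assumes A: "approximable A" and B: "approximable B"
  shows "approximable (A \<inter> B)"
  unfolding approximable_def
proof (intro conjI allI impI)
  have AB: "A \<in> sets \<gamma>" "B \<in> sets \<gamma>" using assms by (auto simp: approximable_def)
  then show "A \<inter> B \<in> sets \<gamma>" by (rule sets.Int)
  fix e :: real assume "e > 0"
  then have e2: "e / 2 > 0" by simp
  obtain f where f: "uniform_poly_limit V f" "(\<integral>z. \<bar>indicator A z - f z\<bar> \<partial>\<gamma>) \<le> e / 2"
    using approximableD[OF A e2] by blast
  obtain g where g: "uniform_poly_limit V g" "(\<integral>z. \<bar>indicator B z - g z\<bar> \<partial>\<gamma>) \<le> e / 2"
    using approximableD[OF B e2] by blast
  have "(\<integral>z. \<bar>indicator (A \<inter> B) z - f z * g z\<bar> \<partial>\<gamma>) \<le>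
      (\<integral>z. \<bar>indicator A z - f z\<bar> + \<bar>indicator B z - g z\<bar> \<partial>\<gamma>)"
  proof (rule integral_mono)
    show "integrable \<gamma> (\<lambda>z. \<bar>indicator (A \<inter> B) z - f z * g z\<bar>)"
      by (intro approximable_diff_integrable sets.Int AB uniform_poly_limit_mult f g)
    show "integrable \<gamma> (\<lambda>z. \<bar>indicator A z - f z\<bar> + \<bar>indicator B z - g z\<bar>)"
      by (intro Bochner_Integration.integrable_add approximable_diff_integrable AB f g)
    fix z assume "z \<in> space \<gamma>"
    then have fg: "0 \<le> f z" "f z \<le> 1" "0 \<le> g z" "g z \<le> 1"
      using f(1) g(1) unfolding uniform_poly_limit_def by auto
    define c where "c = f z * g z"
    have "0 \<le> (1 - f z) * (1 - g z)" using fg by simp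
    then have "0 \<le> 1 - f z - g z + c" by (simp add: c_def algebra_simps)
    moreover have "0 \<le> c" "c \<le> g z" "c \<le> f z"
      using fg by (simp_all add: c_def mult_left_le mult_left_le_one_le)
    ultimately show "\<bar>indicator (A \<inter> B) z - f z * g z\<bar> \<le> \<bar>indicator A z - f z\<bar> + \<bar>indicator B z - g z\<bar>"
      unfolding c_def[symmetric] using fg by (cases "z \<in> A"; cases "z \<in> B") simp_all
  qed
  also have "\<dots> = (\<integral>z. \<bar>indicator A z - f z\<bar> \<partial>\<gamma>) + (\<integral>z. \<bar>indicator B z - g z\<bar> \<partial>\<gamma>)"
    by (intro Bochner_Integration.integral_add approximable_diff_integrable AB f g)
  also have "\<dots> \<le> e" using f g by simp
  finally show "\<exists>h. uniform_poly_limit V h \<and> (\<integral>z. \<bar>indicator (A \<inter> B) z - h z\<bar> \<partial>\<gamma>) \<le> e"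
    using uniform_poly_limit_mult[OF f(1) g(1)] by (intro exI[of _ "\<lambda>z. f z * g z"]) simp
qed

lemma approximable_limit:
  assumes A: "A \<in> sets \<gamma>" and g: "\<And>n :: nat. uniform_poly_limit V (g n)"
    and lim: "\<And>z. z \<in> prob_simplex V \<Longrightarrow> (\<lambda>n. g n z) \<longlonglongrightarrow> indicator A z"
  shows "approximable A"
  unfolding approximable_def
proof (intro conjI allI impI A)
  fix e :: real assume e: "e > 0"
  have "(\<lambda>n. \<integral>z. \<bar>indicator A z - g n z\<bar> \<partial>\<gamma>) \<longlonglongrightarrow> (\<integral>z. 0 \<partial>\<gamma>)"
  proof (rule integral_dominated_convergence[where w = "\<lambda>_. 1"])
    show "(\<lambda>z. \<bar>indicator A z - g n z\<bar>) \<in> borel_measurable \<gamma>" for n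
      using approximable_diff_integrable[OF A g[of n]] by simp
    show "AE z in \<gamma>. (\<lambda>n. \<bar>indicator A z - g n z\<bar>) \<longlonglongrightarrow> 0"
    proof (rule AE_I2)
      fix z assume "z \<in> space \<gamma>"
      then have "(\<lambda>n. \<bar>indicator A z - g n z\<bar>) \<longlonglongrightarrow> \<bar>indicator A z - indicator A z\<bar>"
        by (intro tendsto_intros lim) simp
      then show "(\<lambda>n. \<bar>indicator A z - g n z\<bar>) \<longlonglongrightarrow> 0" by simp
    qed
    show "AE z in \<gamma>. norm \<bar>indicator A z - g n z\<bar> \<le> 1" for n
    proof (rule AE_I2)
      fix z assume "z \<in> space \<gamma>"
      then have "0 \<le> g n z" "g n z \<le> 1" using g[of n] unfolding uniform_poly_limit_def by auto
      then show "norm \<bar>indicator A z - g n z\<bar> \<le> 1" by (auto simp: indicator_def)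
    qed
  qed auto
  then have "eventually (\<lambda>n. (\<integral>z. \<bar>indicator A z - g n z\<bar> \<partial>\<gamma>) < e) sequentially"
    using e by (intro order_tendstoD(2)) auto
  then obtain n where "(\<integral>z. \<bar>indicator A z - g n z\<bar> \<partial>\<gamma>) < e"
    by (auto simp: eventually_sequentially)
  then show "\<exists>h. uniform_poly_limit V h \<and> (\<integral>z. \<bar>indicator A z - h z\<bar> \<partial>\<gamma>) \<le> e"
    using g[of n] by (intro exI[of _ "g n"]) simp
qed

lemma approximable_UN:
  assumes A: "\<And>n :: nat. approximable (A n)"
  shows "approximable (\<Union>n. A n)"
proof -
  have A_sets: "A n \<in> sets \<gamma>" for n using A by (simp add: approximable_def)
  have A_sub: "A n \<subseteq> prob_simplex V" for n using sets.sets_into_space[OF A_sets[of n]] by simp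
  have Un: "approximable (B \<union> C)" if B: "approximable B" and C: "approximable C" for B C
  proof -
    have "B \<subseteq> prob_simplex V" "C \<subseteq> prob_simplex V"
      using B C sets.sets_into_space[of _ \<gamma>] by (auto simp: approximable_def)
    then have "B \<union> C = prob_simplex V - ((prob_simplex V - B) \<inter> (prob_simplex V - C))" by auto
    then show ?thesis using B C by (simp only: approximable_compl approximable_Int)
  qed
  define B where "B n = (\<Union>i<n. A i)" for n
  have B: "approximable (B n)" for n
    by (induction n) (auto simp: B_def lessThan_Suc approximable_empty intro: Un A)
  have B_sets: "B n \<in> sets \<gamma>" for n using B by (simp add: approximable_def)
  have U: "(\<Union>n. A n) \<in> sets \<gamma>" using A_sets by blast
  show ?thesis
    unfolding approximable_def
  proof (intro conjI allI impI U)
    fix e :: real assume e: "e > 0"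
    have "(\<lambda>n. \<integral>z. \<bar>indicator (\<Union>n. A n) z - indicator (B n) z\<bar> \<partial>\<gamma>) \<longlonglongrightarrow> (\<integral>z. (0 :: real) \<partial>\<gamma>)"
    proof (rule integral_dominated_convergence[where w = "\<lambda>_. 1"])
      show "(\<lambda>z. \<bar>indicator (\<Union>n. A n) z - indicator (B n) z\<bar> :: real) \<in> borel_measurable \<gamma>" for n
        by (intro borel_measurable_abs borel_measurable_diff borel_measurable_indicator U B_sets)
      show "AE z in \<gamma>. (\<lambda>n. \<bar>indicator (\<Union>n. A n) z - indicator (B n) z\<bar> :: real) \<longlonglongrightarrow> 0"
      proof (rule AE_I2)
        fix z
        show "(\<lambda>n. \<bar>indicator (\<Union>n. A n) z - indicator (B n) z\<bar> :: real) \<longlonglongrightarrow> 0"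
        proof (cases "z \<in> (\<Union>n. A n)")
          case True
          then obtain i where "z \<in> A i" by blast
          then have "\<forall>n\<ge>Suc i. \<bar>indicator (\<Union>n. A n) z - indicator (B n) z\<bar> = (0 :: real)"
            by (auto simp: B_def indicator_def)
          then show ?thesis by (intro tendsto_eventually) (auto simp: eventually_sequentially)
        next
          case False
          then have "\<bar>indicator (\<Union>n. A n) z - indicator (B n) z\<bar> = (0 :: real)" for n
            by (auto simp: B_def indicator_def)
          then show ?thesis by simp
        qed
      qed
    qed (auto simp: indicator_def)
    then have "eventually (\<lambda>n. (\<integral>z. \<bar>indicator (\<Union>n. A n) z - indicator (B n) z\<bar> \<partial>\<gamma>) < e / 2) sequentially"
      using e by (intro order_tendstoD(2)) auto
    then obtain n where n: "(\<integral>z. \<bar>indicator (\<Union>n. A n) z - indicator (B n) z\<bar> \<partial>\<gamma>) < e / 2"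
      by (auto simp: eventually_sequentially)
    have "e / 2 > 0" using e by simp
    then obtain g where g: "uniform_poly_limit V g" "(\<integral>z. \<bar>indicator (B n) z - g z\<bar> \<partial>\<gamma>) \<le> e / 2"
      using approximableD[OF B[of n]] by blast
    have int: "integrable \<gamma> (\<lambda>z. \<bar>indicator (\<Union>n. A n) z - indicator (B n) z\<bar> :: real)"
      by (intro unit_integrable borel_measurable_abs borel_measurable_diff borel_measurable_indicator U B_sets)
        (auto simp: indicator_def)
    have "(\<integral>z. \<bar>indicator (\<Union>n. A n) z - g z\<bar> \<partial>\<gamma>) \<le>
        (\<integral>z. \<bar>indicator (\<Union>n. A n) z - indicator (B n) z\<bar> + \<bar>indicator (B n) z - g z\<bar> \<partial>\<gamma>)"
      by (intro integral_mono Bochner_Integration.integrable_add int approximable_diff_integrable U B_sets g) linarith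
    also have "\<dots> = (\<integral>z. \<bar>indicator (\<Union>n. A n) z - indicator (B n) z\<bar> \<partial>\<gamma>) + (\<integral>z. \<bar>indicator (B n) z - g z\<bar> \<partial>\<gamma>)"
      by (intro Bochner_Integration.integral_add int approximable_diff_integrable B_sets g)
    also have "\<dots> \<le> e" using n g by simp
    finally show "\<exists>h. uniform_poly_limit V h \<and> (\<integral>z. \<bar>indicator (\<Union>n. A n) z - h z\<bar> \<partial>\<gamma>) \<le> e"
      using g by blast
  qed
qed

lemma restrict_sets: "A \<in> sets (\<Pi>\<^sub>M x\<in>V. borel) \<Longrightarrow> prob_simplex V \<inter> A \<in> sets \<gamma>"
  by (simp add: sets_dirichlet sets_restrict_space)

lemma approximable_halfspace:
  assumes x: "x \<in> V"
  shows "approximable {z \<in> prob_simplex V. z x \<le> t}"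
proof (rule approximable_limit)
  have "{z \<in> space (\<Pi>\<^sub>M x\<in>V. borel). z x \<le> t} \<in> sets (\<Pi>\<^sub>M x\<in>V. borel)" using x by measurable
  moreover have "{z \<in> prob_simplex V. z x \<le> t} = prob_simplex V \<inter> {z \<in> space (\<Pi>\<^sub>M x\<in>V. borel). z x \<le> t}"
    by (auto simp: prob_simplex_def space_PiM)
  ultimately show "{z \<in> prob_simplex V. z x \<le> t} \<in> sets \<gamma>" by (simp add: restrict_sets)
  \<comment> \<open>Continuous ramps, equal to one up to \<open>t\<close> and steeper and steeper beyond it.\<close>
  define h where "h n s = max 0 (min 1 (1 - real n * (s - t)))" for n :: nat and s :: real
  show "uniform_poly_limit V (\<lambda>z. h n (z x))" for n
    by (rule uniform_poly_limit_coord[OF x]) (auto simp: h_def intro!: continuous_intros)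
  show "(\<lambda>n. h n (z x)) \<longlonglongrightarrow> indicator {z \<in> prob_simplex V. z x \<le> t} z" if z: "z \<in> prob_simplex V" for z
  proof (cases "z x \<le> t")
    case True
    then have "h n (z x) = 1" for n
      using mult_nonneg_nonpos[of "real n" "z x - t"] by (simp add: h_def)
    then show ?thesis using True z by simp
  next
    case False
    obtain N where N: "1 / (z x - t) \<le> real N" using real_arch_simple by blast
    have "h n (z x) = 0" if "N \<le> n" for n
    proof -
      have "1 / (z x - t) \<le> real n" using N that by linarith
      then have "1 \<le> real n * (z x - t)" using False by (simp add: field_simps)
      then show ?thesis by (simp add: h_def)
    qed
    then have "eventually (\<lambda>n. h n (z x) = 0) sequentially" by (auto simp: eventually_sequentially)
    then show ?thesis using False by (simp add: tendsto_eventually)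
  qed
qed

lemma approximable_coordinate:
  assumes x: "x \<in> V" and S: "S \<in> sets (borel :: real measure)"
  shows "approximable {z \<in> prob_simplex V. z x \<in> S}"
proof -
  have "S \<in> sigma_sets UNIV (range (\<lambda>t :: real. {..t}))"
    using S by (subst (asm) borel_eq_atMost) simp
  then show ?thesis
  proof induction
    case (Basic S)
    then show ?case using approximable_halfspace[OF x] by auto
  next
    case Empty
    show ?case using approximable_empty by simp
  next
    case (Compl S)
    have "{z \<in> prob_simplex V. z x \<in> UNIV - S} = prob_simplex V - {z \<in> prob_simplex V. z x \<in> S}" by auto
    then show ?case using approximable_compl[OF Compl.IH] by simp
  next
    case (Union S)
    have "{z \<in> prob_simplex V. z x \<in> (\<Union>n. S n)} = (\<Union>n. {z \<in> prob_simplex V. z x \<in> S n})" by auto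
    then show ?case using approximable_UN[OF Union.IH] by simp
  qed
qed

lemma approximable_all:
  assumes "A \<in> sets \<gamma>"
  shows "approximable A"
proof -
  obtain B where B: "B \<in> sets (\<Pi>\<^sub>M x\<in>V. borel)" "A = prob_simplex V \<inter> B"
    using assms by (auto simp: sets_dirichlet sets_restrict_space)
  have sub: "prob_simplex V \<subseteq> (\<Pi>\<^sub>E x\<in>V. space (borel :: real measure))"
    by (auto simp: prob_simplex_def)
  have "approximable (prob_simplex V \<inter> B)"
    using B(1) unfolding sets_PiM_single
  proof induction
    case (Basic B)
    then obtain x S where xS: "x \<in> V" "S \<in> sets (borel :: real measure)"
      and B: "B = {f \<in> \<Pi>\<^sub>E i\<in>V. space borel. f x \<in> S}" by blast
    have "prob_simplex V \<inter> B = {z \<in> prob_simplex V. z x \<in> S}" using sub by (auto simp: B)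
    then show ?case using approximable_coordinate[OF xS] by simp
  next
    case Empty
    show ?case using approximable_empty by simp
  next
    case (Compl B)
    have "prob_simplex V \<inter> ((\<Pi>\<^sub>E i\<in>V. space borel) - B) = prob_simplex V - (prob_simplex V \<inter> B)"
      using sub by auto
    then show ?case using approximable_compl[OF Compl.IH] by simp
  next
    case (Union B)
    have "prob_simplex V \<inter> (\<Union>n. B n) = (\<Union>n. prob_simplex V \<inter> B n)" by auto
    then show ?case using approximable_UN[OF Union.IH] by simp
  qed
  then show ?thesis using B by simp
qed

definition poly_closure :: "(('a \<Rightarrow> real) \<Rightarrow> real) \<Rightarrow> bool" where
  "poly_closure f \<longleftrightarrow> f \<in> L2_space \<gamma> \<and> (\<forall>e>0. \<exists>p. polynomial_on V p \<and> L2_norm \<gamma> (\<lambda>z. p z - f z) < e)"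

lemma poly_closureD:
  "poly_closure f \<Longrightarrow> 0 < e \<Longrightarrow> \<exists>p. polynomial_on V p \<and> L2_norm \<gamma> (\<lambda>z. p z - f z) < e"
  unfolding poly_closure_def by blast

text \<open>
  For functions with values in the unit interval, the square of a difference is at most its modulus, so
  approximation in mean gives approximation in the square norm.
\<close>

lemma poly_closure_indicator:
  assumes A: "A \<in> sets \<gamma>"
  shows "poly_closure (indicator A)"
proof -
  have ind: "indicator A \<in> L2_space \<gamma>"
    unfolding L2_space_def
    by (intro CollectI conjI borel_measurable_indicator A unit_integrable borel_measurable_power) (auto simp: indicator_def)
  have "\<exists>p. polynomial_on V p \<and> L2_norm \<gamma> (\<lambda>z. p z - indicator A z) < e" if e: "e > 0" for e
  proof -
    have e2: "(e / 3)\<^sup>2 > 0" using e by simp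
    obtain g where g: "uniform_poly_limit V g" "(\<integral>z. \<bar>indicator A z - g z\<bar> \<partial>\<gamma>) \<le> (e / 3)\<^sup>2"
      using approximableD[OF approximable_all[OF A] e2] by blast
    have "e / 3 > 0" using e by simp
    then obtain p where p: "polynomial_on V p" "\<forall>z\<in>prob_simplex V. \<bar>g z - p z\<bar> \<le> e / 3"
      using g(1) unfolding uniform_poly_limit_def by blast
    have g01: "0 \<le> g z" "g z \<le> 1" if "z \<in> prob_simplex V" for z
      using g(1) that unfolding uniform_poly_limit_def by auto
    have gm: "g \<in> borel_measurable \<gamma>" by (rule borel_measurable_dirichletI[OF g(1)])
    have gL2: "g \<in> L2_space \<gamma>"
      unfolding L2_space_def
      by (intro CollectI conjI gm unit_integrable borel_measurable_power)
        (use g01 in \<open>auto simp: power_le_one\<close>)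
    have "L2_norm \<gamma> (\<lambda>z. g z - indicator A z) \<le> e / 3"
      unfolding L2_norm_def
    proof (rule real_le_lsqrt)
      have "(\<integral>z. (g z - indicator A z)\<^sup>2 \<partial>\<gamma>) \<le> (\<integral>z. \<bar>indicator A z - g z\<bar> \<partial>\<gamma>)"
      proof (rule integral_mono)
        show "integrable \<gamma> (\<lambda>z. (g z - indicator A z)\<^sup>2)"
          by (rule L2_spaceD(2)[OF L2_space_diff[OF gL2 ind]])
        show "integrable \<gamma> (\<lambda>z. \<bar>indicator A z - g z\<bar>)" by (rule approximable_diff_integrable[OF A g(1)])
        fix z assume "z \<in> space \<gamma>"
        then have "\<bar>g z - indicator A z\<bar> \<le> 1" using g01[of z] by (auto simp: indicator_def)
        then have "\<bar>g z - indicator A z\<bar> * \<bar>g z - indicator A z\<bar> \<le> 1 * \<bar>g z - indicator A z\<bar>"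
          by (intro mult_right_mono) auto
        then show "(g z - indicator A z)\<^sup>2 \<le> \<bar>indicator A z - g z\<bar>"
          by (simp add: power2_eq_square abs_minus_commute flip: abs_mult)
      qed
      then show "(\<integral>z. (g z - indicator A z)\<^sup>2 \<partial>\<gamma>) \<le> (e / 3)\<^sup>2" using g(2) by simp
    qed (use e in auto)
    moreover have "L2_norm \<gamma> (\<lambda>z. p z - g z) \<le> e / 3"
      unfolding L2_norm_def
    proof (rule real_le_lsqrt)
      have "(\<integral>z. (p z - g z)\<^sup>2 \<partial>\<gamma>) \<le> (\<integral>z. (e / 3)\<^sup>2 \<partial>\<gamma>)"
      proof (rule integral_mono)
        show "integrable \<gamma> (\<lambda>z. (p z - g z)\<^sup>2)"
          by (rule L2_spaceD(2)[OF L2_space_diff[OF polynomial_L2[OF p(1)] gL2]])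
        fix z assume "z \<in> space \<gamma>"
        then have "\<bar>p z - g z\<bar> \<le> e / 3" using p(2) by (simp add: abs_minus_commute)
        then show "(p z - g z)\<^sup>2 \<le> (e / 3)\<^sup>2" by (metis abs_ge_zero power2_abs power_mono)
      qed simp
      then show "(\<integral>z. (p z - g z)\<^sup>2 \<partial>\<gamma>) \<le> (e / 3)\<^sup>2" using prob_space by simp
    qed (use e in auto)
    ultimately have "L2_norm \<gamma> (\<lambda>z. p z - indicator A z) < e"
      using L2_norm_diff_triangle[OF polynomial_L2[OF p(1)] gL2 ind] e by linarith
    then show ?thesis using p(1) by blast
  qed
  then show ?thesis using ind by (simp add: poly_closure_def)
qed

lemma poly_closure_add:
  assumes f: "poly_closure f" and g: "poly_closure g"
  shows "poly_closure (\<lambda>z. f z + g z)"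
  unfolding poly_closure_def
proof (intro conjI allI impI)
  have L2: "f \<in> L2_space \<gamma>" "g \<in> L2_space \<gamma>" using assms by (auto simp: poly_closure_def)
  then show "(\<lambda>z. f z + g z) \<in> L2_space \<gamma>" by (rule L2_space_add)
  fix e :: real assume "e > 0"
  then have e2: "e / 2 > 0" by simp
  obtain p where p: "polynomial_on V p" "L2_norm \<gamma> (\<lambda>z. p z - f z) < e / 2"
    using poly_closureD[OF f e2] by blast
  obtain q where q: "polynomial_on V q" "L2_norm \<gamma> (\<lambda>z. q z - g z) < e / 2"
    using poly_closureD[OF g e2] by blast
  have "L2_norm \<gamma> (\<lambda>z. (p z - f z) + (q z - g z)) \<le> L2_norm \<gamma> (\<lambda>z. p z - f z) + L2_norm \<gamma> (\<lambda>z. q z - g z)"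
    by (intro L2_norm_triangle L2_space_diff polynomial_L2 p q L2)
  then have "L2_norm \<gamma> (\<lambda>z. (p z + q z) - (f z + g z)) < e"
    using p q by (simp add: algebra_simps)
  then show "\<exists>p. polynomial_on V p \<and> L2_norm \<gamma> (\<lambda>z. p z - (f z + g z)) < e"
    using p q by (intro exI[of _ "\<lambda>z. p z + q z"]) (simp add: polynomial_on.add)
qed

lemma poly_closure_cmult:
  assumes f: "poly_closure f"
  shows "poly_closure (\<lambda>z. b * f z)"
  unfolding poly_closure_def
proof (intro conjI allI impI)
  show "(\<lambda>z. b * f z) \<in> L2_space \<gamma>" using f by (auto simp: poly_closure_def intro: L2_space_cmult)
  fix e :: real assume e: "e > 0"
  then have "e / (\<bar>b\<bar> + 1) > 0" by simp
  then obtain p where p: "polynomial_on V p" "L2_norm \<gamma> (\<lambda>z. p z - f z) < e / (\<bar>b\<bar> + 1)"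
    using poly_closureD[OF f] by blast
  have "L2_norm \<gamma> (\<lambda>z. b * p z - b * f z) = \<bar>b\<bar> * L2_norm \<gamma> (\<lambda>z. p z - f z)"
    unfolding right_diff_distrib[symmetric] L2_norm_cmult ..
  also have "\<dots> \<le> (\<bar>b\<bar> + 1) * L2_norm \<gamma> (\<lambda>z. p z - f z)"
    by (intro mult_right_mono L2_norm_nonneg) simp
  also have "\<dots> < e" using p(2) by (simp add: field_simps)
  finally show "\<exists>p. polynomial_on V p \<and> L2_norm \<gamma> (\<lambda>z. p z - b * f z) < e"
    using p by (intro exI[of _ "\<lambda>z. b * p z"]) (simp add: polynomial_on_cmult)
qed

lemma poly_closure_simple:
  fixes s :: "('a \<Rightarrow> real) \<Rightarrow> real"
  assumes s: "simple_function \<gamma> s"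
  shows "\<exists>t. poly_closure t \<and> (\<forall>z\<in>prob_simplex V. t z = s z)"
proof -
  define t where "t J z = (\<Sum>y\<in>J. y * indicator (s -` {y} \<inter> space \<gamma>) z)" for J and z :: "'a \<Rightarrow> real"
  have fin: "finite (s ` space \<gamma>)" using s by (rule simple_functionD)
  have "poly_closure (t J)" if "finite J" for J
    using that
  proof (induction J)
    case empty
    show ?case
      using poly_closure_indicator[OF sets.empty_sets] by (simp add: t_def[abs_def] indicator_def[abs_def])
  next
    case (insert y J)
    have "poly_closure (\<lambda>z. y * indicator (s -` {y} \<inter> space \<gamma>) z + t J z)"
      by (intro poly_closure_add poly_closure_cmult poly_closure_indicator insert.IH simple_functionD(2)[OF s])
    moreover have "t (insert y J) = (\<lambda>z. y * indicator (s -` {y} \<inter> space \<gamma>) z + t J z)"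
      unfolding t_def[abs_def] by (rule ext) (rule sum.insert[OF insert.hyps])
    ultimately show ?case by simp
  qed
  moreover have "t (s ` space \<gamma>) z = s z" if z: "z \<in> prob_simplex V" for z
  proof -
    have "t (s ` space \<gamma>) z = (\<Sum>y\<in>s ` space \<gamma>. if y = s z then y else 0)"
      unfolding t_def using z by (intro sum.cong) (auto simp: indicator_def)
    also have "\<dots> = s z" using fin z by (simp add: sum.delta)
    finally show ?thesis .
  qed
  ultimately show ?thesis using fin by (intro exI[of _ "t (s ` space \<gamma>)"]) auto
qed

text \<open>
  Simple functions are dense by dominated convergence, and indicator functions have already been
  approximated.
\<close>

lemma polynomials_dense:
  assumes h: "h \<in> L2_space \<gamma>" and e: "0 < e"
  shows "\<exists>p. polynomial_on V p \<and> L2_norm \<gamma> (\<lambda>z. p z - h z) < e"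
proof -
  have hm: "h \<in> borel_measurable \<gamma>" by (rule L2_spaceD(1)[OF h])
  obtain s where s: "\<And>n. simple_function \<gamma> (s n)"
    and lim: "\<And>z. z \<in> space \<gamma> \<Longrightarrow> (\<lambda>n. s n z) \<longlonglongrightarrow> h z"
    and bound: "\<And>n z. z \<in> space \<gamma> \<Longrightarrow> norm (s n z) \<le> 2 * norm (h z)"
    using borel_measurable_implies_sequence_metric[OF hm, of 0] unfolding norm_conv_dist by metis
  have s_meas: "s n \<in> borel_measurable \<gamma>" for n using s by (rule borel_measurable_simple_function)
  have "(\<lambda>n. \<integral>z. (s n z - h z)\<^sup>2 \<partial>\<gamma>) \<longlonglongrightarrow> (\<integral>z. 0 \<partial>\<gamma>)"
  proof (rule integral_dominated_convergence[where w = "\<lambda>z. 9 * (h z)\<^sup>2"])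
    show "(\<lambda>z. (s n z - h z)\<^sup>2) \<in> borel_measurable \<gamma>" for n
      by (intro borel_measurable_power borel_measurable_diff s_meas hm)
    show "integrable \<gamma> (\<lambda>z. 9 * (h z)\<^sup>2)" by (intro integrable_mult_right L2_spaceD h)
    show "AE z in \<gamma>. (\<lambda>n. (s n z - h z)\<^sup>2) \<longlonglongrightarrow> 0"
    proof (rule AE_I2)
      fix z assume "z \<in> space \<gamma>"
      then have "(\<lambda>n. (s n z - h z)\<^sup>2) \<longlonglongrightarrow> (h z - h z)\<^sup>2" by (intro tendsto_intros lim)
      then show "(\<lambda>n. (s n z - h z)\<^sup>2) \<longlonglongrightarrow> 0" by simp
    qed
    show "AE z in \<gamma>. norm ((s n z - h z)\<^sup>2) \<le> 9 * (h z)\<^sup>2" for n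
    proof (rule AE_I2)
      fix z assume "z \<in> space \<gamma>"
      then have "\<bar>s n z - h z\<bar> \<le> 3 * \<bar>h z\<bar>" using bound[of z n] by simp
      then have "\<bar>s n z - h z\<bar>\<^sup>2 \<le> (3 * \<bar>h z\<bar>)\<^sup>2" by (intro power_mono) auto
      then show "norm ((s n z - h z)\<^sup>2) \<le> 9 * (h z)\<^sup>2" by (simp add: power_mult_distrib)
    qed
  qed simp
  then have "eventually (\<lambda>n. (\<integral>z. (s n z - h z)\<^sup>2 \<partial>\<gamma>) < (e / 2)\<^sup>2) sequentially"
    using e by (intro order_tendstoD(2)) auto
  then obtain n where n: "(\<integral>z. (s n z - h z)\<^sup>2 \<partial>\<gamma>) < (e / 2)\<^sup>2"
    by (auto simp: eventually_sequentially)
  obtain t where t: "poly_closure t" "\<forall>z\<in>prob_simplex V. t z = s n z"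
    using poly_closure_simple[OF s] by blast
  have tL2: "t \<in> L2_space \<gamma>" using t by (simp add: poly_closure_def)
  have "(\<integral>z. (t z - h z)\<^sup>2 \<partial>\<gamma>) = (\<integral>z. (s n z - h z)\<^sup>2 \<partial>\<gamma>)"
    using t(2) by (intro Bochner_Integration.integral_cong) auto
  then have "L2_norm \<gamma> (\<lambda>z. t z - h z) < e / 2"
    unfolding L2_norm_def using n e by (intro real_less_lsqrt) auto
  moreover obtain p where p: "polynomial_on V p" "L2_norm \<gamma> (\<lambda>z. p z - t z) < e / 2"
    using poly_closureD[OF t(1), of "e / 2"] e by auto
  ultimately have "L2_norm \<gamma> (\<lambda>z. p z - h z) < e"
    using L2_norm_diff_triangle[OF polynomial_L2[OF p(1)] tL2 h] by linarith
  then show ?thesis using p(1) by blast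
qed

end

section \<open>The spectrum of the Brownian energy process\<close>

context dirichlet_moments
begin

lemma E_monomial_pos: "0 < E (\<lambda>z. \<Prod>i\<in>I. z i ^ k i)" if "I \<noteq> {}"
proof -
  have "0 < sum a I" using finite_I a_pos that by (intro sum_pos) auto
  then show ?thesis
    unfolding E_monomial by (intro divide_pos_pos prod_pos pochhammer_pos a_pos)
qed

lemma E_pair_pos:
  assumes xy: "x \<in> I" "y \<in> I" "x \<noteq> y"
  shows "0 < E (\<lambda>z. (z x * z y) ^ n)"
proof -
  have "(\<Prod>i\<in>I. z i ^ (if i \<in> {x, y} then n else 0)) = (z x * z y) ^ n" for z :: "'i \<Rightarrow> real"
  proof -
    have "(\<Prod>i\<in>I. z i ^ (if i \<in> {x, y} then n else 0)) = (\<Prod>i\<in>I. if i \<in> {x, y} then z i ^ n else 1)"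
      by (intro prod.cong) auto
    also have "\<dots> = (\<Prod>i\<in>I \<inter> {x, y}. z i ^ n)"
      by (rule prod.inter_restrict[OF finite_I, symmetric])
    also have "I \<inter> {x, y} = {x, y}" using xy by auto
    finally show ?thesis using xy(3) by (simp add: power_mult_distrib)
  qed
  then show ?thesis
    using E_monomial_pos[of "\<lambda>i. if i \<in> {x, y} then n else 0"] xy by auto
qed

text \<open>
  Integration by parts moves the derivative from \<open>p\<close> to the test function \<open>q\<close>. Hence if \<open>p\<close> vanishes
  almost everywhere, so does its derivative.
\<close>

lemma null_diff_deriv:
  assumes xy: "x \<in> I" "y \<in> I" and p: "polynomial_on I p" "E (\<lambda>z. (p z)\<^sup>2) = 0" and q: "polynomial_on I q"
  shows "E (\<lambda>z. z x * z y * diff_deriv x y p z * q z) = 0"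
proof -
  let ?D = "diff_deriv x y"
  have pol: "polynomial_on I (\<lambda>z. a y * z x - a x * z y)" "polynomial_on I (\<lambda>z. z x * z y * ?D q z)"
    using xy q by (auto intro!: poly_intros polynomial_on_diff_deriv)
  have "0 = E (\<lambda>z. p z * ((a y * z x - a x * z y) * q z))"
    by (rule E_null_mult[symmetric]) (intro p polynomial_on.mult pol q)+
  also have "\<dots> = E (\<lambda>z. (a y * z x - a x * z y) * (p z * q z))" by (simp add: mult_ac)
  also have "\<dots> = E (\<lambda>z. z x * z y * ?D (\<lambda>z. p z * q z) z)"
    by (intro stein xy polynomial_on.mult p q)
  also have "\<dots> = E (\<lambda>z. z x * z y * ?D p z * q z + p z * (z x * z y * ?D q z))"
    by (simp add: diff_deriv_mult[OF p(1) q] algebra_simps)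
  also have "\<dots> = E (\<lambda>z. z x * z y * ?D p z * q z) + E (\<lambda>z. p z * (z x * z y * ?D q z))"
    by (intro E_add polynomial_on.mult polynomial_on.coord polynomial_on_diff_deriv xy p q)
  also have "E (\<lambda>z. p z * (z x * z y * ?D q z)) = 0"
    by (rule E_null_mult[OF p(1) pol(2) p(2)])
  finally show ?thesis by simp
qed

text \<open>
  A criterion for a quadratic polynomial not to vanish in \<open>L\<^sup>2\<close>. If \<open>p\<close> does, then so do
  \<open>r = z x * z y * D p\<close> and \<open>D r\<close>, and the latter is \<open>z x * z y * b\<close> plus a multiple of \<open>D p\<close>.
\<close>

lemma null_second_diff_deriv:
  assumes xy: "x \<in> I" "y \<in> I" "x \<noteq> y" and p: "polynomial_on I p" "E (\<lambda>z. (p z)\<^sup>2) = 0"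
    and D2: "diff_deriv x y (diff_deriv x y p) = (\<lambda>z. b)"
  shows "b = 0"
proof -
  let ?D = "diff_deriv x y"
  define r where "r = (\<lambda>z. z x * z y * ?D p z)"
  have Dp: "polynomial_on I (?D p)" by (rule polynomial_on_diff_deriv[OF p(1)])
  have r: "polynomial_on I r" unfolding r_def by (intro polynomial_on.mult polynomial_on.coord xy Dp)
  have r_null: "E (\<lambda>z. (r z)\<^sup>2) = 0"
    using null_diff_deriv[OF xy(1,2) p r] by (simp add: r_def power2_eq_square)
  have xyp: "polynomial_on I (\<lambda>z. z x * z y)" by (intro polynomial_on.mult polynomial_on.coord xy)
  have "?D (\<lambda>z. z x * z y) = (\<lambda>z. z y - z x)"
    using xy by (simp add: diff_deriv_mult[OF polynomial_on.coord[OF xy(1)] polynomial_on.coord[OF xy(2)]] diff_deriv_coord)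
  then have "?D r = (\<lambda>z. (z y - z x) * ?D p z + z x * z y * b)"
    unfolding r_def diff_deriv_mult[OF xyp Dp] D2 by simp
  then have "0 = E (\<lambda>z. z x * z y * ((z y - z x) * ?D p z + z x * z y * b))"
    using null_diff_deriv[OF xy(1,2) r r_null polynomial_on.const[of I 1]] by simp
  also have "\<dots> = E (\<lambda>z. r z * (z y - z x) + b * (z x * z y)\<^sup>2)"
    by (simp add: r_def power2_eq_square algebra_simps)
  also have "\<dots> = E (\<lambda>z. r z * (z y - z x)) + b * E (\<lambda>z. (z x * z y)\<^sup>2)"
  proof -
    have 1: "polynomial_on I (\<lambda>z. r z * (z y - z x))"
      by (intro polynomial_on.mult polynomial_on_diff polynomial_on.coord r xy)
    have 2: "polynomial_on I (\<lambda>z. (z x * z y)\<^sup>2)" by (rule polynomial_on_power[OF xyp])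
    show ?thesis unfolding E_add[OF 1 polynomial_on_cmult[OF 2]] E_cmult[OF 2] ..
  qed
  also have "E (\<lambda>z. r z * (z y - z x)) = 0"
    by (rule E_null_mult[OF r _ r_null]) (intro poly_intros xy)
  finally show "b = 0" using E_pair_pos[OF xy, of 2] by simp
qed

end

context dirichlet_prob
begin

abbreviation neg_generator :: "('a \<Rightarrow> 'a \<Rightarrow> real) \<Rightarrow> (('a \<Rightarrow> real) \<Rightarrow> real) \<Rightarrow> ('a \<Rightarrow> real) \<Rightarrow> real" where
  "neg_generator c p \<equiv> (\<lambda>\<zeta>. - bep_generator V c \<alpha> p \<zeta>)"

lemma prob_prob_simplex [simp]: "prob (prob_simplex V) = 1"
  using prob_space by simp

lemma polynomial_on_neg_generator: "polynomial_on V p \<Longrightarrow> polynomial_on V (neg_generator c p)"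
  by (intro polynomial_on_uminus polynomial_on_bep_generator)

lemma neg_generator_diff:
  assumes "polynomial_on V p" "polynomial_on V q"
  shows "neg_generator c (\<lambda>\<zeta>. p \<zeta> - q \<zeta>) = (\<lambda>\<zeta>. neg_generator c p \<zeta> - neg_generator c q \<zeta>)"
  using bep_generator_add[OF assms(1) polynomial_on_cmult[OF assms(2), of "-1"], of c \<alpha>]
    bep_generator_cmult[OF assms(2), of c \<alpha> "-1"] by (simp add: fun_eq_iff)

text \<open>
  The criterion for operators with a core applies because \<open>- L - l\<close> preserves the degree: on each space
  of polynomials of bounded degree, a lower bound gives approximate solvability.
\<close>

lemma resolvent_iff:
  "l \<in> L2_resolvent_set \<gamma> (bep_operator V c \<alpha>) \<longleftrightarrow>
    (\<exists>e>0. \<forall>p. polynomial_on V p \<longrightarrow> e * L2_norm \<gamma> p \<le> L2_norm \<gamma> (\<lambda>\<zeta>. neg_generator c p \<zeta> - l * p \<zeta>))"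
  unfolding bep_operator_def
proof (rule L2_resolvent_set_core)
  fix e d :: real and q
  assume e: "0 < e" "\<And>p. polynomial_on V p \<Longrightarrow> e * L2_norm \<gamma> p \<le> L2_norm \<gamma> (\<lambda>\<zeta>. neg_generator c p \<zeta> - l * p \<zeta>)"
    and q: "polynomial_on V q" and d: "0 < d"
  show "\<exists>p. polynomial_on V p \<and> L2_norm \<gamma> (\<lambda>\<zeta>. (neg_generator c p \<zeta> - l * p \<zeta>) - q \<zeta>) < d"
    unfolding L2_norm_eq_nrm
  proof (rule D.degree_preserving_dense_range[OF _ _ _ _ e(1) _ q d])
    show "poly_deg V n (\<lambda>\<zeta>. neg_generator c p \<zeta> - l * p \<zeta>)" if "poly_deg V n p" for n p
      using poly_deg_cmult[OF poly_deg_bep_generator[OF that, of c \<alpha>], of "-1"]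
      by (intro poly_deg_diff poly_deg_cmult that) simp
    show "e * D.nrm p \<le> D.nrm (\<lambda>\<zeta>. neg_generator c p \<zeta> - l * p \<zeta>)" if "polynomial_on V p" for p
      using e(2)[OF that] by (simp only: L2_norm_eq_nrm)
    fix p r assume p: "polynomial_on V p" and r: "polynomial_on V r"
    show "(\<lambda>\<zeta>. neg_generator c (\<lambda>z. p z + r z) \<zeta> - l * (p \<zeta> + r \<zeta>)) =
        (\<lambda>\<zeta>. (neg_generator c p \<zeta> - l * p \<zeta>) + (neg_generator c r \<zeta> - l * r \<zeta>))"
      by (simp add: bep_generator_add[OF p r] fun_eq_iff algebra_simps)
    have pr: "polynomial_on V (\<lambda>\<zeta>. r \<zeta> * neg_generator c p \<zeta>)" "polynomial_on V (\<lambda>\<zeta>. p \<zeta> * neg_generator c r \<zeta>)"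
      "polynomial_on V (\<lambda>\<zeta>. r \<zeta> * p \<zeta>)"
      by (intro polynomial_on.mult polynomial_on_neg_generator p r)+
    have "(\<integral>\<zeta>. r \<zeta> * (neg_generator c p \<zeta> - l * p \<zeta>) \<partial>\<gamma>) =
        (\<integral>\<zeta>. r \<zeta> * neg_generator c p \<zeta> \<partial>\<gamma>) - l * (\<integral>\<zeta>. r \<zeta> * p \<zeta> \<partial>\<gamma>)"
      using D.E_diff[OF pr(1) polynomial_on_cmult[OF pr(3), of l]] by (simp add: right_diff_distrib mult.left_commute)
    also have "(\<integral>\<zeta>. r \<zeta> * neg_generator c p \<zeta> \<partial>\<gamma>) = (\<integral>\<zeta>. p \<zeta> * neg_generator c r \<zeta> \<partial>\<gamma>)"
      by (rule D.bep_generator_symmetric[OF p r])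
    also have "(\<integral>\<zeta>. p \<zeta> * neg_generator c r \<zeta> \<partial>\<gamma>) - l * (\<integral>\<zeta>. r \<zeta> * p \<zeta> \<partial>\<gamma>) =
        (\<integral>\<zeta>. p \<zeta> * (neg_generator c r \<zeta> - l * r \<zeta>) \<partial>\<gamma>)"
      using D.E_diff[OF pr(2) polynomial_on_cmult[OF pr(3), of l]] by (simp add: right_diff_distrib mult_ac)
    finally show "(\<integral>\<zeta>. r \<zeta> * (neg_generator c p \<zeta> - l * p \<zeta>) \<partial>\<gamma>) = (\<integral>\<zeta>. p \<zeta> * (neg_generator c r \<zeta> - l * r \<zeta>) \<partial>\<gamma>)" .
  next
    fix p b assume p: "polynomial_on V p"
    show "(\<lambda>\<zeta>. neg_generator c (\<lambda>z. b * p z) \<zeta> - l * (b * p \<zeta>)) = (\<lambda>\<zeta>. b * (neg_generator c p \<zeta> - l * p \<zeta>))"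
      by (simp add: bep_generator_cmult[OF p] fun_eq_iff algebra_simps)
  qed
qed (rule polynomial_L2 polynomial_on_diff polynomial_on_neg_generator neg_generator_diff polynomials_dense; assumption)+

lemma polynomial_eigenvalue_in_spectrum:
  assumes p: "polynomial_on V p" and nz: "(\<integral>\<zeta>. (p \<zeta>)\<^sup>2 \<partial>\<gamma>) \<noteq> 0"
    and eig: "\<And>\<zeta>. \<zeta> \<in> prob_simplex V \<Longrightarrow> neg_generator c p \<zeta> = l * p \<zeta>"
  shows "l \<in> L2_spectrum \<gamma> (bep_operator V c \<alpha>)"
proof -
  have "L2_norm \<gamma> (\<lambda>\<zeta>. neg_generator c p \<zeta> - l * p \<zeta>) = L2_norm \<gamma> (\<lambda>\<zeta>. 0)"
    unfolding L2_norm_def using eig by (intro arg_cong[where f = sqrt] Bochner_Integration.integral_cong) auto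
  then have 0: "L2_norm \<gamma> (\<lambda>\<zeta>. neg_generator c p \<zeta> - l * p \<zeta>) = 0" by (simp add: L2_norm_def)
  have "L2_norm \<gamma> p > 0"
    using nz D.E_sq_nonneg[OF p] by (simp add: L2_norm_def less_le)
  then have "\<not> e * L2_norm \<gamma> p \<le> L2_norm \<gamma> (\<lambda>\<zeta>. neg_generator c p \<zeta> - l * p \<zeta>)" if "e > 0" for e
    using that 0 by (simp add: not_le)
  then have "l \<notin> L2_resolvent_set \<gamma> (bep_operator V c \<alpha>)"
    unfolding resolvent_iff using p by blast
  then show ?thesis by (simp add: L2_spectrum_def)
qed

text \<open>
  A Poincare inequality with constant \<open>b\<close> makes \<open>- L - l\<close> bounded below for every \<open>l < b\<close> other than
  zero: on mean zero functions by \<open>b - l\<close>, on constants by \<open>\<bar>l\<bar>\<close>, and the two parts are orthogonal.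
\<close>

lemma resolvent_below_poincare:
  assumes poincare: "\<And>f. polynomial_on V f \<Longrightarrow> (\<integral>\<zeta>. f \<zeta> \<partial>\<gamma>) = 0 \<Longrightarrow>
      b * (\<integral>\<zeta>. (f \<zeta>)\<^sup>2 \<partial>\<gamma>) \<le> (\<integral>\<zeta>. f \<zeta> * neg_generator c f \<zeta> \<partial>\<gamma>)"
    and l: "l < b" "l \<noteq> 0"
  shows "l \<in> L2_resolvent_set \<gamma> (bep_operator V c \<alpha>)"
  unfolding resolvent_iff
proof (intro exI conjI allI impI)
  let ?e = "min (b - l) \<bar>l\<bar>"
  show "0 < ?e" using l by simp
  fix p assume p: "polynomial_on V p"
  define m where "m = (\<integral>\<zeta>. p \<zeta> \<partial>\<gamma>)"
  define f where "f = (\<lambda>\<zeta>. p \<zeta> - m)"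
  have f: "polynomial_on V f" unfolding f_def by (intro poly_intros p)
  have f0: "(\<integral>\<zeta>. f \<zeta> \<partial>\<gamma>) = 0"
    using D.E_diff[OF p polynomial_on.const[of V m]] by (simp add: f_def m_def prob_space)
  define g where "g = (\<lambda>\<zeta>. neg_generator c f \<zeta> - l * f \<zeta>)"
  have Lf: "polynomial_on V (neg_generator c f)" by (rule polynomial_on_neg_generator[OF f])
  have g: "polynomial_on V g" unfolding g_def by (intro polynomial_on_diff polynomial_on_cmult Lf f)
  have L1: "bep_generator V c \<alpha> (\<lambda>\<zeta>. 1) = (\<lambda>\<zeta>. 0)" by (simp add: bep_generator_def fun_eq_iff)
  have Lm: "bep_generator V c \<alpha> (\<lambda>\<zeta>. m) = (\<lambda>\<zeta>. 0)" by (simp add: bep_generator_def fun_eq_iff)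
  have Lp: "neg_generator c p = neg_generator c f"
    using neg_generator_diff[OF p polynomial_on.const[of V m], of c] by (simp add: f_def Lm fun_eq_iff)
  have g0: "(\<integral>\<zeta>. g \<zeta> \<partial>\<gamma>) = 0"
    using D.E_diff[OF Lf polynomial_on_cmult[OF f, of l]] D.bep_generator_symmetric[OF f polynomial_on.const[of V 1], of c] f0
    by (simp add: g_def L1)
  have split: "(\<integral>\<zeta>. (h \<zeta> + r)\<^sup>2 \<partial>\<gamma>) = (D.nrm h)\<^sup>2 + r\<^sup>2"
    if h: "polynomial_on V h" "(\<integral>\<zeta>. h \<zeta> \<partial>\<gamma>) = 0" for h r
  proof -
    have "(\<integral>\<zeta>. (h \<zeta> + r)\<^sup>2 \<partial>\<gamma>) = (\<integral>\<zeta>. (h \<zeta>)\<^sup>2 + ((2 * r) * h \<zeta> + r\<^sup>2) \<partial>\<gamma>)"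
      by (intro Bochner_Integration.integral_cong) (simp_all add: power2_sum algebra_simps)
    also have "\<dots> = (\<integral>\<zeta>. (h \<zeta>)\<^sup>2 \<partial>\<gamma>) + ((2 * r) * (\<integral>\<zeta>. h \<zeta> \<partial>\<gamma>) + r\<^sup>2)"
      using D.E_add[OF polynomial_on_power[OF h(1), of 2] polynomial_on.add[OF polynomial_on_cmult[OF h(1), of "2 * r"] polynomial_on.const[of V "r\<^sup>2"]]]
        D.E_add[OF polynomial_on_cmult[OF h(1), of "2 * r"] polynomial_on.const[of V "r\<^sup>2"]]
      by (simp add: prob_space)
    finally show ?thesis using D.nrm_square[OF h(1)] h(2) by simp
  qed
  have "(b - l) * D.nrm f \<le> D.nrm g"
  proof (cases "D.nrm f = 0")
    case True
    then show ?thesis using D.nrm_nonneg[OF g] by simp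
  next
    case False
    then have pos: "D.nrm f > 0" using D.nrm_nonneg[OF f] by simp
    have "(\<integral>\<zeta>. f \<zeta> * g \<zeta> \<partial>\<gamma>) = (\<integral>\<zeta>. f \<zeta> * neg_generator c f \<zeta> \<partial>\<gamma>) - l * (\<integral>\<zeta>. (f \<zeta>)\<^sup>2 \<partial>\<gamma>)"
      using D.E_diff[OF polynomial_on.mult[OF f Lf] polynomial_on_cmult[OF polynomial_on_power[OF f, of 2], of l]]
      by (simp add: g_def power2_eq_square algebra_simps)
    then have "(b - l) * (D.nrm f)\<^sup>2 \<le> (\<integral>\<zeta>. f \<zeta> * g \<zeta> \<partial>\<gamma>)"
      using poincare[OF f f0] D.nrm_square[OF f] by (simp add: algebra_simps)
    also have "\<dots> \<le> sqrt ((D.nrm f)\<^sup>2 * (D.nrm g)\<^sup>2)"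
      using D.Cauchy_Schwarz[OF f g] D.nrm_square[OF f] D.nrm_square[OF g] by (intro real_le_rsqrt) simp
    also have "\<dots> = D.nrm f * D.nrm g"
      using D.nrm_nonneg[OF f] D.nrm_nonneg[OF g] by (simp add: real_sqrt_mult)
    finally have "D.nrm f * ((b - l) * D.nrm f) \<le> D.nrm f * D.nrm g"
      by (simp add: power2_eq_square mult_ac)
    then show ?thesis using pos by simp
  qed
  then have "?e * D.nrm f \<le> D.nrm g"
    using mult_right_mono[of ?e "b - l" "D.nrm f"] D.nrm_nonneg[OF f] by simp
  then have 1: "(?e * D.nrm f)\<^sup>2 \<le> (D.nrm g)\<^sup>2"
    using \<open>0 < ?e\<close> D.nrm_nonneg[OF f] by (intro power_mono) auto
  have 2: "(?e * m)\<^sup>2 \<le> (l * m)\<^sup>2"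
    using \<open>0 < ?e\<close> by (simp add: power_mult_distrib mult_right_mono abs_le_square_iff[symmetric])
  show "?e * L2_norm \<gamma> p \<le> L2_norm \<gamma> (\<lambda>\<zeta>. neg_generator c p \<zeta> - l * p \<zeta>)"
  proof (rule power2_le_imp_le)
    have "(?e * L2_norm \<gamma> p)\<^sup>2 = ?e\<^sup>2 * (\<integral>\<zeta>. (f \<zeta> + m)\<^sup>2 \<partial>\<gamma>)"
      by (simp add: power_mult_distrib L2_norm_square f_def)
    also have "\<dots> = (?e * D.nrm f)\<^sup>2 + (?e * m)\<^sup>2"
      by (simp only: split[OF f f0] power_mult_distrib distrib_left)
    also have "\<dots> \<le> (D.nrm g)\<^sup>2 + (- (l * m))\<^sup>2" using 1 2 by simp
    also have "\<dots> = (\<integral>\<zeta>. (g \<zeta> + - (l * m))\<^sup>2 \<partial>\<gamma>)" by (simp only: split[OF g g0])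
    also have "\<dots> = (L2_norm \<gamma> (\<lambda>\<zeta>. neg_generator c p \<zeta> - l * p \<zeta>))\<^sup>2"
    proof -
      have "bep_generator V c \<alpha> f \<zeta> = bep_generator V c \<alpha> p \<zeta>" for \<zeta>
        using fun_cong[OF Lp, of \<zeta>] by simp
      then have "g \<zeta> + - (l * m) = neg_generator c p \<zeta> - l * p \<zeta>" for \<zeta>
        unfolding g_def by (simp add: f_def algebra_simps)
      then show ?thesis by (simp only: L2_norm_square)
    qed
    finally show "(?e * L2_norm \<gamma> p)\<^sup>2 \<le> (L2_norm \<gamma> (\<lambda>\<zeta>. neg_generator c p \<zeta> - l * p \<zeta>))\<^sup>2" .
  qed (rule L2_norm_nonneg)
qed

lemma resolvent_open:
  assumes "l \<in> L2_resolvent_set \<gamma> (bep_operator V c \<alpha>)"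
  shows "\<exists>d>0. \<forall>k. \<bar>k - l\<bar> < d \<longrightarrow> k \<in> L2_resolvent_set \<gamma> (bep_operator V c \<alpha>)"
proof -
  obtain e where e: "e > 0" "\<And>p. polynomial_on V p \<Longrightarrow> e * L2_norm \<gamma> p \<le> L2_norm \<gamma> (\<lambda>\<zeta>. neg_generator c p \<zeta> - l * p \<zeta>)"
    using assms unfolding resolvent_iff by blast
  have "k \<in> L2_resolvent_set \<gamma> (bep_operator V c \<alpha>)" if k: "\<bar>k - l\<bar> < e / 2" for k
    unfolding resolvent_iff
  proof (intro exI[of _ "e / 2"] conjI allI impI)
    fix p assume p: "polynomial_on V p"
    have A: "(\<lambda>\<zeta>. neg_generator c p \<zeta> - k * p \<zeta>) \<in> L2_space \<gamma>"
      by (intro polynomial_L2 polynomial_on_diff polynomial_on_cmult polynomial_on_neg_generator p)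
    have "L2_norm \<gamma> (\<lambda>\<zeta>. (neg_generator c p \<zeta> - k * p \<zeta>) + (k - l) * p \<zeta>) \<le>
        L2_norm \<gamma> (\<lambda>\<zeta>. neg_generator c p \<zeta> - k * p \<zeta>) + \<bar>k - l\<bar> * L2_norm \<gamma> p"
      using L2_norm_triangle[OF A L2_space_cmult[OF polynomial_L2[OF p], of "k - l"]] by (simp add: L2_norm_cmult)
    moreover have "(\<lambda>\<zeta>. (neg_generator c p \<zeta> - k * p \<zeta>) + (k - l) * p \<zeta>) = (\<lambda>\<zeta>. neg_generator c p \<zeta> - l * p \<zeta>)"
      by (simp add: fun_eq_iff algebra_simps)
    moreover have "\<bar>k - l\<bar> * L2_norm \<gamma> p \<le> e / 2 * L2_norm \<gamma> p"
      using k by (intro mult_right_mono L2_norm_nonneg) simp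
    ultimately show "e / 2 * L2_norm \<gamma> p \<le> L2_norm \<gamma> (\<lambda>\<zeta>. neg_generator c p \<zeta> - k * p \<zeta>)"
      using e(2)[OF p] by (simp add: algebra_simps)
  qed (use e in simp)
  then show ?thesis using e(1) by (intro exI[of _ "e / 2"]) auto
qed

text \<open>
  The spectrum is closed and has no point in a punctured neighbourhood of zero or below zero, so
  its nonzero part, if not empty, has a least element.
\<close>

lemma gap_BEP_properties:
  assumes b: "0 < b"
    and poincare: "\<And>f. polynomial_on V f \<Longrightarrow> (\<integral>\<zeta>. f \<zeta> \<partial>\<gamma>) = 0 \<Longrightarrow>
      b * (\<integral>\<zeta>. (f \<zeta>)\<^sup>2 \<partial>\<gamma>) \<le> (\<integral>\<zeta>. f \<zeta> * neg_generator c f \<zeta> \<partial>\<gamma>)"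
    and k: "k \<in> L2_spectrum \<gamma> (bep_operator V c \<alpha>)" "k \<noteq> 0"
  shows "b \<le> gap_BEP V c \<alpha>" "gap_BEP V c \<alpha> \<le> k"
proof -
  define X where "X = {l. l \<in> L2_spectrum \<gamma> (bep_operator V c \<alpha>) \<and> l \<noteq> 0}"
  have lower: "b \<le> l" if "l \<in> X" for l
    using resolvent_below_poincare[OF poincare, of l] that by (force simp: X_def L2_spectrum_def)
  have kX: "k \<in> X" using k by (simp add: X_def)
  have bdd: "bdd_below X" using lower by (auto simp: bdd_below_def)
  define m where "m = Inf X"
  have m_le: "m \<le> l" if "l \<in> X" for l unfolding m_def by (rule cInf_lower[OF that bdd])
  have "m \<in> L2_spectrum \<gamma> (bep_operator V c \<alpha>)"
  proof (rule ccontr)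
    assume "m \<notin> L2_spectrum \<gamma> (bep_operator V c \<alpha>)"
    then have "m \<in> L2_resolvent_set \<gamma> (bep_operator V c \<alpha>)" by (simp add: L2_spectrum_def)
    then obtain d where d: "d > 0" "\<And>l. \<bar>l - m\<bar> < d \<Longrightarrow> l \<in> L2_resolvent_set \<gamma> (bep_operator V c \<alpha>)"
      using resolvent_open by blast
    have "\<exists>l\<in>X. l < m + d"
      unfolding m_def by (rule cInf_lessD) (use kX d m_def in auto)
    then obtain l where l: "l \<in> X" "l < m + d" by blast
    then have "l \<in> L2_resolvent_set \<gamma> (bep_operator V c \<alpha>)" using m_le[OF l(1)] by (intro d) auto
    then show False using l by (simp add: X_def L2_spectrum_def)
  qed
  moreover have "b \<le> m" unfolding m_def by (rule cInf_greatest) (use kX lower in auto)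
  ultimately have mX: "m \<in> X" using b by (simp add: X_def)
  have "gap_BEP V c \<alpha> = m"
    unfolding gap_BEP_def by (rule Least_equality) (use mX m_le in \<open>auto simp: X_def\<close>)
  then show "b \<le> gap_BEP V c \<alpha>" "gap_BEP V c \<alpha> \<le> k" using \<open>b \<le> m\<close> m_le[OF kX] by simp_all
qed

end

section \<open>The random walk\<close>

lemma connected_weighted_graphD:
  assumes "connected_weighted_graph V c"
  shows "finite V" "V \<noteq> {}" "2 \<le> card V" "x \<in> V \<Longrightarrow> y \<in> V \<Longrightarrow> c x y = c y x"
    "x \<in> V \<Longrightarrow> y \<in> V \<Longrightarrow> 0 \<le> c x y" "x \<in> V \<Longrightarrow> c x x = 0"
  using assms by (auto simp: connected_weighted_graph_def)

text \<open>Functions that are linear in the coordinates form a copy of the random walk.\<close>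

lemma diff_deriv_linear:
  assumes V: "finite V" and xy: "x \<in> V" "y \<in> V"
  shows "diff_deriv x y (\<lambda>\<zeta>. \<Sum>w\<in>V. g w * \<zeta> w) = (\<lambda>\<zeta>. g x - g y)"
proof -
  have P: "polynomial_on V (\<lambda>\<zeta>. g w * \<zeta> w)" if "w \<in> V" for w
    using that by (intro polynomial_on_cmult polynomial_on.coord)
  have D: "diff_deriv x y (\<lambda>\<zeta>. g w * \<zeta> w) = (\<lambda>\<zeta>. g w * ((if x = w then 1 else 0) - (if y = w then 1 else 0)))"
    if "w \<in> V" for w
    using diff_deriv_cmult[OF polynomial_on.coord[OF that], of x y "g w"] by (simp add: diff_deriv_coord)
  have "diff_deriv x y (\<lambda>\<zeta>. \<Sum>w\<in>V. g w * \<zeta> w) = (\<lambda>\<zeta>. \<Sum>w\<in>V. diff_deriv x y (\<lambda>\<zeta>. g w * \<zeta> w) \<zeta>)"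
    using P by (rule diff_deriv_sum)
  also have "\<dots> = (\<lambda>\<zeta>. \<Sum>w\<in>V. (if x = w then g w else 0) - (if y = w then g w else 0))"
    by (intro ext sum.cong refl) (auto simp: D)
  also have "\<dots> = (\<lambda>\<zeta>. g x - g y)"
    using V xy by (simp add: sum_subtractf)
  finally show ?thesis .
qed

lemma bep_generator_linear:
  assumes graph: "connected_weighted_graph V c"
  shows "bep_generator V c \<alpha> (\<lambda>\<zeta>. \<Sum>w\<in>V. g w * \<zeta> w) \<zeta> = (\<Sum>x\<in>V. rw_generator V c \<alpha> g x * \<zeta> x)"
proof -
  note G = connected_weighted_graphD[OF graph]
  define T where "T x y = c x y * \<alpha> y * (g y - g x) * \<zeta> x" for x y
  have "bep_generator V c \<alpha> (\<lambda>\<zeta>. \<Sum>w\<in>V. g w * \<zeta> w) \<zeta> = 1 / 2 * (\<Sum>x\<in>V. \<Sum>y\<in>V. T x y + T y x)"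
    unfolding bep_generator_def
  proof (intro arg_cong2[where f = "(*)"] refl sum.cong)
    fix x y assume xy: "x \<in> V" "y \<in> V"
    show "c x y * (- (\<alpha> y * \<zeta> x - \<alpha> x * \<zeta> y) * diff_deriv x y (\<lambda>\<zeta>. \<Sum>w\<in>V. g w * \<zeta> w) \<zeta> +
        \<zeta> x * \<zeta> y * diff_deriv x y (diff_deriv x y (\<lambda>\<zeta>. \<Sum>w\<in>V. g w * \<zeta> w)) \<zeta>) = T x y + T y x"
      unfolding diff_deriv_linear[OF G(1) xy] T_def G(4)[OF xy(2,1)] by (simp add: algebra_simps)
  qed
  also have "(\<Sum>x\<in>V. \<Sum>y\<in>V. T x y + T y x) = 2 * (\<Sum>x\<in>V. \<Sum>y\<in>V. T x y)"
    by (simp add: sum.distrib sum.swap[of "\<lambda>x y. T y x"])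
  finally show ?thesis by (simp add: rw_generator_def T_def sum_distrib_right)
qed

context dirichlet_prob
begin

text \<open>
  The constant \<open>g x - g y\<close> is a derivative of the linear function.
\<close>

lemma linear_null_constant:
  assumes null: "(\<integral>\<zeta>. (\<Sum>w\<in>V. g w * \<zeta> w)\<^sup>2 \<partial>\<gamma>) = 0" and xy: "x \<in> V" "y \<in> V"
  shows "g x = g y"
proof (cases "x = y")
  case False
  have p: "polynomial_on V (\<lambda>\<zeta>. \<Sum>w\<in>V. g w * \<zeta> w)"
    by (intro polynomial_on_sum polynomial_on_cmult polynomial_on.coord)
  have xyp: "polynomial_on V (\<lambda>\<zeta>. \<zeta> x * \<zeta> y)" using xy by (intro polynomial_on.mult polynomial_on.coord)
  have "(\<integral>\<zeta>. \<zeta> x * \<zeta> y * (g x - g y) * 1 \<partial>\<gamma>) = 0"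
    using D.null_diff_deriv[OF xy p null polynomial_on.const[of V 1]]
    unfolding diff_deriv_linear[OF finite_V xy] .
  then have "(g x - g y) * (\<integral>\<zeta>. \<zeta> x * \<zeta> y \<partial>\<gamma>) = 0" by auto
  moreover have "(\<integral>\<zeta>. \<zeta> x * \<zeta> y \<partial>\<gamma>) > 0" using D.E_pair_pos[OF xy False, of 1] by simp
  ultimately show ?thesis by auto
qed simp

lemma rw_eigenvalue_in_spectrum:
  assumes graph: "connected_weighted_graph V c" and l: "l \<in> rw_eigenvalues V c \<alpha>" "l \<noteq> 0"
  shows "l \<in> L2_spectrum \<gamma> (bep_operator V c \<alpha>)"
proof -
  obtain g where g: "\<exists>x\<in>V. g x \<noteq> 0" "\<And>x. x \<in> V \<Longrightarrow> - rw_generator V c \<alpha> g x = l * g x"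
    using l unfolding rw_eigenvalues_def by blast
  show ?thesis
  proof (rule polynomial_eigenvalue_in_spectrum)
    show "polynomial_on V (\<lambda>\<zeta>. \<Sum>w\<in>V. g w * \<zeta> w)"
      by (intro polynomial_on_sum polynomial_on_cmult polynomial_on.coord)
    show "neg_generator c (\<lambda>\<zeta>. \<Sum>w\<in>V. g w * \<zeta> w) \<zeta> = l * (\<Sum>w\<in>V. g w * \<zeta> w)" for \<zeta>
    proof -
      have "neg_generator c (\<lambda>\<zeta>. \<Sum>w\<in>V. g w * \<zeta> w) \<zeta> = (\<Sum>x\<in>V. - rw_generator V c \<alpha> g x * \<zeta> x)"
        by (simp add: bep_generator_linear[OF graph] sum_negf)
      also have "\<dots> = (\<Sum>x\<in>V. l * g x * \<zeta> x)" by (intro sum.cong) (simp_all add: g(2))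
      finally show ?thesis by (simp add: sum_distrib_left mult.assoc)
    qed
    show "(\<integral>\<zeta>. (\<Sum>w\<in>V. g w * \<zeta> w)\<^sup>2 \<partial>\<gamma>) \<noteq> 0"
    proof
      assume null: "(\<integral>\<zeta>. (\<Sum>w\<in>V. g w * \<zeta> w)\<^sup>2 \<partial>\<gamma>) = 0"
      obtain x where x: "x \<in> V" "g x \<noteq> 0" using g(1) by blast
      have "rw_generator V c \<alpha> g x = 0"
        unfolding rw_generator_def using linear_null_constant[OF null _ x(1)] by (intro sum.neutral) simp
      then show False using g(2)[OF x(1)] x(2) l(2) by simp
    qed
  qed
qed

text \<open>
  The minimum of the Rayleigh quotient over mean zero functions is attained by compactness, and a
  minimiser is an eigenfunction.
\<close>

lemma rw_least_nonzero_eigenvalue: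
  assumes graph: "connected_weighted_graph V c"
    and poincare: "\<And>f. polynomial_on V f \<Longrightarrow> (\<integral>\<zeta>. f \<zeta> \<partial>\<gamma>) = 0 \<Longrightarrow>
      b * (\<integral>\<zeta>. (f \<zeta>)\<^sup>2 \<partial>\<gamma>) \<le> (\<integral>\<zeta>. f \<zeta> * neg_generator c f \<zeta> \<partial>\<gamma>)"
    and b: "0 < b"
  shows "gap_RW V c \<alpha> \<in> rw_eigenvalues V c \<alpha>" "gap_RW V c \<alpha> \<noteq> 0"
proof -
  note G = connected_weighted_graphD[OF graph]
  define A where "A f x = - rw_generator V c \<alpha> f x" for f x
  define ip where "ip f h = (\<Sum>x\<in>V. \<alpha> x * (f x * h x))" for f h
  have ip_commute: "ip f h = ip h f" for f h by (simp add: ip_def mult.commute)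
  have ip_add: "ip f (\<lambda>x. s * g x + t * h x) = s * ip f g + t * ip f h" for f g h s t
    by (simp add: ip_def distrib_left sum.distrib sum_distrib_left mult_ac)
  have A_lin: "A (\<lambda>x. s * g x + t * h x) = (\<lambda>x. s * A g x + t * A h x)" for g h s t
  proof
    fix x
    have "rw_generator V c \<alpha> (\<lambda>x. s * g x + t * h x) x = s * rw_generator V c \<alpha> g x + t * rw_generator V c \<alpha> h x"
      unfolding rw_generator_def sum_distrib_left sum.distrib[symmetric]
      by (intro sum.cong) (simp_all add: algebra_simps)
    then show "A (\<lambda>x. s * g x + t * h x) x = s * A g x + t * A h x" by (simp add: A_def)
  qed
  have A_sym: "ip f (A h) = ip h (A f)" for f h
  proof -
    have 1: "ip f (A h) = (\<Sum>x\<in>V. \<Sum>y\<in>V. c x y * \<alpha> x * \<alpha> y * (f x * h x - f x * h y))" for f h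
      unfolding ip_def A_def rw_generator_def sum_negf[symmetric] sum_distrib_left
      by (intro sum.cong refl) (simp add: algebra_simps)
    have "ip f (A h) - ip h (A f) = (\<Sum>x\<in>V. \<Sum>y\<in>V. c x y * \<alpha> x * \<alpha> y * (h x * f y)) - (\<Sum>x\<in>V. \<Sum>y\<in>V. c x y * \<alpha> x * \<alpha> y * (f x * h y))"
      unfolding 1 sum_subtractf[symmetric] by (intro sum.cong refl) (simp add: algebra_simps)
    also have "(\<Sum>x\<in>V. \<Sum>y\<in>V. c x y * \<alpha> x * \<alpha> y * (h x * f y)) = (\<Sum>y\<in>V. \<Sum>x\<in>V. c x y * \<alpha> x * \<alpha> y * (h x * f y))"
      by (rule sum.swap)
    also have "\<dots> = (\<Sum>x\<in>V. \<Sum>y\<in>V. c x y * \<alpha> x * \<alpha> y * (f x * h y))"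
      by (intro sum.cong refl) (simp add: G(4) mult_ac)
    finally show ?thesis by simp
  qed
  have A1: "A (\<lambda>_. 1) = (\<lambda>_. 0)" by (simp add: A_def rw_generator_def fun_eq_iff)
  define \<Phi> where "\<Phi> f = ip f f" for f
  define S where "S = {f. \<Phi> f = 1} \<inter> {f. ip f (\<lambda>_. 1) = 0}"
  define K where "K = (\<Sum>x\<in>V. 1 / \<alpha> x) + 1"
  define box where "box = (\<Pi>\<^sub>E x\<in>UNIV. if x \<in> V then {- K..K} else {0 :: real})"
  have cont: "continuous_on UNIV (\<lambda>f :: 'a \<Rightarrow> real. ip f f)" "continuous_on UNIV (\<lambda>f :: 'a \<Rightarrow> real. ip f (\<lambda>_. 1))"
    "continuous_on UNIV (\<lambda>f :: 'a \<Rightarrow> real. ip f (A f))"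
    unfolding ip_def A_def rw_generator_def by (intro continuous_intros continuous_on_product_coordinates)+
  have "compact box"
  proof -
    have "compactin (product_topology (\<lambda>i. euclidean) UNIV) box"
      unfolding box_def compactin_PiE by auto
    then show ?thesis by (simp add: euclidean_product_topology)
  qed
  moreover have "closed S"
    unfolding S_def \<Phi>_def
    by (intro closed_Int closed_Collect_eq cont continuous_on_const)
  ultimately have comp: "compact (box \<inter> S)" by (rule compact_Int_closed)
  have ip_cong: "ip f h = ip f' h'" if "\<And>x. x \<in> V \<Longrightarrow> f x = f' x" "\<And>x. x \<in> V \<Longrightarrow> h x = h' x" for f f' h h'
    unfolding ip_def using that by (intro sum.cong) auto
  have A_cong: "A f x = A f' x" if "\<And>x. x \<in> V \<Longrightarrow> f x = f' x" "x \<in> V" for f f' x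
    unfolding A_def rw_generator_def using that by (intro arg_cong[where f = uminus] sum.cong) auto
  have ipA_cong: "ip f (A f) = ip f' (A f')" if "\<And>x. x \<in> V \<Longrightarrow> f x = f' x" for f f'
    using that A_cong[OF that] by (intro ip_cong)
  have \<Phi>_nonneg: "0 \<le> \<Phi> f" for f
    unfolding \<Phi>_def ip_def by (intro sum_nonneg mult_nonneg_nonneg[OF less_imp_le[OF \<alpha>_pos] zero_le_square])
  have \<Phi>_zero: "f x = 0" if "\<Phi> f = 0" "x \<in> V" for f x
  proof -
    have "\<alpha> x * (f x * f x) = 0"
      using that G(1) sum_nonneg_eq_0_iff[of V "\<lambda>x. \<alpha> x * (f x * f x)"] \<alpha>_pos less_imp_le[OF \<alpha>_pos]
      by (auto simp: \<Phi>_def ip_def)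
    then show ?thesis using \<alpha>_pos[OF that(2)] by simp
  qed
  have \<Phi>_scale: "\<Phi> (\<lambda>x. s * f x) = s\<^sup>2 * \<Phi> f" for s f
    by (simp add: \<Phi>_def ip_def sum_distrib_left power2_eq_square mult_ac)
  define cut where "cut f = (\<lambda>x. if x \<in> V then f x else (0 :: real))" for f :: "'a \<Rightarrow> real"
  have in_S: "cut f \<in> box \<inter> S" if f: "\<Phi> f = 1" "ip f (\<lambda>_. 1) = 0" for f
  proof
    show "cut f \<in> S"
      using f ip_cong[of "cut f" f "cut f" f] ip_cong[of "cut f" f "\<lambda>_. 1" "\<lambda>_. 1"] by (simp add: S_def \<Phi>_def cut_def)
    have "- K \<le> f x \<and> f x \<le> K" if x: "x \<in> V" for x
    proof -
      have "\<alpha> x * (f x * f x) \<le> \<Phi> f"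
        unfolding \<Phi>_def ip_def using G(1) x
        by (intro member_le_sum mult_nonneg_nonneg[OF less_imp_le[OF \<alpha>_pos] zero_le_square]) auto
      then have "(f x)\<^sup>2 \<le> 1 / \<alpha> x" using f \<alpha>_pos[OF x] by (simp add: field_simps power2_eq_square)
      also have "\<dots> \<le> (\<Sum>x\<in>V. 1 / \<alpha> x)"
        using G(1) x by (intro member_le_sum divide_nonneg_pos \<alpha>_pos) auto
      finally have le: "(f x)\<^sup>2 \<le> K - 1" by (simp add: K_def)
      have "\<bar>f x\<bar> \<le> K"
      proof (rule ccontr)
        assume "\<not> \<bar>f x\<bar> \<le> K"
        moreover have "1 \<le> K" using le zero_le_power2[of "f x"] by linarith
        ultimately have "1 * K \<le> \<bar>f x\<bar> * \<bar>f x\<bar>" by (intro mult_mono) auto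
        then show False using le by (simp add: power2_eq_square)
      qed
      then show ?thesis by linarith
    qed
    moreover have "0 \<le> K" unfolding K_def using \<alpha>_pos
      by (intro add_nonneg_nonneg sum_nonneg divide_nonneg_pos) auto
    ultimately show "cut f \<in> box" by (auto simp: box_def cut_def)
  qed
  obtain x y where xy: "x \<in> V" "y \<in> V" "x \<noteq> y"
  proof -
    have "\<not> card V \<le> Suc 0" using G(3) by simp
    then show ?thesis using that G(1) by (auto simp: card_le_Suc0_iff_eq)
  qed
  have "box \<inter> S \<noteq> {}"
  proof -
    have nz: "\<alpha> x \<noteq> 0" "\<alpha> y \<noteq> 0" using \<alpha>_pos[OF xy(1)] \<alpha>_pos[OF xy(2)] by auto
    define h where "h w = (if w = x then 1 / \<alpha> x else if w = y then - 1 / \<alpha> y else 0)" for w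
    have "ip h (\<lambda>_. 1) = (\<Sum>w\<in>V. (if w = x then 1 else 0) - (if w = y then 1 else 0))"
      unfolding ip_def h_def using xy nz by (intro sum.cong) auto
    also have "\<dots> = 0" using xy G(1) by (simp add: sum_subtractf)
    finally have h0: "ip h (\<lambda>_. 1) = 0" .
    have "\<Phi> h \<noteq> 0" using \<Phi>_zero[of h x] xy nz by (auto simp: h_def)
    then have "\<Phi> h > 0" using \<Phi>_nonneg[of h] by simp
    define s where "s = 1 / sqrt (\<Phi> h)"
    have "s\<^sup>2 * \<Phi> h = 1" using \<open>\<Phi> h > 0\<close> by (simp add: s_def power_divide)
    then have "\<Phi> (\<lambda>w. s * h w) = 1" by (simp only: \<Phi>_scale)
    moreover have "ip (\<lambda>w. s * h w) (\<lambda>_. 1) = 0"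
      using ip_add[of "\<lambda>_. 1" s h 0 h] h0 by (simp add: ip_commute)
    ultimately show ?thesis using in_S by blast
  qed
  from continuous_attains_inf[OF comp this continuous_on_subset[OF cont(3)]]
  obtain f where f: "f \<in> box \<inter> S" and f_min: "\<And>h. h \<in> box \<inter> S \<Longrightarrow> ip f (A f) \<le> ip h (A h)" by auto
  define \<mu> where "\<mu> = ip f (A f)"
  have f1: "\<Phi> f = 1" "ip f (\<lambda>_. 1) = 0" using f by (auto simp: S_def)
  have rayleigh: "\<mu> * \<Phi> h \<le> ip h (A h)" if h: "ip h (\<lambda>_. 1) = 0" for h
  proof (cases "\<Phi> h = 0")
    case True
    then have "ip h (A h) = 0" using \<Phi>_zero[OF True] by (simp add: ip_def)
    then show ?thesis using True by simp
  next
    case False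
    then have pos: "\<Phi> h > 0" using \<Phi>_nonneg[of h] by simp
    define s where "s = 1 / sqrt (\<Phi> h)"
    have s2: "s\<^sup>2 * \<Phi> h = 1" using pos by (simp add: s_def power_divide)
    have "ip (\<lambda>w. s * h w) (\<lambda>_. 1) = 0"
      using ip_add[of "\<lambda>_. 1" s h 0 h] h by (simp add: ip_commute)
    then have "cut (\<lambda>w. s * h w) \<in> box \<inter> S" using s2 by (intro in_S) (simp_all add: \<Phi>_scale)
    from f_min[OF this] have "\<mu> \<le> ip (\<lambda>w. s * h w) (A (\<lambda>w. s * h w))"
      using ipA_cong[of "cut (\<lambda>w. s * h w)" "\<lambda>w. s * h w"] by (simp add: \<mu>_def cut_def)
    also have "\<dots> = s\<^sup>2 * ip h (A h)"
      using A_lin[of s h 0 h] ip_add[of "\<lambda>w. s * h w" s "A h" 0 h] ip_add[of "A h" s h 0 h]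
      by (simp add: ip_commute power2_eq_square)
    finally have "\<mu> * \<Phi> h \<le> s\<^sup>2 * ip h (A h) * \<Phi> h" using pos by (intro mult_right_mono) auto
    also have "\<dots> = ip h (A h)" using s2 by (simp add: mult_ac)
    finally show ?thesis .
  qed
  \<comment> \<open>The form \<open>ip h (A h) - \<mu> * \<Phi> h\<close> is nonnegative and vanishes at \<open>f\<close>, so \<open>f\<close> lies in its kernel.\<close>
  have euler: "ip h (A f) = \<mu> * ip h f" if h: "ip h (\<lambda>_. 1) = 0" for h
  proof -
    have "(ip h (A f) - \<mu> * ip h f)\<^sup>2 \<le> 0 * (ip h (A h) - \<mu> * \<Phi> h)"
    proof (rule nonneg_quadratic_discriminant)
      fix s t
      have "ip (\<lambda>w. s * f w + t * h w) (\<lambda>_. 1) = 0"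
        using ip_add[of "\<lambda>_. 1" s f t h] h f1 by (simp add: ip_commute)
      then have "\<mu> * \<Phi> (\<lambda>w. s * f w + t * h w) \<le> ip (\<lambda>w. s * f w + t * h w) (A (\<lambda>w. s * f w + t * h w))"
        by (rule rayleigh)
      also have "ip (\<lambda>w. s * f w + t * h w) (A (\<lambda>w. s * f w + t * h w)) =
          s * (s * ip f (A f) + t * ip h (A f)) + t * (s * ip f (A h) + t * ip h (A h))"
        unfolding A_lin ip_add unfolding ip_commute[of "\<lambda>w. s * f w + t * h w"] ip_add
        by (simp add: ip_commute[of "A f"] ip_commute[of "A h"])
      also have "ip f (A h) = ip h (A f)" by (rule A_sym)
      also have "\<Phi> (\<lambda>w. s * f w + t * h w) = s * (s * \<Phi> f + t * ip h f) + t * (s * ip h f + t * \<Phi> h)"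
        unfolding \<Phi>_def ip_add unfolding ip_commute[of "\<lambda>w. s * f w + t * h w"] ip_add
        by (simp add: ip_commute[of f h])
      finally show "0 \<le> s\<^sup>2 * 0 + 2 * s * t * (ip h (A f) - \<mu> * ip h f) + t\<^sup>2 * (ip h (A h) - \<mu> * \<Phi> h)"
        unfolding f1(1) \<mu>_def[symmetric] by (simp add: power2_eq_square algebra_simps)
    qed
    then show ?thesis by simp
  qed
  have ipA1: "ip (\<lambda>_. 1) (A h) = 0" for h
    unfolding A_sym[of "\<lambda>_. 1" h] A1 by (simp add: ip_def)
  have eig: "A f w = \<mu> * f w" if w: "w \<in> V" for w
  proof -
    define T where "T = sum \<alpha> V"
    have T: "T > 0" unfolding T_def using G(1,2) \<alpha>_pos by (intro sum_pos)
    define d where "d v = (if v = w then 1 else 0 :: real)" for v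
    define h where "h = (\<lambda>v. 1 * d v + (- \<alpha> w / T) * 1)"
    have ipd: "ip k d = \<alpha> w * k w" for k
      using G(1) w by (simp add: ip_def d_def if_distrib cong: if_cong)
    have ip1: "ip (\<lambda>_. 1) (\<lambda>_. 1) = T" by (simp add: ip_def T_def)
    have "ip h (\<lambda>_. 1) = 0"
      unfolding ip_commute[of h "\<lambda>_. 1"] unfolding h_def ip_add ipd ip1 using T by simp
    from euler[OF this] have "ip (A f) h = \<mu> * ip f h" by (simp add: ip_commute)
    moreover have "ip (A f) h = \<alpha> w * A f w"
      unfolding h_def ip_add ipd using ipA1[of f] by (simp add: ip_commute)
    moreover have "ip f h = \<alpha> w * f w" unfolding h_def ip_add ipd using f1 by simp
    ultimately have "\<alpha> w * A f w = \<alpha> w * (\<mu> * f w)" by simp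
    then show ?thesis using \<alpha>_pos[OF w] by simp
  qed
  have f_nz: "\<exists>x\<in>V. f x \<noteq> 0"
  proof (rule ccontr)
    assume "\<not> ?thesis"
    then have "\<Phi> f = 0" by (simp add: \<Phi>_def ip_def)
    then show False using f1 by simp
  qed
  have \<mu>_in: "\<mu> \<in> rw_eigenvalues V c \<alpha>"
    unfolding rw_eigenvalues_def using f_nz eig by (auto simp: A_def)
  have "\<mu> \<noteq> 0"
  proof
    \<comment> \<open>The linear function of the eigenfunction would have no energy, hence by the Poincare
      inequality no variance.\<close>
    assume "\<mu> = 0"
    let ?p = "\<lambda>\<zeta>. \<Sum>w\<in>V. f w * \<zeta> w"
    have p: "polynomial_on V ?p" by (intro polynomial_on_sum polynomial_on_cmult polynomial_on.coord)
    have Lp: "bep_generator V c \<alpha> ?p \<zeta> = 0" for \<zeta>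
      using eig \<open>\<mu> = 0\<close> by (simp add: bep_generator_linear[OF graph] A_def)
    have T: "sum \<alpha> V > 0" using G(1,2) \<alpha>_pos by (intro sum_pos)
    have "sum \<alpha> V * (\<integral>\<zeta>. ?p \<zeta> \<partial>\<gamma>) = (\<Sum>w\<in>V. f w * (sum \<alpha> V * (\<integral>\<zeta>. \<zeta> w \<partial>\<gamma>)))"
    proof -
      have "(\<integral>\<zeta>. ?p \<zeta> \<partial>\<gamma>) = (\<Sum>w\<in>V. \<integral>\<zeta>. f w * \<zeta> w \<partial>\<gamma>)"
        by (intro D.E_sum polynomial_on_cmult polynomial_on.coord)
      then show ?thesis by (simp add: sum_distrib_left mult_ac)
    qed
    also have "\<dots> = (\<Sum>w\<in>V. f w * \<alpha> w)"
    proof (intro sum.cong refl)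
      fix w assume "w \<in> V"
      then show "f w * (sum \<alpha> V * (\<integral>\<zeta>. \<zeta> w \<partial>\<gamma>)) = f w * \<alpha> w"
        using D.E_shift[of w "\<lambda>_. 0"] by simp
    qed
    also have "\<dots> = 0" using f1(2) by (simp add: ip_def mult.commute)
    finally have "(\<integral>\<zeta>. ?p \<zeta> \<partial>\<gamma>) = 0" using T by simp
    from poincare[OF p this] have "b * (\<integral>\<zeta>. (?p \<zeta>)\<^sup>2 \<partial>\<gamma>) \<le> 0" by (simp add: Lp)
    then have "(\<integral>\<zeta>. (?p \<zeta>)\<^sup>2 \<partial>\<gamma>) \<le> 0"
      using b by (simp add: mult_le_0_iff)
    then have "(\<integral>\<zeta>. (?p \<zeta>)\<^sup>2 \<partial>\<gamma>) = 0" by (rule antisym[OF _ D.E_sq_nonneg[OF p]])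
    then have const: "f u = f v" if "u \<in> V" "v \<in> V" for u v
      using linear_null_constant that by blast
    obtain u where u: "u \<in> V" "f u \<noteq> 0" using f_nz by blast
    have "ip f (\<lambda>_. 1) = (\<Sum>w\<in>V. \<alpha> w * f u)"
      unfolding ip_def by (intro sum.cong refl) (simp add: const[OF _ u(1)])
    then have "sum \<alpha> V * f u = 0" unfolding f1(2) sum_distrib_right by (rule sym)
    then show False using T u by simp
  qed
  moreover have "\<mu> \<le> l" if l: "l \<in> rw_eigenvalues V c \<alpha>" "l \<noteq> 0" for l
  proof -
    obtain g where g: "\<exists>x\<in>V. g x \<noteq> 0" "\<And>x. x \<in> V \<Longrightarrow> A g x = l * g x"
      using l unfolding rw_eigenvalues_def A_def by blast
    have ipg: "ip h (A g) = l * ip h g" for h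
    proof -
      have "ip h (A g) = ip h (\<lambda>x. l * g x + 0 * g x)" using g(2) by (intro ip_cong) auto
      then show ?thesis unfolding ip_add by simp
    qed
    have "l * ip (\<lambda>_. 1) g = 0" using ipg[of "\<lambda>_. 1"] ipA1 by simp
    then have "ip g (\<lambda>_. 1) = 0" using l(2) by (simp add: ip_commute)
    then have "\<mu> * \<Phi> g \<le> l * \<Phi> g" using rayleigh[of g] ipg[of g] by (simp add: \<Phi>_def)
    moreover have "\<Phi> g > 0" using \<Phi>_nonneg[of g] \<Phi>_zero[of g] g(1) by (auto simp: less_le)
    ultimately show ?thesis by simp
  qed
  ultimately have "gap_RW V c \<alpha> = \<mu>"
    unfolding gap_RW_def using \<mu>_in by (intro Least_equality) auto
  then show "gap_RW V c \<alpha> \<in> rw_eigenvalues V c \<alpha>" "gap_RW V c \<alpha> \<noteq> 0"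
    using \<mu>_in \<open>\<mu> \<noteq> 0\<close> by simp_all
qed

end

lemma bep_poincare_constant:
  assumes graph: "connected_weighted_graph V c" and \<alpha>: "\<forall>x\<in>V. 0 < \<alpha> x"
    and f: "polynomial_on V f" and mean0: "(\<integral>\<zeta>. f \<zeta> \<partial>dirichlet V \<alpha>) = 0"
  defines "b \<equiv> alpha_ratio V \<alpha> * alpha_min V \<alpha> * c_min V c / (4 * (real (card V))\<^sup>2 * real (graph_diam V c))"
  shows "0 < b" "b * (\<integral>\<zeta>. (f \<zeta>)\<^sup>2 \<partial>dirichlet V \<alpha>) \<le> (\<integral>\<zeta>. f \<zeta> * - bep_generator V c \<alpha> f \<zeta> \<partial>dirichlet V \<alpha>)"
proof -
  note G = connected_weighted_graphD[OF graph]
  interpret dirichlet_prob V \<alpha> using G \<alpha> by unfold_locales auto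
  have "0 < graph_diam V c"
  proof -
    have "\<not> card V \<le> Suc 0" using G(3) by simp
    then obtain x y where xy: "x \<in> V" "y \<in> V" "x \<noteq> y" using G(1) by (auto simp: card_le_Suc0_iff_eq)
    have "(x, y) \<in> (wedges V c)\<^sup>*" using graph xy by (simp add: connected_weighted_graph_def)
    then obtain n where "(x, y) \<in> wedges V c ^^ n" by (auto dest: rtrancl_imp_relpow)
    then have "(x, y) \<in> wedges V c ^^ graph_dist V c x y" unfolding graph_dist_def by (rule LeastI)
    then have "graph_dist V c x y \<noteq> 0" using xy(3) by (cases "graph_dist V c x y") auto
    then show ?thesis using graph_dist_le_diam[OF G(1) xy, of c] by linarith
  qed
  then have den: "0 < 4 * (real (card V))\<^sup>2 * real (graph_diam V c)" using G(3) by simp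
  show "0 < b"
    unfolding b_def using alpha_min_properties(1,3)[OF G(1,2) \<alpha>] c_min_properties(1)[OF graph]
    by (intro divide_pos_pos[OF _ den] mult_pos_pos)
  have "bep_energy V c \<alpha> f = (\<integral>\<zeta>. f \<zeta> * - bep_generator V c \<alpha> f \<zeta> \<partial>dirichlet V \<alpha>)"
    unfolding bep_energy_def D.bep_generator_form[OF f f] by (simp add: power2_eq_square)
  then show "b * (\<integral>\<zeta>. (f \<zeta>)\<^sup>2 \<partial>dirichlet V \<alpha>) \<le> (\<integral>\<zeta>. f \<zeta> * - bep_generator V c \<alpha> f \<zeta> \<partial>dirichlet V \<alpha>)"
    using bep_poincare[OF graph \<alpha> f mean0] den by (simp add: b_def field_simps)
qed

lemma gap_bounds:
  assumes graph: "connected_weighted_graph V c" and \<alpha>: "\<forall>x\<in>V. 0 < \<alpha> x"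
  defines "b \<equiv> alpha_ratio V \<alpha> * alpha_min V \<alpha> * c_min V c / (4 * (real (card V))\<^sup>2 * real (graph_diam V c))"
  shows "0 < b" "b \<le> gap_BEP V c \<alpha>" "gap_BEP V c \<alpha> \<le> gap_RW V c \<alpha>"
    "gap_RW V c \<alpha> \<in> rw_eigenvalues V c \<alpha>" "gap_RW V c \<alpha> \<noteq> 0"
    "k \<in> L2_spectrum (dirichlet V \<alpha>) (bep_operator V c \<alpha>) \<Longrightarrow> k \<noteq> 0 \<Longrightarrow> gap_BEP V c \<alpha> \<le> k"
proof -
  interpret dirichlet_prob V \<alpha> using connected_weighted_graphD[OF graph] \<alpha> by unfold_locales auto
  note P = bep_poincare_constant[OF graph \<alpha>, folded b_def]
  show b: "0 < b" by (rule P(1)[OF polynomial_on.const[of V 0]]) simp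
  show rw1: "gap_RW V c \<alpha> \<in> rw_eigenvalues V c \<alpha>"
    by (rule rw_least_nonzero_eigenvalue(1)[OF graph P(2) b])
  show rw2: "gap_RW V c \<alpha> \<noteq> 0"
    by (rule rw_least_nonzero_eigenvalue(2)[OF graph P(2) b])
  note BEP = gap_BEP_properties[OF b P(2)]
  note spec = rw_eigenvalue_in_spectrum[OF graph rw1 rw2]
  show "b \<le> gap_BEP V c \<alpha>" by (rule BEP(1)[OF _ _ spec rw2])
  show "gap_BEP V c \<alpha> \<le> gap_RW V c \<alpha>" by (rule BEP(2)[OF _ _ spec rw2])
  show "gap_BEP V c \<alpha> \<le> k" if "k \<in> L2_spectrum (dirichlet V \<alpha>) (bep_operator V c \<alpha>)" "k \<noteq> 0"
    by (rule BEP(2)[OF _ _ that])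
qed

section \<open>Strict inequality on a rook's graph\<close>

text \<open>
  The squares of a \<open>7 \<times> 7\<close> board, numbered by rows; two squares are joined if a rook moves from
  one to the other. The graph is strongly regular, which is the content of the two sums below.
\<close>

definition rook :: "nat \<Rightarrow> nat \<Rightarrow> real" where
  "rook x y = (if x \<noteq> y \<and> (x div 7 = y div 7 \<or> x mod 7 = y mod 7) then 1 else 0)"

lemma sum_board:
  fixes F :: "nat \<Rightarrow> nat \<Rightarrow> real"
  shows "(\<Sum>z<49. F (z div 7) (z mod 7)) = (\<Sum>i<7. \<Sum>j<7. F i j)"
proof -
  have "(\<Sum>z<49. F (z div 7) (z mod 7)) = (\<Sum>(i, j)\<in>{..<7} \<times> {..<7}. F i j)"
    by (rule sum.reindex_bij_witness[of _ "\<lambda>(i, j). 7 * i + j" "\<lambda>z. (z div 7, z mod 7)"]) auto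
  then show ?thesis by (simp add: sum.cartesian_product)
qed

definition same :: "nat \<Rightarrow> nat \<Rightarrow> real" where
  "same a b = (if a = b then 1 else 0)"

text \<open>
  In this form sums over the board factor into sums over rows and columns.
\<close>

lemma rook_same:
  "rook x y = same (x div 7) (y div 7) + same (x mod 7) (y mod 7) - 2 * (same (x div 7) (y div 7) * same (x mod 7) (y mod 7))"
proof -
  have "x = y \<longleftrightarrow> x div 7 = y div 7 \<and> x mod 7 = y mod 7"
    by (metis div_mult_mod_eq)
  then show ?thesis by (auto simp: rook_def same_def)
qed

lemma sum_same_mult: "a < n \<Longrightarrow> (\<Sum>i<n. same a i * g i) = g a"
proof -
  assume "a < n"
  have "(\<Sum>i<n. same a i * g i) = (\<Sum>i<n. if a = i then g i else 0)"
    by (intro sum.cong) (auto simp: same_def)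
  then show ?thesis using \<open>a < n\<close> by simp
qed

lemma sum_same: "a < 7 \<Longrightarrow> (\<Sum>i<7. same a i) = 1"
  by (simp add: same_def)

lemma sum_same_same: "a < 7 \<Longrightarrow> (\<Sum>i<7. same a i * same i b) = same a b"
  by (rule sum_same_mult)

lemma rook_degree:
  assumes "x < 49"
  shows "(\<Sum>z<49. rook x z) = 12"
proof -
  define a b where "a = x div 7" and "b = x mod 7"
  have ab: "a < 7" "b < 7" using assms by (auto simp: a_def b_def)
  have "(\<Sum>z<49. rook x z) = (\<Sum>i<7. \<Sum>j<7. same a i + same b j - 2 * (same a i * same b j))"
    unfolding rook_same a_def b_def by (rule sum_board)
  also have "\<dots> = (\<Sum>i<7. 7 * same a i + 1 - 2 * same a i)"
    using ab by (simp add: sum.distrib sum_subtractf sum_same flip: sum_distrib_left)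
  also have "\<dots> = 12"
    using ab by (simp add: sum.distrib sum_subtractf sum_same flip: sum_distrib_left)
  finally show ?thesis .
qed

lemma rook_square:
  assumes "x < 49" "y < 49"
  shows "(\<Sum>z<49. rook x z * rook z y) = 2 + 3 * rook x y + 10 * same x y"
proof -
  define a b c d where "a = x div 7" and "b = x mod 7" and "c = y div 7" and "d = y mod 7"
  have ab: "a < 7" "b < 7" "c < 7" "d < 7" using assms by (auto simp: a_def b_def c_def d_def)
  have same_commute: "same i j = same j i" for i j by (simp add: same_def)
  have sum_same': "(\<Sum>i<7. same i b) = 1" if "b < 7" for b
    using sum_same[OF that] by (simp only: same_commute)
  have inner: "(\<Sum>j<7. (p + same b j - 2 * (p * same b j)) * (q + same j d - 2 * (q * same j d))) =
      3 * (p * q) + p + q + (1 - 2 * p) * (1 - 2 * q) * same b d" for p q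
  proof -
    have "(p + s - 2 * (p * s)) * (q + t - 2 * (q * t)) =
        p * q + (p * (1 - 2 * q)) * t + (q * (1 - 2 * p)) * s + ((1 - 2 * p) * (1 - 2 * q)) * (s * t)" for s t :: real
      by (simp add: algebra_simps)
    then have "(\<Sum>j<7. (p + same b j - 2 * (p * same b j)) * (q + same j d - 2 * (q * same j d))) =
        7 * (p * q) + (p * (1 - 2 * q)) * (\<Sum>j<7. same j d) + (q * (1 - 2 * p)) * (\<Sum>j<7. same b j) +
        ((1 - 2 * p) * (1 - 2 * q)) * (\<Sum>j<7. same b j * same j d)"
      by (simp only: sum.distrib sum_distrib_left[symmetric]) simp
    also have "\<dots> = 3 * (p * q) + p + q + (1 - 2 * p) * (1 - 2 * q) * same b d"
      unfolding sum_same[OF ab(2)] sum_same'[OF ab(4)] sum_same_same[OF ab(2)] by (simp add: algebra_simps)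
    finally show ?thesis .
  qed
  have "(\<Sum>z<49. rook x z * rook z y) = (\<Sum>i<7. \<Sum>j<7.
      (same a i + same b j - 2 * (same a i * same b j)) * (same i c + same j d - 2 * (same i c * same j d)))"
    unfolding rook_same a_def b_def c_def d_def by (rule sum_board)
  also have "\<dots> = (\<Sum>i<7. 3 * (same a i * same i c) + same a i + same i c +
      (1 - 2 * same a i) * (1 - 2 * same i c) * same b d)"
    by (simp only: inner)
  also have "\<dots> = (\<Sum>i<7. same b d + (3 + 4 * same b d) * (same a i * same i c) +
      (1 - 2 * same b d) * same a i + (1 - 2 * same b d) * same i c)"
    by (intro sum.cong refl) (simp add: algebra_simps)
  also have "\<dots> = 7 * same b d + (3 + 4 * same b d) * same a c + (1 - 2 * same b d) + (1 - 2 * same b d)"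
    unfolding sum.distrib sum_distrib_left[symmetric]
    using ab by (simp add: sum_same sum_same' sum_same_same)
  also have "\<dots> = 2 + 3 * (same a c + same b d - 2 * (same a c * same b d)) + 10 * (same a c * same b d)"
    by (simp add: algebra_simps)
  also have "same a c * same b d = same x y"
  proof -
    have "x = y \<longleftrightarrow> a = c \<and> b = d" unfolding a_def b_def c_def d_def by (metis div_mult_mod_eq)
    then show ?thesis by (simp add: same_def)
  qed
  also have "same a c + same b d - 2 * same x y = rook x y"
    unfolding rook_same[of x y] a_def[symmetric] b_def[symmetric] c_def[symmetric] d_def[symmetric]
      \<open>same a c * same b d = same x y\<close> ..
  finally show ?thesis .
qed

lemma rook_commute: "rook x y = rook y x"
  by (auto simp: rook_def)

lemma rook_graph: "connected_weighted_graph {..<49} rook"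
  unfolding connected_weighted_graph_def
proof (intro conjI ballI)
  fix x y :: nat assume x: "x \<in> {..<49}" and y: "y \<in> {..<49}"
  show "rook x y = rook y x" by (rule rook_commute)
  define z where "z = 7 * (x div 7) + y mod 7"
  have z: "z div 7 = x div 7" "z mod 7 = y mod 7" by (simp_all add: z_def)
  have "z < 49" using x unfolding z_def lessThan_iff by presburger
  have step: "(u, v) \<in> (wedges {..<49} rook)\<^sup>*"
    if "u < 49" "v < 49" "u div 7 = v div 7 \<or> u mod 7 = v mod 7" for u v
    using that by (cases "u = v") (auto simp: wedges_def rook_def)
  show "(x, y) \<in> (wedges {..<49} rook)\<^sup>*"
    using rtrancl_trans[OF step[of x z] step[of z y]] x y z \<open>z < 49\<close> by simp
qed (auto simp: rook_def)

text \<open>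
  By strong regularity the adjacency matrix acts on mean zero functions with eigenvalues solving
  \<open>t\<^sup>2 = 3 * t + 10\<close>, that is, \<open>5\<close> and \<open>- 2\<close>; the random walk has the eigenvalues \<open>(12 - t) / 44\<close>.
\<close>

lemma rook_rw_eigenvalue:
  assumes l: "l \<in> rw_eigenvalues {..<49} rook (\<lambda>_. 1 / 44)" "l \<noteq> 0"
  shows "7 / 44 \<le> l"
proof -
  obtain f where nz: "\<exists>x\<in>{..<49}. f x \<noteq> 0"
    and eig: "\<And>x. x < 49 \<Longrightarrow> - rw_generator {..<49} rook (\<lambda>_. 1 / 44) f x = l * f x"
    using l unfolding rw_eigenvalues_def by auto
  define C where "C g x = (\<Sum>y<49. rook x y * g y)" for g x
  define t where "t = 12 - 44 * l"
  have Cf: "C f x = t * f x" if x: "x < 49" for x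
  proof -
    have "rw_generator {..<49} rook (\<lambda>_. 1 / 44) f x = (\<Sum>y<49. 1 / 44 * (rook x y * f y) - 1 / 44 * f x * rook x y)"
      unfolding rw_generator_def by (intro sum.cong refl) (simp add: algebra_simps diff_divide_distrib)
    also have "\<dots> = 1 / 44 * C f x - 1 / 44 * f x * 12"
      unfolding sum_subtractf sum_distrib_left[symmetric] C_def rook_degree[OF x] ..
    finally show ?thesis using eig[OF x] by (simp add: t_def algebra_simps)
  qed
  have sumC: "(\<Sum>x<49. C f x) = 12 * (\<Sum>x<49. f x)"
  proof -
    have "(\<Sum>x<49. C f x) = (\<Sum>y<49. \<Sum>x<49. rook y x * f y)"
      unfolding C_def by (subst sum.swap) (simp add: rook_commute)
    also have "\<dots> = (\<Sum>y<49. (\<Sum>x<49. rook y x) * f y)" by (simp add: sum_distrib_right)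
    also have "\<dots> = (\<Sum>y<49. 12 * f y)" by (intro sum.cong refl) (simp add: rook_degree)
    finally show ?thesis by (simp add: sum_distrib_left)
  qed
  have "(\<Sum>x<49. C f x) = t * (\<Sum>x<49. f x)"
    unfolding sum_distrib_left by (intro sum.cong refl) (simp add: Cf)
  then have "44 * l * (\<Sum>x<49. f x) = 0" using sumC by (simp add: t_def algebra_simps)
  then have sum0: "(\<Sum>x<49. f x) = 0" using l(2) by simp
  obtain x where x: "x < 49" "f x \<noteq> 0" using nz by auto
  have "t * (t * f x) = t * C f x" using Cf[OF x(1)] by simp
  also have "\<dots> = C (C f) x"
    unfolding C_def[of "C f"] C_def[of f x] sum_distrib_left
    by (intro sum.cong refl) (simp add: Cf)
  also have "\<dots> = (\<Sum>y<49. (\<Sum>z<49. rook x z * rook z y) * f y)"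
    unfolding C_def sum_distrib_left sum_distrib_right by (subst sum.swap) (simp add: mult.assoc)
  also have "\<dots> = (\<Sum>y<49. 2 * f y + 3 * (rook x y * f y) + 10 * (same x y * f y))"
    by (intro sum.cong refl) (simp only: lessThan_iff rook_square[OF x(1)] distrib_right mult.assoc)
  also have "\<dots> = 2 * (\<Sum>y<49. f y) + 3 * C f x + 10 * (\<Sum>y<49. same x y * f y)"
    by (simp add: sum.distrib sum_distrib_left C_def)
  also have "(\<Sum>y<49. same x y * f y) = f x"
    using x(1) by (rule sum_same_mult)
  finally have "(t * t - 3 * t - 10) * f x = 0" using sum0 Cf[OF x(1)] by (simp add: algebra_simps)
  then have "t * t - 3 * t - 10 = 0" using x(2) by (simp only: mult_eq_0_iff simp_thms)
  then have "(t - 5) * (t + 2) = 0" by (simp add: algebra_simps)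
  then have "t = 5 \<or> t = - 2" by auto
  then show ?thesis by (auto simp: t_def)
qed

text \<open>
  By strong regularity \<open>\<Sum>\<zeta> x\<^sup>2\<close>, the sum of \<open>\<zeta> x * \<zeta> y\<close> over adjacent pairs and the constants span a
  space that is invariant under the generator on the simplex. For a small weight \<open>a\<close> of the sites the
  mass sits in few piles, and an eigenfunction in this space measures how long two piles on
  non-adjacent squares stay apart. They become adjacent when one of them moves to one of their two
  common neighbours, which happens at rate \<open>4 * a\<close>; the random walk relaxes at rate \<open>7 * a\<close>. The
  coefficients below solve the eigenvalue equation for \<open>a = 1 / 44\<close>, where the eigenvalue is \<open>6 * a\<close>.
\<close>

definition rook_poly :: "(nat \<Rightarrow> real) \<Rightarrow> real" where
  "rook_poly \<zeta> = (\<Sum>x<49. \<zeta> x * (10 * \<zeta> x + 9 * (\<Sum>y<49. rook x y * \<zeta> y))) - 6"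

lemma polynomial_on_rook_poly: "polynomial_on {..<49} rook_poly"
  unfolding rook_poly_def[abs_def]
  by (intro polynomial_on_diff polynomial_on_sum polynomial_on.mult polynomial_on.add polynomial_on.const
      polynomial_on.coord)

lemma rook_poly_diff_deriv:
  assumes uv: "u < 49" "v < 49"
  shows "diff_deriv u v rook_poly =
    (\<lambda>\<zeta>. \<Sum>w<49. (20 * (same u w - same v w) + 18 * (rook u w - rook v w)) * \<zeta> w)"
proof -
  let ?V = "{..<49} :: nat set"
  let ?S = "\<lambda>x \<zeta>. 10 * \<zeta> x + 9 * (\<Sum>y<49. rook x y * \<zeta> y)"
  define h where "h x w = 10 * same x w + 9 * rook x w" for x w
  have S: "?S x \<zeta> = (\<Sum>w<49. h x w * \<zeta> w)" if "x < 49" for x \<zeta>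
  proof -
    have "(\<Sum>w<49. h x w * \<zeta> w) = 10 * (\<Sum>w<49. same x w * \<zeta> w) + 9 * (\<Sum>w<49. rook x w * \<zeta> w)"
      by (simp add: h_def distrib_right sum.distrib sum_distrib_left mult.assoc)
    then show ?thesis using sum_same_mult[OF that] by simp
  qed
  have p: "polynomial_on ?V (\<lambda>\<zeta>. \<Sum>w<49. h x w * \<zeta> w)" for x
    by (intro polynomial_on_sum polynomial_on_cmult polynomial_on.coord)
  have eq: "rook_poly = (\<lambda>\<zeta>. (\<Sum>x<49. \<zeta> x * (\<Sum>w<49. h x w * \<zeta> w)) - 6)"
    unfolding rook_poly_def[abs_def] by (intro ext arg_cong2[where f = "(-)"] sum.cong refl) (simp add: S)
  have q: "polynomial_on ?V (\<lambda>\<zeta>. \<zeta> x * (\<Sum>w<49. h x w * \<zeta> w))" if "x \<in> ?V" for x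
    using that by (intro polynomial_on.mult polynomial_on.coord p)
  have "diff_deriv u v rook_poly = (\<lambda>\<zeta>. \<Sum>x<49. diff_deriv u v (\<lambda>\<zeta>. \<zeta> x * (\<Sum>w<49. h x w * \<zeta> w)) \<zeta>)"
  proof -
    have "diff_deriv u v rook_poly =
        (\<lambda>\<zeta>. diff_deriv u v (\<lambda>\<zeta>. \<Sum>x<49. \<zeta> x * (\<Sum>w<49. h x w * \<zeta> w)) \<zeta> - diff_deriv u v (\<lambda>\<zeta>. 6) \<zeta>)"
      unfolding eq by (rule diff_deriv_diff[OF polynomial_on_sum polynomial_on.const]) (rule q)
    then show ?thesis using diff_deriv_sum[OF q, of ?V "\<lambda>x. x" u v] by simp
  qed
  also have "\<dots> = (\<lambda>\<zeta>. \<Sum>x<49. (same u x - same v x) * (\<Sum>w<49. h x w * \<zeta> w) + \<zeta> x * (h x u - h x v))"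
  proof (intro ext sum.cong refl)
    fix \<zeta> x assume "x \<in> ?V"
    show "diff_deriv u v (\<lambda>\<zeta>. \<zeta> x * (\<Sum>w<49. h x w * \<zeta> w)) \<zeta> =
        (same u x - same v x) * (\<Sum>w<49. h x w * \<zeta> w) + \<zeta> x * (h x u - h x v)"
      using uv unfolding diff_deriv_mult[OF polynomial_on.coord[OF \<open>x \<in> ?V\<close>] p]
      by (simp add: diff_deriv_linear diff_deriv_coord same_def)
  qed
  also have "\<dots> = (\<lambda>\<zeta>. \<Sum>w<49. (20 * (same u w - same v w) + 18 * (rook u w - rook v w)) * \<zeta> w)"
  proof
    fix \<zeta> :: "nat \<Rightarrow> real"
    have "(\<Sum>x<49. (same u x - same v x) * (\<Sum>w<49. h x w * \<zeta> w)) = (\<Sum>w<49. h u w * \<zeta> w) - (\<Sum>w<49. h v w * \<zeta> w)"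
      using uv by (simp add: left_diff_distrib sum_subtractf sum_same_mult)
    moreover have "h x u = h u x" for x u
      by (simp add: h_def same_def rook_commute[of x u])
    ultimately have "(\<Sum>x<49. (same u x - same v x) * (\<Sum>w<49. h x w * \<zeta> w) + \<zeta> x * (h x u - h x v)) =
        (\<Sum>w<49. h u w * \<zeta> w) - (\<Sum>w<49. h v w * \<zeta> w) + (\<Sum>w<49. \<zeta> w * (h u w - h v w))"
      by (simp only: sum.distrib)
    also have "\<dots> = (\<Sum>w<49. h u w * \<zeta> w - h v w * \<zeta> w + \<zeta> w * (h u w - h v w))"
      by (simp only: sum.distrib sum_subtractf)
    also have "\<dots> = (\<Sum>w<49. (20 * (same u w - same v w) + 18 * (rook u w - rook v w)) * \<zeta> w)"
      by (intro sum.cong refl) (simp add: h_def algebra_simps)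
    finally show "(\<Sum>x<49. (same u x - same v x) * (\<Sum>w<49. h x w * \<zeta> w) + \<zeta> x * (h x u - h x v)) =
        (\<Sum>w<49. (20 * (same u w - same v w) + 18 * (rook u w - rook v w)) * \<zeta> w)" .
  qed
  finally show ?thesis .
qed

lemma rook_poly_eigenfunction:
  assumes \<zeta>: "sum \<zeta> {..<49} = 1"
  shows "- bep_generator {..<49} rook (\<lambda>_. 1 / 44) rook_poly \<zeta> = 6 / 44 * rook_poly \<zeta>"
proof -
  let ?V = "{..<49} :: nat set"
  define S where "S x = (\<Sum>y<49. rook x y * \<zeta> y)" for x
  define Q where "Q = (\<Sum>x<49. \<zeta> x * \<zeta> x)"
  define R where "R = (\<Sum>x<49. \<zeta> x * S x)"
  have same_sum: "(\<Sum>w<49. same u w * \<zeta> w) = \<zeta> u" if "u < 49" for u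
    using that by (rule sum_same_mult)
  have D1: "diff_deriv u v rook_poly \<zeta> = 20 * (\<zeta> u - \<zeta> v) + 18 * (S u - S v)" if "u < 49" "v < 49" for u v
  proof -
    have "diff_deriv u v rook_poly \<zeta> = (\<Sum>w<49. 20 * (same u w * \<zeta> w) - 20 * (same v w * \<zeta> w) +
        (18 * (rook u w * \<zeta> w) - 18 * (rook v w * \<zeta> w)))"
      unfolding rook_poly_diff_deriv[OF that] by (intro sum.cong refl) (simp add: algebra_simps)
    also have "\<dots> = 20 * (\<Sum>w<49. same u w * \<zeta> w) - 20 * (\<Sum>w<49. same v w * \<zeta> w) + (18 * S u - 18 * S v)"
      unfolding sum.distrib sum_subtractf sum_distrib_left[symmetric] S_def ..
    finally show ?thesis using same_sum[OF that(1)] same_sum[OF that(2)] by simp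
  qed
  have D2: "rook u v * diff_deriv u v (diff_deriv u v rook_poly) \<zeta> = 4 * rook u v" if "u < 49" "v < 49" for u v
    using that unfolding rook_poly_diff_deriv[OF that] by (simp add: diff_deriv_linear same_def rook_def)
  define T where "T u v = rook u v * (- (1 / 44 * (\<zeta> u - \<zeta> v)) * (20 * (\<zeta> u - \<zeta> v) + 18 * (S u - S v)) + 4 * (\<zeta> u * \<zeta> v))" for u v
  have "bep_generator ?V rook (\<lambda>_. 1 / 44) rook_poly \<zeta> = 1 / 2 * (\<Sum>u<49. \<Sum>v<49. T u v)"
    unfolding bep_generator_def
  proof (intro arg_cong2[where f = "(*)"] refl sum.cong)
    fix u v assume uv: "u \<in> ?V" "v \<in> ?V"
    have "rook u v * (- (1 / 44 * \<zeta> u - 1 / 44 * \<zeta> v) * diff_deriv u v rook_poly \<zeta> +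
        \<zeta> u * \<zeta> v * diff_deriv u v (diff_deriv u v rook_poly) \<zeta>) =
        rook u v * (- (1 / 44 * \<zeta> u - 1 / 44 * \<zeta> v) * diff_deriv u v rook_poly \<zeta>) +
        \<zeta> u * \<zeta> v * (rook u v * diff_deriv u v (diff_deriv u v rook_poly) \<zeta>)"
      by (simp add: algebra_simps)
    also have "\<dots> = T u v"
      using uv by (simp add: D1 D2 T_def algebra_simps diff_divide_distrib add_divide_distrib)
    finally show "rook u v * (- (1 / 44 * \<zeta> u - 1 / 44 * \<zeta> v) * diff_deriv u v rook_poly \<zeta> +
        \<zeta> u * \<zeta> v * diff_deriv u v (diff_deriv u v rook_poly) \<zeta>) = T u v" .
  qed
  also have "(\<Sum>u<49. \<Sum>v<49. T u v) = (\<Sum>u<49. \<Sum>v<49.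
      (rook u v * (- (1 / 44) * (20 * (\<zeta> u * \<zeta> u) + 18 * (\<zeta> u * S u))) +
       rook v u * (- (1 / 44) * (20 * (\<zeta> v * \<zeta> v) + 18 * (\<zeta> v * S v)))) +
      ((40 / 44 + 4) * (\<zeta> u * (rook u v * \<zeta> v)) +
       18 / 44 * (\<zeta> u * (rook u v * S v) + \<zeta> v * (rook v u * S u))))"
    unfolding T_def by (intro sum.cong refl) (simp add: rook_commute[of v u for u v] algebra_simps diff_divide_distrib add_divide_distrib)
  also have "\<dots> = 2 * (- (1 / 44) * (240 * Q + 216 * R)) + ((40 / 44 + 4) * R + 18 / 44 * (2 * (2 + 3 * R + 10 * Q)))"
  proof -
    have 1: "(\<Sum>u<49. \<Sum>v<49. rook u v * g u) = 12 * (\<Sum>u<49. g u)" for g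
    proof -
      have "(\<Sum>u<49. \<Sum>v<49. rook u v * g u) = (\<Sum>u<49. 12 * g u)"
        by (intro sum.cong refl) (simp add: sum_distrib_right[symmetric] rook_degree)
      then show ?thesis by (simp add: sum_distrib_left)
    qed
    have 2: "(\<Sum>u<49. - (1 / 44) * (20 * (\<zeta> u * \<zeta> u) + 18 * (\<zeta> u * S u))) = - (1 / 44) * (20 * Q + 18 * R)"
      unfolding Q_def R_def sum_distrib_left sum.distrib[symmetric] ..
    have 3: "(\<Sum>u<49. \<Sum>v<49. \<zeta> u * (rook u v * \<zeta> v)) = R"
      unfolding R_def S_def sum_distrib_left ..
    have 4: "(\<Sum>u<49. \<Sum>v<49. \<zeta> u * (rook u v * S v)) = 2 + 3 * R + 10 * Q"
    proof -
      have "(\<Sum>v<49. rook u v * S v) = 2 + 3 * S u + 10 * \<zeta> u" if u: "u < 49" for u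
      proof -
        have "(\<Sum>v<49. rook u v * S v) = (\<Sum>y<49. (\<Sum>v<49. rook u v * rook v y) * \<zeta> y)"
          unfolding S_def sum_distrib_left sum_distrib_right by (subst sum.swap) (simp add: mult.assoc)
        also have "\<dots> = (\<Sum>y<49. 2 * \<zeta> y + 3 * (rook u y * \<zeta> y) + 10 * (same u y * \<zeta> y))"
          by (intro sum.cong refl) (simp only: lessThan_iff rook_square[OF u] distrib_right mult.assoc)
        also have "\<dots> = 2 * (\<Sum>y<49. \<zeta> y) + 3 * S u + 10 * (\<Sum>y<49. same u y * \<zeta> y)"
          unfolding sum.distrib sum_distrib_left[symmetric] S_def ..
        finally show ?thesis using \<zeta> same_sum[OF u] by simp
      qed
      then have "(\<Sum>u<49. \<Sum>v<49. \<zeta> u * (rook u v * S v)) = (\<Sum>u<49. \<zeta> u * (2 + 3 * S u + 10 * \<zeta> u))"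
        by (intro sum.cong refl) (simp flip: sum_distrib_left)
      also have "\<dots> = (\<Sum>u<49. 2 * \<zeta> u + 3 * (\<zeta> u * S u) + 10 * (\<zeta> u * \<zeta> u))"
        by (intro sum.cong refl) (simp add: algebra_simps)
      also have "\<dots> = 2 * (\<Sum>u<49. \<zeta> u) + 3 * R + 10 * Q"
        unfolding sum.distrib sum_distrib_left[symmetric] R_def Q_def ..
      finally show ?thesis using \<zeta> by simp
    qed
    have 5: "(\<Sum>u<49. \<Sum>v<49. \<zeta> v * (rook v u * S u)) = 2 + 3 * R + 10 * Q"
      by (subst sum.swap) (rule 4)
    have A: "(\<Sum>u<49. \<Sum>v<49. rook u v * (- (1 / 44) * (20 * (\<zeta> u * \<zeta> u) + 18 * (\<zeta> u * S u)))) =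
        12 * (- (1 / 44) * (20 * Q + 18 * R))"
      unfolding 1 2 ..
    have B: "(\<Sum>u<49. \<Sum>v<49. rook v u * (- (1 / 44) * (20 * (\<zeta> v * \<zeta> v) + 18 * (\<zeta> v * S v)))) =
        12 * (- (1 / 44) * (20 * Q + 18 * R))"
      by (subst sum.swap) (rule A)
    have C: "(\<Sum>u<49. \<Sum>v<49. (40 / 44 + 4) * (\<zeta> u * (rook u v * \<zeta> v))) = (40 / 44 + 4) * R"
      unfolding 3[symmetric] sum_distrib_left ..
    have D: "(\<Sum>u<49. \<Sum>v<49. 18 / 44 * (\<zeta> u * (rook u v * S v) + \<zeta> v * (rook v u * S u))) =
        18 / 44 * ((\<Sum>u<49. \<Sum>v<49. \<zeta> u * (rook u v * S v)) + (\<Sum>u<49. \<Sum>v<49. \<zeta> v * (rook v u * S u)))"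
      by (simp only: sum_distrib_left sum.distrib[symmetric])
    show ?thesis
      unfolding sum.distrib A B C D unfolding 4 5 by (simp add: algebra_simps)
  qed
  finally have "bep_generator ?V rook (\<lambda>_. 1 / 44) rook_poly \<zeta> = - (6 / 44) * (10 * Q + 9 * R - 6)"
    by (simp add: algebra_simps)
  moreover have "rook_poly \<zeta> = 10 * Q + 9 * R - 6"
  proof -
    have "rook_poly \<zeta> = (\<Sum>x<49. 10 * (\<zeta> x * \<zeta> x) + 9 * (\<zeta> x * S x)) - 6"
      unfolding rook_poly_def S_def by (simp add: algebra_simps)
    then show ?thesis unfolding sum.distrib sum_distrib_left[symmetric] Q_def R_def .
  qed
  ultimately show ?thesis by simp
qed

lemma rook_strict: "gap_BEP {..<49} rook (\<lambda>_. 1 / 44) < gap_RW {..<49} rook (\<lambda>_. 1 / 44)"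
proof -
  let ?V = "{..<49} :: nat set" and ?\<alpha> = "\<lambda>_ :: nat. 1 / 44 :: real"
  have \<alpha>: "\<forall>x\<in>?V. 0 < ?\<alpha> x" by simp
  interpret dirichlet_prob ?V ?\<alpha> by unfold_locales (auto simp: lessThan_empty_iff)
  have "6 / 44 \<in> L2_spectrum \<gamma> (bep_operator ?V rook ?\<alpha>)"
  proof (rule polynomial_eigenvalue_in_spectrum[OF polynomial_on_rook_poly])
    show "- bep_generator ?V rook ?\<alpha> rook_poly \<zeta> = 6 / 44 * rook_poly \<zeta>" if "\<zeta> \<in> prob_simplex ?V" for \<zeta>
      using that by (intro rook_poly_eigenfunction) (simp add: prob_simplex_def)
    show "(\<integral>\<zeta>. (rook_poly \<zeta>)\<^sup>2 \<partial>\<gamma>) \<noteq> 0"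
    proof
      assume null: "(\<integral>\<zeta>. (rook_poly \<zeta>)\<^sup>2 \<partial>\<gamma>) = 0"
      have "diff_deriv 0 1 (diff_deriv 0 1 rook_poly) = (\<lambda>\<zeta>. 4)"
        by (simp add: rook_poly_diff_deriv diff_deriv_linear same_def rook_def)
      then have "(4 :: real) = 0"
        by (intro D.null_second_diff_deriv[OF _ _ _ polynomial_on_rook_poly null, of 0 1]) auto
      then show False by simp
    qed
  qed
  then have "gap_BEP ?V rook ?\<alpha> \<le> 6 / 44"
    by (rule gap_bounds(6)[OF rook_graph \<alpha>]) simp
  also have "6 / 44 < (7 / 44 :: real)" by simp
  also have "7 / 44 \<le> gap_RW ?V rook ?\<alpha>"
    by (rule rook_rw_eigenvalue[OF gap_bounds(4,5)[OF rook_graph \<alpha>]])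
  finally show ?thesis .
qed

section \<open>The spectral gap\<close>

theorem corollary8p1:
  shows "(\<forall>(V :: 'a set) c \<alpha>.
            connected_weighted_graph V c \<longrightarrow> (\<forall>x\<in>V. 0 < \<alpha> x) \<longrightarrow>
              alpha_min V \<alpha> *
                (1 / 21 * (alpha_ratio V \<alpha> / 6 powr (alpha_min V \<alpha> / alpha_ratio V \<alpha>)) *
                 (c_min V c / ((real (card V))\<^sup>2 * real (graph_diam V c))))
                \<le> gap_BEP V c \<alpha> \<and>
              gap_BEP V c \<alpha> \<le> gap_RW V c \<alpha>) \<and>
         (\<exists>(V :: nat set) c \<alpha>.
            connected_weighted_graph V c \<and> (\<forall>x\<in>V. 0 < \<alpha> x) \<and>
            gap_BEP V c \<alpha> < gap_RW V c \<alpha>)"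
proof (intro conjI allI impI)
  fix V :: "'a set" and c :: "'a \<Rightarrow> 'a \<Rightarrow> real" and \<alpha> :: "'a \<Rightarrow> real"
  assume graph: "connected_weighted_graph V c" and \<alpha>: "\<forall>x\<in>V. 0 < \<alpha> x"
  note G = connected_weighted_graphD[OF graph]
  note am = alpha_min_properties[OF G(1,2) \<alpha>]
  define X where "X = alpha_ratio V \<alpha> * alpha_min V \<alpha> * c_min V c / ((real (card V))\<^sup>2 * real (graph_diam V c))"
  define P where "P = 6 powr (alpha_min V \<alpha> / alpha_ratio V \<alpha>)"
  have P: "1 \<le> P" unfolding P_def using am(1,3) by (intro ge_one_powr_ge_zero) auto
  have X: "0 \<le> X"
    unfolding X_def using am(1,3) c_min_properties(1)[OF graph] by (intro divide_nonneg_nonneg mult_nonneg_nonneg) auto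
  have "alpha_min V \<alpha> * (1 / 21 * (alpha_ratio V \<alpha> / P) * (c_min V c / ((real (card V))\<^sup>2 * real (graph_diam V c)))) = X / (21 * P)"
    by (simp add: X_def mult_ac)
  also have "\<dots> \<le> X / 4" using X P by (intro divide_left_mono) auto
  also have "X / 4 \<le> gap_BEP V c \<alpha>" using gap_bounds(2)[OF graph \<alpha>] by (simp add: X_def mult.assoc)
  finally show "alpha_min V \<alpha> * (1 / 21 * (alpha_ratio V \<alpha> / 6 powr (alpha_min V \<alpha> / alpha_ratio V \<alpha>)) *
      (c_min V c / ((real (card V))\<^sup>2 * real (graph_diam V c)))) \<le> gap_BEP V c \<alpha>"
    by (simp only: P_def)
  show "gap_BEP V c \<alpha> \<le> gap_RW V c \<alpha>" by (rule gap_bounds(3)[OF graph \<alpha>])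
next
  show "\<exists>(V :: nat set) c \<alpha>. connected_weighted_graph V c \<and> (\<forall>x\<in>V. 0 < \<alpha> x) \<and> gap_BEP V c \<alpha> < gap_RW V c \<alpha>"
    using rook_graph rook_strict by (intro exI[of _ "{..<49}"] exI[of _ rook] exI[of _ "\<lambda>_. 1 / 44"]) auto
qed

end
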